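(* Assume that the function $w$ has only finitely many turning points in $[0,a]$ and that $w$ is $1$-simple at each of them. If $p$ and $p^{-1}$ are essentially bounded in neighborhoods of these turning points, then $\infty$ is not a spectral singularity of $A$.
   Context: Setting. Let $a>0$ and let $w,p,q:\mathbb R\to\mathbb R$ be measurable and $a$-periodic, with $w,q,p^{-1}$ integrable over $(0,a)$, $w\neq0$ a.e. and $p>0$ a.e. Put $\mathfrak a(f):=\frac1w\big(-(pf')'+qf\big)$. $L^2_{|w|}(\mathbb R)$ has scalar product $(f,g)=\int_{\mathbb R}f\overline g|w|\,dx$. The maximal operator $A$ is $Af:=\mathfrak a(f)$, $\operatorname{dom}A=\{f\in L^2_{|w|}(\mathbb R): f,pf'\in AC_{\rm loc}(\mathbb R),\ \mathfrak a(f)\in L^2_{|w|}(\mathbb R)\}$. Let $\mathcal H_a:=L^2_{|w|}(0,a)$ with $(f,g)_a=\int_0^af\overline g|w|\,dx$ and $[f,g]_a=\int_0^af\overline g\,w\,dx=(J_af,g)_a$, where $J_a$ is multiplication by $\operatorname{sgn}w$. For $t\in\mathcal I:=[-\pi,\pi]$ let $A(t)f:=\mathfrak a(f)$ with $\operatorname{dom}A(t)=\{f\in\mathcal H_a: f,pf'\in AC([0,a]),\ \mathfrak a(f)\in\mathcal H_a,\ f(a)=e^{it}f(0),\ (pf')(a)=e^{it}(pf')(0)\}$; it is $J_a$-self-adjoint (i.e. $J_aA(t)$ is self-adjoint) and has compact resolvent. Turning points. $w$ is indefinite on an interval if neither $w>0$ a.e. nor $w<0$ a.e. on it. $x_0\in\mathbb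 R$ is a turning point of $w$ if $w$ is indefinite on $(x_0-\delta,x_0+\delta)$ for each $\delta>0$. $w$ is $1$-simple at a turning point $x_0$ if there exist $\delta>0$, $\tau_+,\tau_->-1$ and functions $\rho_+\in C^1([x_0,x_0+\delta])$, $\rho_-\in C^1([x_0-\delta,x_0])$ with $\rho_+(x_0)\ne0$, $\rho_-(x_0)\neq0$ and $\operatorname{sgn}(\rho_+(x_0+x))=-\operatorname{sgn}(\rho_-(x_0-x))=\mathrm{const}$ for $x\in[0,\delta]$, such that $w(x)=\rho_\pm(x)|x-x_0|^{\tau_\pm}$ for $\pm(x-x_0)\in(0,\delta)$. Sign types. For a $J_a$-self-adjoint operator $B$ in $\mathcal H_a$, $\lambda\in\sigma_+(B)$ ($\sigma_-(B)$) means: there is a sequence $(f_n)\subset\operatorname{dom}B$ with $\|f_n\|_a=1$, $(B-\lambda)f_n\to0$, and every such sequence satisfies $\liminf_n[f_n,f_n]_a>0$ (respectively $\limsup_n[f_n,f_n]_a<0$). A set $\Delta\subset\mathbb R$ is of positive (negative) type with respect to $B$ if $\Delta\cap\sigma(B)\subset\sigma_+(B)$ (respectively $\sigma_-(B)$). Spectral function. Let $\varphi_\lambda,\psi_\lambda$ be the solutions of $\mathfrak a(u)=\lambda u$ with $\varphi_\lambda(0)=1,(p\varphi_\lambda')(0)=0,\psi_\lambda(0)=0,(p\psi_\lambda')(0)=1$ and $D(\lambda)=\varphi_\lambda(a)+(p\psi_\lambda')(a)$; $\sigma(A)=\{\lambda:D(\lambda)\in[-2,2]\}$, and the critical points of $A$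 are the $\lambda\in\sigma(A)$ with $\dot D(\lambda)=0$. The Gelfand transform $\mathcal G:L^2_{|w|}(\mathbb R)\to L^2(\mathcal I,\mathcal H_a)$, $(\mathcal Gf)(t)=\lim_{N\to\infty}\frac1{\sqrt{2\pi}}\sum_{n=-N}^Ne^{-int}f(\cdot+na)$ (limit in $L^2(\mathcal I,\mathcal H_a)$), is unitary. For a bounded Borel set $\Delta$ such that the boundary of $\Delta\cap\sigma(A)$ relative to $\sigma(A)$ contains no critical point, $E(\Delta)=\mathcal G^{-1}\widetilde E(\Delta)\mathcal G$, where $(\widetilde E(\Delta)F)(t)=E(t;\Delta)F(t)$ and $E(t;\Delta)$ is the Riesz–Dunford spectral projection of $A(t)$ corresponding to the finite set $\sigma(A(t))\cap\Delta$. Spectral singularity at $\infty$. Let $\mathcal R>0$ be such that for all $t\in\mathcal I$ the non-real spectrum of $A(t)$ lies in $\{|\lambda|<\mathcal R\}$, $(-\infty,-\mathcal R)$ is of negative type and $(\mathcal R,\infty)$ is of positive type with respect to $A(t)$ (such $\mathcal R$ exists, and it is chosen so that $\pm\mathcal R$ are not critical points). $\infty$ is a spectral singularity of $A$ if $\sup_{C>\mathcal R}\|E([\mathcal R,C])\|=\infty$ or $\sup_{C>\mathcal R}\|E([-C,-\mathcal R])\|=\infty$ (suprema over those $C$ for which $E$ of the interval is defined). *)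

theory Defs
  imports "HOL-Complex_Analysis.Complex_Analysis"
begin

section \<open>Weighted L2 spaces and operators in them\<close>

text \<open>
  Elements of an L2 space over a measure are represented by square integrable functions; no quotient
  by almost everywhere equality is taken. An operator is given by its graph, a relation between
  such functions: \<open>B f g\<close> means that \<open>f\<close> lies in the domain and \<open>B f = g\<close> almost everywhere. Every
  graph below allows all representatives \<open>g\<close> of the image; in the graphs of the differential
  operators \<open>f\<close> is the absolutely continuous representative.
\<close>

type_synonym 'a operator = "('a \<Rightarrow> complex) \<Rightarrow> ('a \<Rightarrow> complex) \<Rightarrow> bool"

definition L2 :: "'a measure \<Rightarrow> ('a \<Rightarrow> complex) set" where
  "L2 M = {f. f \<in> borel_measurable M \<and> integrable M (\<lambda>x. (cmod (f x))\<^sup>2)}"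

definition l2inner :: "'a measure \<Rightarrow> ('a \<Rightarrow> complex) \<Rightarrow> ('a \<Rightarrow> complex) \<Rightarrow> complex" where
  "l2inner M f g = (LINT x|M. f x * cnj (g x))"

definition l2norm :: "'a measure \<Rightarrow> ('a \<Rightarrow> complex) \<Rightarrow> real" where
  "l2norm M f = sqrt (LINT x|M. (cmod (f x))\<^sup>2)"

text \<open>The measure \<open>\<bar>w\<bar> dx\<close> on \<open>S\<close>.\<close>

definition weighted :: "(real \<Rightarrow> real) \<Rightarrow> real set \<Rightarrow> real measure" where
  "weighted w S = density (lebesgue_on S) (\<lambda>x. ennreal \<bar>w x\<bar>)"

definition op_norm :: "'a measure \<Rightarrow> 'a operator \<Rightarrow> ereal" where
  "op_norm M T = (SUP (f, g) \<in> {(f, g). T f g \<and> l2norm M f \<le> 1}. ereal (l2norm M g))"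

text \<open>
  The first conjunct is surjectivity of \<open>B - z\<close>; the second one is injectivity together
  with boundedness of the inverse.
\<close>

definition resolvent_set :: "'a measure \<Rightarrow> 'a operator \<Rightarrow> complex set" where
  "resolvent_set M B = {z.
     (\<forall>u\<in>L2 M. \<exists>f. B f (\<lambda>x. z * f x + u x)) \<and>
     (\<exists>K. \<forall>f g. B f g \<longrightarrow> l2norm M f \<le> K * l2norm M (\<lambda>x. g x - z * f x))}"

definition spectrum :: "'a measure \<Rightarrow> 'a operator \<Rightarrow> complex set" where
  "spectrum M B = - resolvent_set M B"

text \<open>\<open>resolvent B z u\<close> is (a representative of) \<open>(z - B)\<^sup>-\<^sup>1 u\<close>, for \<open>z\<close> in the resolvent set.\<close>

definition resolvent :: "'a operator \<Rightarrow> complex \<Rightarrow> ('a \<Rightarrow> complex) \<Rightarrow> ('a \<Rightarrow> complex)" where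
  "resolvent B z u = (SOME f. B f (\<lambda>x. z * f x - u x))"

text \<open>
  Riesz-Dunford projection \<open>(2 \<pi> i)\<^sup>-\<^sup>1 \<integral>\<^sub>\<Gamma> (z - B)\<^sup>-\<^sup>1 dz\<close> corresponding to a finite set \<open>\<Lambda>\<close> of isolated
  points of the spectrum, where \<open>\<Gamma>\<close> is the cycle of positively oriented circles of a
  common radius around the points of \<open>\<Lambda>\<close>. It has winding number 1 about each point of \<open>\<Lambda>\<close> and 0
  about the other points of the spectrum. The integral is the weak one, i.e. it is tested
  against all elements \<open>h\<close> of the space.
\<close>

definition riesz_projection :: "'a measure \<Rightarrow> 'a operator \<Rightarrow> complex set \<Rightarrow> 'a operator" where
  "riesz_projection M B \<Lambda> u v \<longleftrightarrow> u \<in> L2 M \<and> v \<in> L2 M \<and> finite \<Lambda> \<and>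
     (\<exists>r>0. (\<forall>l\<in>\<Lambda>. cball l r \<inter> spectrum M B = {l}) \<and>
        (\<forall>h\<in>L2 M. l2inner M v h =
           1 / (2 * of_real pi * \<i>) *
           (\<Sum>l\<in>\<Lambda>. contour_integral (circlepath l r) (\<lambda>z. l2inner M (resolvent B z u) h))))"

section \<open>Sturm-Liouville operators\<close>

definition AC_on :: "real \<Rightarrow> real \<Rightarrow> (real \<Rightarrow> complex) \<Rightarrow> bool" where
  "AC_on c d f \<longleftrightarrow> (\<forall>\<epsilon>>0. \<exists>\<delta>>0. \<forall>(n::nat) l u.
     (\<forall>i<n. c \<le> l i \<and> l i \<le> u i \<and> u i \<le> d) \<longrightarrow>
     (\<forall>i<n. \<forall>j<n. i \<noteq> j \<longrightarrow> {l i<..<u i} \<inter> {l j<..<u j} = {}) \<longrightarrow>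
     (\<Sum>i<n. u i - l i) < \<delta> \<longrightarrow> (\<Sum>i<n. cmod (f (u i) - f (l i))) < \<epsilon>)"

definition AC_loc :: "(real \<Rightarrow> complex) \<Rightarrow> bool" where
  "AC_loc f \<longleftrightarrow> (\<forall>c d. c \<le> d \<longrightarrow> AC_on c d f)"

text \<open>
  \<open>g = (1/w) (- (p f')' + q f)\<close> almost everywhere on the open set \<open>S\<close>, where \<open>v\<close> is the quasi-derivative
  \<open>p f'\<close>. As \<open>p\<close> and \<open>f'\<close> are only determined almost everywhere, \<open>p f'\<close> being absolutely continuous
  means that \<open>v\<close> is; point values such as \<open>(p f')(0)\<close> are those of \<open>v\<close>.
\<close>

definition sl_expr :: "(real \<Rightarrow> real) \<Rightarrow> (real \<Rightarrow> real) \<Rightarrow> (real \<Rightarrow> real) \<Rightarrow> real set \<Rightarrow>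
    (real \<Rightarrow> complex) \<Rightarrow> (real \<Rightarrow> complex) \<Rightarrow> (real \<Rightarrow> complex) \<Rightarrow> bool" where
  "sl_expr w p q S f v g \<longleftrightarrow> (AE x in lebesgue_on S. \<exists>f' v'.
     (f has_vector_derivative f') (at x) \<and> v x = of_real (p x) * f' \<and>
     (v has_vector_derivative v') (at x) \<and>
     g x = 1 / of_real (w x) * (- v' + of_real (q x) * f x))"

abbreviation L2R :: "(real \<Rightarrow> real) \<Rightarrow> real measure" where
  "L2R w \<equiv> weighted w UNIV"

abbreviation L2a :: "(real \<Rightarrow> real) \<Rightarrow> real \<Rightarrow> real measure" where
  "L2a w a \<equiv> weighted w {0<..<a}"

definition maximal_op :: "(real \<Rightarrow> real) \<Rightarrow> (real \<Rightarrow> real) \<Rightarrow> (real \<Rightarrow> real) \<Rightarrow> real operator" where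
  "maximal_op w p q f g \<longleftrightarrow> f \<in> L2 (L2R w) \<and> g \<in> L2 (L2R w) \<and>
     (\<exists>v. AC_loc f \<and> AC_loc v \<and> sl_expr w p q UNIV f v g)"

definition fiber_op ::
  "(real \<Rightarrow> real) \<Rightarrow> (real \<Rightarrow> real) \<Rightarrow> (real \<Rightarrow> real) \<Rightarrow> real \<Rightarrow> real \<Rightarrow> real operator" where
  "fiber_op w p q a t f g \<longleftrightarrow> f \<in> L2 (L2a w a) \<and> g \<in> L2 (L2a w a) \<and>
     (\<exists>v. AC_on 0 a f \<and> AC_on 0 a v \<and> sl_expr w p q {0<..<a} f v g \<and>
          f a = exp (\<i> * of_real t) * f 0 \<and> v a = exp (\<i> * of_real t) * v 0)"

text \<open>The pair \<open>(u, p u')\<close> for the solution of the eigenvalue equation with given initial values.\<close>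

definition sl_solution :: "(real \<Rightarrow> real) \<Rightarrow> (real \<Rightarrow> real) \<Rightarrow> (real \<Rightarrow> real) \<Rightarrow> complex \<Rightarrow>
    complex \<Rightarrow> complex \<Rightarrow> (real \<Rightarrow> complex) \<times> (real \<Rightarrow> complex)" where
  "sl_solution w p q z c0 c1 = (THE (u, v). AC_loc u \<and> AC_loc v \<and>
     sl_expr w p q UNIV u v (\<lambda>x. z * u x) \<and> u 0 = c0 \<and> v 0 = c1)"

definition discriminant ::
  "(real \<Rightarrow> real) \<Rightarrow> (real \<Rightarrow> real) \<Rightarrow> (real \<Rightarrow> real) \<Rightarrow> real \<Rightarrow> complex \<Rightarrow> complex" where
  "discriminant w p q a z = fst (sl_solution w p q z 1 0) a + snd (sl_solution w p q z 0 1) a"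

definition critical_point ::
  "(real \<Rightarrow> real) \<Rightarrow> (real \<Rightarrow> real) \<Rightarrow> (real \<Rightarrow> real) \<Rightarrow> real \<Rightarrow> complex \<Rightarrow> bool" where
  "critical_point w p q a z \<longleftrightarrow>
     z \<in> spectrum (L2R w) (maximal_op w p q) \<and> deriv (discriminant w p q a) z = 0"

section \<open>Turning points\<close>

definition indefinite_on :: "(real \<Rightarrow> real) \<Rightarrow> real set \<Rightarrow> bool" where
  "indefinite_on w S \<longleftrightarrow>
     \<not> (AE x in lebesgue_on S. w x > 0) \<and> \<not> (AE x in lebesgue_on S. w x < 0)"

definition turning_point :: "(real \<Rightarrow> real) \<Rightarrow> real \<Rightarrow> bool" where
  "turning_point w x0 \<longleftrightarrow> (\<forall>\<delta>>0. indefinite_on w {x0 - \<delta><..<x0 + \<delta>})"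

text \<open>Derivatives at the end points of a closed interval are one-sided.\<close>

definition C1_on :: "real set \<Rightarrow> (real \<Rightarrow> real) \<Rightarrow> bool" where
  "C1_on S f \<longleftrightarrow> (\<exists>f'. (\<forall>x\<in>S. (f has_real_derivative f' x) (at x within S)) \<and> continuous_on S f')"

definition one_simple :: "(real \<Rightarrow> real) \<Rightarrow> real \<Rightarrow> bool" where
  "one_simple w x0 \<longleftrightarrow> (\<exists>\<delta>>0. \<exists>\<tau>p>-1. \<exists>\<tau>m>-1. \<exists>\<rho>p \<rho>m.
     C1_on {x0..x0 + \<delta>} \<rho>p \<and> C1_on {x0 - \<delta>..x0} \<rho>m \<and> \<rho>p x0 \<noteq> 0 \<and> \<rho>m x0 \<noteq> 0 \<and>
     (\<exists>c. \<forall>x\<in>{0..\<delta>}. sgn (\<rho>p (x0 + x)) = c \<and> - sgn (\<rho>m (x0 - x)) = c) \<and>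
     (\<forall>x. x - x0 \<in> {0<..<\<delta>} \<longrightarrow> w x = \<rho>p x * \<bar>x - x0\<bar> powr \<tau>p) \<and>
     (\<forall>x. - (x - x0) \<in> {0<..<\<delta>} \<longrightarrow> w x = \<rho>m x * \<bar>x - x0\<bar> powr \<tau>m))"

section \<open>Sign types\<close>

definition indef_inner ::
  "(real \<Rightarrow> real) \<Rightarrow> real \<Rightarrow> (real \<Rightarrow> complex) \<Rightarrow> (real \<Rightarrow> complex) \<Rightarrow> complex" where
  "indef_inner w a f g = (LINT x|lebesgue_on {0<..<a}. f x * cnj (g x) * of_real (w x))"

definition approx_eigenseq ::
  "'a measure \<Rightarrow> 'a operator \<Rightarrow> complex \<Rightarrow> (nat \<Rightarrow> 'a \<Rightarrow> complex) \<Rightarrow> bool" where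
  "approx_eigenseq M B z f \<longleftrightarrow> (\<exists>g. (\<forall>n. B (f n) (g n) \<and> l2norm M (f n) = 1) \<and>
     (\<lambda>n. l2norm M (\<lambda>x. g n x - z * f n x)) \<longlonglongrightarrow> 0)"

definition sigma_plus :: "(real \<Rightarrow> real) \<Rightarrow> real \<Rightarrow> real operator \<Rightarrow> complex set" where
  "sigma_plus w a B = {z. (\<exists>f. approx_eigenseq (L2a w a) B z f) \<and>
     (\<forall>f. approx_eigenseq (L2a w a) B z f \<longrightarrow>
        liminf (\<lambda>n. ereal (Re (indef_inner w a (f n) (f n)))) > 0)}"

definition sigma_minus :: "(real \<Rightarrow> real) \<Rightarrow> real \<Rightarrow> real operator \<Rightarrow> complex set" where
  "sigma_minus w a B = {z. (\<exists>f. approx_eigenseq (L2a w a) B z f) \<and>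
     (\<forall>f. approx_eigenseq (L2a w a) B z f \<longrightarrow>
        limsup (\<lambda>n. ereal (Re (indef_inner w a (f n) (f n)))) < 0)}"

definition positive_type :: "(real \<Rightarrow> real) \<Rightarrow> real \<Rightarrow> real operator \<Rightarrow> real set \<Rightarrow> bool" where
  "positive_type w a B \<Delta> \<longleftrightarrow> of_real ` \<Delta> \<inter> spectrum (L2a w a) B \<subseteq> sigma_plus w a B"

definition negative_type :: "(real \<Rightarrow> real) \<Rightarrow> real \<Rightarrow> real operator \<Rightarrow> real set \<Rightarrow> bool" where
  "negative_type w a B \<Delta> \<longleftrightarrow> of_real ` \<Delta> \<inter> spectrum (L2a w a) B \<subseteq> sigma_minus w a B"

section \<open>Gelfand transform and spectral function\<close>

text \<open>
  \<open>L\<^sup>2(\<I>, \<H>\<^sub>a)\<close> is realised as the L2 space of the product measure: an element \<open>F\<close> is a function of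
  pairs \<open>(t, x)\<close>, and \<open>F(t)\<close> is the slice \<open>\<lambda>x. F (t, x)\<close>.
\<close>

abbreviation L2I :: "(real \<Rightarrow> real) \<Rightarrow> real \<Rightarrow> (real \<times> real) measure" where
  "L2I w a \<equiv> lebesgue_on {-pi..pi} \<Otimes>\<^sub>M L2a w a"

definition gelfand_sum :: "real \<Rightarrow> nat \<Rightarrow> (real \<Rightarrow> complex) \<Rightarrow> real \<times> real \<Rightarrow> complex" where
  "gelfand_sum a N f = (\<lambda>(t, x). 1 / of_real (sqrt (2 * pi)) *
     (\<Sum>n = - int N..int N. exp (- \<i> * of_int n * of_real t) * f (x + of_int n * a)))"

text \<open>Graph of the Gelfand transform.\<close>

definition gelfand :: "(real \<Rightarrow> real) \<Rightarrow> real \<Rightarrow> (real \<Rightarrow> complex) \<Rightarrow> (real \<times> real \<Rightarrow> complex) \<Rightarrow> bool" where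
  "gelfand w a f F \<longleftrightarrow> f \<in> L2 (L2R w) \<and> F \<in> L2 (L2I w a) \<and>
     (\<lambda>N. l2norm (L2I w a) (\<lambda>y. F y - gelfand_sum a N f y)) \<longlonglongrightarrow> 0"

definition E_defined ::
  "(real \<Rightarrow> real) \<Rightarrow> (real \<Rightarrow> real) \<Rightarrow> (real \<Rightarrow> real) \<Rightarrow> real \<Rightarrow> complex set \<Rightarrow> bool" where
  "E_defined w p q a \<Delta> \<longleftrightarrow> bounded \<Delta> \<and> \<Delta> \<in> sets borel \<and>
     (let \<sigma> = spectrum (L2R w) (maximal_op w p q)
      in \<forall>z \<in> top_of_set \<sigma> frontier_of (\<Delta> \<inter> \<sigma>). \<not> critical_point w p q a z)"

definition spectral_E ::
  "(real \<Rightarrow> real) \<Rightarrow> (real \<Rightarrow> real) \<Rightarrow> (real \<Rightarrow> real) \<Rightarrow> real \<Rightarrow> complex set \<Rightarrow> real operator" where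
  "spectral_E w p q a \<Delta> f g \<longleftrightarrow> (\<exists>F G. gelfand w a f F \<and> gelfand w a g G \<and>
     (AE t in lebesgue_on {-pi..pi}.
        riesz_projection (L2a w a) (fiber_op w p q a t)
          (spectrum (L2a w a) (fiber_op w p q a t) \<inter> \<Delta>) (\<lambda>x. F (t, x)) (\<lambda>x. G (t, x))))"

section \<open>Spectral singularity at infinity\<close>

definition admissible_radius ::
  "(real \<Rightarrow> real) \<Rightarrow> (real \<Rightarrow> real) \<Rightarrow> (real \<Rightarrow> real) \<Rightarrow> real \<Rightarrow> real \<Rightarrow> bool" where
  "admissible_radius w p q a R \<longleftrightarrow> R > 0 \<and>
     (\<forall>t\<in>{-pi..pi}.
        spectrum (L2a w a) (fiber_op w p q a t) - \<real> \<subseteq> {z. cmod z < R} \<and>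
        negative_type w a (fiber_op w p q a t) {..<-R} \<and>
        positive_type w a (fiber_op w p q a t) {R<..}) \<and>
     \<not> critical_point w p q a (of_real R) \<and> \<not> critical_point w p q a (of_real (-R))"

definition infinity_spectral_singularity ::
  "(real \<Rightarrow> real) \<Rightarrow> (real \<Rightarrow> real) \<Rightarrow> (real \<Rightarrow> real) \<Rightarrow> real \<Rightarrow> real \<Rightarrow> bool" where
  "infinity_spectral_singularity w p q a R \<longleftrightarrow>
     (SUP C \<in> {C. C > R \<and> E_defined w p q a (of_real ` {R..C})}.
        op_norm (L2R w) (spectral_E w p q a (of_real ` {R..C}))) = \<infinity> \<or>
     (SUP C \<in> {C. C > R \<and> E_defined w p q a (of_real ` {-C..-R})}.
        op_norm (L2R w) (spectral_E w p q a (of_real ` {-C..-R}))) = \<infinity>"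

end

theory Submission
  imports Defs
begin

text \<open>
By the Gelfand transform it suffices to bound the spectral projections of the fibers \<open>A(t)\<close> uniformly in \<open>t\<close>.
Such a projection is the sum of the indefinite-orthogonal projections onto the eigenspaces in the
interval, so a bound follows from \<open>[f,f] \<ge> c (f,f)\<close> on finite sums \<open>f\<close> of eigenfunctions of positive type,
with \<open>c\<close> independent of \<open>t\<close> and of the number of summands.

For eigenvalues above some \<open>R'\<close> this comes from a Hermitian form \<open>Y\<close> with \<open>Y(f,f) \<ge> (f,f)/2\<close> and
\<open>\<bar>Y(f,A(t)f)\<bar> \<le> C (E(f) + sup \<bar>f\<bar>^2)\<close>, \<open>E\<close> the energy: \<open>Y\<close> is the product with \<open>sgn w\<close>, whose boundary terms at the
turning points are cancelled by small forms built from dilations across the point; this is where \<open>1\<close>-simplicity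
and the bounds on \<open>p\<close> enter. Along \<open>f(s) = \<Sum> exp(- s l) f_l\<close> a combination of \<open>Y(f(s),f(s))\<close> and \<open>[f(s),f(s)]\<close>
is monotone and tends to \<open>0\<close>, which gives the inequality. The eigenvalues in \<open>(R, R']\<close> are bounded in number,
and compactness produces \<open>c\<close> for them, unless some eigenvector at \<open>R\<close> is neutral; then \<open>R\<close> is a critical point.
The negative half-line is the positive one for \<open>- w\<close>.
\<close>

text \<open>Positivity of each single eigenvector gives no common bound: the lower bound could
  degenerate as t varies, as eigenvalues tend to infinity, or as summands accumulate. High
  eigenvalues must therefore be treated all at once. The product with \<open>sgn w\<close> alone
  fails, since integrating it by parts against \<open>A(t) f\<close> leaves terms
  \<open>f(xi) cnj (v(xi))\<close> at the turning points, while the energy controls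
  \<open>v = p f'\<close> only in the mean. A correcting form must produce these terms with the
  opposite sign and yet be small against the norm: a large dilation factor makes it small, and a
  second factor is there because \<open>A(t)\<close> also acts on the other argument, where no
  boundary term may appear. Along the exponential flow an estimate of \<open>Y(f, A(t) f)\<close>
  integrates to one of \<open>Y(f, f)\<close> whose constant does not see the number of summands.
  Two end points need care. A turning point may sit at the end of the period, so the period cell is
  moved. Eigenvalues equal to R need not be of positive type, but R is an eigenvalue of A(t) for
  finitely many t only, a null set in the Gelfand transform.\<close>

abbreviation cx :: "real \<Rightarrow> complex" where "cx \<equiv> complex_of_real"

notation (input) absolutely_integrable_on (infixr "abs'_int'_on" 46)

notation (input) LIMSEQ ("((_)/ ----> (_))" [60, 60] 60)

abbreviation eit :: "real => complex" where "eit t == exp (\<i> * of_real t)"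

abbreviation lsum :: "'i set => ('i => real => complex) => real => complex" where "lsum L f == %x. \<Sum>l\<in>L. f l x"

lemmas abs_int_def = absolutely_integrable_on_def

section \<open>Absolutely continuous functions\<close>

text \<open>Lebesgue differentiation from the right, put as an error linear in the length k so that
  it matches the definition of a derivative.\<close>

lemma right_average_ae:
 fixes g :: "real => 'b::euclidean_space"
 assumes "!!c d. g integrable_on {c..d}"
 obtains N where "negligible N"
  "!!x e. x \<notin> N ==> 0 < e ==> \<exists>r>0. \<forall>k. 0 < k & k < r --> norm (integral {x..x + k} g - k *\<^sub>R g x) <= e*k"
proof -
 obtain N where N: "negligible N" "!!x e. [|x \<notin> N; 0 < e|] ==> \<exists>r>0. \<forall>k. 0 < k & k < r -->
   norm (integral (cbox x (x + k *\<^sub>R One)) g /\<^sub>R k ^ DIM(real) - g x) < e"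
  by (rule integrable_ccontinuous_explicit[of g]) (use assms in auto)
 show ?thesis
 proof (rule that[OF N(1)])
  fix x e assume "x \<notin> N" "0 < (e :: real)"
  then obtain r where r: "0 < r" "\<forall>k. 0 < k & k < r --> norm (integral {x..x + k} g /\<^sub>R k - g x) < e"
   using N(2)[of x e] by auto
  have "norm (integral {x..x + k} g - k *\<^sub>R g x) <= e*k" if k: "0 < k" "k < r" for k
  proof -
   have "integral {x..x + k} g - k *\<^sub>R g x = k *\<^sub>R (integral {x..x + k} g /\<^sub>R k - g x)"
    using k by (simp add: scaleR_diff_right)
   moreover have "norm (integral {x..x + k} g /\<^sub>R k - g x) < e" using r(2) k by blast
   ultimately show ?thesis using k by (simp add: mult.commute)
  qed
  with r(1) show "\<exists>r>0. \<forall>k. 0 < k & k < r --> norm (integral {x..x + k} g - k *\<^sub>R g x) <= e*k" by blast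
 qed
qed

text \<open>Averages to the left of x are averages to the right of -x of the reflected function, so
  the one-sided statement is applied twice. Extending \<open>h\<close> by zero removes the boundary
  cases.\<close>

lemma indefinite_integral_differentiable_ae:
 fixes h :: "real => 'b::euclidean_space"
 assumes h: "h integrable_on {c..d}"
 shows "negligible {x : {c<..<d}. \<not> ((%y. integral {c..y} h) has_vector_derivative h x) (at x)}"
proof -
 define g where "g x = (if x : {c..d} then h x else 0)" for x
 define F where "F y = integral {c..y} h" for y
 have gi: "g integrable_on {x..y}" for x y
  unfolding g_def integrable_restrict_Int by (simp, rule integrable_on_subinterval[OF h]) auto
 have Fd: "F y - F x = integral {x..y} g" if "c <= x" "x <= y" "y <= d" for x y
 proof -
  have "integral {x..y} g = integral {x..y} h" by (rule integral_cong) (use that in \<open>auto simp: g_def\<close>)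
  then show ?thesis
   using Henstock_Kurzweil_Integration.integral_combine[of c x y h] integrable_on_subinterval[OF h, of c y] that
   by (auto simp: F_def algebra_simps)
 qed
 obtain N where N: "negligible N" "!!x e. x \<notin> N ==> 0 < e ==> \<exists>r>0. \<forall>k. 0 < k & k < r -->
   norm (integral {x..x + k} g - k *\<^sub>R g x) <= e*k"
  by (rule right_average_ae[OF gi]) blast
 have "(%x. g (- x)) integrable_on {x..y}" for x y using gi[of "- y" "- x"] Henstock_Kurzweil_Integration.integrable_reflect_real[where f = g and a = "- y" and b = "- x"] by simp
 then obtain M where M: "negligible M" "!!x e. x \<notin> M ==> 0 < e ==> \<exists>r>0. \<forall>k. 0 < k & k < r -->
   norm (integral {x..x + k} (%x. g (- x)) - k *\<^sub>R g (- x)) <= e*k"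
  by (rule right_average_ae) blast
 have "(F has_vector_derivative h x) (at x)" if x: "x : {c<..<d}" "x \<notin> N" "- x \<notin> M" for x
  unfolding has_vector_derivative_def has_derivative_at_alt
 proof (intro conjI allI impI)
  fix e :: real assume "0 < e"
  obtain r s where r: "0 < r" "\<forall>k. 0 < k & k < r --> norm (integral {x..x + k} g - k *\<^sub>R g x) <= e*k"
   and s: "0 < s" "\<forall>k. 0 < k & k < s --> norm (integral {- x..- x + k} (%x. g (- x)) - k *\<^sub>R g x) <= e*k"
   using N(2)[OF x(2) \<open>0 < e\<close>] M(2)[OF x(3) \<open>0 < e\<close>] by auto
  have gx: "g x = h x" using x by (simp add: g_def)
  have "norm (F y - F x - (y - x) *\<^sub>R h x) <= e*norm (y - x)"
   if y: "norm (y - x) < min (min r s) (min (x - c) (d - x))" for y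
  proof (rule linorder_cases[of x y])
   assume "x < y"
   then show ?thesis using r(2)[THEN spec, of "y - x"] Fd[of x y] x y by (simp add: gx)
  next
   assume l: "y < x"
   have "F y - F x - (y - x) *\<^sub>R h x = - (integral {- x..- x + (x - y)} (%x. g (- x)) - (x - y) *\<^sub>R g x)"
    using Fd[of y x] Henstock_Kurzweil_Integration.integral_reflect_real[where f = g and a = y and b = x] l x y by (simp add: gx algebra_simps)
   then show ?thesis using s(2)[THEN spec, of "x - y"] l y by (simp only: norm_minus_cancel) simp
  qed simp
  moreover have "0 < min (min r s) (min (x - c) (d - x))" using r(1) s(1) x by simp
  ultimately show "\<exists>r>0. \<forall>y. norm (y - x) < r --> norm (F y - F x - (y - x) *\<^sub>R h x) <= e*norm (y - x)" by blast
 qed (rule bounded_linear_scaleR_left)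
 moreover have "negligible (N \<union> uminus ` M)" using N(1) M(1) by (auto intro: negligible_differentiable_image_negligible differentiable_on_minus differentiable_on_ident)
 moreover have "x : uminus ` M" if "- x : M" for x using that by (intro image_eqI[of _ _ "- x"]) auto
 ultimately show ?thesis unfolding F_def[abs_def] by (elim negligible_subset) blast
qed

text \<open>The index set is arbitrary because the fundamental theorem indexes the intervals by the
  tagged pieces of a division.\<close>

definition small_family :: "real => real => real => 'i set => ('i => real) => ('i => real) => bool" where
 "small_family c d dl I l u \<longleftrightarrow> finite I & (\<forall>i\<in>I. c <= l i & l i <= u i & u i <= d) \<and>
   (\<forall>i\<in>I. \<forall>j\<in>I. i ~= j --> {l i<..<u i} \<inter> {l j<..<u j} = {}) & (\<Sum>i\<in>I. u i - l i) < dl"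

definition ac_on :: "real => real => (real => 'b::real_normed_vector) => bool" where
 "ac_on c d f \<longleftrightarrow> (\<forall>ep>0. \<exists>dl>0. \<forall>(n::nat) l u. small_family c d dl {..<n} l u -->
   (\<Sum>i<n. norm (f (u i) - f (l i))) < ep)"

lemma AC_on_iff_ac_on: "AC_on c d f \<longleftrightarrow> ac_on c d f"
 unfolding AC_on_def ac_on_def small_family_def by (simp add: Ball_def imp_conjL)

lemma ac_onE_finite:
 assumes "ac_on c d f" "ep > 0"
 obtains dl where "dl > 0" "!!(I::'i set) l u. small_family c d dl I l u ==> (\<Sum>i\<in>I. norm (f (u i) - f (l i))) < ep"
proof -
 obtain dl where dl: "dl > 0" "!!(n::nat) l u. small_family c d dl {..<n} l u ==> (\<Sum>i<n. norm (f (u i) - f (l i))) < ep"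
  using assms unfolding ac_on_def by blast
 show ?thesis
 proof (rule that[OF dl(1)])
  fix I :: "'i set" and l u
  assume sf: "small_family c d dl I l u"
  then have "finite I" by (simp add: small_family_def)
  then obtain b where b: "bij_betw b {..<card I} I"
   using ex_bij_betw_nat_finite[of I] by (auto simp: atLeast0LessThan)
  have inI: "i < card I ==> b i : I" for i using b by (auto simp: bij_betw_def)
  have "(\<Sum>i<card I. norm (f ((u \<circ> b) i) - f ((l \<circ> b) i))) < ep"
  proof (rule dl(2))
   have "i < card I ==> j < card I ==> i ~= j ==> b i ~= b j" for i j
    using b by (auto simp: bij_betw_def inj_on_def)
   then show "small_family c d dl {..<card I} (l \<circ> b) (u \<circ> b)"
    using sf inI sum.reindex_bij_betw[OF b, of "%i. u i - l i"] unfolding small_family_def by simp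
  qed
  then show "(\<Sum>i\<in>I. norm (f (u i) - f (l i))) < ep"
   using sum.reindex_bij_betw[OF b, of "%i. norm (f (u i) - f (l i))"] by simp
 qed
qed

lemma ac_on_subset:
 assumes "ac_on c d f" "c <= c'" "d' <= d"
 shows "ac_on c' d' f"
proof -
 have "c' <= u & u <= v & v <= d' --> c <= u & u <= v & v <= d" for u v using assms by linarith
 then have "small_family c d dl {..<n} l u" if "small_family c' d' dl {..<n} l u" for dl l u and n :: nat
  using that unfolding small_family_def by blast
 then show ?thesis using assms(1) unfolding ac_on_def by meson
qed

lemma ac_on_imp_continuous_on:
 assumes "ac_on c d f"
 shows "continuous_on {c..d} f"
 unfolding continuous_on_iff
proof (intro ballI allI impI)
 fix x and ep :: real assume x: "x : {c..d}" and "ep > 0"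
 obtain dl where dl: "dl > 0" "!!(I::nat set) l u. small_family c d dl I l u ==> (\<Sum>i\<in>I. norm (f (u i) - f (l i))) < ep"
  by (rule ac_onE_finite[OF assms \<open>ep > 0\<close>]) blast
 have "dist (f x') (f x) < ep" if "x' : {c..d}" "dist x' x < dl" for x'
  using dl(2)[of "{0}" "%_. min x x'" "%_. max x x'"] that x
  by (cases "x <= x'") (auto simp: dist_norm norm_minus_commute small_family_def)
 then show "\<exists>dl>0. \<forall>x'\<in>{c..d}. dist x' x < dl --> dist (f x') (f x) < ep" using dl(1) by blast
qed

text \<open>Covers products and Lipschitz compositions at once: only the increments have to be
  dominated.\<close>

lemma ac_on_bound:
 assumes f: "ac_on c d f" and g: "ac_on c d g" and "K \<ge> 0"
  and bnd: "!!x y. c <= x ==> x <= y ==> y <= d ==>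
   norm (F y - F x) <= K*(norm (f y - f x) + norm (g y - g x))"
 shows "ac_on c d F"
 unfolding ac_on_def
proof (intro allI impI)
 fix ep :: real assume "ep > 0"
 define e where "e = ep/(2*(K + 1))"
 have "e > 0" using \<open>ep > 0\<close> \<open>K \<ge> 0\<close> by (simp add: e_def)
 obtain dl1 where dl1: "dl1 > 0" "!!(I::nat set) l u. small_family c d dl1 I l u ==> (\<Sum>i\<in>I. norm (f (u i) - f (l i))) < e"
  by (rule ac_onE_finite[OF f \<open>e > 0\<close>]) blast
 obtain dl2 where dl2: "dl2 > 0" "!!(I::nat set) l u. small_family c d dl2 I l u ==> (\<Sum>i\<in>I. norm (g (u i) - g (l i))) < e"
  by (rule ac_onE_finite[OF g \<open>e > 0\<close>]) blast
 have "(\<Sum>i<n. norm (F (u i) - F (l i))) < ep"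
  if a: "small_family c d (min dl1 dl2) {..<n} l u" for n :: nat and l u
 proof -
  have a12: "small_family c d dl1 {..<n} l u" "small_family c d dl2 {..<n} l u"
   using a by (auto simp: small_family_def)
  have "(\<Sum>i<n. norm (F (u i) - F (l i))) <= (\<Sum>i<n. K*(norm (f (u i) - f (l i)) + norm (g (u i) - g (l i))))"
   using a by (intro sum_mono bnd) (auto simp: small_family_def)
  also have "... = K*((\<Sum>i<n. norm (f (u i) - f (l i))) + (\<Sum>i<n. norm (g (u i) - g (l i))))"
   by (simp add: sum_distrib_left sum.distrib distrib_left)
  also have "... <= K*(e + e)"
   using dl1(2)[OF a12(1)] dl2(2)[OF a12(2)] \<open>K \<ge> 0\<close> by (intro mult_left_mono add_mono) auto
  also have "... = ep*(K/(K + 1))" using \<open>K \<ge> 0\<close> by (simp add: e_def divide_simps)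
  also have "... < ep*1" using \<open>ep > 0\<close> \<open>K \<ge> 0\<close> by (intro mult_strict_left_mono) auto
  finally show ?thesis by simp
 qed
 then show "\<exists>dl>0. \<forall>(n::nat) l u. small_family c d dl {..<n} l u --> (\<Sum>i<n. norm (F (u i) - F (l i))) < ep"
  using dl1(1) dl2(1) by (intro exI[of _ "min dl1 dl2"]) auto
qed

lemma ac_on_mult:
 fixes f g :: "real => 'b::real_normed_algebra"
 assumes f: "ac_on c d f" and g: "ac_on c d g"
 shows "ac_on c d (%x. f x*g x)"
proof -
 have "bounded (f ` {c..d})" "bounded (g ` {c..d})"
  using ac_on_imp_continuous_on[OF f] ac_on_imp_continuous_on[OF g]
  by (auto intro!: compact_imp_bounded compact_continuous_image)
 then obtain B C where "\<forall>x\<in>f ` {c..d}. norm x <= B" "\<forall>x\<in>g ` {c..d}. norm x <= C"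
  unfolding bounded_iff by (elim exE)
 then have B: "!!x. x : {c..d} ==> norm (f x) <= B" "!!x. x : {c..d} ==> norm (g x) <= C" by auto
 show ?thesis
 proof (rule ac_on_bound[OF f g, of "\<bar>B\<bar> + \<bar>C\<bar>"])
  fix x y assume xy: "c <= x" "x <= y" "y <= d"
  have "f y*g y - f x*g x = f y*(g y - g x) + (f y - f x)*g x" by (simp add: algebra_simps)
  then have "norm (f y*g y - f x*g x) <= norm (f y)*norm (g y - g x) + norm (f y - f x)*norm (g x)"
   by (metis add_mono norm_mult_ineq norm_triangle_le)
  also have "... <= (\<bar>B\<bar> + \<bar>C\<bar>)*norm (g y - g x) + norm (f y - f x)*(\<bar>B\<bar> + \<bar>C\<bar>)"
   using B[of y] B[of x] xy by (intro add_mono mult_right_mono mult_left_mono) auto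
  finally show "norm (f y*g y - f x*g x) <= (\<bar>B\<bar> + \<bar>C\<bar>)*(norm (f y - f x) + norm (g y - g x))"
   by (simp add: algebra_simps)
 qed auto
qed

lemma sum_integral_disjoint_le:
 fixes g :: "real => real"
 assumes g: "g abs_int_on {c..d}" and pos: "!!x. 0 <= g x" and "finite I"
  and I: "!!i. i : I ==> c <= l i & l i <= u i & u i <= d"
  and dis: "!!i j. i : I ==> j : I ==> i ~= j ==> {l i<..<u i} \<inter> {l j<..<u j} = {}"
 shows "(\<Sum>i\<in>I. integral {l i..u i} g) <= integral {c..d} g"
proof -
 have int: "g integrable_on {l i..u i}" if "i : I" for i
  using g I[OF that] by (metis abs_int_def atLeastatMost_subset_iff integrable_on_subinterval)
 have "(g has_integral (\<Sum>i\<in>I. integral {l i..u i} g)) (\<Union>i\<in>I. {l i<..<u i})"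
 proof (rule has_integral_UN[OF \<open>finite I\<close>])
  show "(g has_integral integral {l i..u i} g) {l i<..<u i}" if "i : I" for i
   using int[OF that] by (metis box_real has_integral_integral has_integral_open_interval)
  show "pairwise (%i i'. negligible ({l i<..<u i} \<inter> {l i'<..<u i'})) I"
   using dis by (auto simp: pairwise_def)
 qed
 moreover have "(g has_integral integral {c..d} g) {c..d}"
  using g by (simp add: abs_int_def integrable_integral)
 ultimately show ?thesis
 proof (rule has_integral_subset_le[rotated 1])
  show "(\<Union>i\<in>I. {l i<..<u i}) \<subseteq> {c..d}" using I by fastforce
 qed (use pos in auto)
qed

text \<open>Truncate \<open>norm (h x)\<close> at a height M. The excess has small total integral,
  and the truncated part contributes at most M times the total length of the intervals.\<close>

lemma ac_on_indefinite_integral: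
 fixes h :: "real => 'b::euclidean_space"
 assumes h: "h abs_int_on {c..d}"
  and F: "!!x y. c <= x ==> x <= y ==> y <= d ==> F y - F x = integral {x..y} h"
 shows "ac_on c d F"
 unfolding ac_on_def
proof (intro allI impI)
 fix ep :: real assume "ep > 0"
 define g where "g x = norm (h x)" for x
 define k where "k n x = min (g x) (real n)" for n x
 have gi: "g abs_int_on {c..d}" unfolding g_def using absolutely_integrable_norm[OF h] by (simp add: o_def)
 have ki: "k n abs_int_on {c..d}" for n
  unfolding k_def by (intro absolutely_integrable_min_1 gi absolutely_integrable_continuous_real continuous_intros)
 have "(%n. integral {c..d} (k n)) ----> integral {c..d} g"
 proof (rule dominated_convergence(2)[where h = g])
  show "k n integrable_on {c..d}" for n using ki by (simp add: abs_int_def)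
  show "g integrable_on {c..d}" using gi by (simp add: abs_int_def)
  show "norm (k n x) <= g x" for n x by (auto simp: k_def g_def)
  show "(%n. k n x) ----> g x" for x
  proof (rule tendsto_eventually)
   obtain N where "g x <= real N" using real_arch_simple by blast
   then show "\<forall>\<^sub>F n in sequentially. k n x = g x"
    unfolding eventually_sequentially k_def
    by (intro exI[of _ N]) (auto simp: min_def order_trans)
  qed
 qed
 then obtain M where "\<bar>integral {c..d} (k M) - integral {c..d} g\<bar> < ep/2"
  by (metis \<open>ep > 0\<close> LIMSEQ_iff half_gt_zero order_refl real_norm_def)
 then have M: "integral {c..d} (%x. g x - k M x) < ep/2"
  using gi ki[of M] by (subst Henstock_Kurzweil_Integration.integral_diff) (auto simp: abs_int_def abs_if split: if_splits)
 define dl where "dl = ep/(2*(real M + 1))"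
 have "dl > 0" using \<open>ep > 0\<close> by (simp add: dl_def)
 moreover have "(\<Sum>i<n. norm (F (u i) - F (l i))) < ep"
  if sf: "small_family c d dl {..<n} l u" for n :: nat and l u
 proof -
  from sf have a: "\<forall>i<n. c <= l i & l i <= u i & u i <= d"
   "\<forall>i<n. \<forall>j<n. i ~= j --> {l i<..<u i} \<inter> {l j<..<u j} = {}"
   "(\<Sum>i<n. u i - l i) < dl" by (auto simp: small_family_def)
  have sub: "{l i..u i} \<subseteq> {c..d}" if "i < n" for i using a(1) that by auto
  note ai = absolutely_integrable_on_subinterval[OF _ sub]
  have "(\<Sum>i<n. norm (F (u i) - F (l i))) <= (\<Sum>i<n. integral {l i..u i} (%x. g x - k M x) + real M*(u i - l i))"
  proof (rule sum_mono)
   fix i assume "i : {..<n}" then have i: "i < n" by simp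
   have "norm (F (u i) - F (l i)) <= integral {l i..u i} g"
    using a(1) i F[of "l i" "u i"] ai[OF h i] unfolding g_def
    by (auto intro!: integral_norm_bound_integral simp: abs_int_def)
   also have "... <= integral {l i..u i} (%x. (g x - k M x) + real M)"
    using ai[OF gi i] ai[OF ki i, of M]
    by (intro integral_le integrable_add integrable_diff) (auto simp: abs_int_def, auto simp: k_def)
   also have "... = integral {l i..u i} (%x. g x - k M x) + integral {l i..u i} (%x. real M)"
    using ai[OF gi i] ai[OF ki i, of M]
    by (intro Henstock_Kurzweil_Integration.integral_add integrable_diff) (auto simp: abs_int_def)
   finally show "norm (F (u i) - F (l i)) <= integral {l i..u i} (%x. g x - k M x) + real M*(u i - l i)"
    using a(1) i by (auto simp: mult.commute)
  qed
  also have "... = (\<Sum>i<n. integral {l i..u i} (%x. g x - k M x)) + real M*(\<Sum>i<n. (u i - l i))"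
   by (simp add: sum.distrib sum_distrib_left)
  also have "... <= integral {c..d} (%x. g x - k M x) + real M*dl"
  proof (intro add_mono mult_left_mono)
   show "(\<Sum>i<n. integral {l i..u i} (%x. g x - k M x)) <= integral {c..d} (%x. g x - k M x)"
    by (rule sum_integral_disjoint_le) (use a gi ki in \<open>auto intro!: set_integral_diff\<close>, auto simp: k_def)
  qed (use a in auto)
  also have "... < ep/2 + ep/2"
  proof (rule add_less_le_mono[OF M])
   show "real M*dl <= ep/2" using \<open>ep > 0\<close> by (simp add: dl_def field_simps)
  qed
  finally show ?thesis by simp
 qed
 ultimately show "\<exists>dl>0. \<forall>(n::nat) l u. small_family c d dl {..<n} l u -->
   (\<Sum>i<n. norm (F (u i) - F (l i))) < ep" by blast
qed

text \<open>Proved with a gauge. At exceptional points the gauge is an open set of measure below the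
  modulus of absolute continuity, so the increments of f over the pieces tagged there are small in
  total; at the other points it is a ball on which the difference quotient is close to the
  derivative.\<close>

lemma fundamental_theorem_of_calculus_ac:
 fixes f :: "real => 'b::banach"
 assumes ac: "ac_on c d f" and "c <= d" and N: "negligible N"
  and der: "!!x. x : {c<..<d} - N ==> (f has_vector_derivative h x) (at x)"
 shows "(h has_integral (f d - f c)) {c..d}"
proof -
 \<comment> \<open>The end points count as exceptional because the derivative is given only
   inside.\<close>
 define N' where "N' = N \<union> {c, d}"
 have N': "negligible N'" using N by (simp add: N'_def)
 define h' where "h' x = (if x : N' then 0 else h x)" for x
 have "(h' has_integral (f d - f c)) {c..d}"
  unfolding has_integral_real
 proof (intro allI impI)
  fix e :: real assume "e > 0"
  obtain dl where dl: "dl > 0" "!!(I::(real \<times> real set) set) l u. small_family c d dl I l u ==>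
    (\<Sum>i\<in>I. norm (f (u i) - f (l i))) < e/2"
   by (rule ac_onE_finite[OF ac half_gt_zero[OF \<open>e > 0\<close>]]) blast
  have "N' : sets lebesgue" using N' by (simp add: negligible_imp_sets)
  then obtain U where U: "open U" "N' \<subseteq> U" "U - N' : lmeasurable" "emeasure lebesgue (U - N') < ennreal dl"
   using sets_lebesgue_outer_open dl(1) by metis
  have Um: "U : lmeasurable"
   using U(2,3) negligible_imp_measurable[OF N'] by (metis Diff_partition fmeasurable.Un)
  have Umeas: "measure lebesgue U < dl"
  proof -
   have "measure lebesgue U = measure lebesgue (U - N')"
    using N' Um by (simp add: fmeasurableD measure_Diff_null_set negligible_iff_null_sets)
   also have "... < dl" using U(3,4) dl(1) by (simp add: emeasure_eq_measure2 ennreal_less_iff)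
   finally show ?thesis .
  qed
  define e' where "e' = e/(2*(d - c + 1))"
  have "e' > 0" using \<open>e > 0\<close> \<open>c <= d\<close> by (simp add: e'_def)
  have "\<exists>r>0. \<forall>y. \<bar>y - x\<bar> < r --> norm (f y - f x - (y - x) *\<^sub>R h' x) <= e'*\<bar>y - x\<bar>"
   if x: "x : {c..d} - N'" for x
  proof -
   have "(f has_vector_derivative h' x) (at x)" using der[of x] x by (auto simp: N'_def h'_def)
   then show ?thesis unfolding has_vector_derivative_def has_derivative_at_alt using \<open>e' > 0\<close> by auto
  qed
  then obtain r where r: "!!x. x : {c..d} - N' ==> r x > 0"
   "!!x y. x : {c..d} - N' ==> \<bar>y - x\<bar> < r x ==> norm (f y - f x - (y - x) *\<^sub>R h' x) <= e'*\<bar>y - x\<bar>"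
   by metis
  define ga where "ga x = (if x : N' then U else if x : {c..d} then ball x (r x) else ball x 1)" for x
  have ga: "gauge ga" using U r by (auto simp: gauge_def ga_def)
  have "norm (sum (%(x,k). measure lborel k *\<^sub>R h' x) p - (f d - f c)) < e"
   if p: "p tagged_division_of {c..d}" and fine: "ga fine p" for p
  proof -
   note pD = tagged_division_ofD[OF p]
   have K: "\<exists>l u. K = {l..u} & c <= l & l <= x & x <= u & u <= d & x : {c..d} & Sup K = u & Inf K = l & measure lborel K = u - l" if xK: "(x, K) : p" for x K
   proof -
    obtain l u where "K = {l..u}" using pD(4)[OF xK] by auto
    then show ?thesis using pD(2,3)[OF xK] by (intro exI[of _ l] exI[of _ u]) auto
   qed
   define T where "T = (%(x::real,K::real set). measure lborel K *\<^sub>R h' x - (f (Sup K) - f (Inf K)))"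
   define p1 where "p1 = {t\<in>p. fst t : N'}"
   define p2 where "p2 = {t\<in>p. fst t \<notin> N'}"
   have fin: "finite p1" "finite p2" using pD(1) by (auto simp: p1_def p2_def)
   have pp: "p = p1 \<union> p2" "p1 \<inter> p2 = {}" by (auto simp: p1_def p2_def)
   have "sum (%(x,k). measure lborel k *\<^sub>R h' x) p - (f d - f c) = sum T p"
    using additive_tagged_division_1[OF \<open>c <= d\<close> p, of f]
    by (simp add: T_def case_prod_unfold sum_subtractf)
   also have "... = sum T p1 + sum T p2" using fin pp by (metis sum.union_disjoint)
   finally have eq: "sum (%(x,k). measure lborel k *\<^sub>R h' x) p - (f d - f c) = sum T p1 + sum T p2" .
   have dis: "{Inf (snd i)<..<Sup (snd i)} \<inter> {Inf (snd j)<..<Sup (snd j)} = {}" if ij: "i : p" "j : p" "i ~= j" for i j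
   proof -
    have "interior (snd i) \<inter> interior (snd j) = {}" using pD(5)[of "fst i" "snd i" "fst j" "snd j"] ij by auto
    moreover have Ki: "snd i = {Inf (snd i)..Sup (snd i)}" if "i : p" for i
     using K[of "fst i" "snd i"] that by auto
    ultimately show ?thesis using ij interior_atLeastAtMost_real by metis
   qed
   have "(\<Sum>t\<in>p1. norm (f (Sup (snd t)) - f (Inf (snd t)))) < e/2"
   proof (rule dl(2), unfold small_family_def, intro conjI ballI impI)
    show "finite p1" by (rule fin)
    show "c <= Inf (snd i)" "Inf (snd i) <= Sup (snd i)" "Sup (snd i) <= d" if "i : p1" for i
     using K[of "fst i" "snd i"] that by (auto simp: p1_def)
    show "{Inf (snd i)<..<Sup (snd i)} \<inter> {Inf (snd j)<..<Sup (snd j)} = {}" if "i : p1" "j : p1" "i ~= j" for i j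
     using dis that by (auto simp: p1_def)
    have "(\<Sum>i\<in>p1. Sup (snd i) - Inf (snd i)) = (\<Sum>i\<in>p1. measure lebesgue {Inf (snd i)<..<Sup (snd i)})"
    proof (rule sum.cong[OF refl])
     fix i assume "i : p1"
     then have "Inf (snd i) <= Sup (snd i)" using K[of "fst i" "snd i"] by (auto simp: p1_def)
     then show "Sup (snd i) - Inf (snd i) = measure lebesgue {Inf (snd i)<..<Sup (snd i)}" by simp
    qed
    also have "... = measure lebesgue (\<Union>i\<in>p1. {Inf (snd i)<..<Sup (snd i)})"
    proof (rule measure_finite_Union[symmetric, OF fin(1)])
     show "disjoint_family_on (%i. {Inf (snd i)<..<Sup (snd i)}) p1"
      using dis by (auto simp: disjoint_family_on_def p1_def)
     show "emeasure lebesgue {Inf (snd i)<..<Sup (snd i)} ~= \<infinity>" for i :: "real \<times> real set"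
      using fmeasurableD2[OF lmeasurable_interval(2)[of "Inf (snd i)" "Sup (snd i)"]] unfolding infinity_ennreal_def .
    qed auto
    also have "... <= measure lebesgue U"
    proof (rule measure_mono_fmeasurable[OF _ _ Um])
     show "(\<Union>i\<in>p1. {Inf (snd i)<..<Sup (snd i)}) \<subseteq> U"
     proof clarify
      fix x K y assume a: "(x, K) : p1" "y : {Inf (snd (x, K))<..<Sup (snd (x, K))}"
      then have "K \<subseteq> ga x" "x : N'" using fine by (auto simp: fine_def p1_def)
      moreover have "y : K"
      proof -
       have "(x, K) : p" using a by (simp add: p1_def)
       from K[OF this] obtain l u where "K = {l..u}" "Sup K = u" "Inf K = l" by blast
       with a show ?thesis by simp
      qed
      ultimately show "y : U" by (auto simp: ga_def)
     qed
    qed (use fin in auto)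
    also note Umeas
    finally show "(\<Sum>i\<in>p1. Sup (snd i) - Inf (snd i)) < dl" .
   qed
   moreover have "norm (sum T p1) <= (\<Sum>t\<in>p1. norm (f (Sup (snd t)) - f (Inf (snd t))))"
    by (rule sum_norm_le) (auto simp: T_def p1_def h'_def norm_minus_commute)
   ultimately have 1: "norm (sum T p1) < e/2" by simp
   have "norm (sum T p2) <= (\<Sum>t\<in>p2. e'*measure lborel (snd t))"
   proof (rule sum_norm_le)
    fix t assume t: "t : p2"
    obtain x K where xK: "t = (x, K)" by (cases t)
    have "(x, K) : p" using t xK by (simp add: p2_def)
    from K[OF this] obtain l u where lu: "K = {l..u}" "c <= l" "l <= x" "x <= u" "u <= d" "x : {c..d}" "Sup K = u" "Inf K = l" "measure lborel K = u - l"
     by blast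
    have "x \<notin> N'" using t xK by (simp add: p2_def)
    then have x: "x : {c..d} - N'" using lu by auto
    have "K \<subseteq> ga x" using fine \<open>(x, K) : p\<close> by (auto simp: fine_def)
    moreover have "ga x = ball x (r x)" using x by (simp add: ga_def)
    ultimately have "K \<subseteq> ball x (r x)" by simp
    moreover have "l : K" "u : K" using lu by auto
    ultimately have "l : ball x (r x)" "u : ball x (r x)" by blast+
    then have "\<bar>l - x\<bar> < r x" "\<bar>u - x\<bar> < r x" by (auto simp: dist_real_def)
    note b = r(2)[OF x this(1)] r(2)[OF x this(2)]
    have "T t = (f l - f x - (l - x) *\<^sub>R h' x) - (f u - f x - (u - x) *\<^sub>R h' x)"
     using lu by (simp add: T_def xK algebra_simps)
    then have "norm (T t) <= e'*\<bar>l - x\<bar> + e'*\<bar>u - x\<bar>"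
     by (simp only:) (rule order_trans[OF norm_triangle_ineq4 add_mono[OF b]])
    also have "... = e'*measure lborel (snd t)" using lu xK by (simp add: algebra_simps)
    finally show "norm (T t) <= e'*measure lborel (snd t)" .
   qed
   also have "... <= (\<Sum>t\<in>p. e'*measure lborel (snd t))"
    using pD(1) \<open>e' > 0\<close> by (intro sum_mono2) (auto simp: p2_def)
   also have "... = e'*(d - c)"
    using additive_content_tagged_division[of p c d] p \<open>c <= d\<close> by (simp add: case_prod_unfold flip: sum_distrib_left)
   also have "... <= e/2" using \<open>e > 0\<close> \<open>c <= d\<close> by (simp add: e'_def field_simps)
   finally have 2: "norm (sum T p2) <= e/2" .
   show ?thesis unfolding eq using 1 2 norm_triangle_ineq[of "sum T p1" "sum T p2"] by linarith
  qed
  with ga show "\<exists>ga. gauge ga & (\<forall>\<D>. \<D> tagged_division_of {c..d} & ga fine \<D> -->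
    norm (sum (%(x,k). measure lborel k *\<^sub>R h' x) \<D> - (f d - f c)) < e)"
   by (intro exI[of _ ga] conjI allI impI) simp_all
 qed
 then show ?thesis by (rule has_integral_spike[OF N', rotated]) (auto simp: h'_def)
qed

text \<open>On an interval S this says that F is locally absolutely continuous with F' = f almost
  everywhere. Stated through integrals it is insensitive to null sets and serves bounded intervals
  and the whole line alike.\<close>

definition primitive_on :: "real set => (real => 'a::euclidean_space) => (real => 'a) => bool" where
 "primitive_on S F f \<longleftrightarrow> (\<forall>x y. x <= y --> {x..y} \<subseteq> S -->
   f abs_int_on {x..y} & integral {x..y} f = F y - F x)"

lemma primitive_onD:
 assumes "primitive_on S F f" "{x..y} \<subseteq> S" "x <= y"
 shows "f abs_int_on {x..y}" "integral {x..y} f = F y - F x"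
  "f integrable_on {x..y}" "(f has_integral (F y - F x)) {x..y}"
proof -
 show a: "f abs_int_on {x..y}" "integral {x..y} f = F y - F x"
  using assms by (auto simp: primitive_on_def)
 show i: "f integrable_on {x..y}" using a(1) by (simp add: abs_int_def)
 show "(f has_integral (F y - F x)) {x..y}" using integrable_integral[OF i] a(2) by simp
qed

lemma primitive_onI:
 assumes "!!x y. x <= y ==> {x..y} \<subseteq> S ==> f abs_int_on {x..y}"
  and "!!x y. x <= y ==> {x..y} \<subseteq> S ==> (f has_integral (F y - F x)) {x..y}"
 shows "primitive_on S F f"
 using assms by (auto simp: primitive_on_def)

lemma primitive_on_subset: "primitive_on S F f ==> T \<subseteq> S ==> primitive_on T F f"
 unfolding primitive_on_def by blast

lemma absolutely_integrable_continuous_mult: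
 fixes f g :: "real => 'a::{euclidean_space, real_normed_algebra}"
 assumes f: "f abs_int_on {c..d}" and G: "continuous_on {c..d} G"
 shows "(%x. f x*G x) abs_int_on {c..d}" "(%x. G x*f x) abs_int_on {c..d}"
proof -
 have m: "G : borel_measurable (lebesgue_on {c..d})"
  by (intro continuous_imp_measurable_on_sets_lebesgue G) auto
 have b: "bounded (G ` {c..d})"
  by (intro compact_imp_bounded compact_continuous_image G) auto
 have bl: "bilinear ((*) :: 'a => 'a => 'a)" "bilinear (%x y :: 'a. y*x)"
  by (auto simp: bilinear_def linear_iff algebra_simps)
 show "(%x. f x*G x) abs_int_on {c..d}"
  using absolutely_integrable_bounded_measurable_product[OF bl(2) m _ b f] by simp
 show "(%x. G x*f x) abs_int_on {c..d}"
  using absolutely_integrable_bounded_measurable_product[OF bl(1) m _ b f] by simp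
qed

lemma primitive_on_ac_on:
 assumes "primitive_on S F f" "{c..d} \<subseteq> S"
 shows "ac_on c d F"
proof (cases "c <= d")
 case True
 show ?thesis
 proof (rule ac_on_indefinite_integral)
  show "f abs_int_on {c..d}" using primitive_onD(1)[OF assms True] .
  show "F y - F x = integral {x..y} f" if "c <= x" "x <= y" "y <= d" for x y
  proof -
   have "{x..y} \<subseteq> S" using assms(2) that by (meson atLeastatMost_subset_iff order_trans)
   then show ?thesis using primitive_onD(2)[OF assms(1) _ that(2)] by simp
  qed
 qed
next
 case False
 have "F y - F x = 0" if "c <= x" "x <= y" "y <= d" for x y using that False by simp
 then show ?thesis using False by (intro ac_on_indefinite_integral[where h = "%_. 0"]) auto
qed

lemma primitive_on_continuous:
 assumes "primitive_on S F f" "{c..d} \<subseteq> S"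
 shows "continuous_on {c..d} F"
 by (rule ac_on_imp_continuous_on[OF primitive_on_ac_on[OF assms]])

lemma primitive_on_continuous_UNIV:
 assumes "primitive_on UNIV F f"
 shows "continuous_on A F"
proof -
 have "isCont F x" for x
 proof -
  have "continuous_on {x-1..x+1} F" by (rule primitive_on_continuous[OF assms]) simp
  then show ?thesis by (rule continuous_on_interior) (simp add: interior_atLeastAtMost_real)
 qed
 then show ?thesis by (simp add: continuous_at_imp_continuous_on)
qed

lemma primitive_on_differentiable_ae:
 assumes "primitive_on S F f" "{c..d} \<subseteq> S" "c <= d"
 shows "negligible {x : {c<..<d}. \<not> (F has_vector_derivative f x) (at x)}"
proof -
 have "(F has_vector_derivative f x) (at x)"
  if x: "x : {c<..<d}" and d: "((%y. integral {c..y} f) has_vector_derivative f x) (at x)" for x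
 proof -
  have "((%y. F c + integral {c..y} f) has_vector_derivative (0 + f x)) (at x)"
   by (intro has_vector_derivative_add has_vector_derivative_const d)
  then have "((%y. F c + integral {c..y} f) has_vector_derivative f x) (at x)" by simp
  then show ?thesis
  proof (rule has_vector_derivative_transform_within_open[where S = "{c<..<d}", unfolded add_0])
   fix y assume "y : {c<..<d}"
   then have y: "c < y & y < d" by simp
   then have "{c..y} \<subseteq> S" using assms(2) by auto
   then show "F c + integral {c..y} f = F y" using primitive_onD(2)[OF assms(1), of c y] y by simp
  qed (use x in auto)
 qed
 then have "{x : {c<..<d}. \<not> (F has_vector_derivative f x) (at x)} \<subseteq>
   {x : {c<..<d}. \<not> ((%y. integral {c..y} f) has_vector_derivative f x) (at x)}" by blast
 then show ?thesis
  by (rule negligible_subset[OF indefinite_integral_differentiable_ae[OF primitive_onD(3)[OF assms]]])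
qed

lemma primitive_on_ac:
 assumes ac: "!!x y. x <= y ==> {x..y} \<subseteq> S ==> ac_on x y F"
  and int: "!!x y. x <= y ==> {x..y} \<subseteq> S ==> f abs_int_on {x..y}"
  and der: "!!x y. x <= y ==> {x..y} \<subseteq> S ==>
   negligible {z : {x<..<y}. \<not> (F has_vector_derivative f z) (at z)}"
 shows "primitive_on S F f"
proof (rule primitive_onI[OF int])
 fix x y :: real assume xy: "x <= y" "{x..y} \<subseteq> S"
 show "(f has_integral (F y - F x)) {x..y}"
  by (rule fundamental_theorem_of_calculus_ac[OF ac[OF xy] xy(1) der[OF xy]]) auto
qed

lemma primitive_on_mult:
 fixes F G :: "real => 'a::{euclidean_space, real_normed_algebra}"
 assumes F: "primitive_on S F f" and G: "primitive_on S G g"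
 shows "primitive_on S (%x. F x*G x) (%x. F x*g x + f x*G x)"
proof (rule primitive_on_ac)
 fix x y :: real assume xy: "x <= y" "{x..y} \<subseteq> S"
 show "ac_on x y (%x. F x*G x)"
  by (intro ac_on_mult primitive_on_ac_on[OF F xy(2)] primitive_on_ac_on[OF G xy(2)])
 show "(%x. F x*g x + f x*G x) abs_int_on {x..y}"
  using primitive_onD(1)[OF F xy(2,1)] primitive_onD(1)[OF G xy(2,1)]
   primitive_on_continuous[OF F xy(2)] primitive_on_continuous[OF G xy(2)]
  by (intro set_integral_add absolutely_integrable_continuous_mult) auto
 have "{z : {x<..<y}. \<not> ((%x. F x*G x) has_vector_derivative F z*g z + f z*G z) (at z)} \<subseteq>
  {z : {x<..<y}. \<not> (F has_vector_derivative f z) (at z)} \<union> {z : {x<..<y}. \<not> (G has_vector_derivative g z) (at z)}"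
  by (auto intro: has_vector_derivative_mult)
 then show "negligible {z : {x<..<y}. \<not> ((%x. F x*G x) has_vector_derivative F z*g z + f z*G z) (at z)}"
  by (rule negligible_subset[rotated])
   (intro negligible_Un primitive_on_differentiable_ae[OF F xy(2,1)] primitive_on_differentiable_ae[OF G xy(2,1)])
qed

text \<open>The exponential is Lipschitz on the bounded range of \<open>c*k\<close>, so absolute
  continuity survives; this is the chain rule that the two Gronwall type estimates use.\<close>

lemma primitive_on_exp:
 fixes k m :: "real => real"
 assumes k: "primitive_on S k m"
 shows "primitive_on S (%x. exp (c*k x)) (%x. m x*(c*exp (c*k x)))"
proof (rule primitive_on_ac)
 fix x y :: real assume xy: "x <= y" "{x..y} \<subseteq> S"
 have kc: "continuous_on {x..y} k" by (rule primitive_on_continuous[OF k xy(2)])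
 have "bounded ((%x. c*k x) ` {x..y})"
  by (intro compact_imp_bounded compact_continuous_image continuous_intros kc) auto
 then obtain B where "\<forall>z\<in>(%x. c*k x) ` {x..y}. norm z <= B"
  unfolding bounded_iff by (elim exE)
 then have B: "!!z. z : {x..y} ==> \<bar>c*k z\<bar> <= B" by auto
 show "ac_on x y (%x. exp (c*k x))"
 proof (rule ac_on_bound[OF primitive_on_ac_on[OF k xy(2)] primitive_on_ac_on[OF k xy(2)]])
  show "0 <= exp B*\<bar>c\<bar>" by simp
  fix u v assume uv: "x <= u" "u <= v" "v <= y"
  have ex: "\<bar>exp s - exp t\<bar> <= exp B*\<bar>s - t\<bar>" if "\<bar>s\<bar> <= B" "\<bar>t\<bar> <= B" for s t :: real
  proof -
   have *: "exp s - exp t <= exp B*(s - t)" if "t <= s" "s <= B" for s t :: real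
   proof -
    have "exp s - exp t = exp s*(1 - exp (t - s))" by (simp add: algebra_simps flip: exp_add)
    also have "... <= exp s*(s - t)" using exp_ge_add_one_self[of "t - s"]
     by (intro mult_left_mono) (linarith, simp)
    also have "... <= exp B*(s - t)" using that by (intro mult_right_mono) auto
    finally show ?thesis .
   qed
   have "s <= B" "t <= B" using that by auto
   then show ?thesis using *[of t s] *[of s t]
    by (cases "t <= s") (simp_all add: abs_of_nonneg abs_of_nonpos)
  qed
  have "norm (exp (c*k v) - exp (c*k u)) <= exp B*\<bar>c*k v - c*k u\<bar>"
   using ex[OF B[of v] B[of u]] uv by simp
  also have "... = exp B*\<bar>c\<bar>*norm (k v - k u)" by (simp add: abs_mult flip: right_diff_distrib)
  also have "... <= exp B*\<bar>c\<bar>*(norm (k v - k u) + norm (k v - k u))" by (intro mult_left_mono) auto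
  finally show "norm (exp (c*k v) - exp (c*k u)) <= exp B*\<bar>c\<bar>*(norm (k v - k u) + norm (k v - k u))" .
 qed
 show "(%x. m x*(c*exp (c*k x))) abs_int_on {x..y}"
  by (intro absolutely_integrable_continuous_mult(1) primitive_onD(1)[OF k xy(2,1)] continuous_intros kc)
 have "{z : {x<..<y}. \<not> ((%x. exp (c*k x)) has_vector_derivative m z*(c*exp (c*k z))) (at z)} \<subseteq>
  {z : {x<..<y}. \<not> (k has_vector_derivative m z) (at z)}"
 proof -
  have "((%x. exp (c*k x)) has_vector_derivative m z*(c*exp (c*k z))) (at z)"
   if "(k has_vector_derivative m z) (at z)" for z
  proof -
  have "(k has_real_derivative m z) (at z)" using that by (simp add: has_real_derivative_iff_has_vector_derivative)
  then have "((%x. exp (c*k x)) has_real_derivative exp (c*k z)*(c*m z)) (at z)"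
   by (auto intro!: derivative_eq_intros)
  then show ?thesis
   by (simp add: has_real_derivative_iff_has_vector_derivative mult_ac)
  qed
  then show ?thesis by blast
 qed
 then show "negligible {z : {x<..<y}. \<not> ((%x. exp (c*k x)) has_vector_derivative m z*(c*exp (c*k z))) (at z)}"
  by (rule negligible_subset[OF primitive_on_differentiable_ae[OF k xy(2,1)]])
qed

lemma primitive_on_add:
 "primitive_on S F f ==> primitive_on S G g ==> primitive_on S (%x. F x + G x) (%x. f x + g x)"
 by (rule primitive_onI)
  (auto intro!: set_integral_add dest: primitive_onD(1), auto dest: has_integral_add[OF primitive_onD(4) primitive_onD(4)] simp: algebra_simps)

lemma primitive_on_diff:
 "primitive_on S F f ==> primitive_on S G g ==> primitive_on S (%x. F x - G x) (%x. f x - g x)"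
 by (rule primitive_onI)
  (auto intro!: set_integral_diff dest: primitive_onD(1), auto dest: has_integral_diff[OF primitive_onD(4) primitive_onD(4)] simp: algebra_simps)

lemma primitive_on_linear:
 assumes "primitive_on S F f" "bounded_linear L"
 shows "primitive_on S (%x. L (F x)) (%x. L (f x))"
proof (rule primitive_onI)
 fix x y :: real assume xy: "x <= y" "{x..y} \<subseteq> S"
 show "(%x. L (f x)) abs_int_on {x..y}"
  using absolutely_integrable_linear[OF primitive_onD(1)[OF assms(1) xy(2,1)] assms(2)] by (simp add: o_def)
 show "((%x. L (f x)) has_integral L (F y) - L (F x)) {x..y}"
  using has_integral_linear[OF primitive_onD(4)[OF assms(1) xy(2,1)] assms(2)] assms(2)
  by (simp add: o_def linear_diff bounded_linear.linear)
qed

lemma primitive_on_const: "primitive_on S (%_. c) (%_. 0)"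
 by (simp add: primitive_on_def)

lemma primitive_on_cmult:
 fixes c :: "'a::{euclidean_space, real_normed_algebra}"
 shows "primitive_on S F f ==> primitive_on S (%x. c*F x) (%x. c*f x)"
 using primitive_on_linear[OF _ bounded_linear_mult_right[of c]] by blast

lemma primitive_on_spike:
 assumes f: "primitive_on S F f" and N: "negligible N" and eq: "!!x. x : S - N ==> g x = f x"
 shows "primitive_on S F g"
proof (rule primitive_onI)
 fix x y :: real assume xy: "x <= y" "{x..y} \<subseteq> S"
 have e: "z : {x..y} - N ==> g z = f z" for z using eq xy by blast
 show "g abs_int_on {x..y}"
  using absolutely_integrable_spike[OF primitive_onD(1)[OF f xy(2,1)] N e] by simp
 show "(g has_integral F y - F x) {x..y}"
  by (rule has_integral_spike[OF N e primitive_onD(4)[OF f xy(2,1)]])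
qed

lemma primitive_on_cong:
 assumes "!!x. x : S ==> F x = G x" "!!x. x : S ==> f x = g x"
 shows "primitive_on S F f \<longleftrightarrow> primitive_on S G g"
proof -
 have "primitive_on S G g" if "primitive_on S F f" "!!x. x : S ==> F x = G x" "!!x. x : S ==> f x = g x" for F G f g
 proof -
  have "primitive_on S F g" by (rule primitive_on_spike[OF that(1) negligible_empty]) (use that(3) in auto)
  moreover have "{x..y} \<subseteq> S ==> x <= y ==> F y - F x = G y - G x" for x y using that(2)[of x] that(2)[of y] by force
  ultimately show ?thesis by (auto simp: primitive_on_def)
 qed
 from this[of F f G g] this[of G g F f] assms show ?thesis by auto
qed

lemma primitive_on_norm_le:
 assumes "primitive_on S F f" "{x..y} \<subseteq> S" "x <= y"
 shows "norm (F y - F x) <= integral {x..y} (%z. norm (f z))"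
 using primitive_onD[OF assms] by (metis abs_int_def integral_norm_bound_integral order_refl)

lemma primitive_on_combine:
 assumes 1: "primitive_on {b..c} F f" and 2: "primitive_on {c..d} F f"
 shows "primitive_on {b..d} F f"
proof (rule primitive_onI)
 fix x y assume xy: "x <= y" "{x..y} \<subseteq> {b..d}"
 consider "y <= c" | "c <= x" | "x < c" "c < y" by linarith
 then have "f abs_int_on {x..y} & (f has_integral F y - F x) {x..y}"
 proof cases
  case 1
  then have "{x..y} \<subseteq> {b..c}" using xy by auto
  then show ?thesis using primitive_onD[OF assms(1) _ xy(1)] by blast
 next
  case 2
  then have "{x..y} \<subseteq> {c..d}" using xy by auto
  then show ?thesis using primitive_onD[OF assms(2) _ xy(1)] by blast
 next
  case 3
  then have s: "{x..c} \<subseteq> {b..c}" "{c..y} \<subseteq> {c..d}" using xy by auto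
  note A = primitive_onD[OF 1 s(1)] primitive_onD[OF 2 s(2)]
  have "f abs_int_on {x..y}"
   using absolutely_integrable_on_combine A 3 by (metis less_imp_le)
  moreover have "(f has_integral (F c - F x) + (F y - F c)) {x..y}"
   by (rule has_integral_combine[of x c y]) (use A 3 in auto)
  ultimately show ?thesis by (simp add: algebra_simps)
 qed
 then show "f abs_int_on {x..y}" "(f has_integral F y - F x) {x..y}" by auto
qed

lemma has_integral_affine:
 fixes f :: "real => 'a::real_normed_vector"
 assumes "m ~= 0" "(f has_integral I) {min (c + m*x) (c + m*y)..max (c + m*x) (c + m*y)}" "x <= y"
 shows "((%z. f (c + m*z)) has_integral (1/\<bar>m\<bar>) *\<^sub>R I) {x..y}"
proof -
 let ?u = "min (c + m*x) (c + m*y)" and ?v = "max (c + m*x) (c + m*y)"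
 have "(%x. (1/m) *\<^sub>R x + - ((1/m) *\<^sub>R c)) ` {?u..?v} = {x..y}"
 proof (cases "m > 0")
  case True
  then have "m*x <= m*y" using assms(3) by simp
  then have "?u = c + m*x" "?v = c + m*y" by auto
  with True assms(3) \<open>m*x <= m*y\<close> show ?thesis
   using image_affinity_atLeastAtMost[of "1/m" "- (c/m)" "c + m*x" "c + m*y"]
   by (simp add: add_divide_distrib)
 next
  case False
  then have "m < 0" using assms(1) by simp
  then have "m*y <= m*x" using assms(3) by simp
  then have "?u = c + m*y" "?v = c + m*x" by auto
  with \<open>m < 0\<close> assms(3) \<open>m*y <= m*x\<close> show ?thesis
   using image_affinity_atLeastAtMost[of "1/m" "- (c/m)" "c + m*y" "c + m*x"]
   by (simp add: add_divide_distrib)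
 qed
 then show ?thesis
  using has_integral_affinity[of f I ?u ?v m c] assms(1,2) by (simp add: add.commute)
qed

lemma absolutely_integrable_affine:
 fixes f :: "real => 'a::euclidean_space"
 assumes "m ~= 0" "f abs_int_on {min (c + m*x) (c + m*y)..max (c + m*x) (c + m*y)}" "x <= y"
 shows "(%z. f (c + m*z)) abs_int_on {x..y}"
 using has_integral_affine[where f = f and x = x and y = y and c = c and m = m]
  has_integral_affine[where f = "%z. norm (f z)" and x = x and y = y and c = c and m = m] assms
 unfolding abs_int_def integrable_on_def by blast

lemma primitive_on_affine:
 assumes F: "primitive_on S F f" and m: "m ~= 0" and sub: "!!x. x : T ==> c + m*x : S"
 shows "primitive_on T (%x. F (c + m*x)) (%x. m *\<^sub>R f (c + m*x))"
proof (rule primitive_onI)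
 fix x y :: real assume xy: "x <= y" "{x..y} \<subseteq> T"
 let ?u = "min (c + m*x) (c + m*y)" and ?v = "max (c + m*x) (c + m*y)"
 have "z : S" if z: "z : {?u..?v}" for z
 proof -
  have "(z - c)/m : {x..y}"
  proof (cases "m > 0")
   case True
   then have "m*x <= m*y" using xy(1) by simp
   then show ?thesis using z True by (auto simp: field_simps)
  next
   case False
   then have "m < 0" using m by simp
   then have "m*y <= m*x" using xy(1) by simp
   then show ?thesis using z \<open>m < 0\<close> by (auto simp: field_simps)
  qed
  then have "c + m*((z - c)/m) : S" using sub xy(2) by blast
  then show ?thesis using m by simp
 qed
 then have uv: "{?u..?v} \<subseteq> S" by blast
 have le: "?u <= ?v" by simp
 note A = primitive_onD[OF F uv le]
 show "(%z. m *\<^sub>R f (c + m*z)) abs_int_on {x..y}"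
  by (intro absolutely_integrable_scaleR_left absolutely_integrable_affine m A(1) xy(1))
 have "((%z. m *\<^sub>R f (c + m*z)) has_integral m *\<^sub>R (1/\<bar>m\<bar>) *\<^sub>R (F ?v - F ?u)) {x..y}"
  by (intro has_integral_cmul has_integral_affine m A(4) xy(1))
 moreover have "m *\<^sub>R (1/\<bar>m\<bar>) *\<^sub>R (F ?v - F ?u) = F (c + m*y) - F (c + m*x)"
 proof (cases "m > 0")
  case True
  then have "m*x <= m*y" using xy(1) by simp
  with True show ?thesis by (simp add: min_def max_def)
 next
  case False
  then have "m < 0" using m by simp
  then have "m*y <= m*x" using xy(1) by simp
  with \<open>m < 0\<close> show ?thesis by (auto simp add: min_def max_def)
 qed
 ultimately show "((%z. m *\<^sub>R f (c + m*z)) has_integral F (c + m*y) - F (c + m*x)) {x..y}" by simp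
qed

lemma primitive_on_shift:
 assumes "primitive_on UNIV F f"
 shows "primitive_on UNIV (%x. F (x + c)) (%x. f (x + c))"
 using primitive_on_affine[OF assms, of 1 UNIV c] by (simp add: add.commute)

section \<open>Initial value problems\<close>

text \<open>One of the two integrals runs over an empty or degenerate interval, so this is the
  oriented integral from c to x.\<close>

definition integral_from :: "real => (real => 'a::euclidean_space) => real => 'a" where
 "integral_from c f x = integral {c..x} f - integral {x..c} f"

lemma integral_from_self [simp]: "integral_from c f c = 0"
 by (simp add: integral_from_def)

lemma integral_from_right: "c <= x ==> integral_from c f x = integral {c..x} f"
 by (cases "c = x") (auto simp: integral_from_def)

lemma integral_from_left: "x <= c ==> integral_from c f x = - integral {x..c} f"
 by (cases "c = x") (auto simp: integral_from_def)

lemma primitive_on_integral_from: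
 assumes f: "!!x y. f abs_int_on {x..y::real}"
 shows "primitive_on UNIV (integral_from c f) f"
proof (rule primitive_onI)
 fix x y :: real assume xy: "x <= y"
 show "f abs_int_on {x..y}" by (rule f)
 have i: "f integrable_on {u..v}" for u v using f[of u v] by (simp add: abs_int_def)
 have c: "integral {u..v} f + integral {v..z} f = integral {u..z} f" if "u <= v" "v <= z" for u v z
  by (rule Henstock_Kurzweil_Integration.integral_combine[OF that i])
 have "integral {x..y} f = integral_from c f y - integral_from c f x"
 proof (cases "c <= x")
  case True
  then show ?thesis using c[of c x y] xy by (simp add: integral_from_right algebra_simps)
 next
  case False
  show ?thesis
  proof (cases "c <= y")
   case True
   then show ?thesis using c[of x c y] False by (simp add: integral_from_right integral_from_left algebra_simps)
  next
   case F: False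
   then show ?thesis using c[of x y c] False xy by (simp add: integral_from_left algebra_simps)
  qed
 qed
 then show "(f has_integral integral_from c f y - integral_from c f x) {x..y}"
  using integrable_integral[OF i[of x y]] by simp
qed

text \<open>Look at the maximum of \<open>exp (- 2*k) * e\<close> with k the primitive of m. The
  weight makes the integral term cost at most half of that maximum, which can then be absorbed; both
  factors 2 stem from this.\<close>

lemma gronwall:
 fixes e m :: "real => real"
 assumes "c <= d" and e: "continuous_on {c..d} e" and m: "m abs_int_on {c..d}"
  and m0: "!!x. 0 <= m x" and "0 <= ep"
  and le: "!!x. x : {c..d} ==> e x <= ep + integral {c..x} (%y. m y*e y)"
  and x: "x : {c..d}"
 shows "e x <= 2*ep*exp (2*integral {c..d} m)"
proof -
 define k where "k y = integral {c..y} m" for y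
 have sub: "m abs_int_on {u..v}" if "c <= u" "v <= d" for u v
  using m that by (meson absolutely_integrable_on_subinterval atLeastatMost_subset_iff)
 have k: "primitive_on {c..d} k m"
 proof (rule primitive_onI)
  fix u v assume uv: "u <= v" "{u..v} \<subseteq> {c..d}"
  then have "c <= u" "v <= d" by auto
  then show "m abs_int_on {u..v}" by (rule sub)
  have "integral {c..u} m + integral {u..v} m = integral {c..v} m"
   using sub[of c v] \<open>c <= u\<close> \<open>v <= d\<close> uv
   by (intro Henstock_Kurzweil_Integration.integral_combine) (auto simp: abs_int_def)
  then show "(m has_integral k v - k u) {u..v}"
   using sub[OF \<open>c <= u\<close> \<open>v <= d\<close>] by (simp add: k_def has_integral_iff abs_int_def)
 qed
 have kc: "continuous_on {c..d} k" by (rule primitive_on_continuous[OF k order_refl])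
 have mono: "k y <= k z" if "c <= y" "y <= z" "z <= d" for y z
 proof -
  have "{y..z} \<subseteq> {c..d}" using that by auto
  note A = primitive_onD[OF k this that(2)]
  have "0 <= integral {y..z} m" by (rule integral_nonneg[OF A(3)]) (use m0 in auto)
  then show ?thesis using A(2) by simp
 qed
 have kc0: "k c = 0" by (simp add: k_def)
 have k0: "0 <= k y" if "y : {c..d}" for y using mono[of c y] that kc0 by simp
 define h where "h y = exp (- 2*k y)*e y" for y
 have "continuous_on {c..d} h" unfolding h_def by (intro continuous_intros kc e)
 then obtain z where z: "z : {c..d}" "!!y. y : {c..d} ==> h y <= h z"
  using continuous_attains_sup[of "{c..d}" h] \<open>c <= d\<close> by auto
 have eh: "e y = exp (2*k y)*h y" for y by (simp add: h_def flip: exp_add mult.assoc)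
 have hz: "h z <= 2*ep"
 proof (cases "h z <= 0")
  case False
  have ex: "primitive_on {c..d} (%x. exp (2*k x)) (%x. m x*(2*exp (2*k x)))"
   by (rule primitive_on_exp[OF k])
  have cz: "{c..z} \<subseteq> {c..d}" "c <= z" using z by auto
  have "e z <= ep + integral {c..z} (%y. m y*e y)" by (rule le[OF z(1)])
  also have "integral {c..z} (%y. m y*e y) <= integral {c..z} (%y. h z/2*(m y*(2*exp (2*k y))))"
  proof (rule integral_le)
   show "(%y. m y*e y) integrable_on {c..z}"
    using absolutely_integrable_continuous_mult(1)[OF sub[of c z] continuous_on_subset[OF e cz(1)]] z
    by (simp add: abs_int_def)
   show "(%y. h z/2*(m y*(2*exp (2*k y)))) integrable_on {c..z}"
    using primitive_onD(3)[OF ex cz] by (rule integrable_on_mult_right)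
   fix y assume "y : {c..z}"
   then have "h y <= h z" using z by auto
   then have "m y*(exp (2*k y)*h y) <= m y*(exp (2*k y)*h z)"
    using m0 by (intro mult_left_mono) auto
   then show "m y*e y <= h z/2*(m y*(2*exp (2*k y)))" unfolding eh by (simp add: mult_ac)
  qed
  also have "... = h z/2*(exp (2*k z) - 1)"
   using primitive_onD(2)[OF ex cz] kc0 by (simp only: integral_mult_right) simp
  finally have "exp (2*k z)*h z <= ep + h z/2*(exp (2*k z) - 1)" unfolding eh by simp
  then have "exp (2*k z)*h z <= 2*ep - h z" by (simp add: algebra_simps)
  moreover have "1*h z <= exp (2*k z)*h z"
   using k0[OF z(1)] False by (intro mult_right_mono) auto
  ultimately show ?thesis using False by linarith
 qed (use \<open>0 <= ep\<close> in linarith)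
 have "e x = exp (2*k x)*h x" by (rule eh)
 also have "... <= exp (2*k x)*(2*ep)" using z(2)[OF x] hz by (intro mult_left_mono) auto
 also have "... <= exp (2*integral {c..d} m)*(2*ep)"
  using mono[of x d] x \<open>0 <= ep\<close> by (intro mult_right_mono) (auto simp: k_def)
 finally show ?thesis by (simp add: mult_ac)
qed

lemma gronwall_two_sided:
 fixes e m :: "real => real"
 assumes e: "continuous_on {c..d} e" and m: "m abs_int_on {c..d}"
  and m0: "!!x. 0 <= m x" and "0 <= ep" and x0: "x0 : {c..d}"
  and le: "!!x. x : {c..d} ==> e x <= ep + integral {min x0 x..max x0 x} (%y. m y*e y)"
  and x: "x : {c..d}"
 shows "e x <= 2*ep*exp (2*integral {c..d} m)"
proof -
 have sub: "m abs_int_on {u..v}" if "c <= u" "v <= d" for u v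
  using m that by (meson absolutely_integrable_on_subinterval atLeastatMost_subset_iff)
 have le2: "integral {u..v} m <= integral {c..d} m" if "c <= u" "v <= d" for u v
  using sub[OF that] m m0 that by (intro integral_subset_le) (auto simp: abs_int_def)
 show ?thesis
 proof (cases "x0 <= x")
  case True
  have "e x <= 2*ep*exp (2*integral {x0..d} m)"
  proof (rule gronwall[where e = e and x = x, OF _ _ sub m0 \<open>0 <= ep\<close>])
   show "continuous_on {x0..d} e" by (rule continuous_on_subset[OF e]) (use x0 in auto)
   show "e y <= ep + integral {x0..y} (%y. m y*e y)" if "y : {x0..d}" for y
    using le[of y] that x0 by (simp add: min_def max_def split: if_splits)
  qed (use x0 x True in auto)
  also have "... <= 2*ep*exp (2*integral {c..d} m)"
   using le2[of x0 d] x0 \<open>0 <= ep\<close> by (intro mult_left_mono) auto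
  finally show ?thesis .
 next
  case False
  have "e (- (-x)) <= 2*ep*exp (2*integral {-x0..-c} (%y. m (-y)))"
  proof (rule gronwall[where x = "-x" and e = "%y. e (-y)" and m = "%y. m (-y)", OF _ _ _ m0 \<open>0 <= ep\<close>])
   have "continuous_on {c..x0} e" by (rule continuous_on_subset[OF e]) (use x0 in auto)
   then show "continuous_on {- x0..- c} (%y. e (- y))"
    by (rule continuous_on_compose2) (auto intro!: continuous_intros)
   show "(%y. m (- y)) abs_int_on {- x0..- c}"
    using sub[of c x0] x0 by simp
   fix y assume y: "y : {- x0..- c}"
   then have "min x0 (-y) = -y" "max x0 (-y) = x0" by auto
   then have "e (-y) <= ep + integral {-y..x0} (%y. m y*e y)"
    using le[of "-y"] y x0 by auto
   then show "e (-y) <= ep + integral {- x0..y} (%y. m (- y)*e (- y))"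
    using Henstock_Kurzweil_Integration.integral_reflect_real[of x0 "-y" "%y. m y*e y"] by simp
  qed (use x0 x False in auto)
  also have "integral {-x0..-c} (%y. m (-y)) = integral {c..x0} m" by simp
  also have "2*ep*exp (2*...) <= 2*ep*exp (2*integral {c..d} m)"
   using le2[of c x0] x0 \<open>0 <= ep\<close> by (intro mult_left_mono) auto
  finally show ?thesis by simp
 qed
qed

text \<open>Integrability is required on every compact interval;
  \<open>periodic_absolutely_integrable\<close> supplies it from one period. The locale is
  instantiated again with translated coefficients, to move the period cell, and with
  \<open>- w\<close>, to reach the negative half-line.\<close>

locale sturm_liouville =
 fixes a :: real and w p q :: "real => real"
 assumes a_pos: "0 < a"
  and w_per: "w (x + a) = w x" and p_per: "p (x + a) = p x" and q_per: "q (x + a) = q x"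
  and w_meas: "w : borel_measurable lebesgue" and p_meas: "p : borel_measurable lebesgue"
  and w_int: "w abs_int_on {c..d}"
  and q_int: "q abs_int_on {c..d}"
  and ip_int: "(%x. inverse (p x)) abs_int_on {c..d}"
  and w_nz: "negligible {x. w x = 0}"
  and p_pos: "negligible {x. p x <= 0}"
begin

text \<open>\<open>v\<close> is the quasi-derivative \<open>p f'\<close>, and \<open>- v' + q f = s\<close>.\<close>

definition sol :: "real set => (real => complex) => (real => complex) => (real => complex) => bool" where
 "sol S s f v \<longleftrightarrow> primitive_on S f (%x. v x/cx (p x)) \<and>
   primitive_on S v (%x. cx (q x)*f x - s x)"

lemma sol_subset: "sol S s f v ==> T \<subseteq> S ==> sol T s f v"
 unfolding sol_def by (blast intro: primitive_on_subset)

lemma sol_continuous: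
 assumes "sol S s f v" "{c..d} \<subseteq> S"
 shows "continuous_on {c..d} f" "continuous_on {c..d} v"
 using assms primitive_on_continuous unfolding sol_def by blast+

lemma sol_continuous_UNIV:
 assumes "sol UNIV s f v"
 shows "continuous_on A f" "continuous_on A v"
 using assms primitive_on_continuous_UNIV unfolding sol_def by blast+

lemma of_real_absolutely_integrable:
 "f abs_int_on S ==> (%x. cx (f x)) abs_int_on S"
 using absolutely_integrable_linear[OF _ bounded_linear_of_real] by (simp add: o_def)

lemma coeff_mult_int:
 assumes "continuous_on {c..d} f"
 shows "(%x. f x/cx (p x)) abs_int_on {c..d}"
  "(%x. cx (q x)*f x) abs_int_on {c..d}"
  "(%x. cx (w x)*f x) abs_int_on {c..d}"
 using absolutely_integrable_continuous_mult(1)[OF of_real_absolutely_integrable[OF ip_int] assms]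
  absolutely_integrable_continuous_mult(1)[OF of_real_absolutely_integrable[OF q_int] assms]
  absolutely_integrable_continuous_mult(1)[OF of_real_absolutely_integrable[OF w_int] assms]
 by (simp_all add: divide_inverse mult.commute)

lemma sol_source_int:
 assumes "sol S s f v" "{c..d} \<subseteq> S" "c <= d"
 shows "s abs_int_on {c..d}"
proof -
 have "primitive_on S v (%x. cx (q x)*f x - s x)" using assms(1) by (simp add: sol_def)
 note A = primitive_onD(1)[OF this assms(2,3)]
 have "(%x. cx (q x)*f x - (q x*f x - s x)) abs_int_on {c..d}"
  by (intro set_integral_diff(1) coeff_mult_int(2) A sol_continuous(1)[OF assms(1,2)])
 then show ?thesis by simp
qed

lemma solI:
 assumes "primitive_on S f F'" "primitive_on S v V'"
  "!!x. x : S ==> F' x = v x/cx (p x)"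
  "!!x. x : S ==> V' x = cx (q x)*f x - s x"
 shows "sol S s f v"
proof -
 have "primitive_on S f F' \<longleftrightarrow> primitive_on S f (%x. v x/cx (p x))"
  by (rule primitive_on_cong) (use assms in auto)
 moreover have "primitive_on S v V' \<longleftrightarrow> primitive_on S v (%x. cx (q x)*f x - s x)"
  by (rule primitive_on_cong) (use assms in auto)
 ultimately show ?thesis using assms(1,2) by (simp add: sol_def)
qed

lemma solD:
 assumes "sol S s f v"
 shows "primitive_on S f (%x. v x/cx (p x))"
  "primitive_on S v (%x. cx (q x)*f x - s x)"
 using assms by (auto simp: sol_def)

lemma sol_add:
 assumes "sol S s f v" "sol S s' f' v'"
 shows "sol S (%x. s x + s' x) (%x. f x + f' x) (%x. v x + v' x)"
 by (rule solI[OF primitive_on_add[OF solD(1)[OF assms(1)] solD(1)[OF assms(2)]]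
    primitive_on_add[OF solD(2)[OF assms(1)] solD(2)[OF assms(2)]]])
  (simp_all add: add_divide_distrib algebra_simps)

lemma sol_cmult:
 assumes "sol S s f v"
 shows "sol S (%x. c * s x) (%x. c*f x) (%x. c * v x)"
 by (rule solI[OF primitive_on_cmult[OF solD(1)[OF assms]] primitive_on_cmult[OF solD(2)[OF assms]]])
  (simp_all add: algebra_simps)

lemma sol_diff:
 assumes "sol S s f v" "sol S s' f' v'"
 shows "sol S (%x. s x - s' x) (%x. f x - f' x) (%x. v x - v' x)"
 using sol_add[OF assms(1) sol_cmult[OF assms(2), of "-1"]] by simp

lemma sol_zero: "sol S (%_. 0) (%_. 0) (%_. 0)"
 by (simp add: sol_def primitive_on_const)

lemma sol_sum:
 assumes "finite I" "!!i. i : I ==> sol S (s i) (f i) (v i)"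
 shows "sol S (%x. \<Sum>i\<in>I. s i x) (%x. \<Sum>i\<in>I. f i x) (%x. \<Sum>i\<in>I. v i x)"
 using assms by (induction rule: finite_induct) (auto intro: sol_zero sol_add)

lemma sol_cnj:
 assumes "sol S s f v"
 shows "sol S (%x. cnj (s x)) (%x. cnj (f x)) (%x. cnj (v x))"
 by (rule solI[OF primitive_on_linear[OF solD(1)[OF assms] bounded_linear_cnj]
    primitive_on_linear[OF solD(2)[OF assms] bounded_linear_cnj]]) simp_all

lemma sol_shift:
 assumes "sol UNIV s f v"
 shows "sol UNIV (%x. s (x + a)) (%x. f (x + a)) (%x. v (x + a))"
 by (rule solI[OF primitive_on_shift[OF solD(1)[OF assms]] primitive_on_shift[OF solD(2)[OF assms]]])
  (simp_all add: p_per q_per)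

lemma sol_cong:
 assumes "sol S s f v" "!!x. x : S ==> s' x = s x" "!!x. x : S ==> f' x = f x" "!!x. x : S ==> v' x = v x"
 shows "sol S s' f' v'"
proof (rule solI)
 show "primitive_on S f' (%x. v x/cx (p x))"
  using solD(1)[OF assms(1)] primitive_on_cong[of S f f'] assms(3) by metis
 show "primitive_on S v' (%x. cx (q x)*f x - s x)"
  using solD(2)[OF assms(1)] primitive_on_cong[of S v v'] assms(4) by metis
qed (use assms in auto)

lemma sol_spike:
 assumes "sol S s f v" "negligible N" "!!x. x : S - N ==> s' x = s x"
 shows "sol S s' f v"
proof -
 have "primitive_on S v (%x. cx (q x)*f x - s' x)"
  by (rule primitive_on_spike[OF solD(2)[OF assms(1)] assms(2)]) (simp add: assms(3))
 then show ?thesis using assms(1) by (simp add: sol_def)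
qed

text \<open>Lagrange's identity: the terms with q and with 1/p cancel. The expression is bilinear;
  conjugates enter through \<open>sol_cnj\<close>.\<close>

lemma sol_wronskian:
 assumes 1: "sol S s f v" and 2: "sol S s' g u"
 shows "primitive_on S (%x. f x*u x - v x*g x) (%x. s x*g x - f x * s' x)"
proof -
 have "primitive_on S (%x. f x*u x - v x*g x)
   (%x. (f x*(cx (q x)*g x - s' x) + v x/cx (p x)*u x)
    - (v x*(u x/cx (p x)) + (cx (q x)*f x - s x)*g x))"
  by (intro primitive_on_diff primitive_on_mult solD(1)[OF 1] solD(2)[OF 1] solD(1)[OF 2] solD(2)[OF 2])
 then show ?thesis by (rule primitive_on_cong[THEN iffD1, rotated -1]) (simp_all add: algebra_simps)
qed

abbreviation wsol :: "(real => complex) => (real => complex) => (real => complex) => bool" where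
 "wsol g == sol {0..a} (%x. cx (w x)*g x)"

text \<open>Here g is the image of f under the differential expression and S any bound of f, so that
  suprema need not be formed.\<close>

abbreviation bounded_sol :: "(real => complex) => (real => complex) => (real => complex) => real => bool => bool" where
 "bounded_sol f v g S P == wsol g f v --> continuous_on {0..a} g --> (\<forall>x\<in>{0..a}. cmod (f x) <= S) --> P"

abbreviation eigsol :: "real set => complex => (real => complex) => (real => complex) => bool" where
 "eigsol S z f v \<equiv> sol S (%x. z*cx (w x)*f x) f v"

text \<open>With Z a bound of the spectral parameter this is one Gronwall weight for a whole disc of
  parameters.\<close>

definition coeff_bound :: "real => real => real" where
 "coeff_bound Z x = \<bar>inverse (p x)\<bar> + \<bar>q x\<bar> + Z*\<bar>w x\<bar>"

lemma coeff_bound_int: "coeff_bound Z abs_int_on {c..d}"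
 unfolding coeff_bound_def
 using absolutely_integrable_abs[OF ip_int] absolutely_integrable_abs[OF q_int] absolutely_integrable_abs[OF w_int]
 by (intro set_integral_add set_integral_mult_right) (auto simp: o_def)

lemma coeff_bound_nonneg: "0 <= Z ==> 0 <= coeff_bound Z x"
 by (simp add: coeff_bound_def)

text \<open>Gronwall's inequality for the sum of |f| and |v|, with a perturbation r of the
  eigenvalue equation. As the constant depends on z only through Z, it serves for uniqueness,
  continuous dependence and compactness.\<close>

lemma sol_bound:
 fixes f v r :: "real => complex" and z :: complex
 assumes f: "sol {c..d} (%x. z*cx (w x)*f x + r x) f v" and x0: "x0 : {c..d}" and x: "x : {c..d}"
  and Z: "cmod z <= Z"
 shows "cmod (f x) + cmod (v x) <=
  2*(cmod (f x0) + cmod (v x0) + integral {c..d} (%x. cmod (r x)))*exp (2*integral {c..d} (coeff_bound Z))"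
proof -
 have cd: "c <= d" using x0 by auto
 have Z0: "0 <= Z" using Z norm_ge_zero order_trans by blast
 have fc: "continuous_on {c..d} f" "continuous_on {c..d} v" using sol_continuous[OF f order_refl] .
 have wfi: "(%x. z*(w x*f x)) abs_int_on {c..d}"
  by (intro set_integrable_mult_right coeff_mult_int fc)
 have ri: "r abs_int_on {c..d}"
  using set_integral_diff(1)[OF sol_source_int[OF f order_refl cd] wfi] by (simp add: mult.assoc)
 have nri: "(%x. cmod (r x)) integrable_on {u..v}" if "c <= u" "v <= d" for u v
  using absolutely_integrable_on_subinterval[OF ri, of u v] that by (auto simp: abs_int_def)
 define e where "e x = cmod (f x) + cmod (v x)" for x
 have ec: "continuous_on {c..d} e" unfolding e_def by (intro continuous_intros fc)
 have mei: "(%y. coeff_bound Z y*e y) integrable_on {u..v}" if "c <= u" "v <= d" for u v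
  using absolutely_integrable_continuous_mult(1)[OF coeff_bound_int continuous_on_subset[OF ec, of "{u..v}"]] that
  by (auto simp: abs_int_def)
 define ep where "ep = cmod (f x0) + cmod (v x0) + integral {c..d} (%x. cmod (r x))"
 have "e x <= 2*ep*exp (2*integral {c..d} (coeff_bound Z))"
 proof (rule gronwall_two_sided[where e = e and x = x, OF ec coeff_bound_int coeff_bound_nonneg[OF Z0] _ x0 _ x])
  show "0 <= ep" unfolding ep_def by (intro add_nonneg_nonneg integral_nonneg nri) auto
  fix y assume y: "y : {c..d}"
  let ?u = "min x0 y" and ?v = "max x0 y"
  have uv: "c <= ?u" "?v <= d" "?u <= ?v" "{?u..?v} \<subseteq> {c..d}" using x0 y by auto
  have pf: "primitive_on {c..d} f (%x. v x/cx (p x))"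
   "primitive_on {c..d} v (%x. cx (q x)*f x - (z*cx (w x)*f x + r x))"
   using solD[OF f] .
  note F = primitive_onD[OF pf(1) uv(4,3)] and V = primitive_onD[OF pf(2) uv(4,3)]
  have "e y <= cmod (f x0) + cmod (v x0) + (cmod (f ?v - f ?u) + cmod (v ?v - v ?u))"
   unfolding e_def by (auto simp: min_def max_def norm_minus_commute
     intro: order_trans[OF add_mono[OF norm_triangle_sub[of "f y" "f x0"] norm_triangle_sub[of "v y" "v x0"]]])
  also have "cmod (f ?v - f ?u) + cmod (v ?v - v ?u) <=
    integral {?u..?v} (%x. cmod (v x/p x)) + integral {?u..?v} (%x. cmod (q x*f x - (z*w x*f x + r x)))"
   by (intro add_mono primitive_on_norm_le[OF pf(1) uv(4,3)] primitive_on_norm_le[OF pf(2) uv(4,3)])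
  also have "... = integral {?u..?v} (%x. cmod (v x/p x) + cmod (q x*f x - (z*w x*f x + r x)))"
   using F(1) V(1) by (intro Henstock_Kurzweil_Integration.integral_add[symmetric]) (auto simp: abs_int_def)
  also have "... <= integral {?u..?v} (%y. coeff_bound Z y*e y + cmod (r y))"
  proof (rule integral_le)
   show "(%x. cmod (v x/p x) + cmod (q x*f x - (z*w x*f x + r x))) integrable_on {?u..?v}"
    using F(1) V(1) by (intro integrable_add) (auto simp: abs_int_def)
   show "(%y. coeff_bound Z y*e y + cmod (r y)) integrable_on {?u..?v}"
    by (intro integrable_add mei nri uv)
   fix x
   have "cmod (v x/p x) = \<bar>inverse (p x)\<bar>*cmod (v x)" by (simp add: norm_divide divide_inverse norm_mult norm_inverse)
   moreover have "cmod (q x*f x - (z*w x*f x + r x)) <= \<bar>q x\<bar>*cmod (f x) + cmod z*\<bar>w x\<bar>*cmod (f x) + cmod (r x)"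
    using norm_triangle_ineq4[of "q x*f x" "z*w x*f x + r x"] norm_triangle_ineq[of "z*w x*f x" "r x"]
    by (simp add: norm_mult)
   moreover have "cmod z*\<bar>w x\<bar>*cmod (f x) <= Z*\<bar>w x\<bar>*cmod (f x)"
    using Z by (intro mult_right_mono) auto
   moreover have "coeff_bound Z x*e x = \<bar>inverse (p x)\<bar>*cmod (v x) + \<bar>q x\<bar>*cmod (f x) + Z*\<bar>w x\<bar>*cmod (f x)
     + (\<bar>inverse (p x)\<bar>*cmod (f x) + \<bar>q x\<bar>*cmod (v x) + Z*\<bar>w x\<bar>*cmod (v x))"
    by (simp add: coeff_bound_def e_def algebra_simps)
   moreover have "0 <= \<bar>inverse (p x)\<bar>*cmod (f x) + \<bar>q x\<bar>*cmod (v x) + Z*\<bar>w x\<bar>*cmod (v x)"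
    using Z0 by simp
   ultimately show "cmod (v x/p x) + cmod (q x*f x - (z*w x*f x + r x)) <= coeff_bound Z x*e x + cmod (r x)"
    by linarith
  qed
  also have "... = integral {?u..?v} (%y. coeff_bound Z y*e y) + integral {?u..?v} (%y. cmod (r y))"
   by (intro Henstock_Kurzweil_Integration.integral_add mei nri uv)
  also have "integral {?u..?v} (%y. cmod (r y)) <= integral {c..d} (%y. cmod (r y))"
   by (intro integral_subset_le nri uv) auto
  finally show "e y <= ep + integral {?u..?v} (%y. coeff_bound Z y*e y)" unfolding ep_def by simp
 qed
 then show ?thesis by (simp add: e_def ep_def)
qed

lemma sol_unique:
 assumes 1: "eigsol UNIV z f v" and 2: "eigsol UNIV z g u"
  and eq: "f x0 = g x0" "v x0 = u x0"
 shows "f = g" "v = u"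
proof -
 have d: "sol UNIV (%x. z*cx (w x)*(f x - g x) + 0) (%x. f x - g x) (%x. v x - u x)"
  using sol_diff[OF 1 2] by (simp add: algebra_simps)
 have le: "cmod (f x - g x) + cmod (v x - u x) <= 0" for x
  using sol_bound[OF sol_subset[OF d subset_UNIV], of x0 "min x x0" "max x x0" x "cmod z"] eq by simp
 have "cmod (f x - g x) = 0 & cmod (v x - u x) = 0" for x
  using le[of x] norm_ge_zero[of "f x - g x"] norm_ge_zero[of "v x - u x"] by linarith
 then show "f = g" "v = u" by auto
qed

text \<open>\<open>m * exp (4*|M|)\<close> has the primitive \<open>exp (4*|M|)/4\<close> up to sign
  on either side of 0, and this 1/4 is the gain. The auxiliary c = 1 or -1 is the sign of M on the
  half-line considered.\<close>

lemma integral_from_exp_bound: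
 fixes h :: "real => complex"
 assumes hi: "!!x y. h abs_int_on {x..y}" and m0: "!!x. 0 <= m x"
  and M: "primitive_on UNIV M m" "M 0 = 0"
  and le: "!!y. cmod (h y) <= m y*(exp (4*\<bar>M y\<bar>)*B)" and B: "0 <= B"
 shows "cmod (integral_from 0 h x) <= B/4*exp (4*\<bar>M x\<bar>)"
proof -
 have mono: "M x <= M y" if "x <= y" for x y
 proof -
  note A = primitive_onD[OF M(1) subset_UNIV that]
  have "0 <= integral {x..y} m" by (rule integral_nonneg[OF A(3)]) (use m0 in auto)
  then show ?thesis using A(2) by simp
 qed
 have hn: "(%x. cmod (h x)) integrable_on {x..y}" "h integrable_on {x..y}" for x y
  using hi by (auto simp: abs_int_def)
 have key: "integral {x..y} (%z. cmod (h z)) <= B/(4*c)*(exp (4*c*M y) - exp (4*c*M x))"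
  if "x <= y" "c ~= 0" "!!z. z : {x..y} ==> \<bar>M z\<bar> = c*M z" for x y c
 proof -
  have ex: "primitive_on UNIV (%x. exp (4*c*M x)) (%x. m x*((4*c)*exp ((4*c)*M x)))"
   by (rule primitive_on_exp[OF M(1)])
  note A = primitive_onD[OF ex subset_UNIV that(1)]
  have "integral {x..y} (%z. cmod (h z)) <= integral {x..y} (%z. B/(4*c)*(m z*((4*c)*exp ((4*c)*M z))))"
  proof (rule integral_le[OF hn(1)])
   show "(%z. B/(4*c)*(m z*((4*c)*exp ((4*c)*M z)))) integrable_on {x..y}"
    by (rule integrable_on_mult_right[OF A(3)])
   show "cmod (h z) <= B/(4*c)*(m z*((4*c)*exp ((4*c)*M z)))" if "z : {x..y}" for z
    using le[of z] that(1) \<open>z : {x..y} ==> \<bar>M z\<bar> = c*M z\<close> \<open>c ~= 0\<close> by (simp add: mult_ac)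
  qed
  also have "... = B/(4*c)*(exp (4*c*M y) - exp (4*c*M x))"
   by (subst integral_mult_right) (simp add: A(2))
  finally show ?thesis .
 qed
 show ?thesis
  proof (cases "0 <= x")
   case T: True
   have "cmod (integral {0..x} h) <= integral {0..x} (%z. cmod (h z))"
    by (rule integral_norm_bound_integral[OF hn(2,1)]) simp
   also have "... <= B/(4*1)*(exp (4*1*M x) - exp (4*1*M 0))"
    using mono[of 0] M(2) by (intro key T) auto
   also have "... <= B/4*exp (4*\<bar>M x\<bar>)"
    using mono[of 0 x] M(2) T B by (simp add: field_simps)
   finally show ?thesis using T by (simp add: integral_from_right)
  next
   case F: False
   then have xl: "x <= 0" by simp
   have "cmod (integral {x..0} h) <= integral {x..0} (%z. cmod (h z))"
    by (rule integral_norm_bound_integral[OF hn(2,1)]) simp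
   also have "... <= B/(4*- 1)*(exp (4*- 1*M 0) - exp (4*- 1*M x))"
    using mono[of _ 0] M(2) by (intro key xl) auto
   also have "... <= B/4*exp (4*\<bar>M x\<bar>)"
    using mono[of x 0] M(2) xl B by (simp add: field_simps)
   finally show ?thesis using xl by (simp add: integral_from_left)
  qed
qed

text \<open>Picard iteration on the whole line in an exponentially weighted norm. A bounded
  continuous Z stands for the pair (f, v) divided by the weight E, so Banach's theorem applies in
  the space of bounded continuous functions.\<close>

lemma ivp_exists:
 "\<exists>f v. eigsol UNIV z f v & f 0 = c0 & v 0 = c1"
proof -
 define m where "m = coeff_bound (cmod z)"
 define M where "M = integral_from 0 m"
 have M: "primitive_on UNIV M m" "M 0 = 0"
  unfolding M_def m_def by (auto intro: primitive_on_integral_from coeff_bound_int)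
 have m0: "0 <= m x" for x unfolding m_def by (simp add: coeff_bound_nonneg)
 \<comment> \<open>With the exponent 4 each of the two components is Lipschitz with constant 1/4,
   hence the pair with 1/2.\<close>
 define E where "E x = exp (4*\<bar>M x\<bar>)" for x
 have Ec: "continuous_on A E" for A unfolding E_def by (intro continuous_intros primitive_on_continuous_UNIV[OF M(1)])
 have E1: "1 <= E x" for x by (simp add: E_def)
 define f where "f Z x = cx (E x)*fst (apply_bcontfun Z x)" for Z :: "real \<Rightarrow>\<^sub>C (complex \<times> complex)" and x
 define v where "v Z x = cx (E x) * snd (apply_bcontfun Z x)" for Z :: "real \<Rightarrow>\<^sub>C (complex \<times> complex)" and x
 define h1 where "h1 Z x = v Z x/cx (p x)" for Z x
 define h2 where "h2 Z x = cx (q x)*f Z x - z*cx (w x)*f Z x" for Z x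
 define F where "F Z x = c0 + integral_from 0 (h1 Z) x" for Z x
 define V where "V Z x = c1 + integral_from 0 (h2 Z) x" for Z x
 define T where "T Z x = (F Z x/cx (E x), V Z x/cx (E x))" for Z x
 have fc: "continuous_on A (f Z)" "continuous_on A (v Z)" for A Z
  unfolding f_def v_def by (intro continuous_intros Ec continuous_on_apply_bcontfun)+
 have hi: "h1 Z abs_int_on {x..y}" "h2 Z abs_int_on {x..y}" for Z x y
  unfolding h1_def[abs_def] h2_def[abs_def] mult.assoc
  by (intro set_integral_diff(1) set_integrable_mult_right coeff_mult_int fc)+
 have pF: "primitive_on UNIV (F Z) (h1 Z)" "primitive_on UNIV (V Z) (h2 Z)" for Z
  unfolding F_def[abs_def] V_def[abs_def]
  using primitive_on_add[OF primitive_on_const[of UNIV c0] primitive_on_integral_from[where c = 0, OF hi(1)]]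
   primitive_on_add[OF primitive_on_const[of UNIV c1] primitive_on_integral_from[where c = 0, OF hi(2)]] by simp_all
 have hd: "cmod (h1 Z y - h1 Y y) <= m y*(E y*dist Z Y)"
  "cmod (h2 Z y - h2 Y y) <= m y*(E y*dist Z Y)" for Z Y y
 proof -
  have d: "dist (fst (apply_bcontfun Z y)) (fst (apply_bcontfun Y y)) <= dist Z Y"
   "dist (snd (apply_bcontfun Z y)) (snd (apply_bcontfun Y y)) <= dist Z Y"
   by (rule order_trans[OF dist_fst_le dist_bounded], rule order_trans[OF dist_snd_le dist_bounded])
  have E0: "0 <= E y" using E1[of y] by simp
  have "cmod (h1 Z y - h1 Y y) = \<bar>inverse (p y)\<bar>*(E y*dist (snd (apply_bcontfun Z y)) (snd (apply_bcontfun Y y)))"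
   using E0 by (simp add: h1_def v_def dist_norm norm_mult norm_divide divide_inverse norm_inverse flip: left_diff_distrib right_diff_distrib)
  also have "... <= m y*(E y*dist Z Y)"
   using d E0 by (intro mult_mono mult_left_mono) (auto simp: m_def coeff_bound_def)
  finally show "cmod (h1 Z y - h1 Y y) <= m y*(E y*dist Z Y)" .
  have "h2 Z y - h2 Y y = (cx (q y) - z*cx (w y))*(cx (E y)*(fst (apply_bcontfun Z y) - fst (apply_bcontfun Y y)))"
   by (simp add: h2_def f_def algebra_simps)
  then have "cmod (h2 Z y - h2 Y y) = cmod (cx (q y) - z*cx (w y))*(E y*dist (fst (apply_bcontfun Z y)) (fst (apply_bcontfun Y y)))"
   using E0 by (simp add: norm_mult dist_norm)
  also have "... <= m y*(E y*dist Z Y)"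
  proof (intro mult_mono mult_left_mono)
   show "cmod (cx (q y) - z*cx (w y)) <= m y"
    using norm_triangle_ineq4[of "cx (q y)" "z*cx (w y)"]
     abs_ge_zero[of "inverse (p y)"]
    unfolding m_def coeff_bound_def norm_mult norm_of_real by linarith
  qed (use d E0 m0 in auto)
  finally show "cmod (h2 Z y - h2 Y y) <= m y*(E y*dist Z Y)" .
 qed
 have Fd: "cmod (F Z x - F Y x) <= dist Z Y/4*E x" "cmod (V Z x - V Y x) <= dist Z Y/4*E x" for Z Y x
 proof -
  have "F Z x - F Y x = integral_from 0 (%y. h1 Z y - h1 Y y) x" "V Z x - V Y x = integral_from 0 (%y. h2 Z y - h2 Y y) x"
   using hi by (auto simp: F_def V_def integral_from_def Henstock_Kurzweil_Integration.integral_diff abs_int_def)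
  moreover have "cmod (integral_from 0 (%y. h1 Z y - h1 Y y) x) <= dist Z Y/4*exp (4*\<bar>M x\<bar>)"
   by (rule integral_from_exp_bound[OF _ m0 M]) (use hd in \<open>auto simp: E_def intro!: set_integral_diff hi\<close>)
  moreover have "cmod (integral_from 0 (%y. h2 Z y - h2 Y y) x) <= dist Z Y/4*exp (4*\<bar>M x\<bar>)"
   by (rule integral_from_exp_bound[OF _ m0 M]) (use hd in \<open>auto simp: E_def intro!: set_integral_diff hi\<close>)
  ultimately show "cmod (F Z x - F Y x) <= dist Z Y/4*E x" "cmod (V Z x - V Y x) <= dist Z Y/4*E x"
   by (simp_all add: E_def)
 qed
 have Td: "dist (T Z x) (T Y x) <= 1/2*dist Z Y" for Z Y x
 proof -
  have "dist (T Z x) (T Y x) <= dist (fst (T Z x)) (fst (T Y x)) + dist (snd (T Z x)) (snd (T Y x))"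
   by (simp add: dist_prod_def sqrt_sum_squares_le_sum)
  also have "dist (fst (T Z x)) (fst (T Y x)) = cmod (F Z x - F Y x)/E x"
   using E1[of x] by (simp add: T_def dist_norm norm_divide flip: diff_divide_distrib)
  also have "dist (snd (T Z x)) (snd (T Y x)) = cmod (V Z x - V Y x)/E x"
   using E1[of x] by (simp add: T_def dist_norm norm_divide flip: diff_divide_distrib)
  also have "cmod (F Z x - F Y x)/E x + cmod (V Z x - V Y x)/E x <= dist Z Y/4 + dist Z Y/4"
   using Fd E1[of x] by (intro add_mono) (auto simp: divide_le_eq)
  finally show ?thesis by simp
 qed
 have z0: "h1 0 = (%_. 0)" "h2 0 = (%_. 0)" by (auto simp: h1_def h2_def f_def v_def)
 have T0: "norm (T 0 x) <= cmod c0 + cmod c1" for x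
 proof -
  have "T 0 x = (c0/E x, c1/E x)" unfolding T_def F_def V_def z0 by (simp add: integral_from_def)
  then have "norm (T 0 x) <= cmod (c0/E x) + cmod (c1/E x)" by (simp add: norm_prod_def sqrt_sum_squares_le_sum)
  also have "... <= cmod c0 + cmod c1"
   using E1[of x] by (intro add_mono) (auto simp: norm_divide divide_le_eq mult_le_cancel_left1 intro: order_trans)
  finally show ?thesis .
 qed
 have Tb: "T Z : bcontfun" for Z
 proof (rule bcontfun_normI)
  have E0: "cx (E x) ~= 0" for x using E1[of x] by simp
  show "continuous_on UNIV (T Z)"
   unfolding T_def using E0
   by (intro continuous_intros primitive_on_continuous_UNIV[OF pF(1)] primitive_on_continuous_UNIV[OF pF(2)] Ec) auto
  show "norm (T Z x) <= cmod c0 + cmod c1 + 1/2*dist Z 0" for x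
   using norm_triangle_ineq[of "T 0 x" "T Z x - T 0 x"] T0[of x] Td[of Z x 0] by (simp add: dist_norm)
 qed
 have app: "apply_bcontfun (Bcontfun (T Z)) = T Z" for Z using Tb by (simp add: Bcontfun_inverse)
 have "\<exists>!Z. Bcontfun (T Z) = Z"
 proof (rule banach_fix_type[of "1/2"])
  show "\<forall>Z Y. dist (Bcontfun (T Z)) (Bcontfun (T Y)) <= 1/2*dist Z Y"
   by (intro allI dist_bound) (simp only: app Td)
 qed auto
 then obtain Z where "Bcontfun (T Z) = Z" by blast
 then have "apply_bcontfun Z = T Z" using app[of Z] by simp
 then have fF: "f Z x = F Z x" "v Z x = V Z x" for x
  using E1[of x] by (auto simp: f_def v_def T_def)
 have "eigsol UNIV z (f Z) (v Z)"
 proof (rule solI)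
  show "primitive_on UNIV (f Z) (h1 Z)" "primitive_on UNIV (v Z) (h2 Z)"
   using pF[of Z] fF by (metis ext)+
 qed (simp_all add: h1_def h2_def)
 moreover have "f Z 0 = c0" "v Z 0 = c1" using fF[of 0] by (simp_all add: F_def V_def)
 ultimately show ?thesis by blast
qed

end

lemma two_mult_le_weighted_squares:
 fixes x y s :: real
 assumes "0 < s"
 shows "2*(x*y) <= s*x^2 + y^2/s"
proof -
 have "0 <= (s*x - y)^2/s" using assms by simp
 also have "... = s*x^2 + y^2/s - 2*(x*y)"
  using assms by (simp add: power2_eq_square field_simps)
 finally show ?thesis by simp
qed

text \<open>The optimal parameter is \<open>sqrt B / sqrt A\<close>; if A or B vanishes, a large or
  a small s excludes a positive I.\<close>

lemma le_sqrt_mult_sqrtI: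
 fixes A B I :: real
 assumes "0 <= A" "0 <= B" and le: "!!s. 0 < s ==> 2*I <= s*A + B/s"
 shows "I <= sqrt A * sqrt B"
proof (cases "A > 0 & B > 0")
 case True
 then have s: "0 < sqrt B/sqrt A" by simp
 have "sqrt B/sqrt A*A = sqrt A * sqrt B" "B/(sqrt B/sqrt A) = sqrt A * sqrt B"
  using True by (simp_all add: field_simps)
 then show ?thesis using le[OF s] by simp
next
 case False
 have "I <= 0"
 proof (rule ccontr)
  assume "\<not> I <= 0"
  then have I: "0 < I" by simp
  show False
  proof (cases "A = 0")
   case True
   have "0 < (B + 1)/I" using I \<open>0 <= B\<close> by simp
   from le[OF this] have "2*I <= B*I/(B + 1)" using True by simp
   moreover have "B*I/(B + 1) <= I" using I \<open>0 <= B\<close> by (simp add: field_simps)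
   ultimately show False using I by linarith
  next
   case A: False
   then have "B = 0" using False assms by auto
   have "0 < I/(A + 1)" using I \<open>0 <= A\<close> by simp
   from le[OF this] have "2*I <= I*A/(A + 1)" using \<open>B = 0\<close> by simp
   moreover have "I*A/(A + 1) <= I" using I \<open>0 <= A\<close> by (simp add: field_simps)
   ultimately show False using I by linarith
  qed
 qed
 then show ?thesis using assms by (meson mult_nonneg_nonneg order_trans real_sqrt_ge_zero)
qed

lemma integral_Cauchy_Schwarz:
 fixes h F G :: "real => real"
 assumes "h integrable_on S" "F integrable_on S" "G integrable_on S"
  and F: "!!x. x : S ==> 0 <= F x" and G: "!!x. x : S ==> 0 <= G x"
  and h: "!!x. x : S ==> h x <= sqrt (F x) * sqrt (G x)"
 shows "integral S h <= sqrt (integral S F) * sqrt (integral S G)"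
proof (rule le_sqrt_mult_sqrtI)
 show "0 <= integral S F" "0 <= integral S G" using assms by (auto intro: integral_nonneg)
 fix s :: real assume s: "0 < s"
 have "integral S (%x. 2*h x) <= integral S (%x. s*F x + (1/s)*G x)"
 proof (rule integral_le)
  fix x assume x: "x : S"
  have "2*h x <= 2*(sqrt (F x) * sqrt (G x))" using h[OF x] by simp
  also have "... <= s*(sqrt (F x))^2 + (sqrt (G x))^2/s" by (rule two_mult_le_weighted_squares[OF s])
  finally show "2*h x <= s*F x + (1/s)*G x" using F[OF x] G[OF x] by simp
 qed (intro integrable_add integrable_on_mult_right assms)+
 also have "... = s*integral S F + (1/s)*integral S G"
  by (simp only: Henstock_Kurzweil_Integration.integral_add[OF integrable_on_mult_right[OF assms(2)]
     integrable_on_mult_right[OF assms(3)]] integral_mult_right)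
 finally show "2*integral S h <= s*integral S F + integral S G/s" by simp
qed

lemma absolutely_integrable_iff_integrable:
 fixes f :: "'a::euclidean_space => 'b::euclidean_space"
 assumes "S : sets lebesgue"
 shows "f abs_int_on S \<longleftrightarrow> integrable (lebesgue_on S) f"
 using assms by (simp add: set_integrable_def integrable_restrict_space)

lemma AE_lebesgue_iff_negligible: "(AE x in lebesgue. P x) \<longleftrightarrow> negligible {x. \<not> P x}"
proof
 assume "AE x in lebesgue. P x"
 then obtain N where "N : null_sets lebesgue" "{x : space lebesgue. \<not> P x} \<subseteq> N"
  unfolding eventually_ae_filter by blast
 then show "negligible {x. \<not> P x}"
  using negligible_subset by (auto simp: negligible_iff_null_sets[symmetric])
next
 assume "negligible {x. \<not> P x}"
 then show "AE x in lebesgue. P x"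
  by (intro AE_I'[of "{x. \<not> P x}"]) (auto simp: negligible_iff_null_sets)
qed

lemma AE_lebesgue_on_iff_negligible:
 assumes "S : sets lebesgue"
 shows "(AE x in lebesgue_on S. P x) \<longleftrightarrow> negligible {x : S. \<not> P x}"
 using assms by (simp add: AE_restrict_space_iff AE_lebesgue_iff_negligible)

section \<open>Square integrable functions\<close>

lemma borel_measurable_cnj [measurable (raw)]:
 "f : borel_measurable M ==> (%x. cnj (f x)) : borel_measurable M"
 by (rule measurable_compose[OF _ borel_measurable_continuous_onI]) (auto intro: continuous_intros)

lemma L2_mult_integrable:
 assumes f: "f : L2 M" and g: "g : L2 M"
 shows "integrable M (%x. f x*cnj (g x))" "integrable M (%x. cmod (f x)*cmod (g x))"
proof -
 have m [measurable]: "f : borel_measurable M" "g : borel_measurable M" using f g by (auto simp: L2_def)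
 have i: "integrable M (%x. (cmod (f x))^2 + (cmod (g x))^2)" using f g by (auto simp: L2_def)
 have le: "cmod (f x)*cmod (g x) <= (cmod (f x))^2 + (cmod (g x))^2" for x
 proof -
  have "2*(cmod (f x)*cmod (g x)) <= (cmod (f x))^2 + (cmod (g x))^2"
   using two_mult_le_weighted_squares[of 1 "cmod (f x)" "cmod (g x)"] by simp
  moreover have "0 <= cmod (f x)*cmod (g x)" by simp
  ultimately show ?thesis by linarith
 qed
 show "integrable M (%x. f x*cnj (g x))"
  by (rule Bochner_Integration.integrable_bound[OF i]) (use le in \<open>auto simp: norm_mult\<close>)
 show "integrable M (%x. cmod (f x)*cmod (g x))"
  by (rule Bochner_Integration.integrable_bound[OF i]) (use le in \<open>auto simp: norm_mult\<close>)
qed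

lemma L2_cmult: "f : L2 M ==> (%x. c*f x) : L2 M"
 by (auto simp: L2_def norm_mult power_mult_distrib)

lemma L2_add:
 assumes f: "f : L2 M" and g: "g : L2 M"
 shows "(%x. f x + g x) : L2 M"
proof -
 have m [measurable]: "f : borel_measurable M" "g : borel_measurable M" using f g by (auto simp: L2_def)
 have i: "integrable M (%x. 2*(cmod (f x))^2 + 2*(cmod (g x))^2)" using f g by (auto simp: L2_def)
 have "(cmod (f x + g x))^2 <= 2*(cmod (f x))^2 + 2*(cmod (g x))^2" for x
 proof -
  have "(cmod (f x + g x))^2 <= (cmod (f x) + cmod (g x))^2"
   by (intro power_mono norm_triangle_ineq) auto
  also have "... <= 2*(cmod (f x))^2 + 2*(cmod (g x))^2"
   using two_mult_le_weighted_squares[of 1 "cmod (f x)" "cmod (g x)"] by (simp add: power2_sum)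
  finally show ?thesis .
 qed
 then have "integrable M (%x. (cmod (f x + g x))^2)"
  by (intro Bochner_Integration.integrable_bound[OF i]) auto
 then show ?thesis by (simp add: L2_def)
qed

lemma L2_diff: "f : L2 M ==> g : L2 M ==> (%x. f x - g x) : L2 M"
 using L2_add[of f M "%x. -1*g x"] L2_cmult[of g M "-1"] by simp

lemma L2_zero: "(%_. 0) : L2 M"
 by (simp add: L2_def)

lemma L2_sum: "finite I ==> (!!i. i : I ==> f i : L2 M) ==> (%x. \<Sum>i\<in>I. f i x) : L2 M"
 by (induction rule: finite_induct) (auto intro: L2_zero L2_add)

lemma l2norm_nonneg: "0 <= l2norm M f"
 by (simp add: l2norm_def)

lemma l2norm_square: "(l2norm M f)^2 = (LINT x|M. (cmod (f x))^2)"
 by (simp add: l2norm_def)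

lemma l2norm_cmult: "l2norm M (%x. c*f x) = cmod c*l2norm M f"
 by (simp add: l2norm_def norm_mult power_mult_distrib real_sqrt_mult)

lemma L2_Cauchy_Schwarz_abs:
 assumes f: "f : L2 M" and g: "g : L2 M"
 shows "(LINT x|M. cmod (f x)*cmod (g x)) <= l2norm M f*l2norm M g"
 unfolding l2norm_def
proof (rule le_sqrt_mult_sqrtI)
 fix s :: real assume s: "0 < s"
 have i: "integrable M (%x. (cmod (f x))^2)" "integrable M (%x. (cmod (g x))^2)" using f g by (auto simp: L2_def)
 have "(LINT x|M. 2*(cmod (f x)*cmod (g x))) <= (LINT x|M. s*(cmod (f x))^2 + (cmod (g x))^2/s)"
  by (rule integral_mono) (use i L2_mult_integrable(2)[OF f g] two_mult_le_weighted_squares[OF s] in auto)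
 also have "... = s*(LINT x|M. (cmod (f x))^2) + (LINT x|M. (cmod (g x))^2)/s"
  using i by (subst Bochner_Integration.integral_add) auto
 finally show "2*(LINT x|M. cmod (f x)*cmod (g x)) <= s*(LINT x|M. (cmod (f x))^2) + (LINT x|M. (cmod (g x))^2)/s"
  by simp
qed auto

lemma L2_Cauchy_Schwarz:
 assumes f: "f : L2 M" and g: "g : L2 M"
 shows "cmod (l2inner M f g) <= l2norm M f*l2norm M g"
proof -
 have "cmod (l2inner M f g) <= (LINT x|M. cmod (f x*cnj (g x)))"
  unfolding l2inner_def by (rule integral_norm_bound)
 also have "... = (LINT x|M. cmod (f x)*cmod (g x))" by (simp add: norm_mult)
 finally show ?thesis using L2_Cauchy_Schwarz_abs[OF assms] by linarith
qed

lemma l2inner_self: "l2inner M f f = cx ((l2norm M f)^2)"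
 unfolding l2norm_square l2inner_def complex_norm_square[symmetric]
 by (simp flip: of_real_power)

lemma l2inner_add_left:
 assumes "f : L2 M" "g : L2 M" "h : L2 M"
 shows "l2inner M (%x. f x + g x) h = l2inner M f h + l2inner M g h"
 unfolding l2inner_def using L2_mult_integrable(1)[OF assms(1,3)] L2_mult_integrable(1)[OF assms(2,3)]
 by (simp add: distrib_right)

lemma l2inner_cmult_left: "l2inner M (%x. c*f x) h = c*l2inner M f h"
 unfolding l2inner_def by (simp add: mult.assoc)

lemma l2inner_diff_left:
 assumes "f : L2 M" "g : L2 M" "h : L2 M"
 shows "l2inner M (%x. f x - g x) h = l2inner M f h - l2inner M g h"
 unfolding l2inner_def using L2_mult_integrable(1)[OF assms(1,3)] L2_mult_integrable(1)[OF assms(2,3)]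
 by (simp add: left_diff_distrib)

lemma l2inner_sum_left:
 assumes "finite I" "!!i. i : I ==> f i : L2 M" "h : L2 M"
 shows "l2inner M (%x. \<Sum>i\<in>I. f i x) h = (\<Sum>i\<in>I. l2inner M (f i) h)"
 using assms
proof (induction rule: finite_induct)
 case empty
 then show ?case by (simp add: l2inner_def)
next
 case (insert i I)
 then show ?case by (simp add: l2inner_add_left L2_sum)
qed

lemma l2norm_triangle:
 assumes f: "f : L2 M" and g: "g : L2 M"
 shows "l2norm M (%x. f x + g x) <= l2norm M f + l2norm M g"
proof (rule power2_le_imp_le)
 have i: "integrable M (%x. (cmod (f x))^2)" "integrable M (%x. (cmod (g x))^2)" using f g by (auto simp: L2_def)
 have "(l2norm M (%x. f x + g x))^2 <= (LINT x|M. ((cmod (f x))^2 + (cmod (g x))^2) + 2*(cmod (f x)*cmod (g x)))"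
  unfolding l2norm_square
 proof (rule integral_mono)
  show "integrable M (%x. (cmod (f x + g x))^2)" using L2_add[OF f g] by (simp add: L2_def)
  show "(cmod (f x + g x))^2 <= ((cmod (f x))^2 + (cmod (g x))^2) + 2*(cmod (f x)*cmod (g x))" for x
   using power_mono[OF norm_triangle_ineq[of "f x" "g x"], of 2] by (simp add: power2_sum)
 qed (use i L2_mult_integrable(2)[OF f g] in auto)
 also have "... = (l2norm M f)^2 + (l2norm M g)^2 + 2*(LINT x|M. cmod (f x)*cmod (g x))"
  unfolding l2norm_square using i L2_mult_integrable(2)[OF f g] by simp
 also have "... <= (l2norm M f + l2norm M g)^2"
  using L2_Cauchy_Schwarz_abs[OF f g] by (simp add: power2_sum)
 finally show "(l2norm M (%x. f x + g x))^2 <= (l2norm M f + l2norm M g)^2" .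
qed (simp add: l2norm_nonneg)

lemma l2norm_eq_0_imp_AE:
 assumes "f : L2 M" "l2norm M f = 0"
 shows "AE x in M. f x = 0"
proof -
 have "(LINT x|M. (cmod (f x))^2) = 0" using assms(2) by (simp add: l2norm_def)
 then have "AE x in M. (cmod (f x))^2 = 0"
  using integral_nonneg_eq_0_iff_AE[of M "%x. (cmod (f x))^2"] assms(1) by (auto simp: L2_def)
 then show ?thesis by auto
qed


section \<open>The fiber operators as integral equations\<close>

context sturm_liouville
begin

abbreviation H :: "(real => complex) set" where "H \<equiv> L2 (L2a w a)"

abbreviation nrm :: "(real => complex) => real" where "nrm \<equiv> l2norm (L2a w a)"

abbreviation br :: "(real => complex) => (real => complex) => complex" where "br \<equiv> indef_inner w a"

lemma w_meas_on [measurable]: "w : borel_measurable (lebesgue_on S)"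
 using w_meas by (rule measurable_restrict_space1)

lemma sets_weighted: "sets (weighted w S) = sets (lebesgue_on S)"
 by (simp add: weighted_def)

lemma measurable_weighted: "f : borel_measurable (weighted w S) \<longleftrightarrow> f : borel_measurable (lebesgue_on S)"
 by (simp add: measurable_cong_sets[OF sets_weighted refl])

lemma integrable_weighted:
 fixes f :: "real => 'b::euclidean_space"
 assumes "f : borel_measurable (lebesgue_on S)"
 shows "integrable (weighted w S) f \<longleftrightarrow> integrable (lebesgue_on S) (%x. \<bar>w x\<bar> *\<^sub>R f x)"
 unfolding weighted_def using assms by (intro integrable_density) auto

lemma integral_weighted:
 fixes f :: "real => 'b::euclidean_space"
 assumes "f : borel_measurable (lebesgue_on S)"
 shows "integral\<^sup>L (weighted w S) f = integral\<^sup>L (lebesgue_on S) (%x. \<bar>w x\<bar> *\<^sub>R f x)"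
 unfolding weighted_def using assms by (intro integral_density) auto

text \<open>Since w vanishes only on a null set, the weighted measure and Lebesgue measure have the
  same null sets.\<close>

lemma AE_weighted:
 assumes "S : sets lebesgue"
 shows "(AE x in weighted w S. P x) \<longleftrightarrow> negligible {x : S. \<not> P x}"
proof -
 have "(AE x in weighted w S. P x) \<longleftrightarrow> (AE x in lebesgue_on S. w x ~= 0 --> P x)"
  unfolding weighted_def by (subst AE_density) (auto simp: zero_less_iff_neq_zero)
 also have "... \<longleftrightarrow> negligible {x : S. w x ~= 0 & \<not> P x}"
  using assms by (simp add: AE_lebesgue_on_iff_negligible conj_commute)
 also have "... \<longleftrightarrow> negligible {x : S. \<not> P x}"
 proof
  assume "negligible {x : S. w x ~= 0 & \<not> P x}"
  then have "negligible ({x : S. w x ~= 0 & \<not> P x} \<union> {x. w x = 0})" using w_nz by (rule negligible_Un)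
  then show "negligible {x : S. \<not> P x}" by (rule negligible_subset) auto
 next
  assume "negligible {x : S. \<not> P x}"
  then show "negligible {x : S. w x ~= 0 & \<not> P x}" by (rule negligible_subset) auto
 qed
 finally show ?thesis .
qed

lemma H_measurable: "f : H ==> f : borel_measurable (lebesgue_on {0<..<a})"
 by (simp add: L2_def measurable_weighted)

lemma H_iff:
 "f : H \<longleftrightarrow> f : borel_measurable (lebesgue_on {0<..<a}) & (%x. \<bar>w x\<bar>*(cmod (f x))^2) abs_int_on {0..a}"
proof -
 have "f : borel_measurable (lebesgue_on {0<..<a}) ==>
   integrable (L2a w a) (%x. (cmod (f x))^2) \<longleftrightarrow> (%x. \<bar>w x\<bar>*(cmod (f x))^2) abs_int_on {0..a}"
  by (subst integrable_weighted)
   (auto simp: absolutely_integrable_on_Icc_iff_Ioo absolutely_integrable_iff_integrable)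
 then show ?thesis by (auto simp: L2_def measurable_weighted)
qed

lemma lint_eq_integral:
 fixes f :: "real => 'b::euclidean_space"
 assumes "f abs_int_on {0..a}"
 shows "integral\<^sup>L (lebesgue_on {0<..<a}) f = integral {0..a} f"
proof -
 have "integrable (lebesgue_on {0<..<a}) f"
  using assms by (simp add: absolutely_integrable_on_Icc_iff_Ioo absolutely_integrable_iff_integrable)
 then have "integral\<^sup>L (lebesgue_on {0<..<a}) f = integral {0<..<a} f"
  by (intro lebesgue_integral_eq_integral) auto
 then show ?thesis by (metis box_real integral_open_interval)
qed

lemma nrm_square:
 assumes "f : H"
 shows "(nrm f)^2 = integral {0..a} (%x. \<bar>w x\<bar>*(cmod (f x))^2)"
proof -
 have m: "f : borel_measurable (lebesgue_on {0<..<a})" "(%x. \<bar>w x\<bar>*(cmod (f x))^2) abs_int_on {0..a}"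
  using assms by (auto simp: H_iff)
 have "(nrm f)^2 = integral\<^sup>L (lebesgue_on {0<..<a}) (%x. \<bar>w x\<bar>*(cmod (f x))^2)"
  unfolding l2norm_square using m(1) by (subst integral_weighted) auto
 then show ?thesis using lint_eq_integral[OF m(2)] by simp
qed

lemma br_int:
 assumes "f : H" "g : H"
 shows "(%x. f x*cnj (g x)*cx (w x)) abs_int_on {0..a}"
proof -
 note [measurable] = H_measurable[OF assms(1)] H_measurable[OF assms(2)]
 have "integrable (lebesgue_on {0<..<a}) (%x. \<bar>w x\<bar> *\<^sub>R (cmod (f x)*cmod (g x)))"
  using L2_mult_integrable(2)[OF assms] by (subst integrable_weighted[symmetric]) auto
 then have "integrable (lebesgue_on {0<..<a}) (%x. f x*cnj (g x)*cx (w x))"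
  by (rule Bochner_Integration.integrable_bound) (auto simp: norm_mult mult_ac)
 then show ?thesis by (simp add: absolutely_integrable_on_Icc_iff_Ioo absolutely_integrable_iff_integrable)
qed

lemma br_eq:
 assumes "f : H" "g : H"
 shows "br f g = integral {0..a} (%x. f x*cnj (g x)*cx (w x))"
 unfolding indef_inner_def by (rule lint_eq_integral[OF br_int[OF assms]])

lemma br_cs:
 assumes "f : H" "g : H"
 shows "cmod (br f g) <= nrm f*nrm g"
proof -
 note [measurable] = H_measurable[OF assms(1)] H_measurable[OF assms(2)]
 have "cmod (br f g) <= integral\<^sup>L (lebesgue_on {0<..<a}) (%x. cmod (f x*cnj (g x)*cx (w x)))"
  unfolding indef_inner_def by (rule integral_norm_bound)
 also have "... = (LINT x|L2a w a. cmod (f x)*cmod (g x))"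
  by (subst integral_weighted) (auto simp: norm_mult mult_ac)
 finally show ?thesis using L2_Cauchy_Schwarz_abs[OF assms] by linarith
qed

lemma br_int': "f : H ==> g : H ==> integrable (lebesgue_on {0<..<a}) (%x. f x*cnj (g x)*cx (w x))"
 using br_int by (simp add: absolutely_integrable_on_Icc_iff_Ioo absolutely_integrable_iff_integrable)

lemma br_add_left: "f : H ==> g : H ==> h : H ==> br (%x. f x + g x) h = br f h + br g h"
 unfolding indef_inner_def using br_int'[of f h] br_int'[of g h] by (simp add: distrib_right)

lemma br_diff_left: "f : H ==> g : H ==> h : H ==> br (%x. f x - g x) h = br f h - br g h"
 unfolding indef_inner_def using br_int'[of f h] br_int'[of g h] by (simp add: left_diff_distrib)

lemma br_cmult_left: "br (%x. c*f x) h = c*br f h"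
 unfolding indef_inner_def by (simp add: mult.assoc)

lemma br_commute: "br g f = cnj (br f g)"
 unfolding indef_inner_def by (subst Bochner_Integration.integral_cnj[symmetric]) (simp add: mult_ac)

lemma br_cmult_right: "br f (%x. c*h x) = cnj c*br f h"
 using br_commute[of f "%x. c*h x"] br_commute[of f h] by (simp add: br_cmult_left)

lemma br_sum_left: "finite I ==> (!!i. i : I ==> f i : H) ==> h : H ==> br (%x. \<Sum>i\<in>I. f i x) h = (\<Sum>i\<in>I. br (f i) h)"
proof (induction rule: finite_induct)
 case empty
 then show ?case by (simp add: indef_inner_def)
next
 case (insert i I)
 then show ?case by (simp add: br_add_left L2_sum)
qed

lemma br_sum_right:
 assumes "finite I" "!!i. i : I ==> f i : H" "h : H"
 shows "br h (%x. \<Sum>i\<in>I. f i x) = (\<Sum>i\<in>I. br h (f i))"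
 by (subst br_commute) (simp add: br_sum_left[OF assms] br_commute[of "f _" h])

lemma br_self_real: "br f f = cx (Re (br f f))"
 using br_commute[of f f] by (simp add: complex_eq_iff)

lemma absw_int: "(%x. \<bar>w x\<bar>) abs_int_on {c..d}"
 using absolutely_integrable_abs[OF w_int] by (simp add: o_def)

lemma cont_sq_int:
 assumes "continuous_on {c..d} f"
 shows "(%x. \<bar>w x\<bar>*(cmod (f x))^2) abs_int_on {c..d}"
 by (intro absolutely_integrable_continuous_mult(1) absw_int continuous_intros assms)

lemma cont_H:
 assumes "continuous_on {0..a} f"
 shows "f : H"
proof -
 have "continuous_on {0<..<a} f" by (rule continuous_on_subset[OF assms]) auto
 then have "f : borel_measurable (lebesgue_on {0<..<a})"
  by (intro continuous_imp_measurable_on_sets_lebesgue) auto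
 then show ?thesis using cont_sq_int[OF assms] by (simp add: H_iff)
qed

lemma one_H: "(%_. 1) : H"
 by (intro cont_H continuous_intros)

text \<open>Cauchy-Schwarz against the constant 1, which lies in the space because w is integrable.
  It makes every element of the space an admissible source in \<open>sol\<close>.\<close>

lemma H_w_int:
 assumes "f : H"
 shows "(%x. cx (w x)*f x) abs_int_on {0..a}"
  "integral {0..a} (%x. cmod (cx (w x)*f x)) <= nrm (%_. 1)*nrm f"
proof -
 show i: "(%x. cx (w x)*f x) abs_int_on {0..a}"
  using br_int[OF assms one_H] by (simp add: mult.commute)
 note [measurable] = H_measurable[OF assms]
 have "integral {0..a} (%x. cmod (cx (w x)*f x)) =
   integral\<^sup>L (lebesgue_on {0<..<a}) (%x. cmod (cx (w x)*f x))"
  using absolutely_integrable_norm[OF i] by (intro lint_eq_integral[symmetric]) (simp add: o_def)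
 also have "... = (LINT x|L2a w a. cmod 1*cmod (f x))"
  by (subst integral_weighted) (auto simp: norm_mult)
 finally show "integral {0..a} (%x. cmod (cx (w x)*f x)) <= nrm (%_. 1)*nrm f"
  using L2_Cauchy_Schwarz_abs[OF one_H assms] by simp
qed

definition qper :: "real => (real => complex) => bool" where
 "qper t f \<longleftrightarrow> (\<forall>x. f (x + a) = eit t*f x)"

lemma good_points_negligible: "negligible ({x. w x = 0} \<union> {x. p x <= 0})"
 by (intro negligible_Un w_nz p_pos)

lemma sol_of_sl_expr:
 assumes f: "AC_on c d f" and v: "AC_on c d v" and sl: "sl_expr w p q {c<..<d} f v g"
  and wg: "(%x. cx (w x)*g x) abs_int_on {c..d}"
 shows "sol {c..d} (%x. cx (w x)*g x) f v"
proof -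
 define Q where "Q x \<longleftrightarrow> (\<exists>f' v'. (f has_vector_derivative f') (at x) & v x = of_real (p x)*f' \<and>
   (v has_vector_derivative v') (at x) & g x = 1/of_real (w x)*(- v' + of_real (q x)*f x))" for x
 define N where "N = {x : {c<..<d}. \<not> Q x} \<union> ({x. w x = 0} \<union> {x. p x <= 0})"
 have N: "negligible N" unfolding N_def using sl good_points_negligible
  by (intro negligible_Un) (simp_all add: sl_expr_def Q_def AE_lebesgue_on_iff_negligible)
 have d: "(f has_vector_derivative v x/cx (p x)) (at x)"
  "(v has_vector_derivative cx (q x)*f x - cx (w x)*g x) (at x)"
  if "x : {c<..<d}" "x \<notin> N" for x
 proof -
  have nz: "w x ~= 0" "p x ~= 0" "Q x" using that by (auto simp: N_def)
  then obtain f' v' where fv: "(f has_vector_derivative f') (at x)" "v x = of_real (p x)*f'"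
   "(v has_vector_derivative v') (at x)" "g x = 1/of_real (w x)*(- v' + of_real (q x)*f x)"
   unfolding Q_def by blast
  have "v x/cx (p x) = f'" "cx (q x)*f x - cx (w x)*g x = v'"
   using fv nz by simp_all
  then show "(f has_vector_derivative v x/cx (p x)) (at x)"
   "(v has_vector_derivative cx (q x)*f x - cx (w x)*g x) (at x)" using fv by simp_all
 qed
 have ac: "ac_on c d f" "ac_on c d v" using f v by (simp_all add: AC_on_iff_ac_on)
 have sub: "c <= x & y <= d" if "x <= y" "{x..y} \<subseteq> {c..d}" for x y using that by auto
 have int: "(%x. v x/cx (p x)) abs_int_on {c..d}"
  "(%x. cx (q x)*f x - cx (w x)*g x) abs_int_on {c..d}"
  using ac[THEN ac_on_imp_continuous_on] wg by (auto intro!: coeff_mult_int set_integral_diff(1))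
 have neg: "negligible {z : {x<..<y}. \<not> P z}" if "x <= y" "{x..y} \<subseteq> {c..d}" "!!z. z : {c<..<d} ==> z \<notin> N ==> P z" for x y P
  by (rule negligible_subset[OF N]) (use that sub[OF that(1,2)] in force)
 show ?thesis
  unfolding sol_def
 proof (intro conjI primitive_on_ac)
  fix x y :: real assume xy: "x <= y" "{x..y} \<subseteq> {c..d}"
  show "ac_on x y f" "ac_on x y v" using sub[OF xy] ac_on_subset ac by blast+
  show "(%x. v x/cx (p x)) abs_int_on {x..y}"
   "(%x. cx (q x)*f x - cx (w x)*g x) abs_int_on {x..y}"
   using absolutely_integrable_on_subinterval[OF int(1) xy(2)] absolutely_integrable_on_subinterval[OF int(2) xy(2)] .
  show "negligible {z : {x<..<y}. \<not> (f has_vector_derivative v z/cx (p z)) (at z)}"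
   by (rule neg[OF xy d(1)])
  show "negligible {z : {x<..<y}. \<not> (v has_vector_derivative cx (q z)*f z - cx (w z)*g z) (at z)}"
   by (rule neg[OF xy d(2)])
 qed
qed

lemma sl_expr_of_sol:
 assumes s: "sol {c..d} (%x. cx (w x)*g x) f v"
 shows "AC_on c d f" "AC_on c d v" "sl_expr w p q {c<..<d} f v g"
proof -
 show "AC_on c d f" "AC_on c d v"
  using primitive_on_ac_on[OF solD(1)[OF s] order_refl] primitive_on_ac_on[OF solD(2)[OF s] order_refl]
  by (simp_all add: AC_on_iff_ac_on)
 show "sl_expr w p q {c<..<d} f v g"
 proof (cases "c <= d")
  case True
  define N where "N = {x : {c<..<d}. \<not> (f has_vector_derivative v x/cx (p x)) (at x)} \<union>
   {x : {c<..<d}. \<not> (v has_vector_derivative cx (q x)*f x - cx (w x)*g x) (at x)} \<union>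
   ({x. w x = 0} \<union> {x. p x <= 0})"
  have N: "negligible N" unfolding N_def
   by (intro negligible_Un good_points_negligible primitive_on_differentiable_ae[OF solD(1)[OF s]]
     primitive_on_differentiable_ae[OF solD(2)[OF s]] order_refl True w_nz p_pos)
  have "\<exists>f' v'. (f has_vector_derivative f') (at x) & v x = of_real (p x)*f' \<and>
   (v has_vector_derivative v') (at x) & g x = 1/of_real (w x)*(- v' + of_real (q x)*f x)"
   if "x : {c<..<d}" "x \<notin> N" for x
  proof (intro exI conjI)
   show "(f has_vector_derivative v x/cx (p x)) (at x)"
    "(v has_vector_derivative cx (q x)*f x - cx (w x)*g x) (at x)"
    using that by (auto simp: N_def)
   have "w x ~= 0" "p x ~= 0" using that by (auto simp: N_def)
   then show "v x = of_real (p x)*(v x/cx (p x))"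
    "g x = 1/of_real (w x)*(- (cx (q x)*f x - cx (w x)*g x) + of_real (q x)*f x)"
    by simp_all
  qed
  then show ?thesis unfolding sl_expr_def
   by (subst AE_lebesgue_on_iff_negligible) (auto intro!: negligible_subset[OF N])
 qed (simp add: sl_expr_def AE_lebesgue_on_iff_negligible)
qed

text \<open>From here on the fiber operators are handled as integral equations. That f lies in the
  space follows from its continuity.\<close>

lemma fiber_op_iff:
 "fiber_op w p q a t f g \<longleftrightarrow> g : H & (\<exists>v. wsol g f v \<and>
   f a = eit t*f 0 & v a = eit t * v 0)"
proof
 assume "fiber_op w p q a t f g"
 then show "g : H & (\<exists>v. wsol g f v \<and>
   f a = eit t*f 0 & v a = eit t * v 0)"
  unfolding fiber_op_def using sol_of_sl_expr H_w_int(1) by blast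
next
 assume "g : H & (\<exists>v. wsol g f v \<and>
   f a = eit t*f 0 & v a = eit t * v 0)"
 then obtain v where "g : H" and s: "wsol g f v"
  and bc: "f a = eit t*f 0" "v a = eit t * v 0" by blast
 then show "fiber_op w p q a t f g"
  unfolding fiber_op_def using sl_expr_of_sol[OF s] cont_H[OF sol_continuous(1)[OF s order_refl]] by blast
qed

lemma fiber_op_H:
 assumes "fiber_op w p q a t f g"
 shows "f : H" "g : H"
 using assms by (auto simp: fiber_op_def)

lemma sol_UNIV_iff:
 assumes "!!c d. c <= d ==> sol {c..d} s f v"
 shows "sol UNIV s f v"
 unfolding sol_def primitive_on_def
proof (intro conjI allI impI)
 fix x y :: real assume "x <= y"
 note A = assms[OF this]
 note B = primitive_onD[OF solD(1)[OF A] order_refl \<open>x <= y\<close>] primitive_onD[OF solD(2)[OF A] order_refl \<open>x <= y\<close>]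
 show "(%x. v x/cx (p x)) abs_int_on {x..y}"
  "(%x. cx (q x)*f x - s x) abs_int_on {x..y}"
  "integral {x..y} (%x. v x/cx (p x)) = f y - f x"
  "integral {x..y} (%x. cx (q x)*f x - s x) = v y - v x" using B by auto
qed

lemma sol_of_sl_expr_UNIV:
 assumes f: "AC_loc f" and v: "AC_loc v" and sl: "sl_expr w p q UNIV f v g"
  and wg: "!!c d. (%x. cx (w x)*g x) abs_int_on {c..d}"
 shows "sol UNIV (%x. cx (w x)*g x) f v"
proof (rule sol_UNIV_iff, rule sol_of_sl_expr[OF _ _ _ wg])
 fix c d :: real assume "c <= d"
 then show "AC_on c d f" "AC_on c d v" using f v by (auto simp: AC_loc_def)
 show "sl_expr w p q {c<..<d} f v g"
  using sl unfolding sl_expr_def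
  by (subst AE_lebesgue_on_iff_negligible, simp, subst (asm) AE_lebesgue_on_iff_negligible, simp)
   (auto elim!: negligible_subset)
qed

lemma sl_expr_of_sol_UNIV:
 assumes s: "sol UNIV (%x. cx (w x)*g x) f v"
 shows "AC_loc f" "AC_loc v" "sl_expr w p q UNIV f v g"
proof -
 note A = sl_expr_of_sol[OF sol_subset[OF s subset_UNIV]]
 show "AC_loc f" "AC_loc v" using A(1,2) by (auto simp: AC_loc_def)
 define Q where "Q x \<longleftrightarrow> (\<exists>f' v'. (f has_vector_derivative f') (at x) & v x = of_real (p x)*f' \<and>
   (v has_vector_derivative v') (at x) & g x = 1/of_real (w x)*(- v' + of_real (q x)*f x))" for x
 have n: "negligible {x : {-real n<..<real n}. \<not> Q x}" for n
  using A(3)[of "- real n" "real n"] unfolding sl_expr_def Q_def by (subst (asm) AE_lebesgue_on_iff_negligible) auto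
 have "{x. \<not> Q x} \<subseteq> (\<Union>n. {x : {-real n<..<real n}. \<not> Q x})"
 proof
  fix x assume "x : {x. \<not> Q x}"
  moreover obtain n where "\<bar>x\<bar> < real n" using reals_Archimedean2 by blast
  ultimately show "x : (\<Union>n. {x : {-real n<..<real n}. \<not> Q x})" by (auto simp: abs_less_iff intro!: exI[of _ n])
 qed
 then have "negligible {x. \<not> Q x}"
  by (rule negligible_subset[rotated]) (rule negligible_countable_Union, use n in auto)
 then show "sl_expr w p q UNIV f v g" unfolding sl_expr_def Q_def[symmetric]
  by (subst AE_lebesgue_on_iff_negligible) auto
qed

text \<open>The Wronskian of f and the conjugate of f' takes the same value at 0 and at a, because
  the two factors \<open>exp (i t)\<close> and its conjugate cancel.\<close>

lemma fiber_op_symmetric: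
 assumes 1: "fiber_op w p q a t f g" and 2: "fiber_op w p q a t f' g'"
 shows "br g f' = br f g'"
proof -
 obtain v v' where s: "wsol g f v" "f a = eit t*f 0" "v a = eit t * v 0"
  "wsol g' f' v'" "f' a = eit t*f' 0" "v' a = eit t * v' 0"
  using 1 2 by (auto simp: fiber_op_iff)
 have g: "g : H" "g' : H" "f : H" "f' : H" using fiber_op_H[OF 1] fiber_op_H[OF 2] by auto
 have e: "eit t*cnj (eit t) = 1"
  by (simp add: exp_cnj flip: exp_add)
 note W = primitive_onD(2)[OF sol_wronskian[OF s(1) sol_cnj[OF s(4)]] order_refl less_imp_le[OF a_pos]]
 have "f a*cnj (v' a) = (eit t*cnj (eit t))*(f 0*cnj (v' 0))"
  "v a*cnj (f' a) = (eit t*cnj (eit t))*(v 0*cnj (f' 0))"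
  unfolding s by (simp_all add: mult_ac)
 then have "integral {0..a} (%x. cx (w x)*g x*cnj (f' x) - f x*cnj (cx (w x)*g' x)) = 0"
  using W by (simp add: e)
 moreover have "integral {0..a} (%x. cx (w x)*g x*cnj (f' x) - f x*cnj (cx (w x)*g' x))
   = integral {0..a} (%x. g x*cnj (f' x)*cx (w x) - f x*cnj (g' x)*cx (w x))"
  by (simp add: mult_ac)
 moreover have "... = br g f' - br f g'"
  using br_int[OF g(1,4)] br_int[OF g(3,2)] unfolding br_eq[OF g(1,4)] br_eq[OF g(3,2)]
  by (intro Henstock_Kurzweil_Integration.integral_diff) (auto simp: abs_int_def)
 ultimately show ?thesis by simp
qed

end

section \<open>Bloch solutions\<close>

lemma continuous_on_ae_zero:
 fixes f :: "real => complex"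
 assumes f: "continuous_on {c..d} f" and "c < d" and neg: "negligible {x : {c<..<d}. f x ~= 0}" and x: "x : {c..d}"
 shows "f x = 0"
proof -
 have "continuous_on {c<..<d} f" by (rule continuous_on_subset[OF f]) auto
 then have "open ({c<..<d} \<inter> f -` (- {0}))" by (intro continuous_open_preimage) auto
 moreover have "{c<..<d} \<inter> f -` (- {0}) = {x : {c<..<d}. f x ~= 0}" by auto
 ultimately have "{x : {c<..<d}. f x ~= 0} = {}" using neg open_not_negligible by metis
 then have "f y = 0" if "y : {c<..<d}" for y using that by blast
 moreover have cl: "closure {c<..<d} = {c..d}" using \<open>c < d\<close> by simp
 ultimately show ?thesis
  using continuous_constant_on_closure[of "{c<..<d}" f 0 x] f x by (metis cl)
qed

lemma exp_i_mult_cnj: "exp (\<i>*cx t)*cnj (exp (\<i>*cx t)) = 1"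
 by (simp add: exp_cnj flip: exp_add)

lemma exp_i_norm: "cmod (exp (\<i>*cx t)) = 1"
 by simp

context sturm_liouville
begin

lemma nrm_eq_0_imp:
 assumes f: "continuous_on {0..a} f" and "nrm f = 0" and "x : {0..a}"
 shows "f x = 0"
proof (rule continuous_on_ae_zero[OF f a_pos _ assms(3)])
 have "AE x in L2a w a. f x = 0" by (rule l2norm_eq_0_imp_AE[OF cont_H[OF f] assms(2)])
 then show "negligible {x : {0<..<a}. f x ~= 0}" by (subst (asm) AE_weighted) auto
qed

text \<open>The derivative \<open>v/p\<close> of f vanishes almost everywhere and p is finite and
  positive there, so the continuous v vanishes.\<close>

lemma sol_zero_imp:
 assumes s: "sol {0..a} s f v" and f: "!!x. x : {0..a} ==> f x = 0" and x: "x : {0..a}"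
 shows "v x = 0"
proof (rule continuous_on_ae_zero[OF sol_continuous(2)[OF s order_refl] a_pos _ x])
 have a: "0 <= a" using a_pos by simp
 let ?N = "{x : {0<..<a}. \<not> (f has_vector_derivative v x/cx (p x)) (at x)} \<union> {x. p x <= 0}"
 have "negligible ?N"
  by (intro negligible_Un p_pos primitive_on_differentiable_ae[OF solD(1)[OF s] order_refl a])
 moreover have "v x = 0" if "x : {0<..<a}" "x \<notin> ?N" for x
 proof -
  have d: "(f has_vector_derivative v x/cx (p x)) (at x)" "p x ~= 0" using that by auto
  have "((%_. 0) has_vector_derivative v x/cx (p x)) (at x)"
  proof (rule has_vector_derivative_transform_within_open[OF d(1) open_greaterThanLessThan])
   show "x : {0<..<a}" by (rule that(1))
   show "f y = 0" if "y : {0<..<a}" for y using that by (intro f) simp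
  qed
  then have "v x/cx (p x) = 0"
   by (rule vector_derivative_unique_at[OF _ has_vector_derivative_const])
  then show ?thesis using d(2) by simp
 qed
 then have "{x : {0<..<a}. v x ~= 0} \<subseteq> ?N" by blast
 ultimately show "negligible {x : {0<..<a}. v x ~= 0}" by (rule negligible_subset)
qed

lemma nrm_le_sup:
 assumes f: "continuous_on {0..a} f" and B: "!!x. x : {0..a} ==> cmod (f x) <= B"
 shows "nrm f <= B*nrm (%_. 1)"
proof (rule power2_le_imp_le)
 have B0: "0 <= B" using B[of 0] a_pos norm_ge_zero[of "f 0"] by (meson atLeastAtMost_iff less_imp_le order_refl order_trans)
 have "(nrm f)^2 <= integral {0..a} (%x. B^2*(\<bar>w x\<bar>*(cmod 1)^2))"
  unfolding nrm_square[OF cont_H[OF f]]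
 proof (rule integral_le)
  show "(%x. \<bar>w x\<bar>*(cmod (f x))^2) integrable_on {0..a}"
   using cont_sq_int[OF f] by (simp add: abs_int_def)
  show "(%x. B^2*(\<bar>w x\<bar>*(cmod 1)^2)) integrable_on {0..a}"
   using absw_int[of 0 a] by (intro integrable_on_mult_right) (simp add: abs_int_def)
  fix x assume "x : {0..a}"
  then have "(cmod (f x))^2 <= B^2" using B by (intro power_mono) auto
  then show "\<bar>w x\<bar>*(cmod (f x))^2 <= B^2*(\<bar>w x\<bar>*(cmod 1)^2)"
   using mult_left_mono[of "(cmod (f x))^2" "B^2" "\<bar>w x\<bar>"] by (simp add: mult.commute)
 qed
 also have "... = (B*nrm (%_. 1))^2"
  unfolding power_mult_distrib nrm_square[OF one_H] by (rule integral_mult_right)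
 finally show "(nrm f)^2 <= (B*nrm (%_. 1))^2" .
 show "0 <= B*nrm (%_. 1)" using B0 by (simp add: l2norm_nonneg)
qed

text \<open>An element of the eigenspace of A(t), continued to the whole line, with its
  quasi-derivative; zero is allowed. On the line, uniqueness and translations of the period cell are
  at hand.\<close>

definition bloch :: "real => complex => (real => complex) => (real => complex) => bool" where
 "bloch t z f v \<longleftrightarrow> eigsol UNIV z f v & qper t f & qper t v"

text \<open>L is a set of distinct eigenvalues with one vector \<open>f l\<close> each.
  Multiplicities are covered, as \<open>f l\<close> is an arbitrary element of the eigenspace. The
  constant depends neither on t nor on L.\<close>

abbreviation high_definite :: "real => real => bool" where
 "high_definite R1 kp == \<forall>t L f v. finite L --> (\<forall>l\<in>L. R1 < l & bloch t (cx l) (f l) (v l) & 0 <= Re (br (f l) (f l))) -->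
   (nrm (lsum L f))^2 <= kp*Re (br (lsum L f) (lsum L f))"

abbreviation definite_above :: "real => real => bool" where
 "definite_above R c == \<forall>t\<in>{-pi..pi}. \<forall>L f v. finite L --> (\<forall>l\<in>L. R < l & bloch t (cx l) (f l) (v l)) -->
   c*(nrm (lsum L f))^2 <= Re (br (lsum L f) (lsum L f))"

text \<open>Continue by the initial value problem at 0. The translate by a and the multiple by
  \<open>exp (i t)\<close> then have the same data, so uniqueness gives quasi-periodicity.\<close>

lemma bloch_of_boundary:
 assumes s: "eigsol {0..a} z f v" and bc: "f a = eit t*f 0" "v a = eit t * v 0"
 shows "\<exists>F V. bloch t z F V & (\<forall>x\<in>{0..a}. F x = f x & V x = v x)"
proof -
 obtain F V where FV: "eigsol UNIV z F V" "F 0 = f 0" "V 0 = v 0" using ivp_exists[of z "f 0" "v 0"] by blast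
 have d: "sol {0..a} (%x. z*cx (w x)*(F x - f x) + 0) (%x. F x - f x) (%x. V x - v x)"
  using sol_diff[OF sol_subset[OF FV(1) subset_UNIV, of "{0..a}"] s] by (simp add: algebra_simps)
 have eq: "F x = f x & V x = v x" if "x : {0..a}" for x
 proof -
  have "cmod (F x - f x) + cmod (V x - v x) <= 0"
   using sol_bound[OF d _ that, of 0 "cmod z"] FV a_pos by simp
  then have "cmod (F x - f x) = 0 & cmod (V x - v x) = 0"
   using norm_ge_zero[of "F x - f x"] norm_ge_zero[of "V x - v x"] by linarith
  then show ?thesis by simp
 qed
 have sh: "eigsol UNIV z (%x. F (x + a)) (%x. V (x + a))"
  using sol_shift[OF FV(1)] by (simp add: w_per)
 have cm: "eigsol UNIV z (%x. eit t*F x) (%x. eit t*V x)"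
  using sol_cmult[OF FV(1), of "eit t"] by (simp add: mult_ac)
 have "F (0 + a) = eit t*F 0" "V (0 + a) = eit t*V 0"
  using eq[of a] FV bc a_pos by auto
 from sol_unique[OF sh cm this] have "bloch t z F V"
  using FV(1) by (simp add: bloch_def qper_def fun_eq_iff)
 with eq show ?thesis by blast
qed

lemma blochD:
 assumes "bloch t z f v"
 shows "eigsol UNIV z f v" "f (x + a) = eit t*f x" "v (x + a) = eit t * v x"
  "continuous_on A f" "continuous_on A v" "f : H"
 using assms sol_continuous_UNIV[of _ f v] cont_H by (auto simp: bloch_def qper_def)

lemma bloch_fiber_op:
 assumes b: "bloch t z f v"
 shows "fiber_op w p q a t f (%x. z*f x)"
 unfolding fiber_op_iff
proof (intro conjI exI)
 show "(%x. z*f x) : H" by (intro L2_cmult blochD(6)[OF b])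
 show "sol {0..a} (%x. cx (w x)*(z*f x)) f v"
  using sol_subset[OF blochD(1)[OF b] subset_UNIV, of "{0..a}"] by (simp add: mult_ac)
qed (use blochD(2,3)[OF b, of 0] in simp_all)

lemma bloch_trivial:
 assumes b: "bloch t z f v" and "nrm f = 0"
 shows "f = (%_. 0)" "v = (%_. 0)"
proof -
 have f0: "f x = 0" if "x : {0..a}" for x by (rule nrm_eq_0_imp[OF blochD(4)[OF b] assms(2) that])
 have v0: "v 0 = 0"
  by (rule sol_zero_imp[OF sol_subset[OF blochD(1)[OF b] subset_UNIV] f0]) (use a_pos in auto)
 have z: "eigsol UNIV z (%_. 0) (%_. 0)" using sol_zero by simp
 show "f = (%_. 0)" "v = (%_. 0)"
  using sol_unique[OF blochD(1)[OF b] z, of 0] f0[of 0] v0 a_pos by auto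
qed

text \<open>Continuous dependence: \<open>f n - F\<close> satisfies the equation at z n with the
  small source \<open>(z n - z') w F + ze n\<close>, so \<open>sol_bound\<close> gives uniform
  convergence.\<close>

lemma sol_tendsto:
 fixes f v ze :: "nat => real => complex" and z :: "nat => complex"
 assumes s: "!!n. sol {0..a} (%x. z n*cx (w x)*f n x + ze n x) (f n) (v n)"
  and z: "z ----> z'" and c: "(%n. f n 0) ----> F 0" "(%n. v n 0) ----> V 0"
  and ze: "(%n. integral {0..a} (%x. cmod (ze n x))) ----> 0"
  and FV: "eigsol UNIV z' F V"
 obtains dl :: "nat => real" where "dl ----> 0"
  "!!n x. x : {0..a} ==> cmod (f n x - F x) + cmod (v n x - V x) <= dl n"
proof -
 have "Bseq z" using z by (rule convergentI[THEN convergent_imp_Bseq])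
 then obtain Z where Z: "!!n. cmod (z n) <= Z" by (auto simp: Bseq_def)
 have S: "sol {0..a} (%x. z'*cx (w x)*F x) F V" by (rule sol_subset[OF FV subset_UNIV])
 have Fc: "continuous_on {0..a} F" using sol_continuous_UNIV[OF FV] by blast
 have wF: "(%x. cx (w x)*F x) abs_int_on {0..a}"
  by (rule coeff_mult_int(3)[OF Fc])
 have fc: "continuous_on {0..a} (f n)" for n using sol_continuous[OF s order_refl] by blast
 have zei: "ze n abs_int_on {0..a}" for n
 proof -
  have "(%x. z n*(cx (w x)*f n x)) abs_int_on {0..a}"
   by (intro set_integrable_mult_right coeff_mult_int(3) fc)
  from set_integral_diff(1)[OF sol_source_int[OF s order_refl less_imp_le[OF a_pos], of n] this]
  show ?thesis by (simp add: mult.assoc)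
 qed
 define rh where "rh n x = (z n - z')*(cx (w x)*F x) + ze n x" for n x
 define C where "C = exp (2*integral {0..a} (coeff_bound Z))"
 define W where "W = integral {0..a} (%x. cmod (cx (w x)*F x))"
 define dl where "dl n = 2*(cmod (f n 0 - F 0) + cmod (v n 0 - V 0) +
   (cmod (z n - z')*W + integral {0..a} (%x. cmod (ze n x))))*C" for n
 show ?thesis
 proof (rule that[of dl])
  have "dl ----> 2*(cmod (F 0 - F 0) + cmod (V 0 - V 0) + (cmod (z' - z')*W + 0))*C"
   unfolding dl_def by (intro tendsto_intros c z ze)
  then show "dl ----> 0" by simp
  fix n x assume x: "x : {0..a}"
  have "sol {0..a} (%x. z n*cx (w x)*(f n x - F x) + rh n x) (%x. f n x - F x) (%x. v n x - V x)"
   by (rule sol_cong[OF sol_diff[OF s[of n] S]]) (simp_all add: rh_def algebra_simps)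
  from sol_bound[OF this _ x Z, of 0]
  have "cmod (f n x - F x) + cmod (v n x - V x) <=
    2*(cmod (f n 0 - F 0) + cmod (v n 0 - V 0) + integral {0..a} (%x. cmod (rh n x)))*C"
   using a_pos by (simp add: C_def)
  also have "integral {0..a} (%x. cmod (rh n x)) <=
    integral {0..a} (%x. cmod (z n - z')*cmod (cx (w x)*F x) + cmod (ze n x))"
  proof (rule integral_le)
   have "rh n abs_int_on {0..a}" unfolding rh_def[abs_def]
    by (intro set_integral_add(1) set_integrable_mult_right wF zei)
   then show "(%x. cmod (rh n x)) integrable_on {0..a}" by (simp add: abs_int_def)
   show "(%x. cmod (z n - z')*cmod (cx (w x)*F x) + cmod (ze n x)) integrable_on {0..a}"
    using wF zei[of n] by (intro integrable_add integrable_on_mult_right) (simp_all add: abs_int_def)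
   show "cmod (rh n x) <= cmod (z n - z')*cmod (cx (w x)*F x) + cmod (ze n x)" for x
    unfolding rh_def by (rule order_trans[OF norm_triangle_ineq]) (simp add: norm_mult)
  qed
  also have "... = cmod (z n - z')*W + integral {0..a} (%x. cmod (ze n x))"
  proof -
   have "(%x. cmod (cx (w x)*F x)) integrable_on {0..a}" "(%x. cmod (ze n x)) integrable_on {0..a}"
    using wF zei[of n] by (simp_all add: abs_int_def)
   then show ?thesis unfolding W_def
    by (simp only: Henstock_Kurzweil_Integration.integral_add[OF integrable_on_mult_right] integral_mult_right)
  qed
  finally show "cmod (f n x - F x) + cmod (v n x - V x) <= dl n"
   by (simp add: dl_def C_def)
 qed
qed

lemma nrm_tendsto:
 assumes d: "dl ----> 0" and le: "!!n x. x : {0..a} ==> cmod (f n x - F x) + cmod (v n x - V x) <= dl n"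
  and f: "!!n. continuous_on {0..a} (f n)" and F: "continuous_on {0..a} F"
 shows "(%n. nrm (%x. f n x - F x)) ----> 0" "(%n. nrm (f n)) ----> nrm F"
proof -
 have "nrm (%x. f n x - F x) <= dl n*nrm (%_. 1)" for n
 proof (rule nrm_le_sup)
  show "continuous_on {0..a} (%x. f n x - F x)" by (intro continuous_intros f F)
  show "cmod (f n x - F x) <= dl n" if "x : {0..a}" for x
   using le[OF that, of n] norm_ge_zero[of "v n x - V x"] by linarith
 qed
 note le' = this
 have lim: "(%n. dl n*nrm (%_. 1)) ----> 0" using tendsto_mult_right[OF d, of "nrm (%_. 1)"] by simp
 show 1: "(%n. nrm (%x. f n x - F x)) ----> 0"
  by (rule tendsto_sandwich[OF _ _ tendsto_const lim]) (simp_all only: l2norm_nonneg le' eventually_True)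
 have H: "f n : H" "F : H" "(%x. f n x - F x) : H" "(%x. F x - f n x) : H" for n
  using f F by (auto intro!: cont_H continuous_intros)
 have "\<bar>nrm (f n) - nrm F\<bar> <= nrm (%x. f n x - F x)" for n
 proof -
  have "nrm (f n) <= nrm (%x. f n x - F x) + nrm F"
   using l2norm_triangle[OF H(3,2), of n] by simp
  moreover have "nrm F <= nrm (%x. F x - f n x) + nrm (f n)"
   using l2norm_triangle[OF H(4,1), of n n] by simp
  moreover have "nrm (%x. F x - f n x) = nrm (%x. f n x - F x)"
   by (simp add: l2norm_def norm_minus_commute)
  ultimately show ?thesis by linarith
 qed
 then have "(%n. nrm (f n) - nrm F) ----> 0"
  by (intro Lim_null_comparison[OF _ 1]) auto
 then show "(%n. nrm (f n)) ----> nrm F" by (rule LIM_zero_cancel)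
qed

text \<open>By compactness: normalised data with vanishing norms and sources would converge to the
  data of a solution F with norm 0, hence to zero. The bound lets eigenfunctions of norm 1 be
  compared through finitely many numbers.\<close>

lemma data_bound:
 "\<exists>C. \<forall>z f v ze. cmod z <= Z --> sol {0..a} (%x. z*cx (w x)*f x + ze x) f v -->
   cmod (f 0) + cmod (v 0) <= C*(nrm f + integral {0..a} (%x. cmod (ze x)))"
proof (rule ccontr)
 assume "\<not> ?thesis"
 then have "\<forall>n. \<exists>z f v ze. cmod z <= Z & sol {0..a} (%x. z*cx (w x)*f x + ze x) f v \<and>
   cmod (f 0) + cmod (v 0) > real (Suc n)*(nrm f + integral {0..a} (%x. cmod (ze x)))"
  by (simp only: not_ex not_all not_imp not_le) blast
 then obtain z f v ze where A: "!!n. cmod (z n) <= Z"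
   "!!n. sol {0..a} (%x. z n*cx (w x)*f n x + ze n x) (f n) (v n)"
   "!!n::nat. cmod (f n 0) + cmod (v n 0) > real (Suc n)*(nrm (f n) + integral {0..a} (%x. cmod (ze n x)))"
  by (simp only: choice_iff) blast
 define I where "I n = integral {0..a} (%x. cmod (ze n x))" for n
 \<comment> \<open>A non-integrable function has integral 0 by convention, so the sign is right in
   every case.\<close>
 have I0: "0 <= I n" for n unfolding I_def
  by (cases "(%x. cmod (ze n x)) integrable_on {0..a}") (auto intro: integral_nonneg simp: not_integrable_integral)
 define B where "B n = cmod (f n 0) + cmod (v n 0)" for n
 have Bpos: "0 < B n" for n
 proof -
  have "0 <= real (Suc n)*(nrm (f n) + I n)"
   using I0[of n] l2norm_nonneg[of "L2a w a" "f n"] by (intro mult_nonneg_nonneg add_nonneg_nonneg) auto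
  also have "... < B n" using A(3)[of n] unfolding B_def I_def .
  finally show ?thesis .
 qed
 define f' where "f' n x = f n x/B n" for n x
 define v' where "v' n x = v n x/B n" for n x
 define ze' where "ze' n x = ze n x/B n" for n x
 have s': "sol {0..a} (%x. z n*cx (w x)*f' n x + ze' n x) (f' n) (v' n)" for n
  by (rule sol_cong[OF sol_cmult[OF A(2)[of n], of "1/B n"]])
   (use Bpos[of n] in \<open>auto simp: f'_def v'_def ze'_def field_simps\<close>)
 have data: "cmod (f' n 0) + cmod (v' n 0) = 1" for n
 proof -
  have "cmod (cx (B n)) = B n" using Bpos[of n] by simp
  then have "cmod (f' n 0) + cmod (v' n 0) = B n/B n"
   unfolding f'_def v'_def norm_divide by (simp only: B_def add_divide_distrib)
  then show ?thesis using Bpos[of n] by simp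
 qed
 have small: "nrm (f' n) + integral {0..a} (%x. cmod (ze' n x)) <= 1/real (Suc n)" for n
 proof -
  have "nrm (f' n) = nrm (f n)/B n"
   using l2norm_cmult[of "L2a w a" "1/B n" "f n"] Bpos[of n] by (simp add: f'_def[abs_def] norm_divide)
  moreover have "integral {0..a} (%x. cmod (ze' n x)) = I n/B n"
   using Bpos[of n] by (simp add: ze'_def norm_divide I_def)
  ultimately have "nrm (f' n) + integral {0..a} (%x. cmod (ze' n x)) = (nrm (f n) + I n)/B n"
   by (simp only: add_divide_distrib)
  also have "... <= 1/real (Suc n)"
  proof -
   have "(nrm (f n) + I n)*real (Suc n) <= B n"
    using A(3)[of n] unfolding B_def I_def by (simp only: mult.commute less_imp_le)
   then show ?thesis using Bpos[of n] by (simp add: pos_divide_le_eq pos_le_divide_eq)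
  qed
  finally show ?thesis .
 qed
 have mem: "(f' n 0, v' n 0, z n) : cball 0 1 \<times> cball 0 1 \<times> cball 0 Z" for n
 proof -
  have "cmod (f' n 0) <= 1" "cmod (v' n 0) <= 1"
   using data[of n] norm_ge_zero[of "f' n 0"] norm_ge_zero[of "v' n 0"] by linarith+
  then show ?thesis using A(1)[of n] by simp
 qed
 have "compact (cball 0 1 \<times> cball 0 1 \<times> cball 0 Z :: (complex \<times> complex \<times> complex) set)"
  by (intro compact_Times compact_cball)
 from this[unfolded compact_def, rule_format, of "%n. (f' n 0, v' n 0, z n)", OF mem]
 obtain l r where r: "strict_mono (r :: nat => nat)" and l: "((%n. (f' n 0, v' n 0, z n)) \<circ> r) ----> l"
  by blast
 obtain c0 c1 z' where lc: "l = (c0, c1, z')" by (cases l)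
 have lim: "(%n. f' (r n) 0) ----> c0" "(%n. v' (r n) 0) ----> c1" "(%n. z (r n)) ----> z'"
  using tendsto_fst[OF l] tendsto_fst[OF tendsto_snd[OF l]] tendsto_snd[OF tendsto_snd[OF l]] by (simp_all add: lc o_def)
 obtain F V where FV: "eigsol UNIV z' F V" "F 0 = c0" "V 0 = c1" using ivp_exists by blast
 have s1: "(%n. 1/real (Suc (r n))) ----> 0"
  using LIMSEQ_subseq_LIMSEQ[OF LIMSEQ_Suc[OF lim_1_over_n] r] by (simp add: o_def)
 have int0: "0 <= integral {0..a} (%x. cmod (ze' n x))" for n
  by (cases "(%x. cmod (ze' n x)) integrable_on {0..a}") (auto intro: integral_nonneg simp: not_integrable_integral)
 have small1: "nrm (f' n) <= 1/real (Suc n)" "integral {0..a} (%x. cmod (ze' n x)) <= 1/real (Suc n)" for n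
  using small[of n] int0[of n] l2norm_nonneg[of "L2a w a" "f' n"] by linarith+
 have ze0: "(%n. integral {0..a} (%x. cmod (ze' (r n) x))) ----> 0"
  by (rule tendsto_sandwich[OF _ _ tendsto_const s1]) (simp_all only: int0 small1 eventually_True)
 have f0: "(%n. nrm (f' (r n))) ----> 0"
  by (rule tendsto_sandwich[OF _ _ tendsto_const s1]) (simp_all only: l2norm_nonneg small1 eventually_True)
 obtain dl where dl: "dl ----> 0" "!!n x. x : {0..a} ==> cmod (f' (r n) x - F x) + cmod (v' (r n) x - V x) <= dl n"
 proof (rule sol_tendsto[of "%n. z (r n)" "%n. f' (r n)" "%n. ze' (r n)" "%n. v' (r n)" z' F V])
  show "(%n. f' (r n) 0) ----> F 0" "(%n. v' (r n) 0) ----> V 0" using lim FV by simp_all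
 qed (use s' lim ze0 FV in blast)+
 have Fc: "continuous_on {0..a} F" using sol_continuous_UNIV[OF FV(1)] by blast
 have "(%n. nrm (f' (r n))) ----> nrm F"
  by (rule nrm_tendsto(2)[OF dl]) (use sol_continuous[OF s' order_refl] Fc in auto)
 then have "nrm F = 0" using f0 LIMSEQ_unique by blast
 then have F0: "F x = 0" if "x : {0..a}" for x using nrm_eq_0_imp[OF Fc _ that] by simp
 have "V 0 = 0"
  by (rule sol_zero_imp[OF sol_subset[OF FV(1) subset_UNIV] F0]) (use a_pos in auto)
 moreover have "F 0 = 0" using F0 a_pos by simp
 moreover have "(%n. cmod (f' (r n) 0) + cmod (v' (r n) 0)) ----> cmod c0 + cmod c1"
  by (intro tendsto_intros lim)
 ultimately have "(%n. 1::real) ----> 0" using data FV by simp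
 then show False using LIMSEQ_unique[OF tendsto_const[of "1::real"]] by fastforce
qed

text \<open>The data, the parameters z and the t stay in a compact set; convergence of these numbers
  along a subsequence is uniform convergence of the functions. The perturbation ze admits
  approximate eigenfunctions, which the blow-up argument for the resolvent produces.\<close>

lemma bloch_compact:
 fixes f v ze :: "nat => real => complex" and z :: "nat => complex" and t :: "nat => real"
 assumes t: "!!n. t n : {-pi..pi}" and Z: "!!n. cmod (z n) <= Z"
  and s: "!!n. sol {0..a} (%x. z n*cx (w x)*f n x + ze n x) (f n) (v n)"
  and bc: "!!n. f n a = exp (\<i> * of_real (t n))*f n 0" "!!n. v n a = exp (\<i> * of_real (t n)) * v n 0"
  and ze: "(%n. integral {0..a} (%x. cmod (ze n x))) ----> 0"
  and nrm: "!!n. nrm (f n) = 1"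
 obtains r t' z' F V where "strict_mono (r :: nat => nat)" "t' : {-pi..pi}" "(%n. t (r n)) ----> t'"
  "(%n. z (r n)) ----> z'" "bloch t' z' F V" "nrm F = 1" "(%n. nrm (%x. f (r n) x - F x)) ----> 0"
proof -
 obtain C where C: "!!z f v ze. cmod z <= Z ==> sol {0..a} (%x. z*cx (w x)*f x + ze x) f v ==>
   cmod (f 0) + cmod (v 0) <= C*(nrm f + integral {0..a} (%x. cmod (ze x)))"
  using data_bound[of Z] by blast
 obtain L where L: "!!n. integral {0..a} (%x. cmod (ze n x)) <= L"
 proof -
  obtain K where "!!n. norm (integral {0..a} (%x. cmod (ze n x))) <= K"
   using convergent_imp_Bseq[OF convergentI[OF ze]] unfolding Bseq_def by blast
  then have "integral {0..a} (%x. cmod (ze n x)) <= K" for n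
   using abs_ge_self order_trans unfolding real_norm_def by blast
  then show ?thesis by (rule that)
 qed
 define B where "B = \<bar>C\<bar>*(1 + \<bar>L\<bar>)"
 have Bn: "cmod (f n 0) + cmod (v n 0) <= B" for n
 proof -
  have I0: "0 <= integral {0..a} (%x. cmod (ze n x))"
   by (cases "(%x. cmod (ze n x)) integrable_on {0..a}") (auto intro: integral_nonneg simp: not_integrable_integral)
  have "cmod (f n 0) + cmod (v n 0) <= C*(1 + integral {0..a} (%x. cmod (ze n x)))"
   using C[OF Z s, of n] nrm by simp
  also have "... <= \<bar>C\<bar>*(1 + \<bar>L\<bar>)" using L[of n] I0 by (intro mult_mono) auto
  finally show ?thesis by (simp add: B_def)
 qed
 have "cmod (f n 0) <= B" "cmod (v n 0) <= B" for n
  using Bn[of n] norm_ge_zero[of "f n 0"] norm_ge_zero[of "v n 0"] by linarith+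
 then have mem: "(f n 0, v n 0, z n, t n) : cball 0 B \<times> cball 0 B \<times> cball 0 Z \<times> {-pi..pi}" for n
  using Z t by auto
 have "compact (cball 0 B \<times> cball 0 B \<times> cball 0 Z \<times> {-pi..pi} :: (complex \<times> complex \<times> complex \<times> real) set)"
  by (intro compact_Times compact_cball compact_Icc)
 from this[unfolded compact_def, rule_format, of "%n. (f n 0, v n 0, z n, t n)", OF mem] obtain l r where lS: "l : cball 0 B \<times> cball 0 B \<times> cball 0 Z \<times> {-pi..pi}"
  and r: "strict_mono (r :: nat => nat)" and l: "((%n. (f n 0, v n 0, z n, t n)) \<circ> r) ----> l"
  by blast
 obtain c0 c1 z' t' where lc: "l = (c0, c1, z', t')" by (cases l)
 have lim: "(%n. f (r n) 0) ----> c0" "(%n. v (r n) 0) ----> c1" "(%n. z (r n)) ----> z'" "(%n. t (r n)) ----> t'"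
  using tendsto_fst[OF l] tendsto_fst[OF tendsto_snd[OF l]] tendsto_fst[OF tendsto_snd[OF tendsto_snd[OF l]]]
   tendsto_snd[OF tendsto_snd[OF tendsto_snd[OF l]]] by (simp_all add: lc o_def)
 obtain F V where FV: "eigsol UNIV z' F V" "F 0 = c0" "V 0 = c1" using ivp_exists by blast
 have zer: "(%n. integral {0..a} (%x. cmod (ze (r n) x))) ----> 0"
  using LIMSEQ_subseq_LIMSEQ[OF ze r] by (simp add: o_def)
 obtain dl where dl: "dl ----> 0" "!!n x. x : {0..a} ==> cmod (f (r n) x - F x) + cmod (v (r n) x - V x) <= dl n"
 proof (rule sol_tendsto[of "%n. z (r n)" "%n. f (r n)" "%n. ze (r n)" "%n. v (r n)" z' F V])
  show "(%n. f (r n) 0) ----> F 0" "(%n. v (r n) 0) ----> V 0" using lim FV by simp_all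
 qed (use s lim zer FV in blast)+
 have Fc: "continuous_on {0..a} F" using sol_continuous_UNIV[OF FV(1)] by blast
 note N = nrm_tendsto[OF dl, OF _ sol_continuous(1)[OF s order_refl] Fc]
 have "nrm F = 1" using N(2) nrm LIMSEQ_unique[OF _ tendsto_const[of 1]] by auto
 have pt: "(%n. f (r n) x) ----> F x" "(%n. v (r n) x) ----> V x" if "x : {0..a}" for x
 proof -
  have "cmod (f (r n) x - F x) <= dl n" "cmod (v (r n) x - V x) <= dl n" for n
   using dl(2)[OF that, of n] norm_ge_zero[of "f (r n) x - F x"] norm_ge_zero[of "v (r n) x - V x"] by linarith+
  then have "(%n. f (r n) x - F x) ----> 0" "(%n. v (r n) x - V x) ----> 0"
   by (auto intro!: Lim_null_comparison[OF _ dl(1)])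
  then show "(%n. f (r n) x) ----> F x" "(%n. v (r n) x) ----> V x" by (auto intro: LIM_zero_cancel)
 qed
 have 0: "0 : {0..a}" "a : {0..a}" using a_pos by auto
 have "(%n. exp (\<i> * of_real (t (r n)))*f (r n) 0) ----> exp (\<i> * of_real t')*F 0"
  "(%n. exp (\<i> * of_real (t (r n))) * v (r n) 0) ----> exp (\<i> * of_real t')*V 0"
  by (intro tendsto_intros lim pt 0)+
 then have bc': "F a = exp (\<i> * of_real t')*F 0" "V a = exp (\<i> * of_real t')*V 0"
  using LIMSEQ_unique[OF pt(1)[OF 0(2)]] LIMSEQ_unique[OF pt(2)[OF 0(2)]] by (simp_all add: bc)
 obtain F' V' where F': "bloch t' z' F' V'" "\<forall>x\<in>{0..a}. F' x = F x & V' x = V x"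
 proof -
  have "\<exists>F' V'. bloch t' z' F' V' & (\<forall>x\<in>{0..a}. F' x = F x & V' x = V x)"
   by (rule bloch_of_boundary[OF sol_subset[OF FV(1) subset_UNIV] bc'])
  then show ?thesis by (elim exE conjE) (rule that)
 qed
 have "F = F'"
 proof (rule sol_unique(1)[OF FV(1) blochD(1)[OF F'(1)]])
  show "F 0 = F' 0" "V 0 = V' 0" using F'(2) 0 by auto
 qed
 with F'(1) have B: "bloch t' z' F V'" by simp
 have "t' : {-pi..pi}" using lS by (simp add: lc)
 then show ?thesis using that[OF r _ lim(4,3) B \<open>nrm F = 1\<close> N(1)] by simp
qed


section \<open>Multipliers of Bloch solutions at a fixed spectral parameter\<close>

lemma bloch_wronskian_const:
 assumes "eigsol UNIV z f v" "eigsol UNIV z g u"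
 shows "f x*u x - v x*g x = f y*u y - v y*g y"
proof -
 have *: "f y*u y - v y*g y = f x*u x - v x*g x" if "x <= y" for x y
  using primitive_onD(2)[OF sol_wronskian[OF assms] subset_UNIV that] by (simp add: mult_ac)
 show ?thesis using *[of x y] *[of y x] by (cases "x <= y") auto
qed

lemma parallel_data:
 assumes 1: "eigsol UNIV z f v" and 2: "eigsol UNIV z g u"
  and w0: "f 0*u 0 - v 0*g 0 = 0" and nz: "\<not> (f 0 = 0 & v 0 = 0)"
 obtains c where "g = (%x. c*f x)" "u = (%x. c * v x)"
proof -
 obtain c where c: "g 0 = c*f 0" "u 0 = c * v 0"
 proof (cases "f 0 = 0")
  case True
  then have "v 0 ~= 0" "g 0 = 0" using nz w0 by auto
  then show ?thesis using that[of "u 0/v 0"] True by simp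
 next
  case False
  then have "u 0 = g 0/f 0 * v 0" using w0 by (simp add: field_simps)
  then show ?thesis using that[of "g 0/f 0"] False by simp
 qed
 have "eigsol UNIV z (%x. c*f x) (%x. c * v x)" using sol_cmult[OF 1, of c] by (simp add: mult_ac)
 from sol_unique[OF 2 this, of 0] c that show ?thesis by auto
qed

lemma finite_exp_i_eq: "finite {t : {-pi..pi}. exp (\<i>*cx t) = exp (\<i>*cx s)}"
proof (cases "\<exists>t0\<in>{-pi..pi}. exp (\<i>*cx t0) = exp (\<i>*cx s)")
 case True
 then obtain t0 where t0: "t0 : {-pi..pi}" "exp (\<i>*cx t0) = exp (\<i>*cx s)" by blast
 have "t : {t0 - 2*pi, t0, t0 + 2*pi}" if t: "t : {-pi..pi}" "exp (\<i>*cx t) = exp (\<i>*cx s)" for t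
 proof -
  have "exp (\<i>*cx t) = exp (\<i>*cx t0)" using t t0 by simp
  then obtain n :: int where "\<i>*cx t = \<i>*cx t0 + cx (2*real_of_int n*pi)*\<i>"
   unfolding exp_eq by auto
  then have n: "t = t0 + 2*real_of_int n*pi" by (simp add: complex_eq_iff)
  then have "2*real_of_int n*pi <= 2*pi" "- (2*pi) <= 2*real_of_int n*pi"
   using t(1) t0(1) unfolding atLeastAtMost_iff by linarith+
  then have "\<bar>2*real_of_int n*pi\<bar> <= 2*pi" by linarith
  then have "\<bar>real_of_int n\<bar> <= 1" using pi_gt_zero by (simp add: abs_mult)
  then have "n = -1 \<or> n = 0 \<or> n = 1" by linarith
  then show ?thesis using n by auto
 qed
 then have "{t : {-pi..pi}. exp (\<i>*cx t) = exp (\<i>*cx s)} \<subseteq> {t0 - 2*pi, t0, t0 + 2*pi}" by blast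
 then show ?thesis by (rule finite_subset) simp
next
 case False
 then have "{t : {-pi..pi}. exp (\<i>*cx t) = exp (\<i>*cx s)} = {}" by blast
 then show ?thesis by (simp only: finite.emptyI)
qed

text \<open>Parallel Bloch solutions share their multiplier; independent ones have multipliers with
  product 1, because their Wronskian is constant and non-zero. So at most \<open>exp (i s)\<close>
  and its inverse occur.\<close>

lemma finite_bloch_parameters:
 "finite {t : {-pi..pi}. \<exists>f v. bloch t z f v & \<not> (f 0 = 0 & v 0 = 0)}" (is "finite ?T")
proof (cases "?T = {}")
 case False
 then obtain s f v where b: "bloch s z f v" "\<not> (f 0 = 0 & v 0 = 0)" by blast
 have "exp (\<i>*cx t) = exp (\<i>*cx s) \<or> exp (\<i>*cx t) = exp (\<i>*cx (-s))"
  if t: "bloch t z g u" "\<not> (g 0 = 0 & u 0 = 0)" for t g u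
 proof (cases "f 0*u 0 - v 0*g 0 = 0")
  case True
  obtain c where c: "g = (%x. c*f x)" "u = (%x. c * v x)"
   using parallel_data[OF blochD(1)[OF b(1)] blochD(1)[OF t(1)] True b(2)] by metis
  then have "g a = exp (\<i> * of_real s)*g 0" "u a = exp (\<i> * of_real s)*u 0"
   using blochD(2,3)[OF b(1), of 0] by simp_all
  moreover have "g a = eit t*g 0" "u a = eit t*u 0"
   using blochD(2,3)[OF t(1), of 0] by simp_all
  ultimately show ?thesis using t(2) by auto
 next
  case False
  have "f a*u a - v a*g a = (exp (\<i> * of_real s)*eit t)*(f 0*u 0 - v 0*g 0)"
   using blochD(2,3)[OF b(1), of 0] blochD(2,3)[OF t(1), of 0] by (simp add: algebra_simps)
  moreover have "f a*u a - v a*g a = f 0*u 0 - v 0*g 0"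
   by (rule bloch_wronskian_const[OF blochD(1)[OF b(1)] blochD(1)[OF t(1)]])
  ultimately have "exp (\<i>*cx s)*eit t = 1" using False by simp
  then have "exp (\<i>*cx t) = inverse (exp (\<i>*cx s))"
   by (metis inverse_unique)
  then show ?thesis by (simp add: exp_minus)
 qed
 then have "?T \<subseteq> {t : {-pi..pi}. exp (\<i>*cx t) = exp (\<i>*cx s)} \<union>
  {t : {-pi..pi}. exp (\<i>*cx t) = exp (\<i>*cx (-s))}" by blast
 then show ?thesis by (rule finite_subset) (intro finite_UnI finite_exp_i_eq)
next
 case True
 show ?thesis unfolding True by simp
qed

section \<open>The discriminant\<close>

text \<open>Uniqueness for the initial value problem discharges the definite description, so the
  discriminant can be computed from any fundamental system.\<close>

lemma sl_solution_eq:
 assumes s: "eigsol UNIV z u v"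
 shows "sl_solution w p q z (u 0) (v 0) = (u, v)"
 unfolding sl_solution_def
proof (rule the_equality)
 have "sol UNIV (%x. cx (w x)*(z*u x)) u v" using s by (simp add: mult_ac)
 from sl_expr_of_sol_UNIV[OF this]
 show "case (u, v) of (u', v') => AC_loc u' & AC_loc v' & sl_expr w p q UNIV u' v' (%x. z*u' x) & u' 0 = u 0 & v' 0 = v 0"
  by simp
 fix y
 assume "case y of (u', v') => AC_loc u' & AC_loc v' & sl_expr w p q UNIV u' v' (%x. z*u' x) & u' 0 = u 0 & v' 0 = v 0"
 then obtain u' v' where y: "y = (u', v')" "AC_loc u'" "AC_loc v'" "sl_expr w p q UNIV u' v' (%x. z*u' x)"
  "u' 0 = u 0" "v' 0 = v 0" by (cases y) auto
 have "continuous_on {c..d} u'" for c d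
  using y(2) ac_on_imp_continuous_on[of c d u'] by (cases "c <= d") (auto simp: AC_loc_def AC_on_iff_ac_on)
 then have "(%x. cx (w x)*(z*u' x)) abs_int_on {c..d}" for c d
  by (intro coeff_mult_int(3) continuous_intros)
 from sol_of_sl_expr_UNIV[OF y(2-4) this] have "eigsol UNIV z u' v'" by (simp add: mult_ac)
 from sol_unique[OF this s, of 0] y show "y = (u, v)" by simp
qed

lemma discriminant_eq:
 assumes "eigsol UNIV z f v" "f 0 = 1" "v 0 = 0" "eigsol UNIV z g u" "g 0 = 0" "u 0 = 1"
 shows "discriminant w p q a z = f a + u a"
 using sl_solution_eq[OF assms(1)] sl_solution_eq[OF assms(4)] assms by (simp add: discriminant_def)

text \<open>An exact difference formula. The Wronskians of solutions at z' with solutions at z equal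
  (z' - z) times integrals over the period; as the monodromy determinant is 1, Cramer's rule
  recovers \<open>f' a\<close> and \<open>u' a\<close> from them.\<close>

lemma discriminant_difference:
 assumes 1: "eigsol UNIV z f v" "f 0 = 1" "v 0 = 0" and 2: "eigsol UNIV z g u" "g 0 = 0" "u 0 = 1"
  and 3: "eigsol UNIV z' f' v'" "f' 0 = 1" "v' 0 = 0" and 4: "eigsol UNIV z' g' u'" "g' 0 = 0" "u' 0 = 1"
 defines "I \<equiv> %h k. integral {0..a} (%x. cx (w x)*(h x*k x))"
 shows "f' a + u' a - (f a + u a) =
  (z' - z)*(f a*I f' g - g a*I f' f - u a*I g' f + v a*I g' g)"
proof -
 have W: "h a*l a - m a*k a - (h 0*l 0 - m 0*k 0) = (z' - z)*I h k"
  if "eigsol UNIV z' h m" "eigsol UNIV z k l" for h m k l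
 proof -
  have "integral {0..a} (%x. z'*cx (w x)*h x*k x - h x*(z*cx (w x)*k x))
    = integral {0..a} (%x. (z' - z)*(cx (w x)*(h x*k x)))"
   by (simp add: algebra_simps)
  also have "... = (z' - z)*I h k" unfolding I_def by (rule integral_mult_right)
  finally show ?thesis
   using primitive_onD(2)[OF sol_wronskian[OF that] subset_UNIV less_imp_le[OF a_pos]] by simp
 qed
 have det: "f a*u a - v a*g a = 1" using bloch_wronskian_const[OF 1(1) 2(1), of a 0] 1 2 by simp
 have e: "f' a * v a - v' a*f a = (z' - z)*I f' f" "f' a*u a - v' a*g a = 1 + (z' - z)*I f' g"
  "g' a * v a - u' a*f a = - 1 + (z' - z)*I g' f" "g' a*u a - u' a*g a = (z' - z)*I g' g"
  using W[OF 3(1) 1(1)] W[OF 3(1) 2(1)] W[OF 4(1) 1(1)] W[OF 4(1) 2(1)] 1 2 3 4 by (simp_all add: algebra_simps)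
 have "f' a = f' a*(f a*u a - v a*g a)" using det by simp
 also have "... = f a*(f' a*u a - v' a*g a) - g a*(f' a * v a - v' a*f a)" by (simp add: algebra_simps)
 finally have A: "f' a = f a*(1 + (z' - z)*I f' g) - g a*((z' - z)*I f' f)" unfolding e .
 have "u' a = u' a*(f a*u a - v a*g a)" using det by simp
 also have "... = v a*(g' a*u a - u' a*g a) - u a*(g' a * v a - u' a*f a)" by (simp add: algebra_simps)
 finally have B: "u' a = v a*((z' - z)*I g' g) - u a*(- 1 + (z' - z)*I g' f)" unfolding e .
 show ?thesis by (subst A, subst B) (simp add: algebra_simps)
qed

lemma w_bilinear_integrable:
 assumes "continuous_on {0..a} h" "continuous_on {0..a} k"
 shows "(%x. cx (w x)*(h x*k x)) integrable_on {0..a}"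
 using coeff_mult_int(3)[of 0 a "%x. h x*k x"] assms
 by (auto intro!: continuous_intros simp: abs_int_def)

lemma w_bilinear_tendsto:
 assumes dl: "dl ----> 0" and le: "!!n x. x : {0..a} ==> cmod (h n x - h' x) <= dl n"
  and c: "!!n. continuous_on {0..a} (h n)" "continuous_on {0..a} h'" "continuous_on {0..a} k"
 shows "(%n. integral {0..a} (%x. cx (w x)*(h n x*k x)))
   ----> integral {0..a} (%x. cx (w x)*(h' x*k x))"
proof -
 define K where "K = integral {0..a} (%x. cmod (cx (w x)*k x))"
 have ki: "(%x. cmod (cx (w x)*k x)) integrable_on {0..a}"
  using coeff_mult_int(3)[OF c(3)] by (simp add: abs_int_def)
 have le': "cmod (integral {0..a} (%x. cx (w x)*(h n x*k x)) - integral {0..a} (%x. cx (w x)*(h' x*k x))) <= dl n*K" for n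
 proof -
  have "integral {0..a} (%x. cx (w x)*(h n x*k x)) - integral {0..a} (%x. cx (w x)*(h' x*k x))
   = integral {0..a} (%x. cx (w x)*(h n x*k x) - cx (w x)*(h' x*k x))"
   by (intro Henstock_Kurzweil_Integration.integral_diff[symmetric] w_bilinear_integrable c)
  also have "cmod ... <= integral {0..a} (%x. dl n*cmod (cx (w x)*k x))"
  proof (rule integral_norm_bound_integral)
   show "(%x. cx (w x)*(h n x*k x) - cx (w x)*(h' x*k x)) integrable_on {0..a}"
    by (intro integrable_diff w_bilinear_integrable c)
   show "(%x. dl n*cmod (cx (w x)*k x)) integrable_on {0..a}"
    by (intro integrable_on_mult_right ki)
   fix x assume x: "x : {0..a}"
   have "cmod (cx (w x)*(h n x*k x) - cx (w x)*(h' x*k x))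
    = cmod (h n x - h' x)*cmod (cx (w x)*k x)"
    by (simp add: norm_mult[symmetric] algebra_simps)
   also have "... <= dl n*cmod (cx (w x)*k x)" by (intro mult_right_mono le x) auto
   finally show "cmod (cx (w x)*(h n x*k x) - cx (w x)*(h' x*k x)) <= dl n*cmod (cx (w x)*k x)" .
  qed
  also have "... = dl n*K" unfolding K_def by (rule integral_mult_right)
  finally show ?thesis .
 qed
 have lim: "(%n. dl n*K) ----> 0" using tendsto_mult_right[OF dl, of K] by simp
 show ?thesis
 proof (rule LIM_zero_cancel, rule Lim_null_comparison[OF always_eventually lim])
  show "\<forall>n. norm (integral {0..a} (%x. cx (w x)*(h n x*k x)) -
    integral {0..a} (%x. cx (w x)*(h' x*k x))) <= dl n*K"
   using le' by blast
 qed
qed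

lemma eigsol_tendsto:
 assumes z: "(%n. z n) ----> z'" and s: "!!n. eigsol UNIV (z n) (f n) (v n)" and s': "eigsol UNIV z' f' v'"
  and c: "!!n. f n 0 = f' 0" "!!n. v n 0 = v' 0"
 shows "\<exists>dl :: nat => real. dl ----> 0 & (\<forall>n. \<forall>x\<in>{0..a}. cmod (f n x - f' x) <= dl n)"
proof -
 have s0: "sol {0..a} (%x. z n*cx (w x)*f n x + 0) (f n) (v n)" for n
  using sol_subset[OF s[of n] subset_UNIV] by simp
 have c': "(%n. f n 0) ----> f' 0" "(%n. v n 0) ----> v' 0" using c by simp_all
 have e0: "(%n. integral {0..a} (%x. cmod 0)) ----> 0" by simp
 show ?thesis
 proof (rule sol_tendsto[of z f "%n x. 0" v z' f' v', OF s0 z c' e0 s'])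
  fix dl :: "nat => real"
  assume "dl ----> 0" and d: "!!n x. x : {0..a} ==> cmod (f n x - f' x) + cmod (v n x - v' x) <= dl n"
  have "cmod (f n x - f' x) <= dl n" if "x : {0..a}" for n x
   using d[OF that, of n] norm_ge_zero[of "v n x - v' x"] by linarith
  with \<open>dl ----> 0\<close> show ?thesis by blast
 qed
qed

text \<open>After division by z' - z in the exact formula only the uniform convergence of the
  solutions over the period is left.\<close>

lemma discriminant_derivative:
 assumes 1: "eigsol UNIV z f v" "f 0 = 1" "v 0 = 0" and 2: "eigsol UNIV z g u" "g 0 = 0" "u 0 = 1"
 defines "I \<equiv> %h k. integral {0..a} (%x. cx (w x)*(h x*k x))"
 shows "deriv (discriminant w p q a) z = (f a - u a)*I f g - g a*I f f + v a*I g g"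
proof -
 have "(discriminant w p q a has_field_derivative ((f a - u a)*I f g - g a*I f f + v a*I g g)) (at z)"
  unfolding has_field_derivative_iff tendsto_at_iff_sequentially
 proof (intro allI impI)
  fix X :: "nat => complex"
  assume X: "\<forall>i. X i : UNIV - {z}" "X ----> z"
  have "\<forall>i. \<exists>f' v'. eigsol UNIV (X i) f' v' & f' 0 = 1 & v' 0 = 0" using ivp_exists by blast
  then obtain f' v' where 3: "!!i. eigsol UNIV (X i) (f' i) (v' i)" "!!i. f' i 0 = 1" "!!i. v' i 0 = 0"
   unfolding choice_iff by blast
  have "\<forall>i. \<exists>f' v'. eigsol UNIV (X i) f' v' & f' 0 = 0 & v' 0 = 1" using ivp_exists by blast
  then obtain g' u' where 4: "!!i. eigsol UNIV (X i) (g' i) (u' i)" "!!i. g' i 0 = 0" "!!i. u' i 0 = 1"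
   unfolding choice_iff by blast
  have eq: "(discriminant w p q a (X i) - discriminant w p q a z)/(X i - z) =
   f a*I (f' i) g - g a*I (f' i) f - u a*I (g' i) f + v a*I (g' i) g" for i
  proof -
   have "X i - z ~= 0" using X(1) by auto
   then show ?thesis
    unfolding discriminant_eq[OF 1 2] discriminant_eq[OF 3[of i] 4[of i]]
     discriminant_difference[OF 1 2 3[of i] 4[of i]] I_def by simp
  qed
  have c: "continuous_on {0..a} f" "continuous_on {0..a} g" "continuous_on {0..a} (f' i)" "continuous_on {0..a} (g' i)" for i
   using sol_continuous_UNIV[OF 1(1)] sol_continuous_UNIV[OF 2(1)] sol_continuous_UNIV[OF 3(1)] sol_continuous_UNIV[OF 4(1)] by blast+
  have i3: "f' n 0 = f 0" "v' n 0 = v 0" and i4: "g' n 0 = g 0" "u' n 0 = u 0" for n using 1 2 3 4 by simp_all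
  obtain dl1 :: "nat => real" where dl1: "dl1 ----> 0" "!!n x. x : {0..a} ==> cmod (f' n x - f x) <= dl1 n"
   using eigsol_tendsto[OF X(2) 3(1) 1(1) i3] by blast
  obtain dl2 :: "nat => real" where dl2: "dl2 ----> 0" "!!n x. x : {0..a} ==> cmod (g' n x - g x) <= dl2 n"
   using eigsol_tendsto[OF X(2) 4(1) 2(1) i4] by blast
  note T = w_bilinear_tendsto[OF dl1, OF _ c(3) c(1)] w_bilinear_tendsto[OF dl2, OF _ c(4) c(2)]
  have lims: "(%i. I (f' i) g) ----> I f g" "(%i. I (f' i) f) ----> I f f" "(%i. I (g' i) f) ----> I g f" "(%i. I (g' i) g) ----> I g g"
   unfolding I_def using T c by auto
  have "(%i. f a*I (f' i) g - g a*I (f' i) f - u a*I (g' i) f + v a*I (g' i) g)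
   ----> f a*I f g - g a*I f f - u a*I g f + v a*I g g"
   by (intro tendsto_intros lims)
  moreover have "I g f = I f g" unfolding I_def by (simp add: mult_ac)
  ultimately have "(%i. (discriminant w p q a (X i) - discriminant w p q a z)/(X i - z))
   ----> (f a - u a)*I f g - g a*I f f + v a*I g g"
   unfolding eq by (simp add: algebra_simps)
  then show "((%y. (discriminant w p q a y - discriminant w p q a z)/(y - z)) \<circ> X)
   ----> (f a - u a)*I f g - g a*I f f + v a*I g g" by (simp add: o_def)
 qed
 then show ?thesis by (rule DERIV_imp_deriv)
qed

text \<open>Write X = al f + be g in the real fundamental system and let D be the derivative of the
  discriminant. The eigenvector equation of the monodromy matrix gives |al|^2 D = - g(a) [X, X] and
  |be|^2 D = v(a) [X, X], and one of al, be is non-zero.\<close>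

lemma discriminant_derivative_neutral:
 assumes b: "bloch t (cx l) X Y" and nz: "\<not> (X 0 = 0 & Y 0 = 0)" and neutral: "br X X = 0"
 shows "deriv (discriminant w p q a) (cx l) = 0"
proof -
 let ?z = "cx l"
 obtain f v where 1: "eigsol UNIV ?z f v" "f 0 = 1" "v 0 = 0" using ivp_exists by blast
 obtain g u where 2: "eigsol UNIV ?z g u" "g 0 = 0" "u 0 = 1" using ivp_exists by blast
 define I where "I h k = integral {0..a} (%x. cx (w x)*(h x*k x))" for h k :: "real => complex"
 define al where "al = X 0"
 define be where "be = Y 0"
 have c: "continuous_on {0..a} f" "continuous_on {0..a} g"
  using sol_continuous_UNIV[OF 1(1)] sol_continuous_UNIV[OF 2(1)] by blast+
 have cn: "eigsol UNIV ?z (%x. cnj (h x)) (%x. cnj (k x))" if "eigsol UNIV ?z h k" for h k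
  using sol_cnj[OF that] by simp
 have "(%x. cnj (f x)) = f" "(%x. cnj (v x)) = v" using sol_unique[OF cn[OF 1(1)] 1(1), of 0] 1 by auto
 then have rf: "cnj (f x) = f x" "cnj (v x) = v x" for x by metis+
 have "(%x. cnj (g x)) = g" "(%x. cnj (u x)) = u" using sol_unique[OF cn[OF 2(1)] 2(1), of 0] 2 by auto
 then have rg: "cnj (g x) = g x" "cnj (u x) = u x" for x by metis+
 have comb: "eigsol UNIV ?z (%x. al*f x + be*g x) (%x. al * v x + be*u x)"
  by (rule sol_cong[OF sol_add[OF sol_cmult[OF 1(1), of al] sol_cmult[OF 2(1), of be]]]) (simp_all add: algebra_simps)
 have X: "X = (%x. al*f x + be*g x)" "Y = (%x. al * v x + be*u x)"
 proof -
  have "X 0 = al*f 0 + be*g 0" "Y 0 = al * v 0 + be*u 0" using 1 2 by (simp_all add: al_def be_def)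
  from sol_unique[OF blochD(1)[OF b] comb this]
  show "X = (%x. al*f x + be*g x)" "Y = (%x. al * v x + be*u x)" .
 qed
 define mu where "mu = eit t"
 have mu1: "mu*cnj mu = 1" unfolding mu_def by (rule exp_i_mult_cnj)
 have e1: "f a*al + g a*be = mu*al" and e2: "v a*al + u a*be = mu*be"
  using blochD(2,3)[OF b, of 0] 1 2 unfolding X mu_def by (simp_all add: mult_ac)
 have det: "f a*u a - v a*g a = 1" using bloch_wronskian_const[OF 1(1) 2(1), of a 0] 1 2 by simp
 have tr: "f a + u a = mu + cnj mu"
 proof -
  have "al*((f a - mu)*(u a - mu) - v a*g a) = 0" using e1 e2 by algebra
  moreover have "be*((f a - mu)*(u a - mu) - v a*g a) = 0" using e1 e2 by algebra
  ultimately have "(f a - mu)*(u a - mu) - v a*g a = 0" using nz by (auto simp: al_def be_def)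
  then have "mu*(f a + u a) = 1 + mu*mu" using det by (simp add: algebra_simps)
  then have "cnj mu*(mu*(f a + u a)) = cnj mu*(1 + mu*mu)" by simp
  moreover have "cnj mu*(mu*(f a + u a)) = (mu*cnj mu)*(f a + u a)" "cnj mu*(1 + mu*mu) = cnj mu + (mu*cnj mu)*mu"
   by (simp_all add: algebra_simps)
  ultimately show ?thesis unfolding mu1 by (simp add: add.commute)
 qed
 have e1': "f a*cnj al + g a*cnj be = cnj mu*cnj al" and e2': "v a*cnj al + u a*cnj be = cnj mu*cnj be"
  using arg_cong[OF e1, of cnj] arg_cong[OF e2, of cnj] rf rg by simp_all
 have "br X X = al*cnj al*I f f + (al*cnj be + cnj al*be)*I f g + be*cnj be*I g g"
 proof -
  have XH: "X : H" by (rule blochD(6)[OF b])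
  note i = w_bilinear_integrable[OF c(1) c(1)] w_bilinear_integrable[OF c(1) c(2)] w_bilinear_integrable[OF c(2) c(2)]
  have "br X X = integral {0..a} (%x. X x*cnj (X x)*cx (w x))" by (rule br_eq[OF XH XH])
  also have "... = integral {0..a} (%x. al*cnj al*(cx (w x)*(f x*f x)) + (al*cnj be + cnj al*be)*(cx (w x)*(f x*g x)) + be*cnj be*(cx (w x)*(g x*g x)))"
   unfolding X by (simp add: rf rg algebra_simps)
  also have "... = integral {0..a} (%x. al*cnj al*(cx (w x)*(f x*f x))) + integral {0..a} (%x. (al*cnj be + cnj al*be)*(cx (w x)*(f x*g x))) + integral {0..a} (%x. be*cnj be*(cx (w x)*(g x*g x)))"
   by (simp only: Henstock_Kurzweil_Integration.integral_add integrable_add integrable_on_mult_right i)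
  finally show ?thesis by (simp only: integral_mult_right I_def)
 qed
 then have n: "al*cnj al*I f f + (al*cnj be + cnj al*be)*I f g + be*cnj be*I g g = 0"
  using neutral by simp
 define D where "D = (f a - u a)*I f g - g a*I f f + v a*I g g"
 \<comment> \<open>These identities say that the coefficients of the quadratic relation
   \<open>n\<close> are proportional to \<open>- g a\<close>, \<open>f a - u a\<close>,
   \<open>v a\<close>, the coefficients of D.\<close>
 have sym: "- g a*(be*cnj be) = v a*(al*cnj al)"
  using e1 e2' tr by algebra
 have s1: "- g a*(al*cnj be + cnj al*be) = (al*cnj al)*(f a - u a)"
  using e1 e1' tr by algebra
 have s2: "v a*(al*cnj be + cnj al*be) = (be*cnj be)*(f a - u a)"
  using e2 e2' tr by algebra
 have D1: "(al*cnj al)*D = 0"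
  using n sym s1 unfolding D_def by algebra
 have D2: "(be*cnj be)*D = 0"
  using n sym s2 unfolding D_def by algebra
 have "D = 0" using D1 D2 nz by (auto simp: al_def be_def)
 then show ?thesis unfolding discriminant_derivative[OF 1 2] D_def I_def .
qed

section \<open>Bloch eigenvalues belong to the spectrum of the maximal operator\<close>

lemma cell_integral_tendsto_0:
 fixes g :: "real => real"
 assumes g: "integrable lebesgue g"
 shows "(%n. integral\<^sup>L lebesgue (%x. indicator {real n*a..real n*a + a} x*g x)) ----> 0"
  "(%n. integral\<^sup>L lebesgue (%x. indicator {- (real n*a) - a..- (real n*a)} x*g x)) ----> 0"
proof -
 have m [measurable]: "g : borel_measurable lebesgue" using g by auto
 have ev: "eventually (%n. x < real n*a) sequentially" for x
 proof -
  obtain N where "x/a < real N" using reals_Archimedean2 by blast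
  then have N: "x < real N*a" using a_pos by (simp add: field_simps)
  have "x < real n*a" if "N <= n" for n
  proof -
   have "real N*a <= real n*a" using that a_pos by simp
   then show ?thesis using N by linarith
  qed
  then show ?thesis unfolding eventually_sequentially by blast
 qed
 have "(%n. integral\<^sup>L lebesgue (%x. indicator {real n*a..real n*a + a} x*g x)) ----> integral\<^sup>L lebesgue (%x::real. 0 :: real)"
 proof (rule integral_dominated_convergence[where w = "%x. \<bar>g x\<bar>"])
  show "AE x in lebesgue. (%n. indicator {real n*a..real n*a + a} x*g x) ----> 0"
  proof (rule always_eventually, rule allI, rule tendsto_eventually)
   fix x
   show "eventually (%n. indicator {real n*a..real n*a + a} x*g x = 0) sequentially"
    by (rule eventually_mono[OF ev[of x]]) (simp add: indicator_def)
  qed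
  show "(%x. indicator {real n*a..real n*a + a} x*g x) : borel_measurable lebesgue" for n
   by (intro borel_measurable_times borel_measurable_indicator m) simp
 qed (use g in \<open>auto simp: indicator_def intro!: always_eventually\<close>)
 then show "(%n. integral\<^sup>L lebesgue (%x. indicator {real n*a..real n*a + a} x*g x)) ----> 0" by simp
 have "(%n. integral\<^sup>L lebesgue (%x. indicator {- (real n*a) - a..- (real n*a)} x*g x)) ----> integral\<^sup>L lebesgue (%x::real. 0 :: real)"
 proof (rule integral_dominated_convergence[where w = "%x. \<bar>g x\<bar>"])
  show "AE x in lebesgue. (%n. indicator {- (real n*a) - a..- (real n*a)} x*g x) ----> 0"
  proof (rule always_eventually, rule allI, rule tendsto_eventually)
   fix x
   show "eventually (%n. indicator {- (real n*a) - a..- (real n*a)} x*g x = 0) sequentially"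
    by (rule eventually_mono[OF ev[of "-x"]]) (simp add: indicator_def)
  qed
  show "(%x. indicator {- (real n*a) - a..- (real n*a)} x*g x) : borel_measurable lebesgue" for n
   by (intro borel_measurable_times borel_measurable_indicator m) simp
 qed (use g in \<open>auto simp: indicator_def intro!: always_eventually\<close>)
 then show "(%n. integral\<^sup>L lebesgue (%x. indicator {- (real n*a) - a..- (real n*a)} x*g x)) ----> 0" by simp
qed

lemma shifted_nrm:
 assumes c: "continuous_on UNIV h"
 shows "(nrm (%x. h (s + x)))^2 = integral\<^sup>L lebesgue (%x. indicator {s..s + a} x*(\<bar>w (x - s)\<bar>*(cmod (h x))^2))"
proof -
 have hc: "continuous_on {0..a} (%x. h (s + x))" "continuous_on {s..s+a} h"
  by (rule continuous_on_compose2[OF c], auto intro!: continuous_intros) (rule continuous_on_subset[OF c], simp)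
 have wi: "(%x. w (- s + 1*x)) abs_int_on {s..s+a}"
  by (rule absolutely_integrable_affine) (use w_int a_pos in auto)
 then have aw: "(%x. \<bar>w (x - s)\<bar>) abs_int_on {s..s+a}"
  using absolutely_integrable_abs[OF wi] by (simp add: o_def)
 have ai: "(%x. \<bar>w (x - s)\<bar>*(cmod (h x))^2) abs_int_on {s..s + a}"
  by (intro absolutely_integrable_continuous_mult(1) aw continuous_intros hc)
 have "((%x. \<bar>w (x - s)\<bar>*(cmod (h x))^2) has_integral integral {s..s+a} (%x. \<bar>w (x - s)\<bar>*(cmod (h x))^2)) {s..s + a}"
  using ai by (simp add: abs_int_def integrable_integral)
 then have "((%x. \<bar>w (s + 1*x - s)\<bar>*(cmod (h (s + 1*x)))^2) has_integral (1/\<bar>1\<bar>) *\<^sub>R integral {s..s+a} (%x. \<bar>w (x - s)\<bar>*(cmod (h x))^2)) {0..a}"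
  using a_pos by (intro has_integral_affine) auto
 then have "integral {0..a} (%x. \<bar>w x\<bar>*(cmod (h (s + x)))^2) = integral {s..s+a} (%x. \<bar>w (x - s)\<bar>*(cmod (h x))^2)"
  by (intro integral_unique) simp
 then have "(nrm (%x. h (s + x)))^2 = integral {s..s+a} (%x. \<bar>w (x - s)\<bar>*(cmod (h x))^2)"
  using nrm_square[OF cont_H[OF hc(1)]] by simp
 also have "... = (LINT x:{s..s+a}|lebesgue. \<bar>w (x - s)\<bar>*(cmod (h x))^2)"
  by (rule set_lebesgue_integral_eq_integral(2)[OF ai, symmetric])
 finally show ?thesis by (simp add: set_lebesgue_integral_def)
qed

lemma w_per_nat: "w (x + real n*a) = w x"
proof (induction n)
 case (Suc n)
 have "w (x + real (Suc n)*a) = w ((x + real n*a) + a)" by (simp add: algebra_simps)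
 then show ?case using Suc by (simp only: w_per)
qed simp

lemma bloch_modulus:
 assumes "qper t f"
 shows "cmod (f (real n*a)) = cmod (f 0)" "cmod (f (- (real n*a))) = cmod (f 0)"
proof -
 show "cmod (f (real n*a)) = cmod (f 0)"
 proof (induction n)
  case (Suc n)
  have "f (real (Suc n)*a) = f (real n*a + a)" by (simp add: algebra_simps)
  also have "cmod ... = cmod (f (real n*a))" using assms by (simp add: qper_def norm_mult)
  finally show ?case using Suc by simp
 qed simp
 show "cmod (f (- (real n*a))) = cmod (f 0)"
 proof (induction n)
  case (Suc n)
  have "f (- (real (Suc n)*a) + a) = f (- (real n*a))" by (simp add: algebra_simps)
  moreover have "cmod (f (- (real (Suc n)*a) + a)) = cmod (f (- (real (Suc n)*a)))"
   using assms by (simp only: qper_def norm_mult exp_i_norm mult_1)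
  ultimately show ?case using Suc by simp
 qed simp
qed

lemma sol_cong_ae_on:
 assumes s: "sol UNIV s f v" and eq: "!!x. x : {c<..<d} ==> s x = s' x"
 shows "sol {c..d} s' f v"
proof (rule sol_spike[OF sol_subset[OF s subset_UNIV]])
 show "negligible {c, d}" by simp
qed (use eq in auto)

text \<open>For a real \<open>l\<close> in the resolvent set, \<open>f\<close> with \<open>(A - l) f = u\<close> and \<open>u = sgn w X\<close> on one cell solves the homogeneous
equation outside the cell, hence its Wronskian with \<open>X\<close> vanishes there; but it jumps by the norm of \<open>u\<close>.\<close>

lemma bloch_in_spectrum:
 assumes b: "bloch t (cx l) X Y" and nz: "nrm X ~= 0"
 shows "cx l : spectrum (L2R w) (maximal_op w p q)"
proof (rule ccontr)
 let ?z = "cx l"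
 assume "?z \<notin> spectrum (L2R w) (maximal_op w p q)"
 then have surj: "!!u. u : L2 (L2R w) ==> \<exists>f. maximal_op w p q f (%x. ?z*f x + u x)"
  by (auto simp: spectrum_def resolvent_set_def)
 \<comment> \<open>The factor sgn w matters for a neutral X: the pairing of \<open>w u\<close> with
   X gives the norm of X instead of [X, X] = 0.\<close>
 define u where "u x = (if x : {0<..<a} then cx (sgn (w x))*X x else 0)" for x
 have Xc: "continuous_on A X" "continuous_on A Y" for A using blochD(4,5)[OF b] by blast+
 have XH: "X : H" by (rule blochD(6)[OF b])
 have [measurable]: "X : borel_measurable lebesgue"
  using continuous_imp_measurable_on_sets_lebesgue[OF Xc(1)[of UNIV]] by simp
 note w_meas_on [measurable del]
 note [measurable] = w_meas
 have um [measurable]: "u : borel_measurable lebesgue" unfolding u_def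
  by (intro measurable_If_set borel_measurable_times borel_measurable_of_real) auto
 have uL: "u : L2 (L2R w)"
 proof -
  have ai: "(%x. \<bar>w x\<bar>*(cmod (X x))^2) abs_int_on {0<..<a}"
   using cont_sq_int[OF Xc(1)] by (simp add: absolutely_integrable_on_Icc_iff_Ioo)
  have "integrable lebesgue (%x. \<bar>w x\<bar> *\<^sub>R (cmod (u x))^2)"
  proof (rule Bochner_Integration.integrable_bound)
   show "integrable lebesgue (%x. indicator {0<..<a} x *\<^sub>R (\<bar>w x\<bar>*(cmod (X x))^2))"
    using ai unfolding set_integrable_def .
   show "(%x. \<bar>w x\<bar> *\<^sub>R (cmod (u x))^2) : borel_measurable lebesgue" by measurable
  qed (auto simp: u_def indicator_def norm_mult sgn_if abs_mult intro!: always_eventually)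
  then show ?thesis using um by (simp add: L2_def measurable_weighted integrable_weighted lebesgue_on_UNIV_eq)
 qed
 obtain h where h: "maximal_op w p q h (%x. ?z*h x + u x)" using surj[OF uL] by blast
 then obtain k where hL: "h : L2 (L2R w)" "(%x. ?z*h x + u x) : L2 (L2R w)" and ac: "AC_loc h" "AC_loc k"
  and sl: "sl_expr w p q UNIV h k (%x. ?z*h x + u x)" by (auto simp: maximal_op_def)
 have hc: "continuous_on {c..d} h" for c d
  using ac(1) ac_on_imp_continuous_on[of c d h] by (cases "c <= d") (auto simp: AC_loc_def AC_on_iff_ac_on)
 have wu: "(%x. cx (w x)*u x) abs_int_on {c..d}" for c d
 proof (rule measurable_bounded_by_integrable_imp_absolutely_integrable)
  have "(%x. cx (w x)*u x) : borel_measurable lebesgue" by measurable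
  then show "(%x. cx (w x)*u x) : borel_measurable (lebesgue_on {c..d})"
   by (rule measurable_restrict_space1)
  show "(%x. cmod (cx (w x)*X x)) integrable_on {c..d}"
   using coeff_mult_int(3)[OF Xc(1)] by (simp add: abs_int_def)
 qed (auto simp: u_def norm_mult sgn_if)
 have "(%x. cx (w x)*(?z*h x + u x)) abs_int_on {c..d}" for c d
 proof -
  have "(%x. cx (w x)*(?z*h x) + cx (w x)*u x) abs_int_on {c..d}"
   by (intro set_integral_add(1) wu coeff_mult_int(3) continuous_intros hc)
  then show ?thesis by (simp add: algebra_simps)
 qed
 from sol_of_sl_expr_UNIV[OF ac sl this]
 have hs: "sol UNIV (%x. cx (w x)*(?z*h x + u x)) h k" .
 have hU: "continuous_on UNIV h" using sol_continuous_UNIV[OF hs] by blast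
 have Xcn: "eigsol UNIV ?z (%x. cnj (X x)) (%x. cnj (Y x))" using sol_cnj[OF blochD(1)[OF b]] by simp
 define om where "om x = h x*cnj (Y x) - k x*cnj (X x)" for x
 have W: "integral {x..y} (%x. cx (w x)*u x*cnj (X x)) = om y - om x" if "x <= y" for x y
 proof -
  have "integral {x..y} (%x. cx (w x)*(?z*h x + u x)*cnj (X x) - h x*(?z*cx (w x)*cnj (X x))) = om y - om x"
   using primitive_onD(2)[OF sol_wronskian[OF hs Xcn] subset_UNIV that] by (simp add: om_def)
  then show ?thesis by (simp add: algebra_simps)
 qed
 have w1: "om a - om 0 = cx ((nrm X)^2)"
 proof -
  have "om a - om 0 = integral {0..a} (%x. cx (w x)*u x*cnj (X x))"
   using W[of 0 a] a_pos by simp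
  also have "... = integral {0..a} (%x. cx (\<bar>w x\<bar>*(cmod (X x))^2))"
  proof (rule integral_spike[of "{0, a}"])
   fix x assume "x : {0..a} - {0, a}"
   then have "u x = cx (sgn (w x))*X x" by (auto simp: u_def)
   then have "cx (w x)*u x*cnj (X x) = cx (w x * sgn (w x))*(X x*cnj (X x))" by simp
   also have "... = cx (\<bar>w x\<bar>*(cmod (X x))^2)"
    by (simp add: complex_norm_square[symmetric] abs_sgn)
   finally show "cx (\<bar>w x\<bar>*(cmod (X x))^2) = cx (w x)*u x*cnj (X x)" by simp
  qed simp
  also have "... = cx (integral {0..a} (%x. \<bar>w x\<bar>*(cmod (X x))^2))"
   using integral_linear[OF _ bounded_linear_of_real, of "%x. \<bar>w x\<bar>*(cmod (X x))^2" "{0..a}"] cont_sq_int[OF Xc(1), of 0 a]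
   by (simp add: o_def abs_int_def)
  finally show ?thesis using nrm_square[OF XH] by simp
 qed
 have wr: "om (real n*a) = om a" if "1 <= n" for n
 proof -
  have "a <= real n*a" using that a_pos by simp
  have "integral {a..real n*a} (%x. cx (w x)*u x*cnj (X x)) = integral {a..real n*a} (%x. 0)"
   by (rule integral_cong) (auto simp: u_def)
  then show ?thesis using W[OF \<open>a <= real n*a\<close>] by simp
 qed
 have wl: "om (- (real n*a)) = om 0" for n
 proof -
  have "- (real n*a) <= 0" using a_pos by simp
  have "integral {- (real n*a)..0} (%x. cx (w x)*u x*cnj (X x)) = integral {- (real n*a)..0} (%x. 0)"
   by (rule integral_cong) (auto simp: u_def)
  then show ?thesis using W[OF \<open>- (real n*a) <= 0\<close>] by simp
 qed
 have gi: "integrable lebesgue (%x. \<bar>w x\<bar>*(cmod (h x))^2)"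
 proof -
  have "h : borel_measurable lebesgue" using hL(1) by (simp add: L2_def measurable_weighted lebesgue_on_UNIV_eq)
  then show ?thesis using hL(1) integrable_weighted[of "%x. (cmod (h x))^2" UNIV] by (simp add: L2_def lebesgue_on_UNIV_eq)
 qed
 obtain C where C0: "\<forall>z f v ze. cmod z <= cmod ?z --> sol {0..a} (%x. z*cx (w x)*f x + ze x) f v -->
   cmod (f 0) + cmod (v 0) <= C*(nrm f + integral {0..a} (%x. cmod (ze x)))"
  using data_bound[of "cmod ?z"] by (elim exE)
 have C: "cmod (f 0) + cmod (v 0) <= C*nrm f" if "sol {0..a} (%x. ?z*cx (w x)*f x + 0) f v" for f v
  using C0[rule_format, of ?z f "%_. 0" v] that by simp
 \<comment> \<open>Where u vanishes, h solves the homogeneous equation, so \<open>data_bound\<close>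
   controls its data at s by its norm on the cell. These norms tend to 0 along the cells because h
   is square integrable.\<close>
 have cell: "cmod (om s) <= (C*nrm (%x. h (s + x)))*(cmod (X s) + cmod (Y s))"
  if per: "!!x. w (s + x) = w x" "!!x. p (s + x) = p x" "!!x. q (s + x) = q x" and u0: "!!x. x : {s<..<s+a} ==> u x = 0" for s
 proof -
  have "sol {s..s+a} (%x. ?z*cx (w x)*h x) h k"
   by (rule sol_cong_ae_on[OF hs]) (simp add: u0)
  then have P: "primitive_on {s..s+a} h (%x. k x/cx (p x))"
    "primitive_on {s..s+a} k (%x. cx (q x)*h x - ?z*cx (w x)*h x)" by (auto simp: sol_def)
  have "sol {0..a} (%x. ?z*cx (w x)*h (s + x) + 0) (%x. h (s + x)) (%x. k (s + x))"
  proof (rule solI)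
   show "primitive_on {0..a} (%x. h (s + x)) (%x. 1 *\<^sub>R (k (s + x)/cx (p (s + x))))"
    using primitive_on_affine[OF P(1), of 1 "{0..a}" s] by simp
   show "primitive_on {0..a} (%x. k (s + x)) (%x. 1 *\<^sub>R (cx (q (s + x))*h (s + x) - ?z*cx (w (s + x))*h (s + x)))"
    using primitive_on_affine[OF P(2), of 1 "{0..a}" s] by simp
  qed (simp_all add: per)
  from C[OF this] have D: "cmod (h s) + cmod (k s) <= C*nrm (%x. h (s + x))" by simp
  have "cmod (om s) <= cmod (h s)*cmod (Y s) + cmod (k s)*cmod (X s)"
   unfolding om_def by (rule order_trans[OF norm_triangle_ineq4]) (simp add: norm_mult)
  also have "... <= (cmod (h s) + cmod (k s))*(cmod (X s) + cmod (Y s))"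
   by (simp add: algebra_simps)
  also have "... <= (C*nrm (%x. h (s + x)))*(cmod (X s) + cmod (Y s))"
   by (intro mult_right_mono D) auto
  finally show ?thesis .
 qed
 have per_r: "w (real n*a + x) = w x" "p (real n*a + x) = p x" "q (real n*a + x) = q x" for n x
 proof -
  show "w (real n*a + x) = w x" using w_per_nat[of x n] by (simp add: add.commute)
  show "p (real n*a + x) = p x"
  proof (induction n)
   case (Suc n)
   have "p (real (Suc n)*a + x) = p ((real n*a + x) + a)" by (simp add: algebra_simps)
   then show ?case using Suc by (simp only: p_per)
  qed simp
  show "q (real n*a + x) = q x"
  proof (induction n)
   case (Suc n)
   have "q (real (Suc n)*a + x) = q ((real n*a + x) + a)" by (simp add: algebra_simps)
   then show ?case using Suc by (simp only: q_per)
  qed simp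
 qed
 have per_l: "w (- (real n*a) + x) = w x" "p (- (real n*a) + x) = p x" "q (- (real n*a) + x) = q x" for n x
  using per_r[of n "- (real n*a) + x"] by simp_all
 have "om a = 0"
 proof -
  have "(nrm (%x. h (real n*a + x)))^2 = integral\<^sup>L lebesgue (%x. indicator {real n*a..real n*a + a} x*(\<bar>w x\<bar>*(cmod (h x))^2))" for n
  proof -
   have "w (x - real n*a) = w x" for x using per_l(1)[of n x] by (simp add: algebra_simps)
   then show ?thesis using shifted_nrm[OF hU, of "real n*a"] by simp
  qed
  then have "(%n. (nrm (%x. h (real n*a + x)))^2) ----> 0" using cell_integral_tendsto_0(1)[OF gi] by simp
  then have "(%n. sqrt ((nrm (%x. h (real n*a + x)))^2)) ----> sqrt 0" by (rule tendsto_real_sqrt)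
  then have "(%n. nrm (%x. h (real n*a + x))) ----> 0" by (simp add: l2norm_nonneg)
  then have "(%n. (C*nrm (%x. h (real n*a + x)))*(cmod (X 0) + cmod (Y 0))) ----> (C*0)*(cmod (X 0) + cmod (Y 0))"
   by (intro tendsto_intros)
  then have lim: "(%n. (C*nrm (%x. h (real n*a + x)))*(cmod (X 0) + cmod (Y 0))) ----> 0" by simp
  have "cmod (om a) <= (C*nrm (%x. h (real n*a + x)))*(cmod (X 0) + cmod (Y 0))" if "1 <= n" for n
  proof -
   have "u x = 0" if "x : {real n*a<..<real n*a + a}" for x
   proof -
    have "a <= real n*a" using \<open>1 <= n\<close> a_pos by simp
    moreover have "real n*a < x" using that by simp
    ultimately have "a <= x" by linarith
    then show ?thesis by (simp add: u_def)
   qed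
   from cell[of "real n*a", OF per_r this] show ?thesis
    using wr[OF that] bloch_modulus[of t X n] bloch_modulus[of t Y n] b by (simp add: bloch_def)
  qed
  then have "cmod (om a) <= 0"
   by (intro LIMSEQ_le_const[OF lim]) blast
  then show ?thesis by simp
 qed
 moreover have "om 0 = 0"
 proof -
  \<comment> \<open>The cell between -(n+1) a and -n a begins at -(n+1) a, whence
    \<open>Suc n\<close>; all these cells lie left of the support of u.\<close>
  have "(nrm (%x. h (- (real (Suc n)*a) + x)))^2 = integral\<^sup>L lebesgue (%x. indicator {- (real n*a) - a..- (real n*a)} x*(\<bar>w x\<bar>*(cmod (h x))^2))" for n
  proof -
   have "w (x - - (real (Suc n)*a)) = w x" for x using per_r(1)[of "Suc n" x] by (simp add: algebra_simps)
   moreover have "{- (real (Suc n)*a)..- (real (Suc n)*a) + a} = {- (real n*a) - a..- (real n*a)}" by (rule arg_cong2[of _ _ _ _ atLeastAtMost]) (simp_all add: algebra_simps)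
   ultimately show ?thesis using shifted_nrm[OF hU, of "- (real (Suc n)*a)"] by (simp only:)
  qed
  then have "(%n. (nrm (%x. h (- (real (Suc n)*a) + x)))^2) ----> 0" using cell_integral_tendsto_0(2)[OF gi] by simp
  then have "(%n. sqrt ((nrm (%x. h (- (real (Suc n)*a) + x)))^2)) ----> sqrt 0" by (rule tendsto_real_sqrt)
  then have "(%n. nrm (%x. h (- (real (Suc n)*a) + x))) ----> 0" by (simp add: l2norm_nonneg)
  then have "(%n. (C*nrm (%x. h (- (real (Suc n)*a) + x)))*(cmod (X 0) + cmod (Y 0))) ----> (C*0)*(cmod (X 0) + cmod (Y 0))"
   by (intro tendsto_intros)
  then have lim: "(%n. (C*nrm (%x. h (- (real (Suc n)*a) + x)))*(cmod (X 0) + cmod (Y 0))) ----> 0" by simp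
  have "cmod (om 0) <= (C*nrm (%x. h (- (real (Suc n)*a) + x)))*(cmod (X 0) + cmod (Y 0))" for n
  proof -
   have "u x = 0" if "x : {- (real (Suc n)*a)<..<- (real (Suc n)*a) + a}" for x
   proof -
    have "- (real (Suc n)*a) + a <= 0" using a_pos by (simp add: algebra_simps)
    moreover have "x < - (real (Suc n)*a) + a" using that by (simp only: greaterThanLessThan_iff)
    ultimately have "x <= 0" by linarith
    then show ?thesis by (simp add: u_def)
   qed
   from cell[of "- (real (Suc n)*a)", OF per_l this] show ?thesis
    using wl[of "Suc n"] bloch_modulus(2)[of t X "Suc n"] bloch_modulus(2)[of t Y "Suc n"] b by (simp add: bloch_def)
  qed
  then have "cmod (om 0) <= 0"
   by (intro LIMSEQ_le_const[OF lim]) blast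
  then show ?thesis by simp
 qed
 ultimately show False using w1 nz by simp
qed

lemma neutral_bloch_critical:
 assumes b: "bloch t (cx l) X Y" and nz: "nrm X ~= 0" and neutral: "br X X = 0"
 shows "critical_point w p q a (cx l)"
proof -
 have "\<not> (X 0 = 0 & Y 0 = 0)"
 proof
  assume "X 0 = 0 & Y 0 = 0"
  moreover have "eigsol UNIV (cx l) (%_. 0) (%_. 0)" using sol_zero by simp
  ultimately have "X = (%_. 0)" using sol_unique(1)[OF blochD(1)[OF b], of "%_. 0" "%_. 0" 0] by simp
  then show False using nz by (simp add: l2norm_def)
 qed
 then show ?thesis
  unfolding critical_point_def using bloch_in_spectrum[OF b nz] discriminant_derivative_neutral[OF b _ neutral] by blast
qed

end

section \<open>Forms at a simple turning point\<close>

lemma mult_le_half_squares: "x*y <= (x^2 + y^2)/2" for x y :: real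
 using sum_squares_bound[of x y] by simp

lemma primitive_on_of_real:
 "primitive_on S F f ==> primitive_on S (%x. cx (F x)) (%x. cx (f x))"
 by (rule primitive_on_linear[OF _ bounded_linear_of_real])

lemma continuous_norm_square_int:
 fixes u :: "real => complex"
 assumes "continuous_on {c..d} u"
 shows "(%x. (cmod (u x))^2) integrable_on {c..d}"
 by (intro integrable_continuous_interval continuous_intros assms)

text \<open>The source s is w times the image of f and cannot be estimated directly. Integration by
  parts trades it for boundary terms, a term with q bounded by suprema, and a product with u bounded
  by \<open>om\<close>. Every estimate of a form against the operator goes through this
  lemma.\<close>

lemma source_by_parts:
 fixes H u f s :: "real => complex" and q :: "real => real"
 assumes "c <= d" and H: "primitive_on {c..d} H H'"
  and u: "primitive_on {c..d} u (%x. cx (q x)*f x - s x)"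
  and q: "q abs_int_on {c..d}" and f: "continuous_on {c..d} f"
  and A: "!!x. x : {c..d} ==> cmod (H x) <= A" and S: "!!x. x : {c..d} ==> cmod (f x) <= S"
  and om: "om integrable_on {c..d}" "!!x. x : {c..d} ==> cmod (H' x)*cmod (u x) <= om x"
 shows "cmod (integral {c..d} (%x. H x*cnj (s x)) + H d*cnj (u d) - H c*cnj (u c))
  <= A*S*integral {c..d} (%x. \<bar>q x\<bar>) + integral {c..d} om"
proof -
 let ?D = "%x. H x*cnj (cx (q x)*f x - s x) + H' x*cnj (u x)"
 have Hc: "continuous_on {c..d} H" by (rule primitive_on_continuous[OF H order_refl])
 have qf: "(%x. cx (q x)*f x) abs_int_on {c..d}"
  using absolutely_integrable_continuous_mult(1)[OF absolutely_integrable_linear[OF q bounded_linear_of_real] f] by (simp add: o_def)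
 have "(%x. cx (q x)*f x - (cx (q x)*f x - s x)) abs_int_on {c..d}"
  by (intro set_integral_diff(1) qf primitive_onD(1)[OF u order_refl \<open>c <= d\<close>])
 then have "s abs_int_on {c..d}" by simp
 then have "(%x. cnj (s x)) abs_int_on {c..d}"
  using absolutely_integrable_linear[OF _ bounded_linear_cnj] by (simp add: o_def)
 from absolutely_integrable_continuous_mult(2)[OF this Hc]
 have s: "(%x. H x*cnj (s x)) integrable_on {c..d}" by (simp add: abs_int_def)
 have "(?D has_integral (H d*cnj (u d) - H c*cnj (u c))) {c..d}"
  using primitive_onD(4)[OF primitive_on_mult[OF H primitive_on_linear[OF u bounded_linear_cnj]] order_refl \<open>c <= d\<close>] by simp
 from has_integral_add[OF integrable_integral[OF s] this]
 have I: "((%x. H x*cnj (s x) + ?D x) has_integral (integral {c..d} (%x. H x*cnj (s x)) + (H d*cnj (u d) - H c*cnj (u c)))) {c..d}" .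
 have qi: "(%x. \<bar>q x\<bar>) integrable_on {c..d}"
  using q by (simp add: abs_int_def)
 have B: "(%x. A*S*\<bar>q x\<bar> + om x) integrable_on {c..d}"
  by (intro integrable_add integrable_on_mult_right qi om)
 have "cmod (integral {c..d} (%x. H x*cnj (s x) + ?D x)) <= integral {c..d} (%x. A*S*\<bar>q x\<bar> + om x)"
 proof (rule integral_norm_bound_integral[OF has_integral_integrable[OF I] B])
  fix x assume x: "x : {c..d}"
  have "H x*cnj (s x) + ?D x = H x*(cx (q x)*cnj (f x)) + H' x*cnj (u x)" by (simp add: algebra_simps)
  also have "cmod ... <= cmod (H x)*(\<bar>q x\<bar>*cmod (f x)) + cmod (H' x)*cmod (u x)"
   by (rule order_trans[OF norm_triangle_ineq]) (simp add: norm_mult)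
  also have "... <= A*(\<bar>q x\<bar>*S) + om x"
   using A[OF x] S[OF x] om(2)[OF x] order_trans[OF norm_ge_zero A[OF x]] by (intro add_mono mult_mono mult_left_mono) auto
  finally show "cmod (H x*cnj (s x) + ?D x) <= A*S*\<bar>q x\<bar> + om x" by (simp add: algebra_simps)
 qed
 also have "... = A*S*integral {c..d} (%x. \<bar>q x\<bar>) + integral {c..d} om"
  using integral_mult_right[of "{c..d}" "A*S" "%x. \<bar>q x\<bar>"]
  by (simp add: Henstock_Kurzweil_Integration.integral_add[OF integrable_on_mult_right[OF qi] om(1)])
 finally show ?thesis unfolding integral_unique[OF I] by (simp only: add_diff_eq)
qed

definition cutoff :: "real => real => real" where
 "cutoff et y = max 0 (1 - y/et)"

lemma cutoff_simps [simp]: "cutoff et 0 = 1"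
 by (simp add: cutoff_def)

lemma cutoff_eq_0: "0 < et ==> et <= y ==> cutoff et y = 0"
 by (simp add: cutoff_def field_simps)

lemma cutoff_abs_le_1: "0 < et ==> 0 <= y ==> \<bar>cutoff et y\<bar> <= 1"
 by (simp add: cutoff_def)

lemma primitive_on_cutoff:
 assumes "0 < et" "et <= d"
 shows "primitive_on {0..d} (cutoff et) (%y. if y < et then - (1/et) else 0)"
proof (rule primitive_on_combine)
 have "primitive_on {0..et} (%y. 1 - (1/et)*y) (%y. - (1/et))"
 proof (rule primitive_onI)
  fix x y :: real assume "x <= y"
  have "((%y. - (1/et)) has_integral (y - x) *\<^sub>R (- (1/et))) {x..y}" using has_integral_const_real[of "- (1/et)" x y] \<open>x <= y\<close> by simp
  then show "((%y. - (1/et)) has_integral 1 - 1/et*y - (1 - 1/et*x)) {x..y}"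
   by (simp add: algebra_simps diff_divide_distrib)
 qed auto
 then have "primitive_on {0..et} (%y. 1 - (1/et)*y) (%y. if y < et then - (1/et) else 0)"
  by (rule primitive_on_spike[where N = "{et}"]) auto
 then show "primitive_on {0..et} (cutoff et) (%y. if y < et then - (1/et) else 0)"
  by (rule primitive_on_cong[THEN iffD1, rotated -1]) (use assms in \<open>auto simp: cutoff_def field_simps\<close>)
 show "primitive_on {et..d} (cutoff et) (%y. if y < et then - (1/et) else 0)"
  by (rule primitive_on_cong[THEN iffD1, rotated -1, OF primitive_on_const[of _ 0]]) (use assms in \<open>auto simp: cutoff_eq_0\<close>)
qed

lemma integral_dilation:
 fixes g :: "real => real"
 assumes "0 < kp" "0 <= d" "g integrable_on {0..kp*d}"
 shows "(%y. g (kp*y)) integrable_on {0..d}" "integral {0..d} (%y. g (kp*y)) = integral {0..kp*d} g/kp"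
proof -
 have "((%y. g (0 + kp*y)) has_integral (1/\<bar>kp\<bar>) *\<^sub>R integral {0..kp*d} g) {0..d}"
  using assms integrable_integral[OF assms(3)] by (intro has_integral_affine) (auto simp: min_def max_def)
 then have "((%y. g (kp*y)) has_integral integral {0..kp*d} g/kp) {0..d}" using assms by simp
 then show "(%y. g (kp*y)) integrable_on {0..d}" "integral {0..d} (%y. g (kp*y)) = integral {0..kp*d} g/kp"
  by (auto intro: integral_unique)
qed

text \<open>Take H(y) = cutoff(y) f2(kp y): a dilation keeps the value f2(0) at the turning point,
  and the cutoff kills the other boundary term. In H' the derivative of f2 is met at the dilated
  point, so it must be bounded by u2 in the unweighted L2 norm; this is what the local bounds on p
  provide.\<close>

lemma dilated_form_bound:
 fixes f1 f2 u1 u2 s1 d2 :: "real => complex" and q1 :: "real => real"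
 assumes dl: "0 < dl" and kp: "1 <= kp" and et: "0 < et" "et <= dl/kp" and K: "0 <= K"
  and f2: "primitive_on {0..dl} f2 d2" and d2: "!!y. y : {0..dl} ==> cmod (d2 y) <= K*cmod (u2 y)"
  and u1: "primitive_on {0..dl} u1 (%y. cx (q1 y)*f1 y - s1 y)"
  and q1: "q1 abs_int_on {0..dl}" and f1: "continuous_on {0..dl} f1"
  and u2: "continuous_on {0..dl} u2"
  and S: "!!y. y : {0..dl} ==> cmod (f1 y) <= S" "!!y. y : {0..dl} ==> cmod (f2 y) <= S"
 shows "cmod (integral {0..dl/kp} (%y. cx (cutoff et y)*f2 (kp*y)*cnj (s1 y)) - f2 0*cnj (u1 0))
  <= (integral {0..dl} (%y. \<bar>q1 y\<bar>) + dl/et^2 + 1 + kp*K) *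
    (S^2 + integral {0..dl} (%y. (cmod (u1 y))^2) + integral {0..dl} (%y. (cmod (u2 y))^2))"
proof -
 let ?L = "dl/kp" and ?E1 = "integral {0..dl} (%y. (cmod (u1 y))^2)" and ?E2 = "integral {0..dl} (%y. (cmod (u2 y))^2)"
  and ?Q = "integral {0..dl} (%y. \<bar>q1 y\<bar>)"
 define H' where "H' = (%y. cx (cutoff et y)*(kp *\<^sub>R d2 (0 + kp*y)) +
   cx (if y < et then - (1/et) else 0)*f2 (0 + kp*y))"
 define om where "om = (%y. (S^2/et^2 + (cmod (u1 y))^2)/2 + (kp*K/2)*((cmod (u2 (kp*y)))^2 + (cmod (u1 y))^2))"
 have L: "0 < ?L" "?L <= dl" "kp*?L = dl" using dl kp by (auto simp: field_simps)
 have S0: "0 <= S" using S(1)[of 0] dl order_trans[OF norm_ge_zero] by force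
 have im: "kp*y : {0..dl}" if "y : {0..?L}" for y
  using that kp dl by (auto simp: field_simps)
 have H: "primitive_on {0..?L} (%y. cx (cutoff et y)*f2 (0 + kp*y)) H'"
  unfolding H'_def
  by (intro primitive_on_mult primitive_on_of_real primitive_on_cutoff et primitive_on_affine[OF f2])
   (use kp im in auto)
 have u1c: "continuous_on {0..?L} u1" using primitive_on_continuous[OF u1, of 0 ?L] L by auto
 have u1i: "(%y. (cmod (u1 y))^2) integrable_on {0..?L}" by (rule continuous_norm_square_int[OF u1c])
 have u1L: "integral {0..?L} (%y. (cmod (u1 y))^2) <= ?E1"
  by (rule integral_subset_le) (use L u1i continuous_norm_square_int[OF primitive_on_continuous[OF u1 order_refl]] in auto)
 have u2i: "(%y. (cmod (u2 (kp*y)))^2) integrable_on {0..?L}"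
  "integral {0..?L} (%y. (cmod (u2 (kp*y)))^2) = ?E2/kp"
  using integral_dilation[of kp ?L "%y. (cmod (u2 y))^2"] kp L continuous_norm_square_int[OF u2] by simp_all
 have E0: "0 <= ?E1" "0 <= ?E2" by (auto intro!: integral_nonneg continuous_norm_square_int u2 primitive_on_continuous[OF u1])
 have omi: "(om has_integral ((?L*(S^2/et^2) + integral {0..?L} (%y. (cmod (u1 y))^2))/2
   + (kp*K/2)*(?E2/kp + integral {0..?L} (%y. (cmod (u1 y))^2)))) {0..?L}"
  unfolding om_def u2i(2)[symmetric]
  by (intro has_integral_add has_integral_divide has_integral_mult_right integrable_integral u1i u2i(1))
   (use has_integral_const_real[of "S^2/et^2" 0 ?L] L in simp)
 have "cmod (integral {0..?L} (%y. cx (cutoff et y)*f2 (0 + kp*y)*cnj (s1 y)) +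
   cx (cutoff et ?L)*f2 (0 + kp*?L)*cnj (u1 ?L) - cx (cutoff et 0)*f2 (0 + kp*0)*cnj (u1 0))
   <= S*S*integral {0..?L} (%y. \<bar>q1 y\<bar>) + integral {0..?L} om"
 proof (rule source_by_parts[OF less_imp_le[OF L(1)] H primitive_on_subset[OF u1]])
  show "q1 abs_int_on {0..?L}" by (rule absolutely_integrable_on_subinterval[OF q1]) (use L in auto)
  show "continuous_on {0..?L} f1" by (rule continuous_on_subset[OF f1]) (use L in auto)
  show "om integrable_on {0..?L}" using omi by blast
  fix y assume y: "y : {0..?L}"
  have c1: "\<bar>cutoff et y\<bar> <= 1" using cutoff_abs_le_1[OF et(1)] y by auto
  show "cmod (cx (cutoff et y)*f2 (0 + kp*y)) <= S"
   using mult_mono[OF c1 S(2)[OF im[OF y]]] by (simp add: norm_mult)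
  show "cmod (f1 y) <= S" using S(1)[of y] y L by auto
  have "cmod (H' y) <= \<bar>cutoff et y\<bar>*(kp*cmod (d2 (kp*y))) + (1/et)*cmod (f2 (kp*y))"
   unfolding H'_def by (rule order_trans[OF norm_triangle_ineq]) (use kp et in \<open>auto simp: norm_mult norm_divide\<close>)
  also have "... <= 1*(kp*(K*cmod (u2 (kp*y)))) + (1/et)*S"
   using c1 d2[OF im[OF y]] S(2)[OF im[OF y]] kp et by (intro add_mono mult_mono mult_left_mono) auto
  finally have "cmod (H' y)*cmod (u1 y) <= (kp*K)*(cmod (u2 (kp*y))*cmod (u1 y)) + (S/et)*cmod (u1 y)"
   using mult_right_mono[OF _ norm_ge_zero, of "cmod (H' y)" _ "u1 y"] by (fastforce simp: algebra_simps)
  also have "... <= (kp*K)*(((cmod (u2 (kp*y)))^2 + (cmod (u1 y))^2)/2) + ((S/et)^2 + (cmod (u1 y))^2)/2"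
   using kp K by (intro add_mono mult_left_mono mult_le_half_squares) auto
  finally show "cmod (H' y)*cmod (u1 y) <= om y" by (simp add: om_def power_divide algebra_simps add_divide_distrib)
 qed (use L in auto)
 then have "cmod (integral {0..?L} (%y. cx (cutoff et y)*f2 (kp*y)*cnj (s1 y)) - f2 0*cnj (u1 0))
   <= S^2*integral {0..?L} (%y. \<bar>q1 y\<bar>) + integral {0..?L} om"
  using et by (simp add: cutoff_eq_0 power2_eq_square)
 also have "... <= S^2*?Q + (dl*(S^2/et^2) + ?E1 + kp*K*(?E2 + ?E1))"
 proof (rule add_mono)
  have "q1 abs_int_on {0..?L}" by (rule absolutely_integrable_on_subinterval[OF q1]) (use L in auto)
  then show "S^2*integral {0..?L} (%y. \<bar>q1 y\<bar>) <= S^2*?Q"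
   using q1 L by (intro mult_left_mono integral_subset_le) (auto simp: abs_int_def)
  have aux: "(x + i)/2 + z <= x' + e + z'" if "x <= x'" "z <= z'/2" "0 <= z'" "0 <= x'" "i <= e" "0 <= e"
   for x i z x' e z' :: real using that by (simp add: field_simps)
  have "?L*(S^2/et^2) <= dl*(S^2/et^2)" using L by (intro mult_right_mono) auto
  moreover have "?E2/kp <= ?E2" using kp E0 mult_right_mono[OF kp E0(2)] by (simp add: field_simps)
  then have "(kp*K/2)*(?E2/kp + integral {0..?L} (%y. (cmod (u1 y))^2)) <= (kp*K/2)*(?E2 + ?E1)"
   using u1L kp K by (intro mult_left_mono add_mono) auto
  moreover have "0 <= kp*K*(?E2 + ?E1)" using kp K E0 by simp
  moreover have "0 <= dl*(S^2/et^2)" using dl by simp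
  ultimately show "integral {0..?L} om <= dl*(S^2/et^2) + ?E1 + kp*K*(?E2 + ?E1)"
   unfolding integral_unique[OF omi] using u1L E0
   by (intro aux) auto
 qed
 also have "... <= (?Q + dl/et^2 + 1 + kp*K)*(S^2 + ?E1 + ?E2)"
 proof -
  have Q0: "0 <= ?Q" using q1 by (intro integral_nonneg) (auto simp: abs_int_def)
  have "0 <= (?Q + dl/et^2)*(?E1 + ?E2) + (S^2 + ?E2) + kp*K*S^2" using Q0 E0 dl kp K by (intro add_nonneg_nonneg mult_nonneg_nonneg) auto
  then show ?thesis by (simp add: algebra_simps)
 qed
 finally show ?thesis .
qed

text \<open>For ep < 1 the derivative of \<open>y powr ep\<close> is singular at 0. As P vanishes
  there and has derivative in L2, P is O(sqrt y), and \<open>y powr (ep - 1/2)\<close> is square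
  integrable for ep > 0. Hence the vanishing of P at the turning point is decisive.\<close>

lemma powr_form_bound:
 fixes P u f s :: "real => complex" and q e :: "real => real"
 assumes dl: "0 < dl" and ep: "0 <= ep"
  and P: "primitive_on {0..dl} P P'" "P 0 = 0" "P dl = 0" and A: "!!y. y : {0..dl} ==> cmod (P y) <= A"
  and e: "continuous_on {0..dl} e" "!!y. y : {0..dl} ==> cmod (P' y) <= e y"
  and u: "primitive_on {0..dl} u (%y. cx (q y)*f y - s y)"
  and q: "q abs_int_on {0..dl}" and f: "continuous_on {0..dl} f"
  and S: "!!y. y : {0..dl} ==> cmod (f y) <= S"
 shows "cmod (integral {0..dl} (%y. cx (y powr ep)*P y*cnj (s y)))
  <= dl powr ep*A*S*integral {0..dl} (%y. \<bar>q y\<bar>) +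
    (ep*dl powr (2*ep) + dl powr ep)*integral {0..dl} (%y. (e y)^2) + (1 + dl powr ep)*integral {0..dl} (%y. (cmod (u y))^2)"
proof -
 define X where "X = integral {0..dl} (%y. (e y)^2)"
 have ei: "(%y. (e y)^2) integrable_on {0..d}" if "d <= dl" for d
  by (intro integrable_continuous_interval continuous_intros continuous_on_subset[OF e(1)]) (use that in auto)
 have X0: "0 <= X" unfolding X_def by (intro integral_nonneg ei) auto
 \<comment> \<open>Cauchy-Schwarz on [0, y], starting from P 0 = 0.\<close>
 have Pe: "cmod (P y) <= sqrt y * sqrt X" if y: "y : {0..dl}" for y
 proof -
  have e0: "0 <= e z" if "z : {0..dl}" for z using order_trans[OF norm_ge_zero e(2)[OF that]] .
  have yi: "e integrable_on {0..y}" by (intro integrable_continuous_interval continuous_on_subset[OF e(1)]) (use y in auto)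
  have "cmod (P y - P 0) <= integral {0..y} (%z. cmod (P' z))" by (rule primitive_on_norm_le[OF P(1)]) (use y in auto)
  also have "... <= integral {0..y} e"
  proof (rule integral_le[OF _ yi])
   show "(%z. cmod (P' z)) integrable_on {0..y}" using primitive_onD(1)[OF P(1), of 0 y] y by (simp add: abs_int_def)
  qed (use e(2) y in auto)
  also have "... <= sqrt (integral {0..y} (%_. 1)) * sqrt (integral {0..y} (%z. (e z)^2))"
   by (rule integral_Cauchy_Schwarz) (use yi ei y e0 in auto)
  also have "... <= sqrt y * sqrt X" unfolding X_def
   using y ei by (intro mult_mono real_sqrt_le_mono integral_subset_le) (auto intro!: integral_nonneg)
  finally show ?thesis using P(2) by simp
 qed
 have uc: "continuous_on {0..dl} u" by (rule primitive_on_continuous[OF u order_refl])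
 define E where "E = integral {0..dl} (%y. (cmod (u y))^2)"
 have E0: "0 <= E" unfolding E_def by (intro integral_nonneg continuous_norm_square_int uc) auto
 define H' where "H' = (%y. cx (y powr ep)*P' y + cx (ep*y powr (ep - 1))*P y)"
 have pw: "primitive_on {0..dl} (%y. y powr ep) (%y. ep*y powr (ep - 1))" if "ep ~= 0"
 proof (rule primitive_onI)
  fix x y :: real assume xy: "x <= y" "{x..y} \<subseteq> {0..dl}"
  then have x: "0 <= x" by simp
  have I: "((%z. z powr (ep - 1)) has_integral b powr ep/ep) {0..b}" if "0 <= b" for b
   using has_integral_powr_from_0[of "ep - 1" b] ep \<open>ep ~= 0\<close> that by simp
  have "(%z. z powr (ep - 1)) integrable_on {x..y}"
   by (rule integrable_subinterval_real[OF has_integral_integrable[OF I[of y]]]) (use x xy in auto)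
  then have i: "(%z. ep*z powr (ep - 1)) integrable_on {x..y}" by (rule integrable_on_mult_right)
  then show "(%z. ep*z powr (ep - 1)) abs_int_on {x..y}"
   by (rule nonnegative_absolutely_integrable_1) (use ep in auto)
  have "integral {0..x} (%z. z powr (ep - 1)) + integral {x..y} (%z. z powr (ep - 1)) = integral {0..y} (%z. z powr (ep - 1))"
   by (rule Henstock_Kurzweil_Integration.integral_combine) (use x xy I[of y] in auto)
  then have "integral {x..y} (%z. z powr (ep - 1)) = y powr ep/ep - x powr ep/ep"
   using integral_unique[OF I[of x]] integral_unique[OF I[of y]] x xy by simp
  then have "integral {x..y} (%z. ep*z powr (ep - 1)) = y powr ep - x powr ep"
   using \<open>ep ~= 0\<close> by (simp add: field_simps)
  then show "((%z. ep*z powr (ep - 1)) has_integral y powr ep - x powr ep) {x..y}"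
   using integrable_integral[OF i] by simp
 qed
 \<comment> \<open>For ep = 0 the weight is 1 except at y = 0, where \<open>0 powr 0\<close> is 0;
   there P vanishes as well.\<close>
 have H: "primitive_on {0..dl} (%y. cx (y powr ep)*P y) H'"
 proof (cases "ep = 0")
  case True
  have "primitive_on {0..dl} P H'"
   by (rule primitive_on_spike[OF P(1), of "{0}"]) (auto simp: H'_def True)
  then show ?thesis by (rule primitive_on_cong[THEN iffD1, rotated -1]) (auto simp: True P(2))
 next
  case False
  show ?thesis unfolding H'_def by (rule primitive_on_mult[OF primitive_on_of_real[OF pw[OF False]] P(1)])
 qed
 have le: "y powr ep <= dl powr ep" if "y : {0..dl}" for y using that ep by (auto intro: powr_mono2)
 define om where "om = (%y. ((ep^2*X)*y powr (2*ep - 1) + (cmod (u y))^2)/2 + (dl powr ep/2)*((e y)^2 + (cmod (u y))^2))"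
 \<comment> \<open>The exponent exceeds -1 for ep > 0. The factor ep^2 absorbs the 1/ep of the
   integral, and the resulting formula also holds for ep = 0.\<close>
 have I: "((%y. (ep^2*X)*y powr (2*ep - 1)) has_integral ep*X*dl powr (2*ep)/2) {0..dl}"
 proof (cases "ep = 0")
  case False
  have "((%y. (ep^2*X)*y powr (2*ep - 1)) has_integral (ep^2*X)*(dl powr (2*ep)/(2*ep))) {0..dl}"
   using has_integral_mult_right[OF has_integral_powr_from_0[of "2*ep - 1" dl]] ep dl False by simp
  then show ?thesis using False by (simp add: power2_eq_square mult.assoc)
 qed simp
 have omi: "(om has_integral (ep*X*dl powr (2*ep)/2 + E)/2 + (dl powr ep/2)*(X + E)) {0..dl}"
  unfolding om_def E_def unfolding X_def
  by (intro has_integral_add has_integral_divide has_integral_mult_right integrable_integral continuous_norm_square_int uc ei order_refl I[unfolded X_def])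
 have "cmod (integral {0..dl} (%y. cx (y powr ep)*P y*cnj (s y)) + cx (dl powr ep)*P dl*cnj (u dl)
   - cx (0 powr ep)*P 0*cnj (u 0)) <= (dl powr ep*A)*S*integral {0..dl} (%y. \<bar>q y\<bar>) + integral {0..dl} om"
 proof (rule source_by_parts[OF less_imp_le[OF dl] H u q f _ S])
  show "om integrable_on {0..dl}" using omi by blast
  fix y assume y: "y : {0..dl}"
  show "cmod (cx (y powr ep)*P y) <= dl powr ep*A"
   using mult_mono[OF le[OF y] A[OF y]] by (simp add: norm_mult)
  have "cmod (H' y) <= y powr ep*cmod (P' y) + ep*y powr (ep - 1)*cmod (P y)"
   unfolding H'_def by (rule order_trans[OF norm_triangle_ineq]) (use ep in \<open>simp add: norm_mult\<close>)
  also have "... <= dl powr ep*e y + ep*y powr (ep - 1)*(sqrt y * sqrt X)"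
   using ep le[OF y] e(2)[OF y] Pe[OF y] by (intro add_mono mult_mono mult_left_mono) auto
  also have "ep*y powr (ep - 1)*(sqrt y * sqrt X) = ep * sqrt X*y powr (ep - 1/2)"
  proof -
   have "y powr (ep - 1) * sqrt y = y powr (ep - 1/2)"
   proof (cases "y = 0")
    case False
    then have "y powr (ep - 1)*y powr (1/2) = y powr (ep - 1/2)" by (simp add: powr_add[symmetric])
    then show ?thesis using y by (simp add: powr_half_sqrt)
   qed simp
   then show ?thesis by (simp add: mult_ac)
  qed
  finally have "cmod (H' y)*cmod (u y) <= (dl powr ep*e y + ep * sqrt X*y powr (ep - 1/2))*cmod (u y)"
   by (rule mult_right_mono) simp
  also have "... = dl powr ep*(e y*cmod (u y)) + (ep * sqrt X*y powr (ep - 1/2))*cmod (u y)" by (simp add: algebra_simps)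
  also have "... <= dl powr ep*(((e y)^2 + (cmod (u y))^2)/2) + ((ep * sqrt X*y powr (ep - 1/2))^2 + (cmod (u y))^2)/2"
   by (intro add_mono mult_left_mono mult_le_half_squares) auto
  also have "(ep * sqrt X*y powr (ep - 1/2))^2 = ep^2*X*y powr (2*ep - 1)"
  proof -
   have "(y powr (ep - 1/2))^2 = y powr (2*ep - 1)"
    by (simp add: power2_eq_square powr_add[symmetric])
   then show ?thesis using X0 by (simp add: power_mult_distrib)
  qed
  finally show "cmod (H' y)*cmod (u y) <= om y" by (simp add: om_def algebra_simps add_divide_distrib)
 qed
 also have "integral {0..dl} om <= (ep*dl powr (2*ep) + dl powr ep)*X + (1 + dl powr ep)*E"
 proof -
  have aux: "(x/2 + E)/2 + y <= x' + d + (1*E + f)" if "0 <= x" "0 <= d" "0 <= f" "x = x'" "y = (d + f)/2" for x y x' d f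
   using that E0 by (simp add: field_simps)
  have "0 <= ep*X*dl powr (2*ep)" "0 <= dl powr ep*X" "0 <= dl powr ep*E" using ep X0 E0 by auto
  moreover have "ep*X*dl powr (2*ep) = ep*dl powr (2*ep)*X" by simp
  moreover have "dl powr ep/2*(X + E) = (dl powr ep*X + dl powr ep*E)/2" by (simp add: algebra_simps)
  ultimately show ?thesis unfolding integral_unique[OF omi] distrib_right by (rule aux)
 qed
 finally show ?thesis using P(2,3) by (simp add: X_def E_def mult.assoc)
qed


text \<open>Pairs f on one side of x0 with g on the other at distances in the ratio kp. With R the
  cutoff times \<open>rh1\<close>, the substitution y = kp z turns it into an integral of a dilated
  f against \<open>w g\<close>; see \<open>form_substitution\<close>.\<close>

definition dilation_form ::
 "real => real => real => real => (real => real) => real => (real => complex) => (real => complex) => complex" where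
 "dilation_form x0 si dl ta R kp f g = cx (kp powr (- 1 - ta)) *
   integral {0..dl} (%y. cx (y powr ta*R (y/kp))*(f (x0 - si*y)*cnj (g (x0 + si*(y/kp)))))"

context sturm_liouville
begin

text \<open>The integral of p |f'|^2, written with v = p f'.\<close>

definition energy :: "(real => complex) => real" where
 "energy v = integral {0..a} (%x. (cmod (v x))^2*inverse (p x))"

lemma energy_int:
 assumes "continuous_on {c..d} v"
 shows "(%x. (cmod (v x))^2*inverse (p x)) abs_int_on {c..d}"
 by (intro absolutely_integrable_continuous_mult(2) ip_int continuous_intros assms)

lemma energy_nonneg:
 assumes "continuous_on {0..a} v"
 shows "0 <= energy v"
proof -
 have "integral {0..a} (%x. (cmod (v x))^2*inverse (p x)) = integral {0..a} (%x. \<bar>(cmod (v x))^2*inverse (p x)\<bar>)"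
  by (rule integral_spike[OF p_pos]) auto
 also have "0 <= ..." using energy_int[OF assms] by (intro integral_nonneg) (auto simp: abs_int_def)
 finally show ?thesis by (simp add: energy_def)
qed

end

definition (in sturm_liouville) sesquilinear :: "((real => complex) => (real => complex) => complex) => bool" where
 "sesquilinear T \<longleftrightarrow> (\<forall>f g h b. continuous_on {0..a} f --> continuous_on {0..a} g --> continuous_on {0..a} h -->
   T (%x. f x + b*g x) h = T f h + b*T g h & T h (%x. f x + b*g x) = T h f + cnj b*T h g)"

text \<open>A turning point in normal form: \<open>si\<close> selects the side with the larger
  exponent ta1, and c is the sign of w there. On the other side the reciprocal of \<open>rh2\<close>
  is kept, because the adjoint estimate divides the weight of the first side by that of the second;
  the quotient contains y to the power ta1 - ta2, which is not negative.\<close>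

locale simple_turning_point = sturm_liouville +
 fixes x0 si c dl ta1 ta2 K :: real and rh1 rh1' rh2 th' :: "real => real"
 assumes si: "si = 1 \<or> si = - 1" and c: "c = 1 \<or> c = - 1" and dl: "0 < dl"
  and inside: "{x0 - dl..x0 + dl} \<subseteq> {0..a}" and ta: "- 1 < ta2" "ta2 <= ta1"
  and w1: "0 < y ==> y <= dl ==> w (x0 + si*y) = c*rh1 y*y powr ta1"
  and w2: "0 < y ==> y <= dl ==> w (x0 - si*y) = - c*rh2 y*y powr ta2"
  and rh1_prim: "primitive_on {0..dl} rh1 rh1'" and rh2_prim: "primitive_on {0..dl} (%y. inverse (rh2 y)) th'"
  and rh1: "y : {0..dl} ==> 0 < rh1 y" "y : {0..dl} ==> rh1 y <= K" "y : {0..dl} ==> \<bar>rh1' y\<bar> <= K"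
  and rh2: "y : {0..dl} ==> 0 < rh2 y" "y : {0..dl} ==> inverse (rh2 y) <= K" "y : {0..dl} ==> \<bar>th' y\<bar> <= K"
  and p_bd: "negligible {x : {x0 - dl..x0 + dl}. \<not> (p x <= K & inverse (p x) <= K)}"
begin

lemma K_pos: "0 < K"
 using rh1(1,2)[of 0] dl by auto

lemma side_in: "m = 1 \<or> m = - 1 ==> y : {0..dl} ==> x0 + m*y : {x0 - dl..x0 + dl}"
 "m = 1 \<or> m = - 1 ==> y : {0..dl} ==> x0 + m*y : {0..a}"
 using inside by auto

lemma has_integral_side:
 fixes g :: "real => real"
 assumes m: "m ~= 0" "\<bar>m\<bar> <= 1" and g: "g abs_int_on {0..a}" and g0: "!!x. x : {0..a} ==> 0 <= g x"
 shows "(%y. g (x0 + m*y)) abs_int_on {0..dl}" "integral {0..dl} (%y. g (x0 + m*y)) <= integral {0..a} g/\<bar>m\<bar>"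
proof -
 let ?u = "min (x0 + m*0) (x0 + m*dl)" and ?v = "max (x0 + m*0) (x0 + m*dl)"
 have "\<bar>m*dl\<bar> <= dl" using m dl by (simp add: abs_mult mult_le_cancel_right1)
 then have "{?u..?v} \<subseteq> {x0 - dl..x0 + dl}" by auto
 then have sub: "{?u..?v} \<subseteq> {0..a}" using inside by blast
 have gs: "g abs_int_on {?u..?v}" by (rule absolutely_integrable_on_subinterval[OF g sub])
 show "(%y. g (x0 + m*y)) abs_int_on {0..dl}" by (rule absolutely_integrable_affine[OF m(1) gs]) (use dl in simp)
 have "((%y. g (x0 + m*y)) has_integral (1/\<bar>m\<bar>) *\<^sub>R integral {?u..?v} g) {0..dl}"
  by (rule has_integral_affine[OF m(1)]) (use gs dl in \<open>auto simp: abs_int_def integrable_integral\<close>)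
 then have "integral {0..dl} (%y. g (x0 + m*y)) = integral {?u..?v} g/\<bar>m\<bar>" by (simp add: integral_unique)
 also have "... <= integral {0..a} g/\<bar>m\<bar>"
  using sub gs g g0 by (intro divide_right_mono integral_subset_le) (auto simp: abs_int_def)
 finally show "integral {0..dl} (%y. g (x0 + m*y)) <= integral {0..a} g/\<bar>m\<bar>" .
qed

text \<open>Both sides are parametrised by the distance y from x0. The factor m makes
  \<open>m v\<close> the quasi-derivative with respect to y, and as m^2 = 1 the equation keeps its
  form. The bounds on p and 1/p bound the derivative of f by v and the unweighted L2 norm of v by
  the energy.\<close>

lemma side_data:
 assumes m: "m = 1 \<or> m = - 1" and s: "sol {0..a} s f v"
 shows "\<exists>d. primitive_on {0..dl} (%y. f (x0 + m*y)) d & (\<forall>y\<in>{0..dl}. cmod (d y) <= K*cmod (of_real m * v (x0 + m*y)))"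
  and "primitive_on {0..dl} (%y. of_real m * v (x0 + m*y)) (%y. cx (q (x0 + m*y))*f (x0 + m*y) - s (x0 + m*y))"
  and "(%y. q (x0 + m*y)) abs_int_on {0..dl}"
  and "continuous_on {0..dl} (%y. f (x0 + m*y))" "continuous_on {0..dl} (%y. of_real m * v (x0 + m*y))"
  and "integral {0..dl} (%y. (cmod (of_real m * v (x0 + m*y)))^2) <= K*energy v"
  and "integral {0..dl} (%y. \<bar>q (x0 + m*y)\<bar>) <= integral {0..a} (%y. \<bar>q y\<bar>)"
proof -
 have m0: "m ~= 0" "\<bar>m\<bar> <= 1" "m*m = 1" "cmod (of_real m) = 1" using m by auto
 have sub: "y : {0..dl} ==> x0 + m*y : {0..a}" for y using side_in(2)[OF m] .
 define B where "B = {x : {x0 - dl..x0 + dl}. \<not> (p x <= K & inverse (p x) <= K)} \<union> {x. p x <= 0}"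
 have B: "negligible B" unfolding B_def by (intro negligible_Un p_bd p_pos)
 have Bv: "0 < p x" "p x <= K" "inverse (p x) <= K" if "x : {x0 - dl..x0 + dl} - B" for x using that by (auto simp: B_def not_le)
 define ip where "ip = (%x. if x : B then 0 else inverse (p x))"
 have "primitive_on {x0 - dl..x0 + dl} f (%x. of_real (ip x) * v x)"
  by (rule primitive_on_spike[OF primitive_on_subset[OF solD(1)[OF s] inside] B]) (auto simp: ip_def divide_inverse mult.commute)
 from primitive_on_affine[OF this m0(1), of "{0..dl}" x0]
 have "primitive_on {0..dl} (%y. f (x0 + m*y)) (%y. m *\<^sub>R (of_real (ip (x0 + m*y)) * v (x0 + m*y)))" using side_in(1)[OF m] by blast
 moreover have "cmod (m *\<^sub>R (of_real (ip (x0 + m*y)) * v (x0 + m*y))) <= K*cmod (of_real m * v (x0 + m*y))" if "y : {0..dl}" for y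
 proof -
  have "\<bar>ip (x0 + m*y)\<bar> <= K" using Bv[of "x0 + m*y"] side_in(1)[OF m that] K_pos by (auto simp: ip_def)
  then show ?thesis using m0 by (auto simp: norm_mult intro: mult_right_mono)
 qed
 ultimately show "\<exists>d. primitive_on {0..dl} (%y. f (x0 + m*y)) d & (\<forall>y\<in>{0..dl}. cmod (d y) <= K*cmod (of_real m * v (x0 + m*y)))"
  by blast
 have "primitive_on {0..dl} (%y. of_real m * v (x0 + m*y)) (%y. of_real m*(m *\<^sub>R (cx (q (x0 + m*y))*f (x0 + m*y) - s (x0 + m*y))))"
  by (intro primitive_on_cmult primitive_on_affine[OF solD(2)[OF s] m0(1)] sub)
 moreover have "of_real m*(m *\<^sub>R z) = z" for z :: complex
  using m0(3) by (simp add: scaleR_conv_of_real flip: mult.assoc of_real_mult)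
 ultimately show "primitive_on {0..dl} (%y. of_real m * v (x0 + m*y)) (%y. cx (q (x0 + m*y))*f (x0 + m*y) - s (x0 + m*y))"
  by simp
 then show uc: "continuous_on {0..dl} (%y. of_real m * v (x0 + m*y))" by (rule primitive_on_continuous) simp
 have "(%y. q (x0 + m*y)) abs_int_on {0..dl}"
  by (rule absolutely_integrable_affine[OF m0(1)]) (use dl q_int in auto)
 then show "(%y. q (x0 + m*y)) abs_int_on {0..dl}" .
 show "continuous_on {0..dl} (%y. f (x0 + m*y))"
  by (intro continuous_on_compose2[OF sol_continuous(1)[OF s order_refl]] continuous_intros) (use sub in auto)
 show "integral {0..dl} (%y. \<bar>q (x0 + m*y)\<bar>) <= integral {0..a} (%y. \<bar>q y\<bar>)"
  using has_integral_side(2)[OF m0(1,2), of "%x. \<bar>q x\<bar>"] absolutely_integrable_abs[OF q_int] m by (auto simp: o_def)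
 have vc: "continuous_on {0..a} v" by (rule sol_continuous(2)[OF s order_refl])
 let ?e = "%x. \<bar>(cmod (v x))^2*inverse (p x)\<bar>"
 have ei: "?e abs_int_on {0..a}" using absolutely_integrable_abs[OF energy_int[OF vc]] by (simp add: o_def)
 note e = has_integral_side[OF m0(1,2) ei]
 have N: "negligible {y : {0..dl}. x0 + m*y : B}"
 proof -
  have "negligible ((%x. m*(x - x0)) ` B)"
   by (rule negligible_differentiable_image_negligible[OF _ B]) (auto intro!: derivative_intros)
  moreover have "{y : {0..dl}. x0 + m*y : B} \<subseteq> (%x. m*(x - x0)) ` B"
  proof
   fix y assume "y : {y : {0..dl}. x0 + m*y : B}"
   moreover have "y = m*((x0 + m*y) - x0)" using m0(3) by (simp flip: mult.assoc)
   ultimately show "y : (%x. m*(x - x0)) ` B" by blast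
  qed
  ultimately show ?thesis by (rule negligible_subset)
 qed
 have "integral {0..dl} (%y. (cmod (of_real m * v (x0 + m*y)))^2)
   = integral {0..dl} (%y. if y : {y : {0..dl}. x0 + m*y : B} then 0 else (cmod (of_real m * v (x0 + m*y)))^2)"
  by (rule integral_spike[OF N]) auto
 also have "... <= integral {0..dl} (%y. K*?e (x0 + m*y))"
 proof (rule integral_le)
  show "(%y. if y : {y : {0..dl}. x0 + m*y : B} then 0 else (cmod (of_real m * v (x0 + m*y)))^2) integrable_on {0..dl}"
   by (rule integrable_spike[OF continuous_norm_square_int[OF uc] N]) auto
  show "(%y. K*?e (x0 + m*y)) integrable_on {0..dl}"
   using e(1) by (intro integrable_on_mult_right) (simp add: abs_int_def)
  fix y assume y: "y : {0..dl}"
  show "(if y : {y : {0..dl}. x0 + m*y : B} then 0 else (cmod (of_real m * v (x0 + m*y)))^2) <= K*?e (x0 + m*y)"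
  proof (cases "x0 + m*y : B")
   case False
   then have "0 < p (x0 + m*y)" "p (x0 + m*y) <= K" using Bv[of "x0 + m*y"] side_in(1)[OF m y] by auto
   then have "1 <= K*inverse (p (x0 + m*y))" by (simp add: field_simps)
   then have "(cmod (v (x0 + m*y)))^2*1 <= (cmod (v (x0 + m*y)))^2*(K*inverse (p (x0 + m*y)))" by (intro mult_left_mono) auto
   then show ?thesis using False \<open>0 < p (x0 + m*y)\<close> m0 by (simp add: norm_mult mult_ac)
  qed (use K_pos y in simp)
 qed
 also have "... = K*integral {0..dl} (%y. ?e (x0 + m*y))" by simp
 also have "... <= K*integral {0..a} ?e" using e(2) K_pos m by (intro mult_left_mono) auto
 also have "integral {0..a} ?e = energy v" unfolding energy_def by (rule integral_spike[OF p_pos]) auto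
 finally show "integral {0..dl} (%y. (cmod (of_real m * v (x0 + m*y)))^2) <= K*energy v" .
qed

lemma powr_weight_int:
 assumes "- 1 < t"
 shows "(%y. cx (y powr t)) abs_int_on {0..d}"
proof (cases "0 <= d")
 case True
 have "(%y. y powr t) integrable_on {0..d}" using has_integral_powr_from_0[OF assms True] by blast
 then have "(%y. y powr t) abs_int_on {0..d}" by (rule nonnegative_absolutely_integrable_1) simp
 then show ?thesis by (rule of_real_absolutely_integrable)
qed simp

abbreviation form :: "real => real => (real => complex) => (real => complex) => complex" where
 "form et kp \<equiv> dilation_form x0 si dl ta1 (%u. cutoff et u*rh1 u) kp"

lemma scaled_in: "1 <= kp ==> y : {0..dl} ==> y/kp : {0..dl}"
 by (auto simp: field_simps mult_le_cancel_left1 intro: order_trans)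

lemma si': "- si = 1 \<or> - si = - 1" "\<bar>si\<bar> = 1" "si ~= 0"
 using si by auto

lemma form_integrand:
 assumes kp: "1 <= kp" and et: "0 < et" "et <= dl" and f: "continuous_on {0..a} f" and g: "continuous_on {0..a} g"
 shows "(%y. cx (y powr ta1*(cutoff et (y/kp)*rh1 (y/kp)))*(f (x0 - si*y)*cnj (g (x0 + si*(y/kp)))))
   abs_int_on {0..dl}"
proof -
 have "continuous_on {0..dl} (cutoff et)" "continuous_on {0..dl} rh1"
  using primitive_on_continuous[OF primitive_on_cutoff[OF et]] primitive_on_continuous[OF rh1_prim] by auto
 moreover have k: "continuous_on {0..dl} (%y. y/kp)" "(%y. y/kp) ` {0..dl} \<subseteq> {0..dl}"
  by (intro continuous_intros) (use kp in simp, rule image_subsetI, erule scaled_in[OF kp])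
 ultimately have "continuous_on {0..dl} (%y. cutoff et (y/kp))" "continuous_on {0..dl} (%y. rh1 (y/kp))"
  by (auto intro: continuous_on_compose2)
 moreover have "continuous_on {0..dl} (%y. f (x0 - si*y))"
  by (rule continuous_on_compose2[OF f]) (use side_in(2)[OF si'(1)] in \<open>auto intro!: continuous_intros\<close>)
 moreover have "continuous_on {0..dl} (%y. g (x0 + si*(y/kp)))"
 proof (rule continuous_on_compose2[OF g])
  show "continuous_on {0..dl} (%y. x0 + si*(y/kp))" by (intro continuous_intros k)
  show "(%y. x0 + si*(y/kp)) ` {0..dl} \<subseteq> {0..a}" using side_in(2)[OF si scaled_in[OF kp]] by blast
 qed
 ultimately have "continuous_on {0..dl} (%y. cx (cutoff et (y/kp)*rh1 (y/kp))*(f (x0 - si*y)*cnj (g (x0 + si*(y/kp)))))"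
  by (intro continuous_intros)
 from absolutely_integrable_continuous_mult(1)[OF powr_weight_int this, of ta1] show ?thesis
  using ta by (simp add: mult_ac)
qed

text \<open>Weighted Cauchy-Schwarz between the two sides. On the side with exponent ta2 the weight
  \<open>y powr ta1\<close> is dominated by \<open>y powr ta2\<close>, as ta2 <= ta1. The remaining
  power of kp is negative because ta1 > -1.\<close>

lemma form_small:
 assumes kp: "1 <= kp" and et: "0 < et" "et <= dl" and f: "continuous_on {0..a} f"
 shows "cmod (form et kp f f) <= K*(1 + dl powr (ta1 - ta2))*kp powr (- (1 + ta1)/2)*(nrm f)^2"
proof -
 define F where "F = (%x. \<bar>w x\<bar>*(cmod (f x))^2)"
 \<comment> \<open>A balances the two sides: after multiplication by the prefactor they contribute
   kp^(-1-ta1) A and 1/A.\<close>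
 define A where "A = kp powr ((1 + ta1)/2)"
 have A: "0 < A" using kp by (simp add: A_def)
 have Fi: "F abs_int_on {0..a}" unfolding F_def by (rule cont_sq_int[OF f])
 have F0: "0 <= F x" for x by (simp add: F_def)
 have Fn: "integral {0..a} F = (nrm f)^2" using nrm_square[OF cont_H[OF f]] by (simp add: F_def)
 have s1: "(%y. F (x0 - si*y)) integrable_on {0..dl}" "integral {0..dl} (%y. F (x0 - si*y)) <= (nrm f)^2"
  using has_integral_side[OF _ _ Fi F0, of "- si"] si' Fn by (auto simp: abs_int_def)
 have "(%y. F (x0 + si/kp*y)) integrable_on {0..dl}" "integral {0..dl} (%y. F (x0 + si/kp*y)) <= (nrm f)^2/\<bar>si/kp\<bar>"
  using has_integral_side[OF _ _ Fi F0, of "si/kp"] si' Fn kp by (auto simp: abs_int_def abs_divide)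
 then have s2: "(%y. F (x0 + si*(y/kp))) integrable_on {0..dl}" "integral {0..dl} (%y. F (x0 + si*(y/kp))) <= kp*(nrm f)^2"
  using si' kp by (simp_all add: abs_divide mult.commute)
 let ?B = "%y. (K/2)*(A*dl powr (ta1 - ta2)*F (x0 - si*y) + kp powr ta1/A*F (x0 + si*(y/kp)))"
 have Bi: "(?B has_integral (K/2)*(A*dl powr (ta1 - ta2)*integral {0..dl} (%y. F (x0 - si*y))
   + kp powr ta1/A*integral {0..dl} (%y. F (x0 + si*(y/kp))))) {0..dl}"
  by (intro has_integral_mult_right has_integral_add integrable_integral s1 s2)
 have "cmod (integral {0..dl} (%y. cx (y powr ta1*(cutoff et (y/kp)*rh1 (y/kp)))*(f (x0 - si*y)*cnj (f (x0 + si*(y/kp))))))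
   <= integral {0..dl} ?B"
 proof (rule integral_norm_bound_integral)
  show "(%y. cx (y powr ta1*(cutoff et (y/kp)*rh1 (y/kp)))*(f (x0 - si*y)*cnj (f (x0 + si*(y/kp))))) integrable_on {0..dl}"
   using form_integrand[OF kp et f f] by (simp add: abs_int_def)
  show "?B integrable_on {0..dl}" using Bi by blast
  fix y assume y: "y : {0..dl}"
  define z where "z = y/kp"
  define X Y where "X = cmod (f (x0 - si*y))" and "Y = cmod (f (x0 + si*z))"
  have z: "z : {0..dl}" using scaled_in[OF kp y] by (simp add: z_def)
  note r1 = rh1(1,2)[OF z] and r2 = rh2(1,2)[OF y]
  show "cmod (cx (y powr ta1*(cutoff et (y/kp)*rh1 (y/kp)))*(f (x0 - si*y)*cnj (f (x0 + si*(y/kp))))) <= ?B y"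
  proof (cases "y = 0")
   case True
   then show ?thesis using F0 K_pos A by simp
  next
   case False
   then have y0: "0 < y" "y <= dl" and z0: "0 < z" "z <= dl" using y z kp by (auto simp: z_def)
   have F2: "F (x0 - si*y) = rh2 y*y powr ta2*X^2" using w2[OF y0] c r2 by (auto simp: F_def X_def abs_mult)
   have F1: "F (x0 + si*z) = rh1 z*z powr ta1*Y^2" using w1[OF z0] c r1 by (auto simp: F_def Y_def abs_mult)
   have yz: "y powr ta1 = kp powr ta1*z powr ta1" using y0 kp by (simp add: z_def powr_divide)
   have "cmod (cx (y powr ta1*(cutoff et (y/kp)*rh1 (y/kp)))*(f (x0 - si*y)*cnj (f (x0 + si*(y/kp)))))
     = y powr ta1*(\<bar>cutoff et z\<bar>*rh1 z)*(X*Y)"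
    using r1 by (simp add: norm_mult X_def Y_def z_def abs_mult)
   also have "... <= y powr ta1*(1*rh1 z)*(X*Y)"
    using cutoff_abs_le_1[OF et(1), of z] z r1 by (intro mult_right_mono mult_left_mono) (auto simp: X_def Y_def)
   also have "... = y powr ta1*(2*(X*(rh1 z*Y)))/2" by simp
   also have "... <= y powr ta1*(A*X^2 + (rh1 z*Y)^2/A)/2"
    by (intro divide_right_mono mult_left_mono two_mult_le_weighted_squares A) auto
   also have "... = (A*(y powr ta1*X^2) + (y powr ta1*(rh1 z*Y)^2)/A)/2" by (simp add: algebra_simps)
   also have "... <= (A*(K*dl powr (ta1 - ta2)*F (x0 - si*y)) + (K*kp powr ta1*F (x0 + si*z))/A)/2"
   proof (intro divide_right_mono add_mono mult_left_mono)
    have "1 <= K*rh2 y" using r2 by (simp add: field_simps)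
    moreover have "y powr ta1 = y powr (ta1 - ta2)*y powr ta2" by (simp flip: powr_add)
    moreover have "y powr (ta1 - ta2) <= dl powr (ta1 - ta2)" using y0 ta by (intro powr_mono2) auto
    ultimately have "y powr ta1*1 <= dl powr (ta1 - ta2)*y powr ta2*(K*rh2 y)" by (intro mult_mono) (auto intro!: mult_right_mono)
    then have "y powr ta1*X^2 <= dl powr (ta1 - ta2)*y powr ta2*(K*rh2 y)*X^2" by (intro mult_right_mono) auto
    then show "y powr ta1*X^2 <= K*dl powr (ta1 - ta2)*F (x0 - si*y)" unfolding F2 by (simp add: mult_ac)
    have "kp powr ta1*z powr ta1*(rh1 z*rh1 z*Y^2) <= kp powr ta1*z powr ta1*(K*rh1 z*Y^2)"
     using r1 by (intro mult_left_mono mult_right_mono) auto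
    then show "y powr ta1*(rh1 z*Y)^2 <= K*kp powr ta1*F (x0 + si*z)" unfolding F1 yz by (simp add: mult_ac power2_eq_square)
   qed (use A in auto)
   also have "... = ?B y" by (simp add: z_def algebra_simps)
   finally show ?thesis .
  qed
 qed
 also have "... <= (K/2)*(A*dl powr (ta1 - ta2)*(nrm f)^2 + kp powr ta1/A*(kp*(nrm f)^2))"
  unfolding integral_unique[OF Bi] using s1(2) s2(2) K_pos A by (intro mult_left_mono add_mono) auto
 finally have I: "cmod (integral {0..dl} (%y. cx (y powr ta1*(cutoff et (y/kp)*rh1 (y/kp)))*(f (x0 - si*y)*cnj (f (x0 + si*(y/kp))))))
   <= (K/2)*(A*dl powr (ta1 - ta2)*(nrm f)^2 + kp powr ta1/A*(kp*(nrm f)^2))" .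
 have "cmod (form et kp f f) <= kp powr (- 1 - ta1)*((K/2)*(A*dl powr (ta1 - ta2)*(nrm f)^2 + kp powr ta1/A*(kp*(nrm f)^2)))"
  using mult_left_mono[OF I powr_ge_zero[of kp "- 1 - ta1"]]
  by (simp only: dilation_form_def norm_mult[of "cx (kp powr (- 1 - ta1))"] norm_of_real abs_of_nonneg[OF powr_ge_zero])
 also have "... = (K/2)*((kp powr (- 1 - ta1)*A)*dl powr (ta1 - ta2) + (kp powr (- 1 - ta1)*kp powr ta1*kp)/A)*(nrm f)^2" by (simp add: algebra_simps)
 also have "kp powr (- 1 - ta1)*A = kp powr (- (1 + ta1)/2)" unfolding A_def by (simp add: field_simps flip: powr_add)
 also have "kp powr (- 1 - ta1)*kp powr ta1*kp = 1" using kp by (simp add: powr_minus flip: powr_add)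
 also have "1/A = kp powr (- (1 + ta1)/2)" by (simp only: A_def powr_minus_divide minus_divide_left[symmetric])
 also have "(K/2)*(kp powr (- (1 + ta1)/2)*dl powr (ta1 - ta2) + kp powr (- (1 + ta1)/2))*(nrm f)^2
   = (K*(1 + dl powr (ta1 - ta2))*kp powr (- (1 + ta1)/2)*(nrm f)^2)/2" by (simp add: algebra_simps add_divide_distrib)
 also have "... <= K*(1 + dl powr (ta1 - ta2))*kp powr (- (1 + ta1)/2)*(nrm f)^2"
  using K_pos by (simp add: add_nonneg_nonneg)
 finally show ?thesis .
qed

lemma form_substitution:
 assumes kp: "1 <= kp" and et: "0 < et" "et <= dl" and f: "continuous_on {0..a} f" and g: "continuous_on {0..a} g"
  and s: "!!x. s x = cx (w x)*g x"
 shows "form et kp f g = of_real c*integral {0..dl/kp} (%y. cx (cutoff et y)*f (x0 - si*(kp*y))*cnj (s (x0 + si*y)))"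
proof -
 let ?I = "%y. cx (y powr ta1*(cutoff et (y/kp)*rh1 (y/kp)))*(f (x0 - si*y)*cnj (g (x0 + si*(y/kp))))"
 let ?J = "%y. cx (cutoff et y)*f (x0 - si*(kp*y))*cnj (s (x0 + si*y))"
 have "(?I has_integral integral {0..dl} ?I) {0..dl}"
  using form_integrand[OF kp et f g] by (auto simp: abs_int_def intro: integrable_integral)
 then have "((%z. ?I (0 + kp*z)) has_integral (1/\<bar>kp\<bar>) *\<^sub>R integral {0..dl} ?I) {0..dl/kp}"
  using kp dl by (intro has_integral_affine) (auto simp: min_def max_def)
 then have "((%z. of_real (c*kp powr ta1)*?J z) has_integral (1/\<bar>kp\<bar>) *\<^sub>R integral {0..dl} ?I) {0..dl/kp}"
 proof (rule has_integral_spike[OF negligible_sing[of 0], rotated -1])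
  fix z assume "z : {0..dl/kp} - {0}"
  then have z: "0 < z" "z <= dl" using kp dl scaled_in[OF kp, of dl] by auto
  have "(kp*z) powr ta1 = kp powr ta1*z powr ta1" using z kp by (simp add: powr_mult)
  moreover have "cnj (s (x0 + si*z)) = of_real (c*rh1 z*z powr ta1)*cnj (g (x0 + si*z))"
   unfolding s w1[OF z] by simp
  ultimately show "of_real (c*kp powr ta1)*?J z = ?I (0 + kp*z)" using kp c by auto
 qed
 then have "integral {0..dl/kp} (%z. of_real (c*kp powr ta1)*?J z) = (1/\<bar>kp\<bar>) *\<^sub>R integral {0..dl} ?I" by (rule integral_unique)
 then have J: "of_real (c*kp powr ta1)*integral {0..dl/kp} ?J = (1/\<bar>kp\<bar>) *\<^sub>R integral {0..dl} ?I"
  by (simp only: integral_mult_right)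
 have "integral {0..dl} ?I = of_real kp*((1/\<bar>kp\<bar>) *\<^sub>R integral {0..dl} ?I)"
  using kp by (simp only: scaleR_conv_of_real) simp
 then have "integral {0..dl} ?I = of_real kp*(of_real (c*kp powr ta1)*integral {0..dl/kp} ?J)" by (simp only: J)
 then have "form et kp f g = of_real (kp powr (- 1 - ta1)*kp*kp powr ta1)*(of_real c*integral {0..dl/kp} ?J)"
  unfolding dilation_form_def by (simp only: of_real_mult mult_ac)
 also have "kp powr (- 1 - ta1)*kp*kp powr ta1 = (kp powr (- 1 - ta1)*kp powr ta1)*kp" by simp
 also have "... = 1" using kp by (simp add: powr_minus flip: powr_add)
 finally show ?thesis by simp
qed

text \<open>The second argument lives on the side si, where the quasi-derivative with respect to the
  distance is \<open>si * v x0\<close> at the turning point; \<open>dilated_form_bound\<close> turns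
  it into the boundary term.\<close>

lemma form_right_bound:
 assumes kp: "1 <= kp" and et: "0 < et" "et <= dl/kp"
 shows "\<exists>C\<ge>0. \<forall>f v g S. bounded_sol f v g S (cmod (form et kp f g - of_real (c * si)*(f x0*cnj (v x0))) <= C*(energy v + S^2))"
proof -
 define C where "C = integral {0..a} (%y. \<bar>q y\<bar>) + dl/et^2 + 1 + kp*K"
 have Q0: "0 <= integral {0..a} (%y. \<bar>q y\<bar>)"
  using q_int[of 0 a] by (intro integral_nonneg) (auto simp: abs_int_def)
 have C0: "0 <= C" using kp K_pos dl Q0 by (simp add: C_def)
 have et': "et <= dl" using et(2) kp dl scaled_in[OF kp, of dl] by auto
 have "cmod (form et kp f g - of_real (c * si)*(f x0*cnj (v x0))) <= C*(1 + 2*K)*(energy v + S^2)"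
  if s: "wsol g f v" and g: "continuous_on {0..a} g" and S: "\<forall>x\<in>{0..a}. cmod (f x) <= S" for f v g S
 proof -
  note fc = sol_continuous[OF s order_refl]
  note R = side_data[OF si s] and L = side_data[OF si'(1) s]
  let ?u1 = "%y. of_real si * v (x0 + si*y)" and ?u2 = "%y. of_real (- si) * v (x0 + - si*y)"
  obtain d where d: "primitive_on {0..dl} (%y. f (x0 + - si*y)) d" "\<forall>y\<in>{0..dl}. cmod (d y) <= K*cmod (?u2 y)" using L(1) by (elim exE conjE)
  let ?X = "S^2 + integral {0..dl} (%y. (cmod (?u1 y))^2) + integral {0..dl} (%y. (cmod (?u2 y))^2)"
  have "cmod (integral {0..dl/kp} (%y. cx (cutoff et y)*f (x0 + - si*(kp*y))*cnj (cx (w (x0 + si*y))*g (x0 + si*y)))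
    - f (x0 + - si*0)*cnj (?u1 0)) <= (integral {0..dl} (%y. \<bar>q (x0 + si*y)\<bar>) + dl/et^2 + 1 + kp*K)*?X"
   by (rule dilated_form_bound[OF dl kp et less_imp_le[OF K_pos] d(1) _ R(2,3,4) L(5)])
    (use d(2) S side_in(2)[OF si] side_in(2)[OF si'(1)] in auto)
  also have "... <= C*((1 + 2*K)*(energy v + S^2))"
  proof (rule mult_mono)
   show "integral {0..dl} (%y. \<bar>q (x0 + si*y)\<bar>) + dl/et^2 + 1 + kp*K <= C" using R(7) by (simp add: C_def)
   have "0 <= energy v + 2*(K*S^2)" using energy_nonneg[OF fc(2)] K_pos by simp
   then show "?X <= (1 + 2*K)*(energy v + S^2)" using R(6) L(6) by (simp add: algebra_simps)
   have "0 <= integral {0..dl} (%y. (cmod (?u1 y))^2)" "0 <= integral {0..dl} (%y. (cmod (?u2 y))^2)"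
    by (intro integral_nonneg continuous_norm_square_int R(5) L(5); simp)+
   then show "0 <= ?X" by (intro add_nonneg_nonneg) auto
  qed (use C0 in simp)
  finally have *: "cmod (integral {0..dl/kp} (%y. cx (cutoff et y)*f (x0 - si*(kp*y))*cnj (cx (w (x0 + si*y))*g (x0 + si*y)))
    - of_real si*(f x0*cnj (v x0))) <= C*(1 + 2*K)*(energy v + S^2)" by (simp add: mult_ac)
  have cc: "cmod (of_real c) = 1" using c by auto
  have "form et kp f g - of_real (c * si)*(f x0*cnj (v x0)) = of_real c*(integral {0..dl/kp} (%y. cx (cutoff et y)*f (x0 - si*(kp*y))*cnj (cx (w (x0 + si*y))*g (x0 + si*y)))
    - of_real si*(f x0*cnj (v x0)))"
   unfolding form_substitution[OF kp et(1) et' fc(1) g refl] by (simp add: algebra_simps)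
  then show ?thesis using*cc by (simp add: norm_mult)
 qed
 then show ?thesis using C0 K_pos by (intro exI[of _ "C*(1 + 2*K)"]) simp
qed

text \<open>The two coefficients sum to \<open>- 2\<close>, which fixes the boundary term at \<open>x0\<close>;
their ratio makes the adjoint of the form vanish at \<open>x0\<close>.\<close>

definition tform :: "real => (real => complex) => (real => complex) => complex" where
 "tform k f g = of_real (2*2 powr (- 1 - ta1)/(1 - 2 powr (- 1 - ta1)))*form (dl/(2*k)) k f g
   - of_real (2/(1 - 2 powr (- 1 - ta1)))*form (dl/(2*k)) (2*k) f g"

lemma cutoff_width: "1 <= k ==> 0 < dl/(2*k)" "1 <= k ==> dl/(2*k) <= dl/k" "1 <= k ==> dl/(2*k) <= dl"
 using dl by (auto simp: field_simps mult_le_cancel_left1 mult_le_cancel_right1)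

lemma weight_ratio: "0 < 1 - 2 powr (- 1 - ta1)"
 using ta powr_less_mono[of "- 1 - ta1" 0 2] by simp

text \<open>The coefficients of the two dilations do not depend on k, while
  \<open>form_small\<close> decays in k.\<close>

lemma tform_small:
 assumes "0 < ep"
 shows "\<exists>k\<ge>1. \<forall>f. continuous_on {0..a} f --> cmod (tform k f f) <= ep*(nrm f)^2"
proof -
 define m where "m = 2 powr (- 1 - ta1)"
 define M where "M = (2*m/(1 - m) + 2/(1 - m))*(K*(1 + dl powr (ta1 - ta2)))"
 have m: "0 < m" "0 < 1 - m" using weight_ratio by (auto simp: m_def)
 have "((%k. M*k powr (- (1 + ta1)/2)) \<longlongrightarrow> M*0) at_top"
  by (intro tendsto_intros tendsto_neg_powr filterlim_ident) (use ta in auto)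
 then have "\<forall>\<^sub>F k in at_top. M*k powr (- (1 + ta1)/2) < ep"
  using \<open>0 < ep\<close> by (auto dest: order_tendstoD(2))
 then have "\<forall>\<^sub>F k in at_top. M*k powr (- (1 + ta1)/2) < ep & 1 <= k"
  by (intro eventually_conj eventually_ge_at_top)
 then obtain k where k: "M*k powr (- (1 + ta1)/2) < ep" "1 <= k" by (rule eventually_happens'[OF trivial_limit_at_top_linorder, THEN exE]) blast
 have "cmod (tform k f f) <= ep*(nrm f)^2" if f: "continuous_on {0..a} f" for f
 proof -
  let ?B = "K*(1 + dl powr (ta1 - ta2))*k powr (- (1 + ta1)/2)*(nrm f)^2"
  have "(2*k) powr (- (1 + ta1)/2) <= k powr (- (1 + ta1)/2)" using k(2) ta by (intro powr_mono2') auto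
  then have "K*(1 + dl powr (ta1 - ta2))*(2*k) powr (- (1 + ta1)/2)*(nrm f)^2 <= ?B"
   using K_pos by (intro mult_right_mono mult_left_mono) auto
  moreover have "1 <= 2*k" using k(2) by simp
  note form_small[OF this cutoff_width(1,3)[OF k(2)] f]
  ultimately have 2: "cmod (form (dl/(2*k)) (2*k) f f) <= ?B" by linarith
  have 1: "cmod (form (dl/(2*k)) k f f) <= ?B" by (rule form_small[OF k(2) cutoff_width(1,3)[OF k(2)] f])
  have "cmod (tform k f f) <= 2*m/(1 - m)*cmod (form (dl/(2*k)) k f f) + 2/(1 - m)*cmod (form (dl/(2*k)) (2*k) f f)"
   unfolding tform_def m_def[symmetric]
   by (rule order_trans[OF norm_triangle_ineq4]) (use m in \<open>simp add: norm_mult del: of_real_divide of_real_mult\<close>)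
  also have "... <= 2*m/(1 - m)*?B + 2/(1 - m)*?B"
   using m by (intro add_mono mult_left_mono 1 2) auto
  also have "... = M*k powr (- (1 + ta1)/2)*(nrm f)^2" unfolding M_def by algebra
  also have "... <= ep*(nrm f)^2" using k(1) by (intro mult_right_mono) auto
  finally show ?thesis .
 qed
 then show ?thesis using k(2) by blast
qed

lemma tform_right_bound:
 assumes k: "1 <= k"
 shows "\<exists>C\<ge>0. \<forall>f v g S. bounded_sol f v g S (cmod (tform k f g + of_real (2*c * si)*(f x0*cnj (v x0))) <= C*(energy v + S^2))"
proof -
 define m where "m = 2 powr (- 1 - ta1)"
 have m: "0 < m" "0 < 1 - m" using weight_ratio by (auto simp: m_def)
 let ?et = "dl/(2*k)"
 from form_right_bound[OF k cutoff_width(1,2)[OF k]] obtain C1 where C1: "0 <= C1"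
  "\<forall>f v g S. bounded_sol f v g S (cmod (form ?et k f g - of_real (c * si)*(f x0*cnj (v x0))) <= C1*(energy v + S^2))"
  by (elim exE conjE)
 from form_right_bound[of "2*k", OF _ cutoff_width(1)[OF k] order_refl] k obtain C2 where C2: "0 <= C2"
  "\<forall>f v g S. bounded_sol f v g S (cmod (form ?et (2*k) f g - of_real (c * si)*(f x0*cnj (v x0))) <= C2*(energy v + S^2))"
  by force
 have "cmod (tform k f g + of_real (2*c * si)*(f x0*cnj (v x0))) <= (2*m/(1 - m)*C1 + 2/(1 - m)*C2)*(energy v + S^2)"
  if h: "wsol g f v" "continuous_on {0..a} g" "\<forall>x\<in>{0..a}. cmod (f x) <= S" for f v g S
 proof -
  let ?J = "of_real (c * si)*(f x0*cnj (v x0))"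
  note B1 = C1(2)[THEN spec, THEN spec, THEN spec, THEN spec, THEN mp, OF h(1), THEN mp, OF h(2), THEN mp, OF h(3)]
  note B2 = C2(2)[THEN spec, THEN spec, THEN spec, THEN spec, THEN mp, OF h(1), THEN mp, OF h(2), THEN mp, OF h(3)]
  have "of_real (2*m/(1 - m)) - of_real (2/(1 - m)) = (- 2 :: complex)"
  proof -
   have "2*m/(1 - m) - 2/(1 - m) = (2*m - 2)/(1 - m)" by (simp add: diff_divide_distrib)
   also have "... = - 2" using m by (simp add: divide_eq_eq)
   finally have "2*m/(1 - m) - 2/(1 - m) = - 2" .
   then show ?thesis by (metis of_real_diff of_real_minus of_real_numeral)
  qed
  then have "of_real (2/(1 - m)) = (of_real (2*m/(1 - m)) + 2 :: complex)" by (simp add: algebra_simps)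
  then have e: "tform k f g + of_real (2*c * si)*(f x0*cnj (v x0))
    = of_real (2*m/(1 - m))*(form ?et k f g - ?J) - of_real (2/(1 - m))*(form ?et (2*k) f g - ?J)"
   unfolding tform_def m_def[symmetric] by (simp add: algebra_simps)
  have "cmod (tform k f g + of_real (2*c * si)*(f x0*cnj (v x0))) <= 2*m/(1 - m)*cmod (form ?et k f g - ?J) + 2/(1 - m)*cmod (form ?et (2*k) f g - ?J)"
   unfolding e by (rule order_trans[OF norm_triangle_ineq4]) (use m in \<open>simp add: norm_mult del: of_real_divide of_real_mult\<close>)
  also have "... <= 2*m/(1 - m)*(C1*(energy v + S^2)) + 2/(1 - m)*(C2*(energy v + S^2))"
   using m B1 B2 by (intro add_mono mult_left_mono) (simp_all only: divide_nonneg_nonneg mult_nonneg_nonneg less_imp_le zero_le_numeral)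
  finally show ?thesis by (simp only: distrib_right mult.assoc)
 qed
 moreover have "0 <= 2*m/(1 - m)*C1 + 2/(1 - m)*C2" using m C1(1) C2(1) by simp
 ultimately show ?thesis by blast
qed

lemma form_sesquilinear:
 assumes kp: "1 <= kp" and et: "0 < et" "et <= dl"
 shows "sesquilinear (form et kp)"
proof -
 let ?I = "%f g y. cx (y powr ta1*(cutoff et (y/kp)*rh1 (y/kp)))*(f (x0 - si*y)*cnj (g (x0 + si*(y/kp))))"
 have i: "(?I f g has_integral integral {0..dl} (?I f g)) {0..dl}" if "continuous_on {0..a} f" "continuous_on {0..a} g" for f g
  using form_integrand[OF kp et that] by (intro integrable_integral) (simp add: abs_int_def)
 have l: "integral {0..dl} (?I (%x. f x + b*g x) h) = integral {0..dl} (?I f h) + b*integral {0..dl} (?I g h)"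
  if "continuous_on {0..a} f" "continuous_on {0..a} g" "continuous_on {0..a} h" for f g h b
 proof -
  have "?I (%x. f x + b*g x) h = (%y. ?I f h y + b*?I g h y)" by (intro ext) algebra
  then show ?thesis using has_integral_add[OF i[OF that(1,3)] has_integral_mult_right[OF i[OF that(2,3)], of b]]
   by (simp only: integral_unique)
 qed
 have r: "integral {0..dl} (?I h (%x. f x + b*g x)) = integral {0..dl} (?I h f) + cnj b*integral {0..dl} (?I h g)"
  if "continuous_on {0..a} f" "continuous_on {0..a} g" "continuous_on {0..a} h" for f g h b
 proof -
  have "?I h (%x. f x + b*g x) = (%y. ?I h f y + cnj b*?I h g y)" unfolding complex_cnj_add complex_cnj_mult by (intro ext) algebra
  then show ?thesis using has_integral_add[OF i[OF that(3,1)] has_integral_mult_right[OF i[OF that(3,2)], of "cnj b"]]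
   by (simp only: integral_unique)
 qed
 show ?thesis unfolding sesquilinear_def dilation_form_def
 proof (intro allI impI conjI)
  fix f g h :: "real => complex" and b
  assume h: "continuous_on {0..a} f" "continuous_on {0..a} g" "continuous_on {0..a} h"
  let ?c = "cx (kp powr (- 1 - ta1))"
  show "?c*integral {0..dl} (?I (%x. f x + b*g x) h) = ?c*integral {0..dl} (?I f h) + b*(?c*integral {0..dl} (?I g h))"
   unfolding l[OF h] by (simp only: distrib_left mult.left_commute)
  show "?c*integral {0..dl} (?I h (%x. f x + b*g x)) = ?c*integral {0..dl} (?I h f) + cnj b*(?c*integral {0..dl} (?I h g))"
   unfolding r[OF h] by (simp only: distrib_left mult.left_commute)
 qed
qed

lemma tform_sesquilinear:
 assumes "1 <= k"
 shows "sesquilinear (tform k)"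
 using form_sesquilinear[OF assms cutoff_width(1,3)[OF assms]] form_sesquilinear[of "2*k", OF _ cutoff_width(1,3)[OF assms]] assms
 unfolding sesquilinear_def tform_def by (simp add: algebra_simps)

text \<open>With the operator acting in the first slot, the weight has to be moved to the other
  side. The integrand becomes \<open>y powr ep\<close> times P(y) times the source there, where P is
  1/rh2 times the difference of the two dilates of cutoff times rh1 times f. Both dilates carry the
  same factor, so P vanishes at the turning point and \<open>powr_form_bound\<close>
  applies.\<close>

lemma tform_left_bound:
 assumes k: "1 <= k"
 shows "\<exists>C\<ge>0. \<forall>f v g S. bounded_sol f v g S (cmod (tform k g f) <= C*(energy v + S^2))"
proof -
 define m where "m = 2 powr (- 1 - ta1)"
 define et where "et = dl/(2*k)"
 \<comment> \<open>The common factor of both dilates: the second coefficient is larger by 2 powr (1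
   + ta1), and \<open>(2*k) powr (- 1 - ta1)\<close> is smaller by the same amount.\<close>
 define be where "be = 2*m/(1 - m)*k powr (- 1 - ta1)"
 define ep where "ep = ta1 - ta2"
 define M where "M = K*K + K + K/et"
 define N where "N = \<bar>be\<bar>*K*(2*M + 2*K)"
 define Q where "Q = integral {0..a} (%y. \<bar>q y\<bar>)"
 define C where "C = dl powr ep*(2*K*K*\<bar>be\<bar>)*Q + (ep*dl powr (2*ep) + dl powr ep)*(3*N^2*(dl + 3*k*K)) + (1 + dl powr ep)*K"
 have m: "0 < m" "0 < 1 - m" using weight_ratio by (auto simp: m_def)
 have et: "0 < et" "et <= dl" "dl/(2*k) = et" using cutoff_width(1,3)[OF k] by (auto simp: et_def)
 have k2: "1 <= 2*k" using k by simp
 have ep0: "0 <= ep" using ta by (simp add: ep_def)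
 have M0: "0 <= M" using K_pos et by (simp add: M_def)
 have N0: "0 <= N" using K_pos M0 by (simp add: N_def)
 have Q0: "0 <= Q" unfolding Q_def using q_int[of 0 a] by (intro integral_nonneg) (auto simp: abs_int_def)
 have C0: "0 <= C" unfolding C_def using ep0 K_pos Q0 dl k by (intro add_nonneg_nonneg mult_nonneg_nonneg) auto
 have be2: "2/(1 - m)*(2*k) powr (- 1 - ta1) = be" using k by (simp add: be_def m_def powr_mult)
 define R where "R = (%u. cutoff et u*rh1 u)"
 define R' where "R' = (%u. cutoff et u*rh1' u + (if u < et then - (1/et) else 0)*rh1 u)"
 have R_prim: "primitive_on {0..dl} R R'"
  unfolding R_def R'_def by (intro primitive_on_mult primitive_on_cutoff et rh1_prim)
 have R_le: "\<bar>R u\<bar> <= K" "\<bar>R' u\<bar> <= K + K/et" if u: "u : {0..dl}" for u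
 proof -
  have c1: "\<bar>cutoff et u\<bar> <= 1" using cutoff_abs_le_1[OF et(1)] u by auto
  have r: "\<bar>rh1 u\<bar> <= K" using rh1[OF u] by auto
  show "\<bar>R u\<bar> <= K" unfolding R_def abs_mult using mult_mono[OF c1 r] by simp
  have "\<bar>R' u\<bar> <= \<bar>cutoff et u\<bar>*\<bar>rh1' u\<bar> + (1/et)*\<bar>rh1 u\<bar>"
   unfolding R'_def by (rule order_trans[OF abs_triangle_ineq]) (use et in \<open>auto simp: abs_mult\<close>)
  also have "... <= 1*K + (1/et)*K"
   using c1 r rh1(3)[OF u] et K_pos by (intro add_mono mult_mono mult_left_mono) auto
  finally show "\<bar>R' u\<bar> <= K + K/et" by simp
 qed
 have "cmod (tform k g f) <= C*(energy v + S^2)"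
  if s: "wsol g f v" and g: "continuous_on {0..a} g" and S: "\<forall>x\<in>{0..a}. cmod (f x) <= S" for f v g S
 proof -
  note fc = sol_continuous[OF s order_refl]
  note R1 = side_data[OF si s] and L = side_data[OF si'(1) s]
  define u1 where "u1 = (%y. of_real si * v (x0 + si*y))"
  define E1 where "E1 = integral {0..dl} (%y. (cmod (u1 y))^2)"
  define f1 where "f1 = (%y. f (x0 + si*y))"
  let ?u2 = "%y. of_real (- si) * v (x0 + - si*y)" and ?s2 = "%y. cx (w (x0 + - si*y))*g (x0 + - si*y)"
  have f1S: "cmod (f1 u) <= S" if "u : {0..dl}" for u using S side_in(2)[OF si that] by (auto simp: f1_def)
  have S0: "0 <= S" using f1S[of 0] dl order_trans[OF norm_ge_zero] by force
  have u1c: "continuous_on {0..dl} u1" using R1(5) by (simp add: u1_def)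
  have E1: "E1 <= K*energy v" using R1(6) by (simp add: u1_def E1_def)
  have En: "0 <= energy v" by (rule energy_nonneg[OF fc(2)])
  obtain d where d: "primitive_on {0..dl} f1 d" "\<forall>y\<in>{0..dl}. cmod (d y) <= K*cmod (u1 y)"
   using R1(1) unfolding u1_def f1_def by (elim exE conjE)
  define G where "G = (%u. cx (R u)*f1 u)"
  define G' where "G' = (%u. cx (R u)*d u + cx (R' u)*f1 u)"
  have G_prim: "primitive_on {0..dl} G G'" unfolding G_def G'_def by (intro primitive_on_mult primitive_on_of_real R_prim d(1))
  have G_le: "cmod (G u) <= K*S" "cmod (G' u) <= M*(S + cmod (u1 u))" if u: "u : {0..dl}" for u
  proof -
   show "cmod (G u) <= K*S" unfolding G_def norm_mult using R_le(1)[OF u] f1S[OF u] K_pos by (intro mult_mono) auto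
   have "cmod (G' u) <= \<bar>R u\<bar>*cmod (d u) + \<bar>R' u\<bar>*cmod (f1 u)"
    unfolding G'_def by (rule order_trans[OF norm_triangle_ineq]) (simp add: norm_mult)
   also have "... <= K*(K*cmod (u1 u)) + (K + K/et)*S"
    using R_le[OF u] d(2) u f1S[OF u] K_pos et by (intro add_mono mult_mono) auto
   also have "... <= M*(S + cmod (u1 u))"
   proof -
    have "0 <= (K + K/et)*cmod (u1 u) + K*K*S" using K_pos et S0 by simp
    then show ?thesis by (simp add: M_def algebra_simps)
   qed
   finally show "cmod (G' u) <= M*(S + cmod (u1 u))" .
  qed
  have dil: "primitive_on {0..dl} (%y. G (y/kp)) (%y. of_real (1/kp)*G' (y/kp))" if "1 <= kp" for kp
   using primitive_on_affine[OF G_prim, of "1/kp" "{0..dl}" 0] scaled_in[OF that] that by (simp add: scaleR_conv_of_real)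
  define D where "D = (%y. of_real be*(G (y/k) - G (y/(2*k))))"
  define D' where "D' = (%y. of_real be*(of_real (1/k)*G' (y/k) - of_real (1/(2*k))*G' (y/(2*k))))"
  define P where "P = (%y. cx (inverse (rh2 y))*D y)"
  define P' where "P' = (%y. cx (inverse (rh2 y))*D' y + cx (th' y)*D y)"
  have P_prim: "primitive_on {0..dl} P P'"
   unfolding P_def P'_def D_def D'_def
   by (intro primitive_on_mult primitive_on_of_real rh2_prim primitive_on_cmult primitive_on_diff dil k k2)
  define e where "e = (%y. N*(S + cmod (u1 (y/k)) + cmod (u1 (y/(2*k)))))"
  have P_le: "cmod (P y) <= 2*K*K*\<bar>be\<bar>*S" "cmod (P' y) <= e y" if y: "y : {0..dl}" for y
  proof -
   note y1 = scaled_in[OF k y] and y2 = scaled_in[OF k2 y]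
   have i: "cmod (cx (inverse (rh2 y))) <= K" "cmod (cx (th' y)) <= K" using rh2[OF y] by (auto simp: norm_inverse)
   have "cmod (G (y/k) - G (y/(2*k))) <= K*S + K*S"
    by (rule order_trans[OF norm_triangle_ineq4 add_mono[OF G_le(1)[OF y1] G_le(1)[OF y2]]])
   then have D: "cmod (D y) <= \<bar>be\<bar>*(K*S + K*S)" unfolding D_def norm_mult by (simp add: mult_left_mono)
   have kk: "cmod (of_real (1/k)) <= 1" "cmod (of_real (1/(2*k))) <= 1" using k by (auto simp: norm_divide)
   have "cmod (of_real (1/k)*G' (y/k) - of_real (1/(2*k))*G' (y/(2*k))) <= 1*(M*(S + cmod (u1 (y/k)))) + 1*(M*(S + cmod (u1 (y/(2*k)))))"
    by (rule order_trans[OF norm_triangle_ineq4], unfold norm_mult) (intro add_mono mult_mono kk G_le(2) y1 y2; simp)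
   then have D': "cmod (D' y) <= \<bar>be\<bar>*(1*(M*(S + cmod (u1 (y/k)))) + 1*(M*(S + cmod (u1 (y/(2*k))))))"
    unfolding D'_def norm_mult[of "of_real be"] norm_of_real by (rule mult_left_mono) simp
   show "cmod (P y) <= 2*K*K*\<bar>be\<bar>*S"
    using mult_mono[OF i(1) D] K_pos by (simp add: P_def norm_mult mult_ac)
   have "cmod (P' y) <= K*(\<bar>be\<bar>*(1*(M*(S + cmod (u1 (y/k)))) + 1*(M*(S + cmod (u1 (y/(2*k))))))) + K*(\<bar>be\<bar>*(K*S + K*S))"
    unfolding P'_def
    by (rule order_trans[OF norm_triangle_ineq], unfold norm_mult) (intro add_mono mult_mono i D D' less_imp_le[OF K_pos] norm_ge_zero)
   also have "... <= e y"
   proof -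
    have "0 <= \<bar>be\<bar>*K*(M*(cmod (u1 (y/k)) + cmod (u1 (y/(2*k)))) + 2*K*(cmod (u1 (y/k)) + cmod (u1 (y/(2*k)))))"
     using K_pos M0 by simp
    then show ?thesis by (simp add: e_def N_def algebra_simps)
   qed
   finally show "cmod (P' y) <= e y" .
  qed
  have uk: "continuous_on {0..dl} (%y. u1 (y/kp))" if "1 <= kp" for kp
   by (rule continuous_on_compose2[OF u1c, of "{0..dl}" "%y. y/kp"])
    (intro continuous_intros, use that in simp, rule image_subsetI, erule scaled_in[OF that])
  have ec: "continuous_on {0..dl} e" unfolding e_def by (intro continuous_intros uk k k2)
  have ui: "integral {0..dl} (%y. (cmod (u1 (y/kp)))^2) <= kp*E1" if kp: "1 <= kp" for kp
  proof -
   have d: "dl/kp <= dl" "0 <= dl/kp" using scaled_in[OF kp, of dl] dl by auto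
   have "continuous_on {0..1/kp*dl} u1" by (rule continuous_on_subset[OF u1c]) (use d in auto)
   from integral_dilation(2)[OF _ _ continuous_norm_square_int[OF this]]
   have "integral {0..dl} (%y. (cmod (u1 (y/kp)))^2) = kp*integral {0..dl/kp} (%y. (cmod (u1 y))^2)"
    using kp dl by simp
   also have "... <= kp*E1" unfolding E1_def using kp d
    by (intro mult_left_mono integral_subset_le continuous_norm_square_int continuous_on_subset[OF u1c]) auto
   finally show ?thesis .
  qed
  have e2: "integral {0..dl} (%y. (e y)^2) <= 3*N^2*(dl + 3*k*K)*(energy v + S^2)"
  proof -
   let ?b = "%y. 3*N^2*(S^2 + (cmod (u1 (y/k)))^2 + (cmod (u1 (y/(2*k))))^2)"
   have bi: "(?b has_integral 3*N^2*(dl*S^2 + integral {0..dl} (%y. (cmod (u1 (y/k)))^2) + integral {0..dl} (%y. (cmod (u1 (y/(2*k))))^2))) {0..dl}"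
    by (intro has_integral_mult_right has_integral_add integrable_integral continuous_norm_square_int uk k k2)
     (use has_integral_const_real[of "S^2" 0 dl] dl in simp)
   have "integral {0..dl} (%y. (e y)^2) <= integral {0..dl} ?b"
   proof (rule integral_le)
    show "(%y. (e y)^2) integrable_on {0..dl}" by (intro integrable_continuous_interval continuous_intros ec)
    fix y
    have "(x + y + z)^2 <= 3*(x^2 + y^2 + z^2)" for x y z :: real
     using sum_squares_ge_zero[of "x - y" "y - z"] zero_le_power2[of "x - z"] by (simp add: power2_eq_square algebra_simps)
    from mult_left_mono[OF this zero_le_power2[of N]] show "(e y)^2 <= ?b y" unfolding e_def power_mult_distrib by (simp only: mult_ac)
   qed (use bi in blast)
   also have "... <= 3*N^2*(dl*S^2 + k*E1 + 2*k*E1)"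
    unfolding integral_unique[OF bi] using ui[OF k] ui[OF k2] dl by (intro mult_left_mono add_mono) auto
   also have "... <= 3*N^2*((dl + 3*k*K)*(energy v + S^2))"
   proof (rule mult_left_mono)
    have "k*E1 <= k*(K*energy v)" using E1 k by (intro mult_left_mono) auto
    moreover have "0 <= dl*energy v + k*(K*S^2)*3" using dl En k K_pos by (intro add_nonneg_nonneg mult_nonneg_nonneg) auto
    ultimately show "dl*S^2 + k*E1 + 2*k*E1 <= (dl + 3*k*K)*(energy v + S^2)" by (simp add: algebra_simps)
   qed simp
   finally show ?thesis by (simp only: mult.assoc)
  qed
  have "cmod (integral {0..dl} (%y. cx (y powr ep)*P y*cnj (?s2 y)))
   <= dl powr ep*(2*K*K*\<bar>be\<bar>*S)*S*integral {0..dl} (%y. \<bar>q (x0 + - si*y)\<bar>) +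
    (ep*dl powr (2*ep) + dl powr ep)*integral {0..dl} (%y. (e y)^2) + (1 + dl powr ep)*integral {0..dl} (%y. (cmod (?u2 y))^2)"
  proof (rule powr_form_bound[OF dl ep0 P_prim _ _ P_le(1) ec P_le(2) L(2,3,4)])
   show "P 0 = 0" by (simp add: P_def D_def)
   \<comment> \<open>The end point dl is sent to dl/k and dl/(2 k), where the cutoff is already 0;
     so no boundary term arises at dl.\<close>
   have "et <= dl/k" "et <= dl/(2*k)" using cutoff_width(2)[OF k] by (auto simp: et_def)
   then show "P dl = 0" by (simp add: P_def D_def G_def R_def cutoff_eq_0[OF et(1)])
  qed (use S side_in(2)[OF si'(1)] in auto)
  also have "... <= dl powr ep*(2*K*K*\<bar>be\<bar>*S)*S*Q + (ep*dl powr (2*ep) + dl powr ep)*(3*N^2*(dl + 3*k*K)*(energy v + S^2)) + (1 + dl powr ep)*(K*energy v)"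
   using L(7) e2 L(6) ep0 K_pos S0 unfolding Q_def by (intro add_mono mult_left_mono) auto
  also have "... <= C*(energy v + S^2)"
  proof -
   have "0 <= dl powr ep*(2*K*K*\<bar>be\<bar>)*Q*energy v + (1 + dl powr ep)*K*S^2"
    using K_pos Q0 En by (intro add_nonneg_nonneg mult_nonneg_nonneg) auto
   moreover have "C*(energy v + S^2) = dl powr ep*(2*K*K*\<bar>be\<bar>*S)*S*Q + (ep*dl powr (2*ep) + dl powr ep)*(3*N^2*(dl + 3*k*K)*(energy v + S^2)) + (1 + dl powr ep)*(K*energy v)
     + (dl powr ep*(2*K*K*\<bar>be\<bar>)*Q*energy v + (1 + dl powr ep)*K*S^2)"
    unfolding C_def power2_eq_square by algebra
   ultimately show ?thesis by linarith
  qed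
  finally have b: "cmod (integral {0..dl} (%y. cx (y powr ep)*P y*cnj (?s2 y))) <= C*(energy v + S^2)" .
  let ?I = "%kp y. cx (y powr ta1*(cutoff et (y/kp)*rh1 (y/kp)))*(g (x0 - si*y)*cnj (f (x0 + si*(y/kp))))"
  have I: "(?I kp has_integral integral {0..dl} (?I kp)) {0..dl}" if "1 <= kp" for kp
   using form_integrand[OF that et(1,2) g fc(1)] by (intro integrable_integral) (simp add: abs_int_def)
  have "tform k g f = of_real (2*m/(1 - m)*k powr (- 1 - ta1))*integral {0..dl} (?I k) - of_real (2/(1 - m)*(2*k) powr (- 1 - ta1))*integral {0..dl} (?I (2*k))"
   unfolding tform_def et(3) dilation_form_def m_def by (simp only: of_real_mult mult.assoc)
  also have "... = of_real be*(integral {0..dl} (?I k) - integral {0..dl} (?I (2*k)))" unfolding be2 be_def[symmetric] by (simp only: right_diff_distrib)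
  also have "... = integral {0..dl} (%y. of_real be*(?I k y - ?I (2*k) y))"
   by (rule integral_unique[symmetric]) (intro has_integral_mult_right has_integral_diff I k k2)
  \<comment> \<open>\<open>y powr ta1\<close> is split into \<open>y powr ep\<close> and the weight
    of w on the side of g; the conjugation moves the source into second place.\<close>
  also have "... = integral {0..dl} (%y. - of_real c*cnj (cx (y powr ep)*P y*cnj (?s2 y)))"
  proof (rule integral_spike[OF negligible_sing[of 0]])
   fix y assume "y : {0..dl} - {0}"
   then have y: "0 < y" "y <= dl" "y : {0..dl}" by auto
   have s2: "?s2 y = - of_real (c*rh2 y*y powr ta2)*g (x0 - si*y)" using w2[OF y(1,2)] by simp
   have pw: "y powr ep*y powr ta2 = y powr ta1" by (simp add: ep_def flip: powr_add)
   have cc: "of_real c * of_real c = (1 :: complex)" using c by auto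
   have "- of_real c*cnj (cx (y powr ep)*P y*cnj (?s2 y))
    = (of_real c * of_real c) * of_real ((y powr ep*y powr ta2)*(inverse (rh2 y)*rh2 y))*(g (x0 - si*y)*cnj (D y))"
    unfolding s2 P_def complex_cnj_mult complex_cnj_cnj complex_cnj_complex_of_real of_real_mult by algebra
   also have "... = of_real (y powr ta1)*(g (x0 - si*y)*cnj (D y))" unfolding cc pw using rh2(1)[OF y(3)] by simp
   also have "... = of_real be*(?I k y - ?I (2*k) y)"
    unfolding D_def G_def R_def f1_def complex_cnj_mult complex_cnj_diff complex_cnj_complex_of_real of_real_mult by algebra
   finally show "- of_real c*cnj (cx (y powr ep)*P y*cnj (?s2 y)) = of_real be*(?I k y - ?I (2*k) y)" .
  qed
  also have "... = - of_real c*cnj (integral {0..dl} (%y. cx (y powr ep)*P y*cnj (?s2 y)))"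
   by (simp only: integral_mult_right integral_cnj)
  finally show ?thesis using b c by (auto simp: norm_mult)
 qed
 then show ?thesis using C0 by blast
qed

end

section \<open>The definite form\<close>

lemma C1_on_primitive:
 assumes "C1_on {c..d} f" "c <= d"
 shows "\<exists>f'. primitive_on {c..d} f f' & continuous_on {c..d} f'"
proof -
 obtain f' where f': "\<forall>x\<in>{c..d}. (f has_real_derivative f' x) (at x within {c..d})" "continuous_on {c..d} f'"
  using assms(1) unfolding C1_on_def by (elim exE conjE)
 have "primitive_on {c..d} f f'"
 proof (rule primitive_onI)
  fix x y assume xy: "x <= y" "{x..y} \<subseteq> {c..d}"
  show "f' abs_int_on {x..y}"
   by (rule absolutely_integrable_continuous_real) (rule continuous_on_subset[OF f'(2) xy(2)])
  show "(f' has_integral f y - f x) {x..y}"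
  proof (rule fundamental_theorem_of_calculus[OF xy(1)])
   fix z assume "z : {x..y}"
   then have "(f has_vector_derivative f' z) (at z within {c..d})"
    using f'(1) xy(2) by (simp add: has_real_derivative_iff_has_vector_derivative subset_iff)
   then show "(f has_vector_derivative f' z) (at z within {x..y})" by (rule has_vector_derivative_within_subset[OF _ xy(2)])
  qed
 qed
 then show ?thesis using f'(2) by blast
qed

lemma C1_on_inverse:
 assumes "C1_on S f" "!!x. x : S ==> f x ~= 0"
 shows "C1_on S (%x. inverse (f x))"
proof -
 obtain f' where f': "\<forall>x\<in>S. (f has_real_derivative f' x) (at x within S)" "continuous_on S f'"
  using assms(1) unfolding C1_on_def by (elim exE conjE)
 have "continuous_on S f" unfolding continuous_on_eq_continuous_within
  using f'(1) by (auto intro: has_field_derivative_imp_has_derivative[THEN has_derivative_continuous])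
 then have "continuous_on S (%x. - (inverse (f x)*f' x*inverse (f x)))"
  using assms(2) f'(2) by (intro continuous_intros) auto
 moreover have "((%x. inverse (f x)) has_real_derivative - (inverse (f x)*f' x*inverse (f x))) (at x within S)" if "x : S" for x
  by (rule DERIV_inverse'[OF bspec[OF f'(1) that] assms(2)[OF that]])
 ultimately show ?thesis unfolding C1_on_def by (intro exI[of _ "%x. - (inverse (f x)*f' x*inverse (f x))"]) simp
qed

lemma C1_on_side:
 assumes m: "m = 1 \<or> m = - 1" and dl: "0 < dl" and r: "C1_on (closed_segment x0 (x0 + m*dl)) r"
 shows "\<exists>r'. primitive_on {0..dl} (%y. s*r (x0 + m*y)) r' & bounded (r' ` {0..dl}) & bounded ((%y. s*r (x0 + m*y)) ` {0..dl})"
proof -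
 let ?S = "{min x0 (x0 + m*dl)..max x0 (x0 + m*dl)}"
 have S: "closed_segment x0 (x0 + m*dl) = ?S" by (simp add: closed_segment_eq_real_ivl min_def max_def)
 have i: "x0 + m*y : ?S" if "y : {0..dl}" for y using m that by auto
 obtain r' where r': "primitive_on ?S r r'" "continuous_on ?S r'" using C1_on_primitive[OF r[unfolded S]] by (auto simp: min_le_iff_disj)
 have a: "primitive_on {0..dl} (%y. r (x0 + m*y)) (%y. m *\<^sub>R r' (x0 + m*y))"
  using primitive_on_affine[OF r'(1), of m "{0..dl}" x0] m i by auto
 have P: "primitive_on {0..dl} (%y. s*r (x0 + m*y)) (%y. s*(m *\<^sub>R r' (x0 + m*y)))" by (rule primitive_on_cmult[OF a])
 have "continuous_on {0..dl} (%y. r' (x0 + m*y))"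
 proof (rule continuous_on_compose2[OF r'(2)])
  show "(%y. x0 + m*y) ` {0..dl} \<subseteq> ?S" by (rule image_subsetI, erule i)
 qed (intro continuous_intros)
 then have "continuous_on {0..dl} (%y. s*(m *\<^sub>R r' (x0 + m*y)))" by (intro continuous_intros)
 then show ?thesis using P primitive_on_continuous[OF P order_refl]
  by (auto intro!: compact_imp_bounded compact_continuous_image)
qed

lemma (in simple_turning_point) turning_form:
 assumes "0 < ep"
 shows "\<exists>T C. 0 <= C & sesquilinear T & (\<forall>f. continuous_on {0..a} f --> cmod (T f f) <= ep*(nrm f)^2) \<and>
  (\<forall>f v g S. bounded_sol f v g S (cmod (of_real (2*c * si)*(f x0*cnj (v x0)) + T f g + cnj (T g f)) <= C*(energy v + S^2)))"
proof -
 obtain k where k: "1 <= k" "\<forall>f. continuous_on {0..a} f --> cmod (tform k f f) <= ep*(nrm f)^2"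
  using tform_small[OF assms] by (elim exE conjE)
 obtain C1 where C1: "0 <= C1" "\<forall>f v g S. bounded_sol f v g S (cmod (tform k f g + of_real (2*c * si)*(f x0*cnj (v x0))) <= C1*(energy v + S^2))"
  using tform_right_bound[OF k(1)] by (elim exE conjE)
 obtain C2 where C2: "0 <= C2" "\<forall>f v g S. bounded_sol f v g S (cmod (tform k g f) <= C2*(energy v + S^2))"
  using tform_left_bound[OF k(1)] by (elim exE conjE)
 have "cmod (of_real (2*c * si)*(f x0*cnj (v x0)) + tform k f g + cnj (tform k g f)) <= (C1 + C2)*(energy v + S^2)"
  if h: "wsol g f v" "continuous_on {0..a} g" "\<forall>x\<in>{0..a}. cmod (f x) <= S" for f v g S
 proof -
  note B1 = C1(2)[THEN spec, THEN spec, THEN spec, THEN spec, THEN mp, OF h(1), THEN mp, OF h(2), THEN mp, OF h(3)]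
  note B2 = C2(2)[THEN spec, THEN spec, THEN spec, THEN spec, THEN mp, OF h(1), THEN mp, OF h(2), THEN mp, OF h(3)]
  have "cmod (of_real (2*c * si)*(f x0*cnj (v x0)) + tform k f g + cnj (tform k g f))
    <= cmod (of_real (2*c * si)*(f x0*cnj (v x0)) + tform k f g) + cmod (tform k g f)"
   using norm_triangle_ineq[of _ "cnj (tform k g f)"] by simp
  also have "... <= C1*(energy v + S^2) + C2*(energy v + S^2)"
   using B1 B2 by (simp only: add.commute add_mono)
  finally show ?thesis by (simp only: distrib_right)
 qed
 moreover have "0 <= C1 + C2" using C1(1) C2(1) by simp
 ultimately show ?thesis using tform_sesquilinear[OF k(1)] k(2) by blast
qed

context sturm_liouville
begin

text \<open>The number j will be the jump of \<open>sgn w\<close> at x0. The third condition says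
  how much definiteness T may cost, the fourth that T cancels the boundary term which integration by
  parts leaves at x0.\<close>

definition controls_jump :: "real => real => real => ((real => complex) => (real => complex) => complex) => real => bool" where
 "controls_jump ep x0 j T C \<longleftrightarrow> 0 <= C & sesquilinear T & (\<forall>f. continuous_on {0..a} f --> cmod (T f f) <= ep*(nrm f)^2) \<and>
  (\<forall>f v g S. bounded_sol f v g S (cmod (of_real j*(f x0*cnj (v x0)) + T f g + cnj (T g f)) <= C*(energy v + S^2)))"

lemma turning_form_oriented:
 assumes si: "si = 1 \<or> si = - 1" and c: "c = 1 \<or> c = - 1" and dl: "0 < dl"
  and inside: "{x0 - dl..x0 + dl} \<subseteq> {0..a}" and ta: "- 1 < ta2" "ta2 <= ta1"
  and w1: "!!y. 0 < y ==> y <= dl ==> w (x0 + si*y) = r1 (x0 + si*y)*y powr ta1"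
  and w2: "!!y. 0 < y ==> y <= dl ==> w (x0 + - si*y) = r2 (x0 + - si*y)*y powr ta2"
  and r1: "C1_on (closed_segment x0 (x0 + si*dl)) r1" "!!y. y : {0..dl} ==> 0 < c*r1 (x0 + si*y)"
  and r2: "C1_on (closed_segment x0 (x0 + - si*dl)) r2" "!!y. y : {0..dl} ==> 0 < - c*r2 (x0 + - si*y)"
  and p_bd: "negligible {x : {x0 - dl..x0 + dl}. \<not> (p x <= K0 & inverse (p x) <= K0)}" and "0 < ep"
 shows "\<exists>T C. controls_jump ep x0 (2*c * si) T C"
proof -
 have si': "- si = 1 \<or> - si = - 1" using si by auto
 obtain rh1' where rh1': "primitive_on {0..dl} (%y. c*r1 (x0 + si*y)) rh1'" "bounded (rh1' ` {0..dl})" "bounded ((%y. c*r1 (x0 + si*y)) ` {0..dl})"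
  using C1_on_side[OF si dl r1(1)] by blast
 have r2nz: "r2 x ~= 0" if "x : closed_segment x0 (x0 + - si*dl)" for x
 proof -
  obtain u where u: "0 <= u" "u <= 1" "x = x0 + - si*(u*dl)"
  proof -
   obtain u where u: "0 <= u" "u <= 1" "x = (1 - u) *\<^sub>R x0 + u *\<^sub>R (x0 + - si*dl)"
    using \<open>x : closed_segment x0 (x0 + - si*dl)\<close> unfolding closed_segment_def by blast
   from u(3) have "x = x0 + - si*(u*dl)" by (simp add: algebra_simps)
   then show ?thesis using that u by blast
  qed
  then have "u*dl : {0..dl}" using dl by (auto simp: mult_le_cancel_right1)
  then show ?thesis using r2(2)[of "u*dl"] u by auto
 qed
 obtain th' where th': "primitive_on {0..dl} (%y. - c*inverse (r2 (x0 + - si*y))) th'" "bounded (th' ` {0..dl})" "bounded ((%y. - c*inverse (r2 (x0 + - si*y))) ` {0..dl})"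
  using C1_on_side[OF si' dl C1_on_inverse[OF r2(1) r2nz]] by blast
 obtain B1 B2 B3 B4 where B: "\<forall>y\<in>{0..dl}. \<bar>rh1' y\<bar> <= B1" "\<forall>y\<in>{0..dl}. \<bar>c*r1 (x0 + si*y)\<bar> <= B2"
  "\<forall>y\<in>{0..dl}. \<bar>th' y\<bar> <= B3" "\<forall>y\<in>{0..dl}. \<bar>- c*inverse (r2 (x0 + - si*y))\<bar> <= B4"
  using rh1'(2,3) th'(2,3) unfolding bounded_iff ball_simps real_norm_def by (elim exE)
 define K where "K = max (max B1 B2) (max (max B3 B4) K0)"
 have c2: "inverse (- c*z) = - c*inverse z" for z using c by auto
 interpret simple_turning_point a w p q x0 si c dl ta1 ta2 K "%y. c*r1 (x0 + si*y)" rh1' "%y. - c*r2 (x0 + - si*y)" th'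
 proof (unfold_locales; (rule si c dl inside ta rh1'(1))?)
  show "w (x0 + si*y) = c*(c*r1 (x0 + si*y))*y powr ta1" if "0 < y" "y <= dl" for y
   using w1[OF that] c by auto
  show "w (x0 - si*y) = - c*(- c*r2 (x0 + - si*y))*y powr ta2" if "0 < y" "y <= dl" for y
   using w2[OF that] c by auto
  show "primitive_on {0..dl} (%y. inverse (- c*r2 (x0 + - si*y))) th'" using th'(1) by (simp only: c2)
  show "negligible {x : {x0 - dl..x0 + dl}. \<not> (p x <= K & inverse (p x) <= K)}"
   by (rule negligible_subset[OF p_bd]) (auto simp: K_def)
  fix y assume y: "y : {0..dl}"
  show "0 < c*r1 (x0 + si*y)" "0 < - c*r2 (x0 + - si*y)" by (rule r1(2)[OF y] r2(2)[OF y])+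
  show "c*r1 (x0 + si*y) <= K" "\<bar>rh1' y\<bar> <= K" "inverse (- c*r2 (x0 + - si*y)) <= K" "\<bar>th' y\<bar> <= K"
   using bspec[OF B(1) y] bspec[OF B(2) y] bspec[OF B(3) y] bspec[OF B(4) y] unfolding c2 K_def
   by (simp_all add: le_max_iff_disj) (simp_all add: abs_le_iff)
 qed
 show ?thesis using turning_form[OF \<open>0 < ep\<close>] unfolding controls_jump_def .
qed

lemma turning_form_exists:
 assumes os: "one_simple w x0" and x0: "0 < x0" "x0 < a" and "0 < ep"
  and p_bd: "\<exists>dl>0. \<exists>K. AE y in lebesgue_on {x0 - dl<..<x0 + dl}. \<bar>p y\<bar> <= K & \<bar>inverse (p y)\<bar> <= K"
 shows "\<exists>j T C dl. controls_jump ep x0 j T C & 0 < dl & (\<forall>y. 0 < y & y < dl --> sgn (w (x0 + y)) = j/2 & sgn (w (x0 - y)) = - j/2)"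
proof -
 obtain dl1 tap tam rhp rhm c where S: "0 < dl1" "- 1 < tap" "- 1 < tam" "C1_on {x0..x0 + dl1} rhp" "C1_on {x0 - dl1..x0} rhm" "rhp x0 ~= 0"
  "\<forall>x\<in>{0..dl1}. sgn (rhp (x0 + x)) = c & - sgn (rhm (x0 - x)) = c"
  "\<forall>x. x - x0 : {0<..<dl1} --> w x = rhp x*\<bar>x - x0\<bar> powr tap"
  "\<forall>x. - (x - x0) : {0<..<dl1} --> w x = rhm x*\<bar>x - x0\<bar> powr tam"
  using os unfolding one_simple_def by (elim exE conjE)
 obtain dl2 K where K: "0 < dl2" "AE y in lebesgue_on {x0 - dl2<..<x0 + dl2}. \<bar>p y\<bar> <= K & \<bar>inverse (p y)\<bar> <= K"
  using p_bd by (elim exE conjE)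
 define dl where "dl = min (min dl1 dl2) (min x0 (a - x0))/2"
 have dl: "0 < dl" "dl < dl1" "dl < dl2" "dl < x0" "dl < a - x0" using S(1) K(1) x0 by (auto simp: dl_def)
 have inside: "{x0 - dl..x0 + dl} \<subseteq> {0..a}" using dl by auto
 have N: "negligible {x : {x0 - dl..x0 + dl}. \<not> (p x <= K & inverse (p x) <= K)}"
 proof (rule negligible_subset)
  show "negligible {y : {x0 - dl2<..<x0 + dl2}. \<not> (\<bar>p y\<bar> <= K & \<bar>inverse (p y)\<bar> <= K)}"
   using K(2) by (subst (asm) AE_lebesgue_on_iff_negligible) auto
 qed (use dl in \<open>auto simp del: abs_inverse dest: abs_le_D1\<close>)
 have "sgn (rhp x0) = c" using S(1) bspec[OF S(7), of 0] by simp
 then have c: "c = 1 \<or> c = - 1" using S(6) by (auto simp: sgn_if split: if_splits)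
 have pos: "0 < c*rhp (x0 + y)" "0 < - c*rhm (x0 - y)" if "y : {0..dl}" for y
 proof -
  have "sgn (rhp (x0 + y)) = c" "sgn (rhm (x0 - y)) = - c" using bspec[OF S(7), of y] that dl by auto
  then show "0 < c*rhp (x0 + y)" "0 < - c*rhm (x0 - y)" using c by (auto simp: sgn_if split: if_splits)
 qed
 have wp: "w (x0 + y) = rhp (x0 + y)*y powr tap" and wm: "w (x0 - y) = rhm (x0 - y)*y powr tam" if "0 < y" "y <= dl" for y
  using S(8)[rule_format, of "x0 + y"] S(9)[rule_format, of "x0 - y"] that dl by auto
 have C1: "C1_on (closed_segment x0 (x0 + 1*dl)) rhp" "C1_on (closed_segment x0 (x0 + - 1*dl)) rhm"
 proof -
  have sub: "C1_on T f" if "C1_on S f" "T \<subseteq> S" for S T f using that unfolding C1_on_def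
   by (meson DERIV_subset continuous_on_subset subsetD)
  show "C1_on (closed_segment x0 (x0 + 1*dl)) rhp" "C1_on (closed_segment x0 (x0 + - 1*dl)) rhm"
   by (rule sub[OF S(4)] sub[OF S(5)]; use dl in \<open>auto simp: closed_segment_eq_real_ivl split: if_splits\<close>)+
 qed
 have "\<exists>T C. controls_jump ep x0 (2*c) T C"
 \<comment> \<open>The side with the larger exponent has to come first. Exchanging the sides changes
   the signs of both c and si, so the jump \<open>2*c*si\<close> stays the same.\<close>
 proof (cases "tam <= tap")
  case True
  have "\<exists>T C. controls_jump ep x0 (2*c*1) T C"
   by (rule turning_form_oriented[where ?r1.0 = rhp and ?r2.0 = rhm, OF _ c dl(1) inside S(3) True _ _ C1(1) _ C1(2) _ N \<open>0 < ep\<close>])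
    (use wp wm pos in auto)
  then show ?thesis by simp
 next
  case False
  have c': "- c = 1 \<or> - c = - 1" using c by auto
  have "\<exists>T C. controls_jump ep x0 (2*- c*- 1) T C"
  proof (rule turning_form_oriented[where ?ta1.0 = tam and ?r1.0 = rhm and ?r2.0 = rhp and si = "- 1", OF _ c' dl(1) inside S(2) _ _ _ C1(2) _ _ _ N \<open>0 < ep\<close>])
   show "C1_on (closed_segment x0 (x0 + - (- 1)*dl)) rhp" using C1(1) by simp
  qed (use wp wm pos False in auto)
  then show ?thesis by simp
 qed
 moreover have "sgn (w (x0 + y)) = 2*c/2 & sgn (w (x0 - y)) = - (2*c)/2" if "0 < y" "y < dl" for y
 proof -
  have "sgn (rhp (x0 + y)) = c" "sgn (rhm (x0 - y)) = - c" using bspec[OF S(7), of y] that dl by auto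
  then show ?thesis using wp[of y] wm[of y] that by (simp add: sgn_mult)
 qed
 ultimately show ?thesis using dl(1) by blast
qed

text \<open>Bisection. The margin ep beyond the end points makes neighbouring pieces overlap in an
  interval, which forces their constants to agree.\<close>

lemma ae_constant_on_interval:
 fixes g :: "real => real"
 assumes "c <= d" and loc: "!!x. x : {c..d} ==> \<exists>dl>0. \<exists>kp. negligible {y : {x - dl<..<x + dl}. g y ~= kp}"
 shows "\<exists>kp. \<exists>ep>0. negligible {y : {c - ep<..<d + ep}. g y ~= kp}"
proof -
 let ?P = "%c' d'. c <= c' --> d' <= d --> (\<exists>kp. \<exists>ep>0. negligible {y : {c' - ep<..<d' + ep}. g y ~= kp})"
 have "?P c d"
 proof (rule Bolzano[where P = ?P, OF \<open>c <= d\<close>])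
  fix x y z assume 1: "?P x y" and 2: "?P y z" and xyz: "x <= y" "y <= z"
  show "?P x z"
  proof (intro impI)
   assume "c <= x" "z <= d"
   then obtain k1 e1 k2 e2 where e: "0 < e1" "negligible {u : {x - e1<..<y + e1}. g u ~= k1}" "0 < e2" "negligible {u : {y - e2<..<z + e2}. g u ~= k2}"
    using 1 2 xyz by (meson order_trans)
   define e where "e = min e1 e2"
   have "k1 = k2"
   proof (rule ccontr)
    assume "k1 ~= k2"
    then have "{y - e<..<y + e} \<subseteq> {u : {x - e1<..<y + e1}. g u ~= k1} \<union> {u : {y - e2<..<z + e2}. g u ~= k2}"
     using xyz by (auto simp: e_def)
    then have "negligible {y - e<..<y + e}" by (rule negligible_subset[OF negligible_Un[OF e(2,4)]])
    moreover have "y : {y - e<..<y + e}" using e by (simp add: e_def)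
    ultimately show False using open_not_negligible[OF open_greaterThanLessThan] by blast
   qed
   then have "{u : {x - e<..<z + e}. g u ~= k1} \<subseteq> {u : {x - e1<..<y + e1}. g u ~= k1} \<union> {u : {y - e2<..<z + e2}. g u ~= k2}"
    using xyz e by (auto simp: e_def)
   then have "negligible {u : {x - e<..<z + e}. g u ~= k1}" by (rule negligible_subset[OF negligible_Un[OF e(2,4)]])
   moreover have "0 < e" using e by (simp add: e_def)
   ultimately show "\<exists>kp. \<exists>ep>0. negligible {u : {x - ep<..<z + ep}. g u ~= kp}" by blast
  qed
 next
  fix x assume "c <= x" "x <= d"
  then obtain dl kp where dl: "0 < dl" "negligible {y : {x - dl<..<x + dl}. g y ~= kp}" using loc[of x] by auto
  have "?P y z" if "y <= x & x <= z & z - y < dl/2" for y z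
  proof -
   have "negligible {u : {y - dl/2<..<z + dl/2}. g u ~= kp}"
    by (rule negligible_subset[OF dl(2)]) (use that in auto)
   then show ?thesis using dl(1) half_gt_zero by blast
  qed
  then show "\<exists>e>0. \<forall>y z. y <= x & x <= z & z - y < e --> ?P y z" using dl(1) half_gt_zero by blast
 qed
 then show ?thesis by simp
qed

text \<open>Subtracting from sgn w its jumps at the turning points leaves a function that is locally
  constant almost everywhere. Comparing this constant just right of 0 and just right of a, where w
  takes the same values, shows that the jumps add up to 0.\<close>

lemma sign_steps:
 assumes P: "P = {x : {0..a}. turning_point w x}" "finite P" "0 \<notin> P"
  and j: "!!x. x : P ==> \<exists>dl>0. \<forall>y. 0 < y & y < dl --> sgn (w (x + y)) = j x/2 & sgn (w (x - y)) = - j x/2"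
 shows "\<exists>th. negligible {x : {0..a}. sgn (w x) ~= th + (\<Sum>xi\<in>P. if xi < x then j xi else 0)}" "(\<Sum>xi\<in>P. j xi) = 0"
proof -
 define g where "g = (%x. sgn (w x) - (\<Sum>xi\<in>P. if xi < x then j xi else 0))"
 have "\<exists>dl>0. \<exists>kp. negligible {y : {x - dl<..<x + dl}. g y ~= kp}" if x: "x : {0..a}" for x
 proof -
  obtain d where d: "0 < d" "\<forall>xi\<in>P. xi ~= x --> d <= dist x xi" using finite_set_avoid[OF P(2), of x] by blast
  have step: "(xi < y) = (xi < x)" if "xi : P" "xi ~= x" "y : {x - d<..<x + d}" for xi y
   using d(2)[rule_format, OF that(1,2)] that(3) by (auto simp: dist_real_def)
  let ?c = "\<Sum>xi\<in>P - {x}. if xi < x then j xi else 0"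
  show ?thesis
  proof (cases "x : P")
   case True
   obtain dl where dl: "0 < dl" "\<forall>y. 0 < y & y < dl --> sgn (w (x + y)) = j x/2 & sgn (w (x - y)) = - j x/2" using j[OF True] by blast
   have "g y = - j x/2 - ?c" if y: "y : {x - min dl d<..<x + min dl d}" "y ~= x" for y
   proof -
    have "(\<Sum>xi\<in>P. if xi < y then j xi else 0) = (if x < y then j x else 0) + (\<Sum>xi\<in>P - {x}. if xi < y then j xi else 0)"
     by (rule sum.remove[OF P(2) True])
    also have "y : {x - d<..<x + d}" using y by auto
    then have "(\<Sum>xi\<in>P - {x}. if xi < y then j xi else 0) = ?c" by (intro sum.cong refl) (use step[of _ y] in auto)
    finally have f: "(\<Sum>xi\<in>P. if xi < y then j xi else 0) = (if x < y then j x else 0) + ?c" .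
    have "0 < \<bar>y - x\<bar> & \<bar>y - x\<bar> < dl" using y by (auto simp: abs_less_iff)
    note s = dl(2)[rule_format, OF this]
    show ?thesis using f s y by (cases "x < y") (auto simp: g_def field_simps)
   qed
   then have "{y : {x - min dl d<..<x + min dl d}. g y ~= - j x/2 - ?c} \<subseteq> {x}" by blast
   then have "negligible {y : {x - min dl d<..<x + min dl d}. g y ~= - j x/2 - ?c}" by (rule negligible_subset[OF negligible_sing])
   moreover have "0 < min dl d" using dl(1) d(1) by simp
   ultimately show ?thesis by blast
  next
   case False
   then have "\<not> turning_point w x" using x P(1) by simp
   then obtain dl where dl: "0 < dl" "\<not> indefinite_on w {x - dl<..<x + dl}" by (auto simp: turning_point_def)
   then have "negligible {y : {x - dl<..<x + dl}. \<not> 0 < w y} \<or> negligible {y : {x - dl<..<x + dl}. \<not> w y < 0}"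
    unfolding indefinite_on_def by (subst (asm) (1 2) AE_lebesgue_on_iff_negligible) auto
   then have "\<exists>kp. negligible {y : {x - dl<..<x + dl}. sgn (w y) ~= kp}"
   proof
    assume "negligible {y : {x - dl<..<x + dl}. \<not> 0 < w y}"
    then have "negligible {y : {x - dl<..<x + dl}. sgn (w y) ~= 1}" by (rule negligible_subset) auto
    then show ?thesis by blast
   next
    assume "negligible {y : {x - dl<..<x + dl}. \<not> w y < 0}"
    then have "negligible {y : {x - dl<..<x + dl}. sgn (w y) ~= - 1}" by (rule negligible_subset) auto
    then show ?thesis by blast
   qed
   then obtain kp where kp: "negligible {y : {x - dl<..<x + dl}. sgn (w y) ~= kp}" by blast
   have c: "(\<Sum>xi\<in>P. if xi < y then j xi else 0) = (\<Sum>xi\<in>P. if xi < x then j xi else 0)" if "y : {x - d<..<x + d}" for y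
    by (rule sum.cong[OF refl]) (use step that False in metis)
   have "negligible {y : {x - min dl d<..<x + min dl d}. g y ~= kp - (\<Sum>xi\<in>P. if xi < x then j xi else 0)}"
   proof (rule negligible_subset[OF kp], rule subsetI)
    fix y assume "y : {y : {x - min dl d<..<x + min dl d}. g y ~= kp - (\<Sum>xi\<in>P. if xi < x then j xi else 0)}"
    then have y: "y : {x - min dl d<..<x + min dl d}" "g y ~= kp - (\<Sum>xi\<in>P. if xi < x then j xi else 0)" by auto
    from y(1) have "y : {x - d<..<x + d}" "y : {x - dl<..<x + dl}" by (simp_all add: min_def split: if_splits)
    then show "y : {y : {x - dl<..<x + dl}. sgn (w y) ~= kp}" using c[of y] y(2) by (auto simp: g_def)
   qed
   moreover have "0 < min dl d" using dl(1) d(1) by simp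
   ultimately show ?thesis by blast
  qed
 qed
 from ae_constant_on_interval[OF less_imp_le[OF a_pos] this] obtain th ep where th: "0 < ep" "negligible {y : {0 - ep<..<a + ep}. g y ~= th}" by blast
 have "negligible {x : {0..a}. sgn (w x) ~= th + (\<Sum>xi\<in>P. if xi < x then j xi else 0)}"
  by (rule negligible_subset[OF th(2)]) (use th(1) in \<open>auto simp: g_def\<close>)
 then show "\<exists>th. negligible {x : {0..a}. sgn (w x) ~= th + (\<Sum>xi\<in>P. if xi < x then j xi else 0)}" ..
 show "(\<Sum>xi\<in>P. j xi) = 0"
 proof (rule ccontr)
  assume nz: "(\<Sum>xi\<in>P. j xi) ~= 0"
  obtain d where d: "0 < d" "\<forall>xi\<in>P. xi ~= 0 --> d <= dist 0 xi" using finite_set_avoid[OF P(2), of 0] by blast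
  define e where "e = min (min d ep) a"
  have e: "0 < e" "e <= d" "e <= ep" "e <= a" using d(1) th(1) a_pos by (auto simp: e_def)
  \<comment> \<open>Right of 0 no jump has been passed, right of a all of them; if their sum were
    not 0, every y in this interval would be exceptional either itself or after translation by
    a.\<close>
  have "{0<..<e} \<subseteq> {y : {0 - ep<..<a + ep}. g y ~= th} \<union> (%y. - a + y) ` {y : {0 - ep<..<a + ep}. g y ~= th}"
  proof
   fix y assume y: "y : {0<..<e}"
   have "(\<Sum>xi\<in>P. if xi < y then j xi else 0) = (\<Sum>xi\<in>P. 0)"
   proof (rule sum.cong[OF refl])
    fix xi assume xi: "xi : P"
    then have "xi ~= 0" "0 <= xi" using P by auto
    then show "(if xi < y then j xi else 0) = 0" using d(2) xi y e by (force simp: dist_real_def)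
   qed
   then have 1: "g y = sgn (w y)" by (simp add: g_def)
   have "(\<Sum>xi\<in>P. if xi < a + y then j xi else 0) = (\<Sum>xi\<in>P. j xi)"
    by (rule sum.cong[OF refl]) (use P(1) y in auto)
   then have 2: "g (a + y) = sgn (w y) - (\<Sum>xi\<in>P. j xi)" using w_per[of y] by (simp add: g_def add.commute)
   have "g y ~= th \<or> g (a + y) ~= th" using 1 2 nz by auto
   moreover have "y = - a + (a + y)" by simp
   moreover have "y : {0 - ep<..<a + ep}" "a + y : {0 - ep<..<a + ep}" using y e th(1) a_pos by auto
   ultimately show "y : {y : {0 - ep<..<a + ep}. g y ~= th} \<union> (%y. - a + y) ` {y : {0 - ep<..<a + ep}. g y ~= th}" by blast
  qed
  then have "negligible {0<..<e}" by (rule negligible_subset[rotated]) (intro negligible_Un negligible_translation th(2))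
  moreover have "e/2 : {0<..<e}" using e by simp
  ultimately show False using open_not_negligible[OF open_greaterThanLessThan] by blast
 qed
qed

text \<open>By \<open>sign_steps\<close>, the product with |w| is a combination of these tails with
  the jumps as coefficients. So each turning point is cut once and contributes one boundary
  term.\<close>

definition tail_form :: "real => (real => complex) => (real => complex) => complex" where
 "tail_form xi f g = integral {xi..a} (%x. cx (w x)*(f x*cnj (g x)))"

lemma tail_form_int:
 assumes "0 <= xi" "continuous_on {0..a} f" "continuous_on {0..a} g"
 shows "(%x. cx (w x)*(f x*cnj (g x))) integrable_on {xi..a}"
proof -
 have "continuous_on {xi..a} f" "continuous_on {xi..a} g" using assms by (auto intro: continuous_on_subset)
 then have "continuous_on {xi..a} (%x. f x*cnj (g x))" by (intro continuous_intros)
 from coeff_mult_int(3)[OF this] show ?thesis by (simp add: abs_int_def)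
qed

lemma tail_form_sesquilinear:
 assumes "0 <= xi"
 shows "sesquilinear (tail_form xi)"
 unfolding sesquilinear_def
proof (intro allI impI conjI)
 fix f g h :: "real => complex" and b
 assume c: "continuous_on {0..a} f" "continuous_on {0..a} g" "continuous_on {0..a} h"
 note i = tail_form_int[OF assms, THEN integrable_integral]
 have "((%x. cx (w x)*(f x*cnj (h x)) + b*(cx (w x)*(g x*cnj (h x)))) has_integral tail_form xi f h + b*tail_form xi g h) {xi..a}"
  unfolding tail_form_def by (intro has_integral_add has_integral_mult_right i c)
 then show "tail_form xi (%x. f x + b*g x) h = tail_form xi f h + b*tail_form xi g h"
  unfolding tail_form_def[of xi "%x. f x + b*g x"] by (intro integral_unique) (simp add: algebra_simps)
 have "((%x. cx (w x)*(h x*cnj (f x)) + cnj b*(cx (w x)*(h x*cnj (g x)))) has_integral tail_form xi h f + cnj b*tail_form xi h g) {xi..a}"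
  unfolding tail_form_def by (intro has_integral_add has_integral_mult_right i c)
 then show "tail_form xi h (%x. f x + b*g x) = tail_form xi h f + cnj b*tail_form xi h g"
  unfolding tail_form_def[of xi h "%x. f x + b*g x"] by (intro integral_unique) (simp add: algebra_simps)
qed

lemma tail_form_cnj: "tail_form xi g f = cnj (tail_form xi f g)"
 unfolding tail_form_def by (simp add: integral_cnj mult_ac)

lemma tail_form_bound:
 assumes s: "wsol g f v" and xi: "xi : {0..a}" and S: "!!x. x : {0..a} ==> cmod (f x) <= S"
 shows "cmod (tail_form xi f g + f a*cnj (v a) - f xi*cnj (v xi)) <= (integral {0..a} (%x. \<bar>q x\<bar>) + 1)*(energy v + S^2)"
proof -
 note fc = sol_continuous[OF s order_refl]
 have sub: "{xi..a} \<subseteq> {0..a}" using xi by simp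
 let ?e = "%x. \<bar>(cmod (v x))^2*inverse (p x)\<bar>"
 have ei: "?e abs_int_on {0..a}" using absolutely_integrable_abs[OF energy_int[OF fc(2)]] by (simp add: o_def)
 have e2: "?e integrable_on {xi..a}" using absolutely_integrable_on_subinterval[OF ei sub] by (simp add: abs_int_def)
 have e: "integral {0..a} ?e = energy v" unfolding energy_def by (rule integral_spike[OF p_pos]) auto
 have "cmod (integral {xi..a} (%x. f x*cnj (cx (w x)*g x)) + f a*cnj (v a) - f xi*cnj (v xi))
  <= S*S*integral {xi..a} (%x. \<bar>q x\<bar>) + integral {xi..a} ?e"
  by (rule source_by_parts[OF _ primitive_on_subset[OF solD(1)[OF s] sub] primitive_on_subset[OF solD(2)[OF s] sub] q_int
   continuous_on_subset[OF fc(1) sub] _ _ e2])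
   (use S xi in \<open>auto simp: norm_divide divide_inverse power2_eq_square abs_mult mult_ac norm_mult norm_inverse\<close>)
 also have "... <= S*S*integral {0..a} (%x. \<bar>q x\<bar>) + integral {0..a} ?e"
  using sub e2 ei q_int[of 0 a] q_int[of xi a] by (intro add_mono mult_left_mono integral_subset_le) (auto simp: abs_int_def)
 also have "... <= (integral {0..a} (%x. \<bar>q x\<bar>) + 1)*(energy v + S^2)"
 proof -
  have "0 <= integral {0..a} (%x. \<bar>q x\<bar>)" using q_int[of 0 a] by (intro integral_nonneg) (auto simp: abs_int_def)
  then have "0 <= integral {0..a} (%x. \<bar>q x\<bar>)*energy v + S^2" using energy_nonneg[OF fc(2)] by simp
  then show ?thesis unfolding e by (simp add: algebra_simps power2_eq_square)
 qed
 finally show ?thesis by (simp add: tail_form_def mult_ac)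
qed

text \<open>In the last condition g is the image of f under A(t). It may be taken continuous, as Y
  is applied to finite sums of eigenfunctions.\<close>

definition definite_form :: "((real => complex) => (real => complex) => complex) => real => bool" where
 "definite_form Y C \<longleftrightarrow> 0 <= C & sesquilinear Y \<and>
  (\<forall>f g. continuous_on {0..a} f --> continuous_on {0..a} g --> Y g f = cnj (Y f g)) \<and>
  (\<forall>f. continuous_on {0..a} f --> (nrm f)^2 <= 2*Re (Y f f)) \<and>
  (\<forall>f v g S t. wsol g f v --> continuous_on {0..a} g -->
   f a = eit t*f 0 --> v a = eit t * v 0 -->
   (\<forall>x\<in>{0..a}. cmod (f x) <= S) --> cmod (Y f g) <= C*(energy v + S^2))"

lemma definite_form_exists:
 assumes P: "P = {x : {0..a}. turning_point w x}" "finite P" "0 \<notin> P" "a \<notin> P"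
  and os: "!!x. x : P ==> one_simple w x"
  and pb: "!!x. x : P ==> \<exists>dl>0. \<exists>K. AE y in lebesgue_on {x - dl<..<x + dl}. \<bar>p y\<bar> <= K & \<bar>inverse (p y)\<bar> <= K"
 shows "\<exists>Y C. definite_form Y C"
proof -
 \<comment> \<open>Each turning point costs \<open>2*ep\<close> times the squared norm in
   \<open>Re (Y f f)\<close>, all together at most half of it; the added 1 covers an empty
   P.\<close>
 define ep where "ep = 1/(4*(real (card P) + 1))"
 have ep: "0 < ep" by (simp add: ep_def)
 have P0: "0 < x" "x < a" if "x : P" for x using that P by (auto simp: less_le)
 have "\<forall>x\<in>P. \<exists>z. controls_jump ep x (fst z) (fst (snd z)) (snd (snd z)) \<and>
   (\<exists>dl>0. \<forall>y. 0 < y & y < dl --> sgn (w (x + y)) = fst z/2 & sgn (w (x - y)) = - fst z/2)"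
 proof
  fix x assume x: "x : P"
  obtain j T C dl where "controls_jump ep x j T C & 0 < dl & (\<forall>y. 0 < y & y < dl --> sgn (w (x + y)) = j/2 & sgn (w (x - y)) = - j/2)"
   using turning_form_exists[OF os[OF x] P0[OF x] ep pb[OF x]] by (elim exE)
  then show "\<exists>z. controls_jump ep x (fst z) (fst (snd z)) (snd (snd z)) \<and>
   (\<exists>dl>0. \<forall>y. 0 < y & y < dl --> sgn (w (x + y)) = fst z/2 & sgn (w (x - y)) = - fst z/2)"
   by (intro exI[of _ "(j, T, C)"]) auto
 qed
 from bchoice[OF this] obtain z where z: "\<forall>x\<in>P. controls_jump ep x (fst (z x)) (fst (snd (z x))) (snd (snd (z x))) \<and>
   (\<exists>dl>0. \<forall>y. 0 < y & y < dl --> sgn (w (x + y)) = fst (z x)/2 & sgn (w (x - y)) = - fst (z x)/2)" by blast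
 define j T C0 where "j = (%x. fst (z x))" and "T = (%x. fst (snd (z x)))" and "C0 = (%x. snd (snd (z x)))"
 have cj: "controls_jump ep x (j x) (T x) (C0 x)" if "x : P" for x using z that by (simp add: j_def T_def C0_def)
 have jw: "\<exists>dl>0. \<forall>y. 0 < y & y < dl --> sgn (w (x + y)) = j x/2 & sgn (w (x - y)) = - j x/2" if "x : P" for x
  using z that by (simp add: j_def)
 obtain th where th: "negligible {x : {0..a}. sgn (w x) ~= th + (\<Sum>xi\<in>P. if xi < x then j xi else 0)}"
  using sign_steps(1)[OF P(1,2,3) jw] by blast
 have j0: "(\<Sum>xi\<in>P. j xi) = 0" by (rule sign_steps(2)[OF P(1,2,3) jw])
 define Q where "Q = integral {0..a} (%x. \<bar>q x\<bar>) + 1"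
 have Q0: "0 <= Q" using q_int[of 0 a] unfolding Q_def by (intro add_nonneg_nonneg integral_nonneg) (auto simp: abs_int_def)
 \<comment> \<open>The tails add up to the product with |w|; T enters together with its adjoint so
   that Y is Hermitian.\<close>
 define Y where "Y = (%f g. of_real th*tail_form 0 f g + (\<Sum>xi\<in>P. of_real (j xi)*tail_form xi f g + (T xi f g + cnj (T xi g f))))"
 define C where "C = \<bar>th\<bar>*Q + (\<Sum>xi\<in>P. \<bar>j xi\<bar>*Q + C0 xi)"
 have Tsq: "sesquilinear (T xi)" "0 <= C0 xi" if "xi : P" for xi using cj[OF that] by (auto simp: controls_jump_def)
 have C: "0 <= C" unfolding C_def using Q0 Tsq(2) by (intro add_nonneg_nonneg sum_nonneg mult_nonneg_nonneg) auto
 have P00: "0 <= xi" if "xi : P" for xi using P0[OF that] by simp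
 have Ysq: "sesquilinear Y"
  unfolding sesquilinear_def
 proof (intro allI impI conjI)
  fix f g h :: "real => complex" and b
  assume c: "continuous_on {0..a} f" "continuous_on {0..a} g" "continuous_on {0..a} h"
  have t: "tail_form xi (%x. f x + b*g x) h = tail_form xi f h + b*tail_form xi g h"
   "tail_form xi h (%x. f x + b*g x) = tail_form xi h f + cnj b*tail_form xi h g" if "0 <= xi" for xi
   using tail_form_sesquilinear[OF that] c unfolding sesquilinear_def by blast+
  have T: "T xi (%x. f x + b*g x) h = T xi f h + b*T xi g h"
   "T xi h (%x. f x + b*g x) = T xi h f + cnj b*T xi h g" if "xi : P" for xi
   using Tsq(1)[OF that] c unfolding sesquilinear_def by blast+
  show "Y (%x. f x + b*g x) h = Y f h + b*Y g h"
   unfolding Y_def by (simp add: t T P00 sum.distrib sum_distrib_left algebra_simps)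
  show "Y h (%x. f x + b*g x) = Y h f + cnj b*Y h g"
   unfolding Y_def by (simp add: t T P00 sum.distrib sum_distrib_left algebra_simps)
 qed
 have Yh: "Y g f = cnj (Y f g)" for f g
  unfolding Y_def tail_form_cnj[of _ g f] by (simp add: add.commute)
 have Yp: "(nrm f)^2 <= 2*Re (Y f f)" if f: "continuous_on {0..a} f" for f
 proof -
  let ?F = "%x. cx (w x)*(f x*cnj (f x))"
  have i: "((%x. if xi < x then ?F x else 0) has_integral tail_form xi f f) {0..a}" if xi: "xi : P" for xi
  proof -
   have "(?F has_integral tail_form xi f f) {xi..a}" unfolding tail_form_def by (rule integrable_integral[OF tail_form_int[OF P00[OF xi] f f]])
   then have "((%x. if x : {xi..a} then ?F x else 0) has_integral tail_form xi f f) {0..a}"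
    by (subst has_integral_restrict) (use P00[OF xi] in auto)
   then show ?thesis by (rule has_integral_spike[OF negligible_sing[of xi], rotated]) auto
  qed
  have "((%x. of_real th*?F x + (\<Sum>xi\<in>P. of_real (j xi)*(if xi < x then ?F x else 0))) has_integral of_real th*tail_form 0 f f + (\<Sum>xi\<in>P. of_real (j xi)*tail_form xi f f)) {0..a}"
   by (intro has_integral_add has_integral_mult_right has_integral_sum P(2) i)
    (simp_all only: tail_form_def integrable_integral[OF tail_form_int[OF order_refl f f]])
  then have "((%x. cx (\<bar>w x\<bar>*(cmod (f x))^2)) has_integral of_real th*tail_form 0 f f + (\<Sum>xi\<in>P. of_real (j xi)*tail_form xi f f)) {0..a}"
  proof (rule has_integral_spike[OF th, rotated])
   fix x assume "x : {0..a} - {x : {0..a}. sgn (w x) ~= th + (\<Sum>xi\<in>P. if xi < x then j xi else 0)}"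
   then have sg: "sgn (w x) = th + (\<Sum>xi\<in>P. if xi < x then j xi else 0)" by simp
   have "(\<Sum>xi\<in>P. of_real (j xi)*(if xi < x then ?F x else 0)) = of_real (\<Sum>xi\<in>P. if xi < x then j xi else 0)*?F x"
    unfolding of_real_sum sum_distrib_right by (rule sum.cong) auto
   then have "of_real th*?F x + (\<Sum>xi\<in>P. of_real (j xi)*(if xi < x then ?F x else 0)) = of_real (sgn (w x))*?F x"
    unfolding sg by (simp add: distrib_right)
   moreover have "of_real (sgn (w x))*?F x = of_real (sgn (w x)*w x)*(f x*cnj (f x))" by (simp add: mult_ac)
   moreover have "sgn (w x)*w x = \<bar>w x\<bar>" by (simp add: abs_sgn mult.commute)
   moreover have "f x*cnj (f x) = cx ((cmod (f x))^2)" by (simp only: complex_norm_square)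
   ultimately show "cx (\<bar>w x\<bar>*(cmod (f x))^2) = of_real th*?F x + (\<Sum>xi\<in>P. of_real (j xi)*(if xi < x then ?F x else 0))"
    by (simp only: of_real_mult)
  qed
  moreover have "((%x. cx (\<bar>w x\<bar>*(cmod (f x))^2)) has_integral cx ((nrm f)^2)) {0..a}"
   using has_integral_linear[OF integrable_integral bounded_linear_of_real, of "%x. \<bar>w x\<bar>*(cmod (f x))^2" "{0..a}"] cont_sq_int[OF f]
   unfolding nrm_square[OF cont_H[OF f]] abs_int_def o_def by blast
  ultimately have e: "of_real th*tail_form 0 f f + (\<Sum>xi\<in>P. of_real (j xi)*tail_form xi f f) = cx ((nrm f)^2)"
   by (rule has_integral_unique)
  have "Y f f = cx ((nrm f)^2) + (\<Sum>xi\<in>P. T xi f f + cnj (T xi f f))"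
   unfolding Y_def sum.distrib e[symmetric] by (simp add: add.assoc)
  then have R: "Re (Y f f) = (nrm f)^2 + (\<Sum>xi\<in>P. 2*Re (T xi f f))" by simp
  have "(\<Sum>xi\<in>P. - (2*(ep*(nrm f)^2))) <= (\<Sum>xi\<in>P. 2*Re (T xi f f))"
  proof (rule sum_mono)
   fix xi assume "xi : P"
   then have "cmod (T xi f f) <= ep*(nrm f)^2" using cj f by (simp add: controls_jump_def)
   then show "- (2*(ep*(nrm f)^2)) <= 2*Re (T xi f f)" using abs_Re_le_cmod[of "T xi f f"] by linarith
  qed
  also have "(\<Sum>xi\<in>P. - (2*(ep*(nrm f)^2))) = - (real (card P)*ep*2)*(nrm f)^2" by simp
  finally have "- (real (card P)*ep*2)*(nrm f)^2 <= (\<Sum>xi\<in>P. 2*Re (T xi f f))" .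
  moreover have "real (card P)*ep*2 <= 1/2" by (simp add: ep_def field_simps)
  then have "real (card P)*ep*2*(nrm f)^2 <= 1/2*(nrm f)^2" by (intro mult_right_mono) auto
  ultimately show ?thesis using R by simp
 qed
 have Yb: "cmod (Y f g) <= C*(energy v + S^2)"
  if s: "wsol g f v" and g: "continuous_on {0..a} g"
   and bc: "f a = eit t*f 0" "v a = eit t * v 0" and S: "\<forall>x\<in>{0..a}. cmod (f x) <= S" for f v g S t
 proof -
  let ?X = "energy v + S^2"
  have e: "f a*cnj (v a) = f 0*cnj (v 0)"
  proof -
   have "f a*cnj (v a) = (eit t*cnj (eit t))*(f 0*cnj (v 0))" unfolding bc by (simp add: mult_ac)
   then show ?thesis by (simp only: exp_i_mult_cnj mult_1)
  qed
  note tb = tail_form_bound[OF s _ bspec[OF S], folded Q_def]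
  \<comment> \<open>For xi = 0 the boundary terms at 0 and a cancel by quasi-periodicity.\<close>
  have t0: "cmod (tail_form 0 f g) <= Q*?X" using tb[of 0] a_pos e by simp
  \<comment> \<open>Boundary terms at a and at xi are inserted: ?A is then bounded by
    \<open>tail_form_bound\<close>, ?B by \<open>controls_jump\<close>, and the terms at a have
    total coefficient 0, the sum of the jumps.\<close>
  let ?A = "%xi. of_real (j xi)*(tail_form xi f g + f a*cnj (v a) - f xi*cnj (v xi))"
   and ?B = "%xi. of_real (j xi)*(f xi*cnj (v xi)) + T xi f g + cnj (T xi g f)"
  have "(\<Sum>xi\<in>P. of_real (j xi)*(f a*cnj (v a))) = of_real (\<Sum>xi\<in>P. j xi)*(f a*cnj (v a))"
   by (simp only: of_real_sum sum_distrib_right)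
  then have z: "(\<Sum>xi\<in>P. of_real (j xi)*(f a*cnj (v a))) = 0" by (simp add: j0)
  have "Y f g = of_real th*tail_form 0 f g + (\<Sum>xi\<in>P. ?A xi + ?B xi) - (\<Sum>xi\<in>P. of_real (j xi)*(f a*cnj (v a)))"
   unfolding Y_def add_diff_eq[symmetric] sum_subtractf[symmetric] by (simp add: algebra_simps)
  then have "cmod (Y f g) <= cmod (of_real th*tail_form 0 f g) + cmod (\<Sum>xi\<in>P. ?A xi + ?B xi)"
   unfolding z by (simp add: norm_triangle_ineq)
  also have "cmod (\<Sum>xi\<in>P. ?A xi + ?B xi) <= (\<Sum>xi\<in>P. \<bar>j xi\<bar>*(Q*?X) + C0 xi*?X)"
  proof (rule order_trans[OF norm_sum sum_mono])
   fix xi assume xi: "xi : P"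
   have "xi : {0..a}" using P0[OF xi] by simp
   then have 1: "cmod (?A xi) <= \<bar>j xi\<bar>*(Q*?X)" unfolding norm_mult norm_of_real by (intro mult_left_mono tb) auto
   have "\<forall>f v g S. bounded_sol f v g S (cmod (of_real (j xi)*(f xi*cnj (v xi)) + T xi f g + cnj (T xi g f)) <= C0 xi*(energy v + S^2))"
    using cj[OF xi] unfolding controls_jump_def by (elim conjE)
   note 2 = this[THEN spec, THEN spec, THEN spec, THEN spec, THEN mp, OF s, THEN mp, OF g, THEN mp, OF S]
   show "cmod (?A xi + ?B xi) <= \<bar>j xi\<bar>*(Q*?X) + C0 xi*?X"
    by (rule order_trans[OF norm_triangle_ineq add_mono[OF 1 2]])
  qed
  also have "cmod (of_real th*tail_form 0 f g) <= \<bar>th\<bar>*(Q*?X)"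
   unfolding norm_mult norm_of_real by (intro mult_left_mono t0) simp
  also have "\<bar>th\<bar>*(Q*?X) + (\<Sum>xi\<in>P. \<bar>j xi\<bar>*(Q*?X) + C0 xi*?X) = C*?X"
   unfolding C_def by (simp only: distrib_right sum_distrib_right mult.assoc)
  finally show ?thesis by simp
 qed
 have "definite_form Y C" unfolding definite_form_def using C Ysq Yh Yp Yb by blast
 then show ?thesis by blast
qed


section \<open>High eigenvalues\<close>

lemma integral_absw_pos:
 assumes "c < d"
 shows "0 < integral {c..d} (%x. \<bar>w x\<bar>)"
proof -
 have i: "integrable (lebesgue_on {c..d}) (%x. \<bar>w x\<bar>)" using absw_int[of c d] by (simp add: absolutely_integrable_iff_integrable)
 have e: "integral {c..d} (%x. \<bar>w x\<bar>) = integral\<^sup>L (lebesgue_on {c..d}) (%x. \<bar>w x\<bar>)"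
  by (rule lebesgue_integral_eq_integral[symmetric, OF i]) simp
 have "integral {c..d} (%x. \<bar>w x\<bar>) ~= 0"
 proof
  assume "integral {c..d} (%x. \<bar>w x\<bar>) = 0"
  then have "AE x in lebesgue_on {c..d}. \<bar>w x\<bar> = 0" using e integral_nonneg_eq_0_iff_AE[OF i] by simp
  then have "negligible {x : {c..d}. \<bar>w x\<bar> ~= 0}" by (subst (asm) AE_lebesgue_on_iff_negligible) auto
  then have "negligible {c<..<d}" by (rule negligible_subset[OF negligible_Un[OF _ w_nz]]) auto
  moreover have "(c + d)/2 : {c<..<d}" using assms by simp
  ultimately show False using open_not_negligible[OF open_greaterThanLessThan] by blast
 qed
 moreover have "0 <= integral {c..d} (%x. \<bar>w x\<bar>)"
  using absw_int[of c d] by (intro integral_nonneg) (auto simp: abs_int_def)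
 ultimately show ?thesis by simp
qed

text \<open>Uniform continuity of the primitive of |1/p| gives the length h; the mass of |w| on a
  cell is continuous in its left end and positive, so it has a positive minimum.\<close>

lemma uniform_cell:
 assumes "0 < ep"
 shows "\<exists>h m. 0 < h & h <= a & 0 < m & (\<forall>c\<in>{0..a - h}. m <= integral {c..c + h} (%x. \<bar>w x\<bar>)
   & integral {c..c + h} (%x. \<bar>inverse (p x)\<bar>) <= ep)"
proof -
 define G where "G = integral_from 0 (%x. \<bar>inverse (p x)\<bar>)"
 define W where "W = integral_from 0 (%x. \<bar>w x\<bar>)"
 have ipa: "(%x. \<bar>inverse (p x)\<bar>) abs_int_on {c..d}" for c d
  using absolutely_integrable_abs[OF ip_int] by (simp add: o_def)
 have G: "primitive_on UNIV G (%x. \<bar>inverse (p x)\<bar>)" unfolding G_def by (rule primitive_on_integral_from[OF ipa])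
 have W: "primitive_on UNIV W (%x. \<bar>w x\<bar>)" unfolding W_def by (rule primitive_on_integral_from[OF absw_int])
 have "uniformly_continuous_on {0..a} G" by (intro compact_uniformly_continuous primitive_on_continuous_UNIV[OF G]) simp
 then obtain d where d: "0 < d" "!!x y. x : {0..a} ==> y : {0..a} ==> dist y x < d ==> dist (G y) (G x) < ep"
  using \<open>0 < ep\<close> unfolding uniformly_continuous_on_def by metis
 define h where "h = min (d/2) a"
 have h: "0 < h" "h <= a" "h < d" using d(1) a_pos by (auto simp: h_def)
 have "continuous_on {0..a - h} (%c. W (c + h) - W c)"
  by (intro continuous_on_diff primitive_on_continuous_UNIV[OF W] continuous_on_compose2[OF primitive_on_continuous_UNIV[OF W, of UNIV]] continuous_intros) auto
 then obtain c0 where c0: "c0 : {0..a - h}" "\<forall>c\<in>{0..a - h}. W (c0 + h) - W c0 <= W (c + h) - W c"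
  using continuous_attains_inf[OF compact_Icc _ \<open>continuous_on {0..a - h} (%c. W (c + h) - W c)\<close>] h by auto
 have Wi: "integral {c..c + h} (%x. \<bar>w x\<bar>) = W (c + h) - W c" for c using primitive_onD(2)[OF W] h by simp
 have "integral {c..c + h} (%x. \<bar>inverse (p x)\<bar>) <= ep" if "c : {0..a - h}" for c
  using primitive_onD(2)[OF G, of c "c + h"] d(2)[of c "c + h"] that h by (auto simp: dist_real_def)
 moreover have "0 < W (c0 + h) - W c0" using integral_absw_pos[of c0 "c0 + h"] Wi h by simp
 ultimately show ?thesis using h c0(2) by - (rule exI[of _ h], rule exI[of _ "W (c0 + h) - W c0"], simp add: Wi)
qed

text \<open>On a short cell f oscillates by at most \<open>sqrt (ep * energy v)\<close>, by
  Cauchy-Schwarz for f' = v/p. Averaging against |w| over the cell compares the value at x with the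
  norm.\<close>

lemma sup_square_bound:
 assumes "0 < ep"
 shows "\<exists>m>0. \<forall>f v s. sol {0..a} s f v --> (\<forall>x\<in>{0..a}. (cmod (f x))^2 <= 2/m*(nrm f)^2 + 2*ep*energy v)"
proof -
 obtain h m where hm: "0 < h" "h <= a" "0 < m"
  "\<forall>c\<in>{0..a - h}. m <= integral {c..c + h} (%x. \<bar>w x\<bar>) & integral {c..c + h} (%x. \<bar>inverse (p x)\<bar>) <= ep"
  using uniform_cell[OF assms] by (elim exE conjE)
 have "(cmod (f x))^2 <= 2/m*(nrm f)^2 + 2*ep*energy v" if s: "sol {0..a} s f v" and x: "x : {0..a}" for f v s x
 proof -
  note fc = sol_continuous[OF s order_refl]
  \<comment> \<open>The left end of a cell of length h that contains x and stays inside the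
    period.\<close>
  define c where "c = min x (a - h)"
  have c: "c : {0..a - h}" "x : {c..c + h}" "{c..c + h} \<subseteq> {0..a}" using x hm by (auto simp: c_def min_def)
  define w0 where "w0 = integral {c..c + h} (%x. \<bar>w x\<bar>)"
  have w0: "m <= w0" "integral {c..c + h} (%x. \<bar>inverse (p x)\<bar>) <= ep" using hm(4) c(1) by (auto simp: w0_def)
  let ?e = "%x. (cmod (v x))^2*\<bar>inverse (p x)\<bar>"
  have ei: "?e abs_int_on {c'..d'}" if "{c'..d'} \<subseteq> {0..a}" for c' d'
   using absolutely_integrable_abs[OF energy_int[OF continuous_on_subset[OF fc(2) that]]] by (simp add: o_def abs_mult)
  have ipi: "(%x. \<bar>inverse (p x)\<bar>) integrable_on {c'..d'}" for c' d'
   using absolutely_integrable_abs[OF ip_int] by (simp add: o_def abs_int_def)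
  have e: "integral {0..a} ?e = energy v" unfolding energy_def by (rule integral_spike[OF p_pos]) auto
  have d: "cmod (f y' - f x') <= sqrt ep * sqrt (energy v)" if xy: "x' <= y'" "{x'..y'} \<subseteq> {c..c + h}" for x' y'
  proof -
   have sub: "{x'..y'} \<subseteq> {0..a}" using xy c(3) by blast
   have "cmod (f y' - f x') <= integral {x'..y'} (%z. cmod (v z/cx (p z)))"
    by (rule primitive_on_norm_le[OF solD(1)[OF s] sub xy(1)])
   also have "... <= sqrt (integral {x'..y'} (%x. \<bar>inverse (p x)\<bar>)) * sqrt (integral {x'..y'} ?e)"
   proof (rule integral_Cauchy_Schwarz)
    show "(%z. cmod (v z/cx (p z))) integrable_on {x'..y'}"
     using primitive_onD(1)[OF solD(1)[OF s] sub xy(1)] by (simp add: abs_int_def)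
    show "?e integrable_on {x'..y'}" using ei[OF sub] by (simp add: abs_int_def)
    fix z
    have "cmod (v z/cx (p z)) = cmod (v z)*\<bar>inverse (p z)\<bar>" by (simp add: norm_mult norm_inverse divide_inverse)
    moreover have "sqrt A * sqrt ((cmod (v z))^2*A) = cmod (v z)*A" if "0 <= A" for A using that by (simp add: real_sqrt_mult)
    ultimately show "cmod (v z/cx (p z)) <= sqrt \<bar>inverse (p z)\<bar> * sqrt (?e z)" by simp
   qed (use ipi in auto)
   also have "... <= sqrt ep * sqrt (energy v)"
   proof (intro mult_mono real_sqrt_le_mono)
    show "integral {x'..y'} (%x. \<bar>inverse (p x)\<bar>) <= ep"
     by (rule order_trans[OF integral_subset_le[OF xy(2) ipi ipi] w0(2)]) simp
    show "integral {x'..y'} ?e <= energy v"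
     unfolding e[symmetric] using ei[OF sub] ei[OF order_refl] by (intro integral_subset_le sub) (auto simp: abs_int_def)
   qed (use assms ei[OF sub] in \<open>auto intro!: integral_nonneg simp: abs_int_def\<close>)
   finally show ?thesis .
  qed
  have E0: "0 <= energy v" by (rule energy_nonneg[OF fc(2)])
  have pt: "(cmod (f x))^2 <= 2*(cmod (f y))^2 + 2*ep*energy v" if y: "y : {c..c + h}" for y
  proof -
   have "cmod (f x - f y) <= sqrt ep * sqrt (energy v)"
   proof (cases "y <= x")
    case True
    show ?thesis by (rule d[OF True]) (use y c(2) in auto)
   next
    case False
    then have "cmod (f y - f x) <= sqrt ep * sqrt (energy v)" by (intro d) (use y c(2) in auto)
    then show ?thesis by (simp only: norm_minus_commute)
   qed
   then have "(cmod (f x - f y))^2 <= (sqrt ep * sqrt (energy v))^2" by (rule power_mono) simp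
   then have 1: "(cmod (f x - f y))^2 <= ep*energy v" using assms E0 by (simp add: power_mult_distrib)
   have "cmod (f x) <= cmod (f y) + cmod (f x - f y)" using norm_triangle_ineq[of "f y" "f x - f y"] by simp
   then have "(cmod (f x))^2 <= (cmod (f y) + cmod (f x - f y))^2" by (rule power_mono) simp
   also have "... <= 2*(cmod (f y))^2 + 2*(cmod (f x - f y))^2"
    using sum_squares_bound[of "cmod (f y)" "cmod (f x - f y)"] by (simp add: power2_sum)
   finally show ?thesis using 1 by simp
  qed
  have ai: "(%x. \<bar>w x\<bar>) integrable_on {c..c + h}" using absw_int by (simp add: abs_int_def)
  have fi: "(%x. \<bar>w x\<bar>*(cmod (f x))^2) integrable_on {c..c + h}" "(%x. \<bar>w x\<bar>*(cmod (f x))^2) integrable_on {0..a}"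
   using cont_sq_int[OF continuous_on_subset[OF fc(1) c(3)]] cont_sq_int[OF fc(1)] by (simp_all add: abs_int_def)
  have "w0*(cmod (f x))^2 = integral {c..c + h} (%y. \<bar>w y\<bar>*(cmod (f x))^2)" by (simp add: w0_def)
  also have "... <= integral {c..c + h} (%y. 2*(\<bar>w y\<bar>*(cmod (f y))^2) + (2*ep*energy v)*\<bar>w y\<bar>)"
  proof (rule integral_le)
   fix y assume "y : {c..c + h}"
   from mult_left_mono[OF pt[OF this], of "\<bar>w y\<bar>"]
   show "\<bar>w y\<bar>*(cmod (f x))^2 <= 2*(\<bar>w y\<bar>*(cmod (f y))^2) + (2*ep*energy v)*\<bar>w y\<bar>" by (simp add: algebra_simps)
  qed (intro integrable_add integrable_on_mult_right integrable_on_mult_left ai fi)+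
  also have "... = 2*integral {c..c + h} (%y. \<bar>w y\<bar>*(cmod (f y))^2) + (2*ep*energy v)*w0"
   unfolding w0_def using Henstock_Kurzweil_Integration.integral_add[OF integrable_on_mult_right[OF fi(1), of 2] integrable_on_mult_right[OF ai, of "2*ep*energy v"]]
   by (simp only: integral_mult_right)
  also have "... <= 2*(nrm f)^2 + (2*ep*energy v)*w0"
   unfolding nrm_square[OF cont_H[OF fc(1)]] by (intro add_right_mono mult_left_mono integral_subset_le c(3) fi) auto
  finally have "(cmod (f x))^2 <= 2/w0*(nrm f)^2 + 2*ep*energy v"
   using w0(1) hm(3) by (simp add: field_simps)
  also have "2/w0*(nrm f)^2 <= 2/m*(nrm f)^2"
   using w0(1) hm(3) by (intro mult_right_mono divide_left_mono) auto
  finally show ?thesis by simp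
 qed
 then show ?thesis using hm(3) by blast
qed

section \<open>Coercivity of the energy\<close>

lemma energy_identity:
 assumes s: "wsol g f v" and g: "continuous_on {0..a} g"
  and bc: "f a = eit t*f 0" "v a = eit t * v 0"
 shows "Re (br g f) = energy v + integral {0..a} (%x. q x*(cmod (f x))^2)"
proof -
 note fc = sol_continuous[OF s order_refl]
 have e: "f a*cnj (v a) = f 0*cnj (v 0)"
 proof -
  have "f a*cnj (v a) = (eit t*cnj (eit t))*(f 0*cnj (v 0))" unfolding bc by (simp add: mult_ac)
  then show ?thesis by (simp only: exp_i_mult_cnj mult_1)
 qed
 have br: "((%x. g x*cnj (f x)*cx (w x)) has_integral br g f) {0..a}"
  using br_int[OF cont_H[OF g] cont_H[OF fc(1)]] unfolding br_eq[OF cont_H[OF g] cont_H[OF fc(1)]]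
  by (intro integrable_integral) (simp add: abs_int_def)
 have "((%x. cnj (g x*cnj (f x)*cx (w x))) has_integral cnj (br g f)) {0..a}"
  using has_integral_linear[OF br bounded_linear_cnj] by (simp add: o_def)
 from has_integral_add[OF this primitive_onD(4)[OF primitive_on_mult[OF solD(1)[OF s] primitive_on_linear[OF solD(2)[OF s] bounded_linear_cnj]] order_refl less_imp_le[OF a_pos]]]
 have "((%x. cnj (g x*cnj (f x)*cx (w x)) + (f x*cnj (cx (q x)*f x - cx (w x)*g x) + v x/cx (p x)*cnj (v x))) has_integral cnj (br g f)) {0..a}"
  unfolding e by simp
 then have 1: "((%x. cx ((cmod (v x))^2*inverse (p x) + q x*(cmod (f x))^2)) has_integral cnj (br g f)) {0..a}"
 proof (rule has_integral_eq[rotated])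
  fix x
  have sq: "cx ((cmod z)^2) = z*cnj z" for z by (simp only: complex_norm_square)
  show "cnj (g x*cnj (f x)*cx (w x)) + (f x*cnj (cx (q x)*f x - cx (w x)*g x) + v x/cx (p x)*cnj (v x))
   = cx ((cmod (v x))^2*inverse (p x) + q x*(cmod (f x))^2)"
   unfolding of_real_add of_real_mult sq by (simp add: divide_inverse algebra_simps)
 qed
 have "(%x. q x*(cmod (f x))^2) abs_int_on {0..a}"
  by (intro absolutely_integrable_continuous_mult(1) q_int continuous_intros fc)
 then have "((%x. (cmod (v x))^2*inverse (p x) + q x*(cmod (f x))^2) has_integral energy v + integral {0..a} (%x. q x*(cmod (f x))^2)) {0..a}"
  unfolding energy_def using energy_int[OF fc(2)] by (intro has_integral_add integrable_integral) (auto simp: abs_int_def)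
 from has_integral_linear[OF this bounded_linear_of_real]
 have "cnj (br g f) = cx (energy v + integral {0..a} (%x. q x*(cmod (f x))^2))"
  unfolding o_def by (rule has_integral_unique[OF 1])
 then have "Re (cnj (br g f)) = energy v + integral {0..a} (%x. q x*(cmod (f x))^2)" by simp
 then show ?thesis by simp
qed

text \<open>In [A f, f] = energy + integral of q |f|^2 the term with q is form bounded with small
  constant by \<open>sup_square_bound\<close>, so the energy absorbs it.\<close>

lemma energy_coercive:
 "\<exists>ga\<ge>0. \<forall>f v g t. wsol g f v --> continuous_on {0..a} g -->
   f a = eit t*f 0 --> v a = eit t * v 0 -->
   (\<exists>S. (\<forall>x\<in>{0..a}. cmod (f x) <= S) & energy v + S^2 <= 3*(Re (br g f) + ga*(nrm f)^2))"
proof -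
 define Q where "Q = integral {0..a} (%x. \<bar>q x\<bar>)"
 have qi: "(%x. \<bar>q x\<bar>) integrable_on {0..a}" using q_int[of 0 a] by (auto simp: abs_int_def)
 have Q0: "0 <= Q" using qi unfolding Q_def by (intro integral_nonneg) auto
 \<comment> \<open>Makes both \<open>2*ep*Q\<close> and \<open>2*ep\<close> at most 1/2: half of the
   energy absorbs the term with q, and S^2 costs at most another half.\<close>
 define ep where "ep = 1/(4*(Q + 1))"
 have ep: "0 < ep" "2*ep*Q <= 1/2" "2*ep <= 1/2" using Q0 by (auto simp: ep_def field_simps)
 obtain m where m: "0 < m" "\<forall>f v s. sol {0..a} s f v --> (\<forall>x\<in>{0..a}. (cmod (f x))^2 <= 2/m*(nrm f)^2 + 2*ep*energy v)"
  using sup_square_bound[OF ep(1)] by (elim exE conjE)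
 define ga where "ga = (6*Q + 2)/(3*m)"
 have "\<exists>S. (\<forall>x\<in>{0..a}. cmod (f x) <= S) & energy v + S^2 <= 3*(Re (br g f) + ga*(nrm f)^2)"
  if h: "wsol g f v" "continuous_on {0..a} g"
   "f a = eit t*f 0" "v a = eit t * v 0" for f v g t
 proof -
  note fc = sol_continuous[OF h(1) order_refl]
  define N where "N = (nrm f)^2/m"
  define E where "E = energy v"
  have E0: "0 <= E" unfolding E_def by (rule energy_nonneg[OF fc(2)])
  have N0: "0 <= N" using m(1) by (simp add: N_def)
  define S where "S = sqrt (2*N + 2*ep*E)"
  have S2: "S^2 = 2*N + 2*ep*E" using E0 N0 ep by (simp add: S_def)
  have fS: "(cmod (f x))^2 <= S^2" if "x : {0..a}" for x
   using m(2)[THEN spec, THEN spec, THEN spec, THEN mp, OF h(1)] that unfolding S2 by (simp add: N_def E_def)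
  have S0: "0 <= S" unfolding S_def using E0 N0 ep by simp
  have "norm (integral {0..a} (%x. q x*(cmod (f x))^2)) <= integral {0..a} (%x. S^2*\<bar>q x\<bar>)"
  proof (rule integral_norm_bound_integral)
   have "(%x. q x*(cmod (f x))^2) abs_int_on {0..a}"
    by (intro absolutely_integrable_continuous_mult(1) q_int continuous_intros fc)
   then show "(%x. q x*(cmod (f x))^2) integrable_on {0..a}" by (simp add: abs_int_def)
   fix x assume "x : {0..a}"
   from mult_right_mono[OF fS[OF this], of "\<bar>q x\<bar>"]
   show "norm (q x*(cmod (f x))^2) <= S^2*\<bar>q x\<bar>" by (simp add: abs_mult mult.commute)
  qed (intro integrable_on_mult_right qi)
  then have "\<bar>integral {0..a} (%x. q x*(cmod (f x))^2)\<bar> <= S^2*Q" by (simp add: Q_def)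
  then have "E <= Re (br g f) + S^2*Q" using energy_identity[OF h] unfolding E_def by linarith
  moreover have "S^2*Q = 2*(N*Q) + (2*ep*Q)*E" unfolding S2 by (simp add: algebra_simps)
  moreover have "(2*ep*Q)*E <= 1/2*E" by (rule mult_right_mono[OF ep(2) E0])
  ultimately have 1: "E <= 2*Re (br g f) + 4*(N*Q)" by linarith
  have "(2*ep)*E <= 1/2*E" by (rule mult_right_mono[OF ep(3) E0])
  then have "E + S^2 <= 3/2*E + 2*N" unfolding S2 by linarith
  also have "... <= 3*Re (br g f) + (6*(N*Q) + 2*N)" using 1 by simp
  also have "6*(N*Q) + 2*N = 3*(ga*(nrm f)^2)" using m(1) by (simp add: ga_def N_def field_simps)
  finally have "energy v + S^2 <= 3*(Re (br g f) + ga*(nrm f)^2)" by (simp add: E_def)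
  moreover have "\<forall>x\<in>{0..a}. cmod (f x) <= S" using fS S0 power2_le_imp_le by blast
  ultimately show ?thesis by blast
 qed
 moreover have "0 <= ga" using Q0 m(1) by (simp add: ga_def)
 ultimately show ?thesis by blast
qed

lemma sesquilinear_sum:
 assumes Y: "sesquilinear Y" and I: "finite I" and f: "!!i. i : I ==> continuous_on {0..a} (f i)"
 shows "Y (%x. \<Sum>i\<in>I. c i*f i x) (%x. \<Sum>i\<in>I. d i*f i x) = (\<Sum>i\<in>I. \<Sum>j\<in>I. c i*cnj (d j)*Y (f i) (f j))"
proof -
 have z: "Y (%_. 0) h = 0" "Y h (%_. 0) = 0" if "continuous_on {0..a} h" for h
 proof -
  have "\<forall>b. Y (%x. 0 + b*0) h = Y (%_. 0) h + b*Y (%_. 0) h & Y h (%x. 0 + b*0) = Y h (%_. 0) + cnj b*Y h (%_. 0)"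
   using Y that unfolding sesquilinear_def by (intro allI) (simp only: continuous_on_const)
  from this[THEN spec, of 1] show "Y (%_. 0) h = 0" "Y h (%_. 0) = 0" by simp_all
 qed
 have l: "Y (%x. \<Sum>i\<in>I. c i*f i x) h = (\<Sum>i\<in>I. c i*Y (f i) h)"
  if h: "continuous_on {0..a} h" for h using I f
 proof (induction rule: finite_induct)
  case (insert i I)
  then have cf: "continuous_on {0..a} (f i)" "continuous_on {0..a} (%x. \<Sum>i\<in>I. c i*f i x)" by (auto intro!: continuous_intros)
  have "Y (%x. (\<Sum>i\<in>I. c i*f i x) + c i*f i x) h = Y (%x. \<Sum>i\<in>I. c i*f i x) h + c i*Y (f i) h"
   using Y[unfolded sesquilinear_def, THEN spec, THEN spec, THEN spec, THEN spec, THEN mp, OF cf(2), THEN mp, OF cf(1), THEN mp, OF h] by (rule conjunct1)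
  then show ?case using insert by (simp add: add.commute)
 qed (simp add: z[OF h])
 have r: "Y h (%x. \<Sum>i\<in>I. d i*f i x) = (\<Sum>i\<in>I. cnj (d i)*Y h (f i))"
  if h: "continuous_on {0..a} h" for h using I f
 proof (induction rule: finite_induct)
  case (insert i I)
  then have cf: "continuous_on {0..a} (f i)" "continuous_on {0..a} (%x. \<Sum>i\<in>I. d i*f i x)" by (auto intro!: continuous_intros)
  have "Y h (%x. (\<Sum>i\<in>I. d i*f i x) + d i*f i x) = Y h (%x. \<Sum>i\<in>I. d i*f i x) + cnj (d i)*Y h (f i)"
   using Y[unfolded sesquilinear_def, THEN spec, THEN spec, THEN spec, THEN spec, THEN mp, OF cf(2), THEN mp, OF cf(1), THEN mp, OF h] by (rule conjunct2)
  then show ?case using insert by (simp add: add.commute)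
 qed (simp add: z[OF h])
 have "continuous_on {0..a} (%x. \<Sum>i\<in>I. d i*f i x)" using f by (intro continuous_intros) auto
 from l[OF this] have "Y (%x. \<Sum>i\<in>I. c i*f i x) (%x. \<Sum>i\<in>I. d i*f i x) = (\<Sum>i\<in>I. c i*Y (f i) (%x. \<Sum>i\<in>I. d i*f i x))" .
 also have "... = (\<Sum>i\<in>I. c i*(\<Sum>j\<in>I. cnj (d j)*Y (f i) (f j)))" by (intro sum.cong refl arg_cong2[of _ _ _ _ "(*)"] r f)
 finally show ?thesis by (simp add: sum_distrib_left mult.assoc)
qed

lemma bloch_orthogonal:
 assumes "bloch t (cx l) f v" "bloch t (cx m) g u" "l ~= m"
 shows "br f g = 0"
proof -
 have "br (%x. cx l*f x) g = br f (%x. cx m*g x)"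
  by (rule fiber_op_symmetric[OF bloch_fiber_op[OF assms(1)] bloch_fiber_op[OF assms(2)]])
 then have "cx (l - m)*br f g = 0" by (simp add: br_cmult_left br_cmult_right algebra_simps)
 then show ?thesis using assms(3) by simp
qed

lemma br_bloch_sum:
 assumes I: "finite L" and b: "!!l. l : L ==> bloch t (cx l) (f l) (v l)"
 shows "br (%x. \<Sum>l\<in>L. c l*f l x) (%x. \<Sum>l\<in>L. d l*f l x) = (\<Sum>l\<in>L. c l*cnj (d l)*br (f l) (f l))"
proof -
 have H: "f l : H" if "l : L" for l by (rule cont_H[OF sol_continuous_UNIV(1)[OF blochD(1)[OF b[OF that]]]])
 have H': "(%x. c*f l x) : H" if "l : L" for l c by (rule L2_cmult[OF H[OF that]])
 have "br (%x. \<Sum>l\<in>L. c l*f l x) (%x. \<Sum>l\<in>L. d l*f l x) = (\<Sum>l\<in>L. \<Sum>m\<in>L. c l*cnj (d m)*br (f l) (f m))"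
  using I H H' by (simp add: br_sum_left br_sum_right L2_sum br_cmult_left br_cmult_right mult.assoc sum_distrib_left)
 also have "... = (\<Sum>l\<in>L. \<Sum>m\<in>L. if m = l then c l*cnj (d l)*br (f l) (f l) else 0)"
  by (intro sum.cong refl) (auto simp: bloch_orthogonal[OF b b])
 finally show ?thesis using I by simp
qed

text \<open>F(s), the sum of \<open>exp (- s*l)\<close> times \<open>f l\<close>, satisfies F' = - A
  F. Hence d/ds Y(F, F) = - 2 Re Y(F, A F) is at least - kp [A F, F] - M Y(F, F). The factor exp (M
  s) removes the last term, and the sum with \<open>cc\<close> integrates the other one. So D
  increases and tends to 0, whence D 0 <= 0 for any number of summands.\<close>

lemma high_eigenvalues:
 assumes Y: "definite_form Y C"
 shows "\<exists>R1 kp. 0 <= kp & high_definite R1 kp"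
proof -
 obtain ga where ga: "0 <= ga" "\<forall>f v g t. wsol g f v --> continuous_on {0..a} g -->
   f a = eit t*f 0 --> v a = eit t * v 0 -->
   (\<exists>S. (\<forall>x\<in>{0..a}. cmod (f x) <= S) & energy v + S^2 <= 3*(Re (br g f) + ga*(nrm f)^2))"
  using energy_coercive by (elim exE conjE)
 note Y' = Y[unfolded definite_form_def]
 note C = Y'[THEN conjunct1] and Ys = Y'[THEN conjunct2, THEN conjunct1] and Yh = Y'[THEN conjunct2, THEN conjunct2, THEN conjunct1]
  and Yp = Y'[THEN conjunct2, THEN conjunct2, THEN conjunct2, THEN conjunct1] and Yb = Y'[THEN conjunct2, THEN conjunct2, THEN conjunct2, THEN conjunct2]
 \<comment> \<open>From 2 |Y(F, A F)| <= 2 C (E + S^2) <= 6 C ([A F, F] + ga |F|^2) and |F|^2 <= 2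
   Y(F, F): kp is the factor of [A F, F], and M that of Y(F, F).\<close>
 define kp where "kp = 6*C"
 define M where "M = 2*kp*ga"
 have kp: "0 <= kp" "0 <= M" using C ga(1) by (auto simp: kp_def M_def)
 have "(nrm (lsum L f))^2 <= (2*kp)*Re (br (lsum L f) (lsum L f))"
  if L: "finite L" and h: "\<forall>l\<in>L. M < l & bloch t (cx l) (f l) (v l) & 0 <= Re (br (f l) (f l))" for t L f v
 proof -
  have b: "bloch t (cx l) (f l) (v l)" and lM: "M < l" if "l : L" for l using h that by auto
  have fc: "continuous_on {0..a} (f l)" if "l : L" for l by (rule sol_continuous_UNIV(1)[OF blochD(1)[OF b[OF that]]])
  define B where "B = (%l. Re (br (f l) (f l)))"
  have B0: "0 <= B l" if "l : L" for l using h that by (simp add: B_def)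
  have Bc: "br (f l) (f l) = cx (B l)" for l unfolding B_def by (rule br_self_real)
  define y where "y = (%l m. Re (Y (f l) (f m)))"
  have ysym: "y l m = y m l" if "l : L" "m : L" for l m
   unfolding y_def Yh[THEN spec, THEN spec, THEN mp, OF fc[OF that(2)], THEN mp, OF fc[OF that(1)]] by simp
  have SS: "Y (%x. \<Sum>l\<in>L. c l*f l x) (%x. \<Sum>l\<in>L. d l*f l x) = (\<Sum>l\<in>L. \<Sum>m\<in>L. c l*cnj (d m)*Y (f l) (f m))" for c d
   by (rule sesquilinear_sum[OF Ys L fc])
  have BS: "br (%x. \<Sum>l\<in>L. c l*f l x) (%x. \<Sum>l\<in>L. d l*f l x) = (\<Sum>l\<in>L. c l*cnj (d l)*cx (B l))" for c d
   unfolding Bc[symmetric] by (rule br_bloch_sum[OF L b])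
  define F V g where "F = (%s x. \<Sum>l\<in>L. cx (exp (- s*l))*f l x)" and "V = (%s x. \<Sum>l\<in>L. cx (exp (- s*l)) * v l x)"
   and "g = (%s x. \<Sum>l\<in>L. cx (l*exp (- s*l))*f l x)"
  define N where "N = (%s. \<Sum>l\<in>L. \<Sum>m\<in>L. exp (- s*(l + m))*y l m)"
  define A where "A = (%s. \<Sum>l\<in>L. l*exp (- s*(2*l))*B l)"
  \<comment> \<open>Chosen so that \<open>cc l * (M - 2*l) = - l\<close>: differentiating the second
    sum of D then gives the terms of [A F, F]. The denominator is positive because l > M >=
    0.\<close>
  define cc where "cc = (%l. l/(2*l - M))"
  define D where "D = (%s. (\<Sum>l\<in>L. \<Sum>m\<in>L. exp ((M - (l + m)) * s)*y l m) - kp*(\<Sum>l\<in>L. cc l*exp ((M - 2*l) * s)*B l))"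
  define D' where "D' = (%s. (\<Sum>l\<in>L. \<Sum>m\<in>L. (M - (l + m))*exp ((M - (l + m)) * s)*y l m) - kp*(\<Sum>l\<in>L. cc l*((M - 2*l)*exp ((M - 2*l) * s))*B l))"
  have Fc: "continuous_on {0..a} (F s)" "continuous_on {0..a} (g s)" for s unfolding F_def g_def using fc by (auto intro!: continuous_intros)
  have YF: "Re (Y (F s) (F s)) = N s" for s
   unfolding F_def SS N_def y_def
   by (simp add: Re_sum ring_distribs mult.assoc flip: of_real_mult exp_add)
  have D'0: "0 <= D' s" for s
  proof -
   have "sol {0..a} (%x. \<Sum>l\<in>L. cx (exp (- s*l))*(cx l*cx (w x)*f l x)) (F s) (V s)"
    unfolding F_def V_def by (intro sol_sum L sol_cmult sol_subset[OF blochD(1)[OF b]]) auto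
   then have s: "sol {0..a} (%x. cx (w x)*g s x) (F s) (V s)"
    by (rule sol_cong) (simp_all add: g_def sum_distrib_left mult_ac)
   have bc: "F s a = eit t*F s 0" "V s a = eit t*V s 0"
    using blochD(2,3)[OF b, of _ 0] by (simp_all add: F_def V_def sum_distrib_left mult_ac)
   obtain S where S: "\<forall>x\<in>{0..a}. cmod (F s x) <= S" "energy (V s) + S^2 <= 3*(Re (br (g s) (F s)) + ga*(nrm (F s))^2)"
    using ga(2)[THEN spec, THEN spec, THEN spec, THEN spec, THEN mp, OF s, THEN mp, OF Fc(2), THEN mp, OF bc(1), THEN mp, OF bc(2)] by (elim exE conjE)
   note Yb' = Yb[THEN spec, THEN spec, THEN spec, THEN spec, THEN spec, THEN mp, OF s, THEN mp, OF Fc(2), THEN mp, OF bc(1), THEN mp, OF bc(2), THEN mp, OF S(1)]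
   have brA: "Re (br (g s) (F s)) = A s"
    unfolding g_def F_def BS A_def
    by (simp add: Re_sum ring_distribs mult_ac flip: of_real_mult exp_add)
   have ReY: "2*Re (Y (F s) (g s)) = (\<Sum>l\<in>L. \<Sum>m\<in>L. (l + m)*exp (- s*(l + m))*y l m)"
   proof -
    have 1: "Re (Y (F s) (g s)) = (\<Sum>l\<in>L. \<Sum>m\<in>L. m*exp (- s*(l + m))*y l m)"
    proof -
     have ee: "exp (- s*(l + m)) = exp (- s*l)*exp (- s*m)" for l m by (simp add: ring_distribs flip: exp_add)
     show ?thesis unfolding F_def g_def SS y_def ee by (simp add: Re_sum mult_ac flip: of_real_mult)
    qed
    also have "... = (\<Sum>m\<in>L. \<Sum>l\<in>L. m*exp (- s*(l + m))*y l m)" by (rule sum.swap)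
    also have "... = (\<Sum>l\<in>L. \<Sum>m\<in>L. l*exp (- s*(l + m))*y l m)"
     by (intro sum.cong refl) (simp add: ysym add.commute)
    finally show ?thesis using 1 by (simp add: algebra_simps sum.distrib)
   qed
   have X: "C*(energy (V s) + S^2) <= C*(3*(A s + ga*(2*N s)))"
   proof -
    have "(nrm (F s))^2 <= 2*N s" using Yp[THEN spec, THEN mp, OF Fc(1)] unfolding YF .
    then have "ga*(nrm (F s))^2 <= ga*(2*N s)" by (rule mult_left_mono[OF _ ga(1)])
    then have "3*(A s + ga*(nrm (F s))^2) <= 3*(A s + ga*(2*N s))" by (simp only: mult_le_cancel_left_pos zero_less_numeral add_le_cancel_left)
    from order_trans[OF S(2)[unfolded brA] this] have "energy (V s) + S^2 <= 3*(A s + ga*(2*N s))" .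
    then show ?thesis by (rule mult_left_mono[OF _ C])
   qed
   have "2*Re (Y (F s) (g s)) <= 2*cmod (Y (F s) (g s))" using complex_Re_le_cmod by simp
   also have "... <= 2*(C*(3*(A s + ga*(2*N s))))" using order_trans[OF Yb' X] by simp
   also have "... = kp*A s + M*N s" by (simp add: kp_def M_def algebra_simps)
   finally have le: "0 <= M*N s - (\<Sum>l\<in>L. \<Sum>m\<in>L. (l + m)*exp (- s*(l + m))*y l m) + kp*A s" unfolding ReY by simp
   have "D' s = exp (M * s)*(M*N s - (\<Sum>l\<in>L. \<Sum>m\<in>L. (l + m)*exp (- s*(l + m))*y l m) + kp*A s)"
   proof -
    have e: "exp ((M - z) * s) = exp (M * s)*exp (- s*z)" for z by (simp add: algebra_simps flip: exp_add)
    have 1: "(\<Sum>l\<in>L. \<Sum>m\<in>L. (M - (l + m))*exp ((M - (l + m)) * s)*y l m)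
      = exp (M * s)*(M*N s - (\<Sum>l\<in>L. \<Sum>m\<in>L. (l + m)*exp (- s*(l + m))*y l m))"
     unfolding e N_def sum_distrib_left sum_subtractf[symmetric] by (intro sum.cong refl) algebra
    have 2: "(\<Sum>l\<in>L. cc l*((M - 2*l)*exp ((M - 2*l) * s))*B l) = - (exp (M * s)*A s)"
     unfolding e A_def sum_distrib_left sum_negf[symmetric]
    proof (intro sum.cong refl)
     fix l assume l: "l : L"
     have "cc l*(M - 2*l) = - l" using lM[OF l] kp(2) by (simp add: cc_def field_simps)
     then show "cc l*((M - 2*l)*(exp (M * s)*exp (- s*(2*l))))*B l = - (exp (M * s)*(l*exp (- s*(2*l))*B l))"
      by algebra
    qed
    show ?thesis unfolding D'_def 1 2 by (simp add: algebra_simps)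
   qed
   then show ?thesis using le by simp
  qed
  have der: "(D has_real_derivative D' s) (at s)" for s
   unfolding D_def D'_def by (auto intro!: derivative_eq_intros simp: mult_ac)
  have mono: "D 0 <= D s" if "0 <= s" for s
   by (rule DERIV_nonneg_imp_nondecreasing[OF that]) (use der D'0 in blast)
  have ex: "((%s. exp ((M - z) * s)) \<longlongrightarrow> 0) at_top" if "M < z" for z
  proof -
   have "filterlim (%s. (M - z) * s) at_bot at_top"
    using that by (intro filterlim_tendsto_neg_mult_at_bot[OF tendsto_const] filterlim_ident) auto
   then show ?thesis by (rule filterlim_compose[OF exp_at_bot])
  qed
  \<comment> \<open>All exponents M - (l + m) are negative, as every eigenvalue in L exceeds M >=
    0.\<close>
  have "(D \<longlongrightarrow> (\<Sum>l\<in>L. \<Sum>m\<in>L. 0*y l m) - kp*(\<Sum>l\<in>L. cc l*0*B l)) at_top"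
   unfolding D_def
  proof (intro tendsto_diff tendsto_sum tendsto_mult tendsto_const ex)
   show "M < l + m" "M < 2*l" if "l : L" "m : L" for l m using lM[OF that(1)] lM[OF that(2)] kp(2) by linarith+
  qed
  then have "(D \<longlongrightarrow> 0) at_top" by simp
  then have "D 0 <= 0"
   by (rule tendsto_lowerbound) (use mono in \<open>auto simp: eventually_at_top_linorder\<close>)
  then have "N 0 <= kp*(\<Sum>l\<in>L. cc l*B l)" by (simp add: D_def N_def)
  \<comment> \<open>l > M gives cc l <= 1, and here the signs of the single products B l
    enter.\<close>
  also have "... <= kp*(\<Sum>l\<in>L. B l)"
  proof (intro mult_left_mono sum_mono kp(1))
   fix l assume l: "l : L"
   have "cc l <= 1" using lM[OF l] kp(2) by (simp add: cc_def field_simps)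
   then show "cc l*B l <= B l" using mult_right_mono[OF _ B0[OF l], of "cc l" 1] by simp
  qed
  finally have N: "N 0 <= kp*(\<Sum>l\<in>L. B l)" .
  have F0: "F 0 = (lsum L f)" by (simp add: F_def)
  have "br (lsum L f) (lsum L f) = (\<Sum>l\<in>L. cx (B l))"
   using BS[of "%_. 1" "%_. 1"] by simp
  then have Br: "Re (br (lsum L f) (lsum L f)) = (\<Sum>l\<in>L. B l)" by (simp add: Re_sum)
  have "(nrm (F 0))^2 <= 2*N 0" using Yp[THEN spec, THEN mp, OF Fc(1)] unfolding YF .
  then show ?thesis using N unfolding F0 Br by simp
 qed
 moreover have "0 <= 2*kp" using kp by simp
 ultimately show ?thesis by blast
qed

section \<open>Moving the period cell away from turning points\<close>

lemma integral_period_shift: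
 fixes g :: "real => 'b::euclidean_space"
 assumes per: "!!x. g (x + a) = g x" and int: "!!c d. g abs_int_on {c..d}" and b: "b : {0..a}"
 shows "integral {0..a} (%x. g (b + x)) = integral {0..a} g"
proof -
 have i: "g integrable_on {c..d}" for c d using int by (simp add: abs_int_def)
 have 1: "integral {0..y} (%x. g (c + x)) = integral {c..c + y} g" if "0 <= y" for c y
  using has_integral_affine[of 1 g _ c 0 y] integrable_integral[OF i[of c "c + y"]] that by (auto intro!: integral_unique)
 have "integral {0..a} (%x. g (b + x)) = integral {b..a} g + integral {a..a + b} g"
  using 1[of a b] a_pos b Henstock_Kurzweil_Integration.integral_combine[of b a "a + b" g] i by (simp add: add.commute)
 also have "integral {a..a + b} g = integral {0..b} g" using 1[of b a] b per by (simp add: add.commute)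
 finally have e: "integral {0..a} (%x. g (b + x)) = integral {b..a} g + integral {0..b} g" .
 have "integral {0..b} g + integral {b..a} g = integral {0..a} g"
  by (rule Henstock_Kurzweil_Integration.integral_combine) (use b i in auto)
 then show ?thesis unfolding e by (simp only: add.commute)
qed

lemma shifted: "sturm_liouville a (%x. w (b + x)) (%x. p (b + x)) (%x. q (b + x))"
proof -
 have ai: "(%x. g (b + x)) abs_int_on {c..d}" if "!!c d. g abs_int_on {c..d}" for g :: "real => real" and c d
  using absolutely_integrable_affine[where f = g and m = 1 and c = b and x = c and y = d] that by (cases "c <= d") auto
 have ng: "negligible {x. P (b + x)}" if "negligible {x. P x}" for P
 proof (rule negligible_subset[OF negligible_translation[OF that, of "- b"]])
  show "{x. P (b + x)} \<subseteq> (+) (- b) ` {x. P x}"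
  proof
   fix x assume "x : {x. P (b + x)}"
   then show "x : (+) (- b) ` {x. P x}" by (intro image_eqI[of _ _ "b + x"]) auto
  qed
 qed
 have me: "(%x. g (b + x)) : borel_measurable lebesgue" if "g : borel_measurable lebesgue" for g :: "real => real"
  using measurable_compose[OF lebesgue_affine_measurable[of "%_. 1" b] that] by simp
 show ?thesis
  by unfold_locales (use a_pos w_per p_per q_per in \<open>auto intro!: ai ng me w_int q_int ip_int w_meas p_meas w_nz p_pos simp: add.assoc[symmetric]\<close>)
qed

lemma turning_point_shift: "turning_point (%x. w (b + x)) x \<longleftrightarrow> turning_point w (b + x)"
proof -
 have "negligible {y : {x - dl<..<x + dl}. \<not> P (w (b + y))} \<longleftrightarrow> negligible {y : {b + x - dl<..<b + x + dl}. \<not> P (w y)}" for P dl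
 proof -
  have e: "{y : {b + x - dl<..<b + x + dl}. \<not> P (w y)} = (+) b ` {y : {x - dl<..<x + dl}. \<not> P (w (b + y))}"
  proof (intro equalityI subsetI)
   fix y assume "y : {y : {b + x - dl<..<b + x + dl}. \<not> P (w y)}"
   then show "y : (+) b ` {y : {x - dl<..<x + dl}. \<not> P (w (b + y))}" by (intro image_eqI[of _ _ "y - b"]) auto
  qed auto
  show ?thesis unfolding e by (rule iffI[OF negligible_translation negligible_translation_rev])
 qed
 note N = this
 show ?thesis unfolding turning_point_def indefinite_on_def
  using N[of _ "%z. 0 < z"] N[of _ "%z. z < 0"] by (simp add: AE_lebesgue_on_iff_negligible)
qed

lemma one_simple_shift:
 assumes "one_simple w (b + x0)"
 shows "one_simple (%x. w (b + x)) x0"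
proof -
 obtain dl tap tam rhp rhm c where S: "0 < dl" "- 1 < tap" "- 1 < tam" "C1_on {b + x0..b + x0 + dl} rhp" "C1_on {b + x0 - dl..b + x0} rhm" "rhp (b + x0) ~= 0" "rhm (b + x0) ~= 0"
  "\<forall>x\<in>{0..dl}. sgn (rhp (b + x0 + x)) = c & - sgn (rhm (b + x0 - x)) = c"
  "\<forall>x. x - (b + x0) : {0<..<dl} --> w x = rhp x*\<bar>x - (b + x0)\<bar> powr tap"
  "\<forall>x. - (x - (b + x0)) : {0<..<dl} --> w x = rhm x*\<bar>x - (b + x0)\<bar> powr tam"
  using assms unfolding one_simple_def by (elim exE conjE)
 have C: "C1_on {c..d} (%x. f (b + x))" if f: "C1_on {b + c..b + d} f" for c d f
 proof -
  obtain f' where f': "\<forall>x\<in>{b + c..b + d}. (f has_real_derivative f' x) (at x within {b + c..b + d})" "continuous_on {b + c..b + d} f'"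
   using f unfolding C1_on_def by (elim exE conjE)
  have "((%x. f (b + x)) has_real_derivative f' (b + x)) (at x within {c..d})" if "x : {c..d}" for x
  proof -
   have 1: "(f has_real_derivative f' (b + x)) (at (b + x) within (+) b ` {c..d})" using f'(1) that by (simp add: add.commute)
   have 2: "((+) b has_real_derivative 1) (at x within {c..d})" by (auto intro!: derivative_eq_intros)
   show ?thesis using DERIV_image_chain[OF 1 2] by (simp add: o_def)
  qed
  moreover have "continuous_on {c..d} (%x. f' (b + x))"
   by (rule continuous_on_compose2[OF f'(2)]) (auto intro!: continuous_intros)
  ultimately show ?thesis unfolding C1_on_def by (intro exI[of _ "%x. f' (b + x)"]) simp
 qed
 show ?thesis unfolding one_simple_def
 proof (rule exI[of _ dl], intro conjI, rule S(1), rule exI[of _ tap], intro conjI, rule S(2), rule exI[of _ tam], intro conjI, rule S(3),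
   rule exI[of _ "%x. rhp (b + x)"], rule exI[of _ "%x. rhm (b + x)"], intro conjI)
  show "\<exists>c. \<forall>x\<in>{0..dl}. sgn (rhp (b + (x0 + x))) = c & - sgn (rhm (b + (x0 - x))) = c"
   using S(8) by (intro exI[of _ c]) (simp add: add.assoc add_diff_eq)
 qed (use S C[of x0 "x0 + dl" rhp] C[of "x0 - dl" x0 rhm] in \<open>auto simp: add.assoc add_diff_eq\<close>)
qed

lemma turning_point_per: "turning_point w (x + a) \<longleftrightarrow> turning_point w x"
 using turning_point_shift[of a x] w_per by (simp add: add.commute)

text \<open>A turning point at 0 would also sit at a and have only one side within the cell. As
  there are finitely many, some b is none, and the cell is moved to start at b. Norms and products
  of Bloch functions do not change, because their integrands are periodic.\<close>

lemma high_eigenvalues_turning: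
 assumes fin: "finite {x : {0..a}. turning_point w x}"
  and os: "!!x. x : {0..a} ==> turning_point w x ==> one_simple w x"
  and pb: "!!x. x : {0..a} ==> turning_point w x ==> \<exists>dl>0. \<exists>K. AE y in lebesgue_on {x - dl<..<x + dl}. \<bar>p y\<bar> <= K & \<bar>inverse (p y)\<bar> <= K"
 shows "\<exists>R1 kp. 0 <= kp & high_definite R1 kp"
proof -
 have "infinite {0<..<a}" using a_pos by (simp add: infinite_Ioo)
 then obtain b where b: "b : {0<..<a}" "\<not> turning_point w b"
 proof -
  have "\<exists>b\<in>{0<..<a}. \<not> turning_point w b"
  proof (rule ccontr)
   assume "\<not> (\<exists>b\<in>{0<..<a}. \<not> turning_point w b)"
   then have "{0<..<a} \<subseteq> {x : {0..a}. turning_point w x}" by auto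
   then show False using \<open>infinite {0<..<a}\<close> fin finite_subset by blast
  qed
  then show ?thesis using that by blast
 qed
 interpret S: sturm_liouville a "%x. w (b + x)" "%x. p (b + x)" "%x. q (b + x)" by (rule shifted)
 define P where "P = {x : {0..a}. turning_point (%x. w (b + x)) x}"
 \<comment> \<open>A turning point in the moved cell is, up to one period, a turning point of the
   original cell, so it inherits the hypotheses by periodicity.\<close>
 have Ptp: "\<exists>z\<in>{0..a}. turning_point w z & (b + x = z \<or> b + x = z + a)" if "x : P" for x
 proof (cases "b + x <= a")
  case True
  then show ?thesis using that b by (intro bexI[of _ "b + x"]) (auto simp: P_def turning_point_shift)
 next
  case False
  then show ?thesis using that b turning_point_per[of "b + x - a"] by (intro bexI[of _ "b + x - a"]) (auto simp: P_def turning_point_shift)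
 qed
 have "P \<subseteq> (%z. z - b) ` {x : {0..a}. turning_point w x} \<union> (%z. z + a - b) ` {x : {0..a}. turning_point w x}"
 proof
  fix x assume "x : P"
  then obtain z where z: "z : {0..a}" "turning_point w z" "b + x = z \<or> b + x = z + a" using Ptp by blast
  from z(3) have "x = z - b \<or> x = z + a - b" by auto
  then show "x : (%z. z - b) ` {x : {0..a}. turning_point w x} \<union> (%z. z + a - b) ` {x : {0..a}. turning_point w x}"
   using z(1,2) by blast
 qed
 then have "finite P" by (rule finite_subset) (use fin in auto)
 moreover have "0 \<notin> P" "a \<notin> P" using b(2) turning_point_per[of b] by (auto simp: P_def turning_point_shift)
 moreover have "one_simple (%x. w (b + x)) x" if "x : P" for x
 proof (rule one_simple_shift)
  note xP = that
  obtain z where z: "z : {0..a}" "turning_point w z" "b + x = z \<or> b + x = z + a" using Ptp[OF xP] by blast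
  have "one_simple (%x. w (- a + x)) (a + z)" by (rule one_simple_shift) (use os z in simp)
  then have "one_simple w (z + a)" using w_per[of "- a + _"] by (simp add: add.commute)
  then show "one_simple w (b + x)" using os[OF z(1,2)] z(3) by auto
 qed
 moreover have "\<exists>dl>0. \<exists>K. AE y in lebesgue_on {x - dl<..<x + dl}. \<bar>p (b + y)\<bar> <= K & \<bar>inverse (p (b + y))\<bar> <= K" if "x : P" for x
 proof -
  note xP = that
  obtain z where z: "z : {0..a}" "turning_point w z" "b + x = z \<or> b + x = z + a" using Ptp[OF xP] by blast
  obtain dl K where K: "0 < dl" "AE y in lebesgue_on {z - dl<..<z + dl}. \<bar>p y\<bar> <= K & \<bar>inverse (p y)\<bar> <= K"
   using pb[OF z(1,2)] by (elim exE conjE)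
  let ?Q = "%y. \<not> (\<bar>p y\<bar> <= K & \<bar>inverse (p y)\<bar> <= K)"
  have N: "negligible {y : {z - dl<..<z + dl}. ?Q y}" using K(2) by (subst (asm) AE_lebesgue_on_iff_negligible) auto
  have pz: "p (b + y) = p (z - x + y)" for y
  proof -
   have "b + y = z - x + y \<or> b + y = (z - x + y) + a" using z(3) by auto
   then show ?thesis using p_per[of "z - x + y"] by (elim disjE) (simp_all only:)
  qed
  have "{y : {x - dl<..<x + dl}. ?Q (b + y)} \<subseteq> (+) (x - z) ` {y : {z - dl<..<z + dl}. ?Q y}"
  proof
   fix y assume "y : {y : {x - dl<..<x + dl}. ?Q (b + y)}"
   then show "y : (+) (x - z) ` {y : {z - dl<..<z + dl}. ?Q y}" unfolding pz by (intro image_eqI[of _ _ "z - x + y"]) auto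
  qed
  then have "negligible {y : {x - dl<..<x + dl}. ?Q (b + y)}" by (rule negligible_subset[OF negligible_translation[OF N]])
  then have "AE y in lebesgue_on {x - dl<..<x + dl}. \<bar>p (b + y)\<bar> <= K & \<bar>inverse (p (b + y))\<bar> <= K"
   by (subst AE_lebesgue_on_iff_negligible) auto
  then show ?thesis using K(1) by blast
 qed
 ultimately have "\<exists>Y C. S.definite_form Y C" by (intro S.definite_form_exists[OF P_def])
 then obtain Y C where "S.definite_form Y C" by blast
 from S.high_eigenvalues[OF this] obtain R1 kp where kp: "0 <= kp"
  "S.high_definite R1 kp"
  by (elim exE conjE)
 have bl: "S.bloch t z (%x. f (b + x)) (%x. v (b + x))" if "bloch t z f v" for t z f v
 proof -
  note s = solD[OF blochD(1)[OF that]]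
  have "S.sol UNIV (%x. z*cx (w (b + x))*f (b + x)) (%x. f (b + x)) (%x. v (b + x))"
   using primitive_on_affine[OF s(1), of 1 UNIV b] primitive_on_affine[OF s(2), of 1 UNIV b] by (simp add: S.sol_def)
  then show ?thesis using that by (simp add: S.bloch_def S.qper_def bloch_def qper_def flip: add.assoc)
 qed
 have per2: "f (x + a)*cnj (f (x + a)) = f x*cnj (f x)" if "!!x. f (x + a) = eit t*f x" for f t x
 proof -
  have "f (x + a)*cnj (f (x + a)) = (eit t*cnj (eit t))*(f x*cnj (f x))" unfolding that by (simp add: mult_ac)
  then show ?thesis by (simp only: exp_i_mult_cnj mult_1)
 qed
 have b0: "b : {0..a}" using b by simp
 have nr: "(S.nrm (%x. f (b + x)))^2 = (nrm f)^2" and brs: "S.br (%x. f (b + x)) (%x. f (b + x)) = br f f"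
  if f: "continuous_on UNIV f" "!!x. f (x + a) = eit t*f x" for f t
 proof -
  have fc: "continuous_on A f" for A using f(1) continuous_on_subset by blast
  have sc: "continuous_on {0..a} (%x. f (b + x))" by (rule continuous_on_compose2[OF f(1)]) (auto intro!: continuous_intros)
  have "cmod (f (x + a)) = cmod (f x)" for x unfolding f(2) norm_mult exp_i_norm by simp
  then have "integral {0..a} (%x. \<bar>w (b + x)\<bar>*(cmod (f (b + x)))^2) = integral {0..a} (%x. \<bar>w x\<bar>*(cmod (f x))^2)"
   by (intro integral_period_shift[where g = "%x. \<bar>w x\<bar>*(cmod (f x))^2"] cont_sq_int fc b0) (simp add: w_per)
  then show "(S.nrm (%x. f (b + x)))^2 = (nrm f)^2"
   unfolding nrm_square[OF cont_H[OF fc]] S.nrm_square[OF S.cont_H[OF sc]] .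
  have "integral {0..a} (%x. cx (w (b + x))*(f (b + x)*cnj (f (b + x)))) = integral {0..a} (%x. cx (w x)*(f x*cnj (f x)))"
   by (intro integral_period_shift[where g = "%x. cx (w x)*(f x*cnj (f x))"] coeff_mult_int(3) continuous_intros fc b0)
    (simp add: w_per per2[of f t, OF f(2)])
  then show "S.br (%x. f (b + x)) (%x. f (b + x)) = br f f"
   unfolding br_eq[OF cont_H[OF fc] cont_H[OF fc]] S.br_eq[OF S.cont_H[OF sc] S.cont_H[OF sc]] by (simp add: mult_ac)
 qed
 have "(nrm (lsum L f))^2 <= kp*Re (br (lsum L f) (lsum L f))"
  if L: "finite L" and h: "\<forall>l\<in>L. R1 < l & bloch t (cx l) (f l) (v l) & 0 <= Re (br (f l) (f l))" for t L f v
 proof -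
  have fb: "bloch t (cx l) (f l) (v l)" if "l : L" for l using h that by blast
  have sc: "continuous_on UNIV (lsum L f)" by (intro continuous_on_sum blochD(4)[OF fb])
  have sp: "(\<Sum>l\<in>L. f l (x + a)) = eit t*(\<Sum>l\<in>L. f l x)" for x
   unfolding sum_distrib_left by (intro sum.cong refl blochD(2)[OF fb])
  have "\<forall>l\<in>L. R1 < l & S.bloch t (cx l) (%x. f l (b + x)) (%x. v l (b + x)) & 0 <= Re (S.br (%x. f l (b + x)) (%x. f l (b + x)))"
   using h bl brs[OF blochD(4)[OF fb] blochD(2)[OF fb]] by simp
  from kp(2)[THEN spec[of _ t], THEN spec[of _ L], THEN spec[of _ "%l x. f l (b + x)"], THEN spec[of _ "%l x. v l (b + x)"], THEN mp, OF L, THEN mp, OF this]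
  show ?thesis unfolding nr[where f = "%x. \<Sum>l\<in>L. f l x", OF sc sp] brs[where f = "%x. \<Sum>l\<in>L. f l x", OF sc sp] .
 qed
 then show ?thesis using kp(1) by blast
qed


section \<open>Uniform definiteness\<close>

lemma bloch_cmult: "bloch t z f v ==> bloch t z (%x. c*f x) (%x. c * v x)"
 using sol_cmult[of UNIV "%x. z*cx (w x)*f x" f v c] by (simp add: bloch_def qper_def mult_ac)

lemma br_self_diff:
 assumes "f : H" "g : H"
 shows "cmod (br f f - br g g) <= nrm (%x. f x - g x)*(nrm f + nrm g)"
proof -
 have d: "(%x. f x - g x) : H" by (rule L2_diff[OF assms])
 have "br g (%x. f x - g x) = cnj (br (%x. f x - g x) g)" by (rule br_commute)
 also have "... = cnj (br f g) - cnj (br g g)" by (simp only: br_diff_left[OF assms assms(2)] complex_cnj_diff)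
 also have "... = br g f - br g g" by (metis br_commute)
 finally have "br g f - br g g = br g (%x. f x - g x)" ..
 then have "br f f - br g g = br (%x. f x - g x) f + br g (%x. f x - g x)"
  unfolding br_diff_left[OF assms assms(1)] by (simp add: algebra_simps)
 also have "cmod ... <= nrm (%x. f x - g x)*nrm f + nrm g*nrm (%x. f x - g x)"
  by (rule order_trans[OF norm_triangle_ineq add_mono[OF br_cs[OF d assms(1)] br_cs[OF assms(2) d]]])
 finally show ?thesis by (simp add: algebra_simps)
qed

lemma l2norm_sum_le:
 assumes "finite I" "!!i. i : I ==> f i : H"
 shows "nrm (%x. \<Sum>i\<in>I. f i x) <= (\<Sum>i\<in>I. nrm (f i))"
 using assms
proof (induction rule: finite_induct)
 case (insert i I)
 then have "nrm (%x. f i x + (\<Sum>i\<in>I. f i x)) <= nrm (f i) + nrm (%x. \<Sum>i\<in>I. f i x)"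
  by (intro l2norm_triangle L2_sum) auto
 then show ?case using insert by simp
qed (simp add: l2norm_def)

text \<open>Otherwise normalised eigenvectors with [g, g] < 1/n converge, by
  \<open>bloch_compact\<close>, to an eigenvector F with [F, F] <= 0 at some eigenvalue in [R, R1].
  Above R this contradicts \<open>positive\<close>, at R it contradicts \<open>crit\<close>.\<close>

lemma uniform_positive:
 assumes positive: "\<forall>t\<in>{-pi..pi}. \<forall>l f v. R < l --> bloch t (cx l) f v --> nrm f ~= 0 --> 0 < Re (br f f)"
  and crit: "\<forall>t\<in>{-pi..pi}. \<forall>f v. bloch t (cx R) f v --> nrm f ~= 0 --> br f f ~= 0"
 shows "\<exists>d>0. \<forall>t\<in>{-pi..pi}. \<forall>l f v. R < l --> l <= R1 --> bloch t (cx l) f v --> d*(nrm f)^2 <= Re (br f f)"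
proof (rule ccontr)
 assume neg: "\<not> ?thesis"
 note pos = positive[rule_format]
 have "\<exists>x. fst x : {-pi..pi} & R < fst (snd x) & fst (snd x) <= R1 & bloch (fst x) (cx (fst (snd x))) (fst (snd (snd x))) (snd (snd (snd x)))
   & Re (br (fst (snd (snd x))) (fst (snd (snd x)))) < inverse (real (Suc n))*(nrm (fst (snd (snd x))))^2" for n
 proof (rule ccontr)
  assume c: "\<not> (\<exists>x. fst x : {-pi..pi} & R < fst (snd x) & fst (snd x) <= R1 & bloch (fst x) (cx (fst (snd x))) (fst (snd (snd x))) (snd (snd (snd x)))
   & Re (br (fst (snd (snd x))) (fst (snd (snd x)))) < inverse (real (Suc n))*(nrm (fst (snd (snd x))))^2)"
  have "inverse (real (Suc n))*(nrm f)^2 <= Re (br f f)" if "t : {-pi..pi}" "R < l" "l <= R1" "bloch t (cx l) f v" for t l f v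
   using c[unfolded not_ex, THEN spec, of "(t, l, f, v)"] that by (simp add: not_less)
  then show False using neg by (metis inverse_positive_iff_positive of_nat_0_less_iff zero_less_Suc)
 qed
 then obtain X where X: "!!n. fst (X n) : {-pi..pi} & R < fst (snd (X n)) & fst (snd (X n)) <= R1 & bloch (fst (X n)) (cx (fst (snd (X n)))) (fst (snd (snd (X n)))) (snd (snd (snd (X n))))
   & Re (br (fst (snd (snd (X n)))) (fst (snd (snd (X n))))) < inverse (real (Suc n))*(nrm (fst (snd (snd (X n)))))^2" by metis
 define t l f v where "t = (%n. fst (X n))" and "l = (%n. fst (snd (X n)))" and "f = (%n. fst (snd (snd (X n))))" and "v = (%n. snd (snd (snd (X n))))"
 have t: "t n : {-pi..pi}" and l: "R < l n" "l n <= R1" and b: "bloch (t n) (cx (l n)) (f n) (v n)"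
  and s: "Re (br (f n) (f n)) < inverse (real (Suc n))*(nrm (f n))^2" for n
  using X[of n] by (auto simp: t_def l_def f_def v_def)
 have nz: "0 < nrm (f n)" for n
 proof -
  have "nrm (f n) ~= 0"
  proof
   assume z: "nrm (f n) = 0"
   then have "f n = (%_. 0)" by (rule bloch_trivial(1)[OF b])
   then have "br (f n) (f n) = 0" by (simp add: indef_inner_def)
   then show False using s[of n] z by simp
  qed
  then show ?thesis using l2norm_nonneg[of _ "f n"] by (simp add: less_le)
 qed
 define g u where "g = (%n x. cx (inverse (nrm (f n)))*f n x)" and "u = (%n x. cx (inverse (nrm (f n))) * v n x)"
 have bg: "bloch (t n) (cx (l n)) (g n) (u n)" for n unfolding g_def u_def by (rule bloch_cmult[OF b])
 have g1: "nrm (g n) = 1" for n unfolding g_def l2norm_cmult using nz[of n] by (simp add: norm_inverse)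
 have gs: "Re (br (g n) (g n)) < inverse (real (Suc n))" for n
 proof -
  have "br (g n) (g n) = cx (inverse (nrm (f n))*inverse (nrm (f n)))*br (f n) (f n)"
   by (simp add: g_def br_cmult_left br_cmult_right mult.assoc)
  then have "Re (br (g n) (g n)) = (inverse (nrm (f n)))^2*Re (br (f n) (f n))" by (simp add: power2_eq_square field_simps)
  also have "... < (inverse (nrm (f n)))^2*(inverse (real (Suc n))*(nrm (f n))^2)"
   by (rule mult_strict_left_mono[OF s]) (use nz[of n] in simp)
  also have "... = inverse (real (Suc n))" using nz[of n] by (simp add: power2_eq_square field_simps)
  finally show ?thesis .
 qed
 have bs: "sol {0..a} (%x. cx (l n)*cx (w x)*g n x + 0) (g n) (u n)" for n
  using sol_subset[OF blochD(1)[OF bg] subset_UNIV] by simp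
 have bc: "g n a = exp (\<i> * of_real (t n))*g n 0" "u n a = exp (\<i> * of_real (t n))*u n 0" for n
  using blochD(2,3)[OF bg[of n], of 0] by simp_all
 have lz: "cmod (cx (l n)) <= max \<bar>R\<bar> \<bar>R1\<bar>" for n using l[of n] by (auto simp: abs_le_iff le_max_iff_disj)
 obtain r t' z' F V where r: "strict_mono (r :: nat => nat)" "t' : {-pi..pi}" "(%n. t (r n)) ----> t'"
  "(%n. cx (l (r n))) ----> z'" "bloch t' z' F V" "nrm F = 1" "(%n. nrm (%x. g (r n) x - F x)) ----> 0"
  by (rule bloch_compact[where t = t and z = "%n. cx (l n)" and f = g and v = u and ze = "%_ _. 0", OF t lz bs bc _ g1]) auto
 have lr: "(%n. l (r n)) ----> Re z'" using tendsto_Re[OF r(4)] by simp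
 have zr: "z' = cx (Re z')"
  by (rule LIMSEQ_unique[OF r(4) tendsto_of_real[OF lr]])
 have Rz: "R <= Re z'" by (rule LIMSEQ_le_const[OF lr]) (use l in \<open>auto intro: less_imp_le\<close>)
 have gH: "g n : H" for n by (rule blochD(6)[OF bg])
 have FH: "F : H" by (rule blochD(6)[OF r(5)])
 have "Re (br F F) <= inverse (real (Suc (r n))) + 2*nrm (%x. g (r n) x - F x)" for n
 proof -
  have "cmod (br (g (r n)) (g (r n)) - br F F) <= nrm (%x. g (r n) x - F x)*2"
   using br_self_diff[OF gH FH, of "r n"] g1 r(6) by simp
  then show ?thesis using gs[of "r n"] abs_Re_le_cmod[of "br (g (r n)) (g (r n)) - br F F"] by simp
 qed
 moreover have "(%n. inverse (real (Suc (r n))) + 2*nrm (%x. g (r n) x - F x)) ----> 0 + 2*0"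
  by (intro tendsto_intros r(7)) (rule LIMSEQ_subseq_LIMSEQ[OF LIMSEQ_inverse_real_of_nat r(1), unfolded o_def])
 ultimately have le: "Re (br F F) <= 0" by (intro LIMSEQ_le_const[of _ 0]) auto
 have b': "bloch t' (cx (Re z')) F V" using r(5) zr by simp
 show False
 proof (cases "R < Re z'")
  case True
  then show False using pos[OF r(2) True b'] r(6) le by simp
 next
  \<comment> \<open>At R itself no sign is known, but F is a limit of vectors of positive type; so
    [F, F] is also non-negative and F is neutral.\<close>
  case False
  then have e: "Re z' = R" using Rz by simp
  have "0 <= Re (br (g n) (g n))" for n using pos[OF t l(1) bg, of n] g1[of n] by simp
  then have "- (2*nrm (%x. g (r n) x - F x)) <= Re (br F F)" for n
  proof -
   have "cmod (br (g (r n)) (g (r n)) - br F F) <= nrm (%x. g (r n) x - F x)*2"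
    using br_self_diff[OF gH FH, of "r n"] g1 r(6) by simp
   then show ?thesis using \<open>!!n. 0 <= Re (br (g n) (g n))\<close>[of "r n"] abs_Re_le_cmod[of "br (g (r n)) (g (r n)) - br F F"] by simp
  qed
  moreover have "(%n. - (2*nrm (%x. g (r n) x - F x))) ----> - (2*0)" by (intro tendsto_intros r(7))
  ultimately have "- (2*0) <= Re (br F F)" by (intro LIMSEQ_le_const2) auto
  then have "br F F = 0" using le br_self_real[of F] by simp
  moreover have "bloch t' (cx R) F V" using b' e by simp
  ultimately show False using crit[rule_format, OF r(2)] r(6) by simp
 qed
qed

text \<open>Eigenvectors f, g at different eigenvalues are orthogonal, so d <= [f, f] = [f - g, f]
  keeps normalised ones at distance at least d. Their data together with the eigenvalue lie in a
  compact set, and each ball of a fine cover holds at most one of them.\<close>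

lemma low_count:
 assumes d: "0 < d" "\<forall>t\<in>{-pi..pi}. \<forall>l f v. R < l --> l <= R1 --> bloch t (cx l) f v --> d*(nrm f)^2 <= Re (br f f)"
 shows "\<exists>N. \<forall>t\<in>{-pi..pi}. \<forall>L f v. finite L --> (\<forall>l\<in>L. R < l & l <= R1 & bloch t (cx l) (f l) (v l) & nrm (f l) = 1) --> card L <= N"
proof -
 define Z where "Z = max \<bar>R\<bar> \<bar>R1\<bar>"
 obtain C where C: "\<forall>z f v ze. cmod z <= Z --> sol {0..a} (%x. z*cx (w x)*f x + ze x) f v -->
   cmod (f 0) + cmod (v 0) <= C*(nrm f + integral {0..a} (%x. cmod (ze x)))" using data_bound[of Z] by (elim exE)
 define e where "e = exp (2*integral {0..a} (coeff_bound Z))"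
 define W where "W = integral {0..a} (%x. \<bar>w x\<bar>)"
 \<comment> \<open>For data and eigenvalues within \<open>2*ep\<close> of each other,
   \<open>sol_bound\<close> with the source (l - m) w f m bounds the distance of the eigenvectors by
   G ep, and ep is chosen to make this less than d.\<close>
 define G where "G = 2*(4 + 2*(2*\<bar>C\<bar>*e*W))*e*nrm (%_. 1)"
 have wi: "(%x. \<bar>w x\<bar>) integrable_on {0..a}" using absw_int by (simp add: abs_int_def)
 have W0: "0 <= W" unfolding W_def by (intro integral_nonneg wi) auto
 have G0: "0 <= G" using W0 by (simp add: G_def e_def l2norm_nonneg)
 define ep where "ep = d/(G + 1)"
 have ep: "0 < ep" "G*ep < d" using d(1) G0 by (auto simp: ep_def field_simps)
 have "compact (cball (0 :: complex) \<bar>C\<bar> \<times> (cball (0 :: complex) \<bar>C\<bar> \<times> {R..R1}))"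
  by (intro compact_Times) auto
 then obtain k where k: "finite k" "cball (0 :: complex) \<bar>C\<bar> \<times> (cball (0 :: complex) \<bar>C\<bar> \<times> {R..R1}) \<subseteq> (\<Union>x\<in>k. ball x ep)"
  using ep(1) unfolding compact_eq_totally_bounded by blast
 have "card L <= card k" if t: "t : {-pi..pi}" and L: "finite L"
  and h: "\<forall>l\<in>L. R < l & l <= R1 & bloch t (cx l) (f l) (v l) & nrm (f l) = 1" for t L f v
 proof -
  have b: "bloch t (cx l) (f l) (v l)" and lR: "R < l" "l <= R1" and n1: "nrm (f l) = 1" if "l : L" for l using h that by auto
  have lZ: "cmod (cx l) <= Z" if "l : L" for l using lR[OF that] by (auto simp: Z_def abs_le_iff le_max_iff_disj)
  have s0: "sol {0..a} (%x. cx l*cx (w x)*f l x + 0) (f l) (v l)" if "l : L" for l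
   using sol_subset[OF blochD(1)[OF b[OF that]] subset_UNIV] by simp
  have data: "cmod (f l 0) + cmod (v l 0) <= \<bar>C\<bar>" if "l : L" for l
   using C[THEN spec, THEN spec, THEN spec, THEN spec, THEN mp, OF lZ[OF that], THEN mp, OF s0[OF that]] n1[OF that] by simp
  have bd: "cmod (f l x) <= 2*\<bar>C\<bar>*e" if l: "l : L" and x: "x : {0..a}" for l x
  proof -
   have "cmod (f l x) + cmod (v l x) <= 2*(cmod (f l 0) + cmod (v l 0))*e"
    using sol_bound[OF s0[OF l] _ x lZ[OF l], of 0] a_pos by (simp add: e_def)
   also have "... <= 2*\<bar>C\<bar>*e" using data[OF l] by (intro mult_right_mono mult_left_mono) (auto simp: e_def)
   finally show ?thesis using norm_ge_zero[of "v l x"] by linarith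
  qed
  have "\<forall>l\<in>L. \<exists>x. x : k & (f l 0, v l 0, l) : ball x ep"
  proof
   fix l assume l: "l : L"
   have "(f l 0, v l 0, l) : cball (0 :: complex) \<bar>C\<bar> \<times> (cball (0 :: complex) \<bar>C\<bar> \<times> {R..R1})"
   proof -
    have "cmod (f l 0) <= \<bar>C\<bar>" "cmod (v l 0) <= \<bar>C\<bar>" using data[OF l] norm_ge_zero[of "f l 0"] norm_ge_zero[of "v l 0"] by linarith+
    then show ?thesis using lR[OF l] by simp
   qed
   then show "\<exists>x. x : k & (f l 0, v l 0, l) : ball x ep" using k(2) by blast
  qed
  from bchoice[OF this] obtain c where c: "\<forall>l\<in>L. c l : k & (f l 0, v l 0, l) : ball (c l) ep" by blast
  have "inj_on c L"
  proof (rule inj_onI, rule ccontr)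
   fix l m assume lm: "l : L" "m : L" "c l = c m" "l ~= m"
   have "dist (f l 0, v l 0, l) (f m 0, v m 0, m) < 2*ep"
   proof -
    have "dist (f l 0, v l 0, l) (c l) < ep" "dist (f m 0, v m 0, m) (c l) < ep"
     using bspec[OF c lm(1)] bspec[OF c lm(2)] lm(3) by (simp_all add: dist_commute)
    from dist_triangle_less_add[OF this] show ?thesis by simp
   qed
   then have D: "cmod (f l 0 - f m 0) <= 2*ep" "cmod (v l 0 - v m 0) <= 2*ep" "\<bar>l - m\<bar> <= 2*ep"
    using dist_fst_le[of "(f l 0, v l 0, l)" "(f m 0, v m 0, m)"] dist_snd_le[of "(f l 0, v l 0, l)" "(f m 0, v m 0, m)"]
     dist_fst_le[of "(v l 0, l)" "(v m 0, m)"] dist_snd_le[of "(v l 0, l)" "(v m 0, m)"] by (auto simp: dist_norm)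
   let ?ze = "%x. cx (l - m)*cx (w x)*f m x"
   have "sol {0..a} (%x. cx l*cx (w x)*(f l x - f m x) + ?ze x) (%x. f l x - f m x) (%x. v l x - v m x)"
    using sol_diff[OF s0[OF lm(1)] s0[OF lm(2)]] by (simp add: algebra_simps)
   note sb = sol_bound[OF this _ _ lZ[OF lm(1)], of 0]
   have "integral {0..a} (%x. cmod (?ze x)) <= integral {0..a} (%x. (2*ep*(2*\<bar>C\<bar>*e))*\<bar>w x\<bar>)"
   proof (rule integral_le)
    have "?ze abs_int_on {0..a}"
     using coeff_mult_int(3)[of 0 a "%x. cx (l - m)*f m x"] blochD(4)[OF b[OF lm(2)]]
     by (simp add: continuous_intros mult_ac)
    then show "(%x. cmod (?ze x)) integrable_on {0..a}" by (simp add: abs_int_def)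
    fix x assume x: "x : {0..a}"
    have "\<bar>l - m\<bar>*cmod (f m x) <= 2*ep*(2*\<bar>C\<bar>*e)" using D(3) bd[OF lm(2) x] ep by (intro mult_mono) auto
    from mult_right_mono[OF this, of "\<bar>w x\<bar>"]
    show "cmod (?ze x) <= (2*ep*(2*\<bar>C\<bar>*e))*\<bar>w x\<bar>" by (simp add: norm_mult mult_ac flip: of_real_diff)
   qed (intro integrable_on_mult_right wi)
   then have ze: "integral {0..a} (%x. cmod (?ze x)) <= 2*ep*(2*\<bar>C\<bar>*e)*W" by (simp add: W_def)
   have pt: "cmod (f l x - f m x) <= 2*(2*ep + 2*ep + 2*ep*(2*\<bar>C\<bar>*e)*W)*e" if x: "x : {0..a}" for x
   proof -
    have "cmod (f l x - f m x) <= cmod (f l x - f m x) + cmod (v l x - v m x)" by simp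
    also have "... <= 2*(cmod (f l 0 - f m 0) + cmod (v l 0 - v m 0) + integral {0..a} (%x. cmod (?ze x)))*e"
     unfolding e_def by (rule sb) (use a_pos x in auto)
    also have "... <= 2*(2*ep + 2*ep + 2*ep*(2*\<bar>C\<bar>*e)*W)*e"
     using D(1,2) ze by (intro mult_right_mono mult_left_mono add_mono) (auto simp: e_def)
    finally show ?thesis .
   qed
   have fH: "f l : H" "f m : H" using blochD(6)[OF b] lm by auto
   have fd: "(%x. f l x - f m x) : H" by (rule L2_diff[OF fH])
   have "nrm (%x. f l x - f m x) <= 2*(2*ep + 2*ep + 2*ep*(2*\<bar>C\<bar>*e)*W)*e*nrm (%_. 1)"
    by (intro nrm_le_sup pt continuous_intros blochD(4)[OF b[OF lm(1)]] blochD(4)[OF b[OF lm(2)]])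
   also have "... = G*ep" by (simp add: G_def algebra_simps)
   finally have nd: "nrm (%x. f l x - f m x) < d" using ep(2) by simp
   have "br (f l) (f l) = br (%x. f l x - f m x) (f l)"
    using br_diff_left[OF fH fH(1)] bloch_orthogonal[OF b[OF lm(2)] b[OF lm(1)]] lm(4) by simp
   then have "Re (br (f l) (f l)) <= nrm (%x. f l x - f m x)"
    using br_cs[OF fd fH(1)] n1[OF lm(1)] complex_Re_le_cmod[of "br (%x. f l x - f m x) (f l)"] by simp
   moreover have "d*(nrm (f l))^2 <= Re (br (f l) (f l))" using d(2) t lR[OF lm(1)] b[OF lm(1)] by blast
   ultimately show False using nd n1[OF lm(1)] by simp
  qed
  then show ?thesis by (rule card_inj_on_le) (use c k(1) in auto)
 qed
 then show ?thesis by blast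
qed

text \<open>Split the sum at R1. The low part has boundedly many summands, each with its own lower
  bound, so Cauchy-Schwarz for sums suffices; the high part is \<open>high\<close>. Orthogonality of
  eigenvectors makes the indefinite product additive over the two parts.\<close>

lemma uniform_definite:
 assumes high: "0 <= kp" "high_definite R1 kp"
  and positive: "\<forall>t\<in>{-pi..pi}. \<forall>l f v. R < l --> bloch t (cx l) f v --> nrm f ~= 0 --> 0 < Re (br f f)"
  and crit: "\<forall>t\<in>{-pi..pi}. \<forall>f v. bloch t (cx R) f v --> nrm f ~= 0 --> br f f ~= 0"
 shows "\<exists>c>0. definite_above R c"
proof -
 obtain d where d: "0 < d" "\<forall>t\<in>{-pi..pi}. \<forall>l f v. R < l --> l <= R1 --> bloch t (cx l) f v --> d*(nrm f)^2 <= Re (br f f)"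
  using uniform_positive[where ?R1.0 = R1, OF positive crit] by (elim exE conjE)
 note pos = positive[rule_format]
 obtain N where N: "\<forall>t\<in>{-pi..pi}. \<forall>L f v. finite L --> (\<forall>l\<in>L. R < l & l <= R1 & bloch t (cx l) (f l) (v l) & nrm (f l) = 1) --> card L <= N"
  using low_count[OF d] by (elim exE)
 \<comment> \<open>2 N/d comes from the low part and 2 kp from the high part, the 2 being that of (x
   + y)^2 <= 2 x^2 + 2 y^2.\<close>
 define M where "M = 2*real N/d + 2*kp + 1"
 have M: "0 < M" using d(1) high(1) by (auto simp: M_def intro!: add_nonneg_pos)
 have "1/M*(nrm (lsum L f))^2 <= Re (br (lsum L f) (lsum L f))"
  if t: "t : {-pi..pi}" and L: "finite L" and h: "\<forall>l\<in>L. R < l & bloch t (cx l) (f l) (v l)" for t L f v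
 proof -
  have b: "bloch t (cx l) (f l) (v l)" and lR: "R < l" if "l : L" for l using h that by auto
  have fH: "f l : H" if "l : L" for l by (rule blochD(6)[OF b[OF that]])
  have B0: "0 <= Re (br (f l) (f l))" if "l : L" for l
  proof (cases "nrm (f l) = 0")
   case True
   then have "f l = (%_. 0)" by (rule bloch_trivial(1)[OF b[OF that]])
   then show ?thesis by (simp add: indef_inner_def)
  qed (use pos[OF t lR[OF that] b[OF that]] in simp)
  \<comment> \<open>L2 drops vanishing summands, since \<open>low_count\<close> counts normalised
    eigenvectors.\<close>
  define L0 L1 L2 where "L0 = {l : L. l <= R1}" and "L1 = {l : L. R1 < l}" and "L2 = {l : L0. nrm (f l) ~= 0}"
  have fin: "finite L0" "finite L1" "finite L2" and LU: "L = L0 \<union> L1" "L0 \<inter> L1 = {}" using L by (auto simp: L0_def L1_def L2_def)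
  have sub: "L0 \<subseteq> L" "L1 \<subseteq> L" "L2 \<subseteq> L" by (auto simp: L0_def L1_def L2_def)
  have S: "Re (br (%x. \<Sum>l\<in>J. f l x) (%x. \<Sum>l\<in>J. f l x)) = (\<Sum>l\<in>J. Re (br (f l) (f l)))" if "J \<subseteq> L" for J
   using br_bloch_sum[of J t f v "%_. 1" "%_. 1"] b that finite_subset[OF that L] by (simp add: Re_sum subset_iff)
  let ?B = "%J. \<Sum>l\<in>J. Re (br (f l) (f l))" and ?F = "%J x. \<Sum>l\<in>J. f l x"
  have BJ: "0 <= ?B J" if "J \<subseteq> L" for J using B0 that by (intro sum_nonneg) auto
  have hi: "(nrm (?F L1))^2 <= kp*?B L1"
   using high(2)[THEN spec, THEN spec, THEN spec, THEN spec, THEN mp, OF fin(2), of t f v] b B0 S[OF sub(2)] by (simp add: L1_def)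
  have cN: "card L2 <= N"
  proof -
   have "\<forall>l\<in>L2. R < l & l <= R1 & bloch t (cx l) (%x. cx (inverse (nrm (f l)))*f l x) (%x. cx (inverse (nrm (f l))) * v l x)
    & nrm (%x. cx (inverse (nrm (f l)))*f l x) = 1"
    using bloch_cmult[OF b] lR l2norm_nonneg[of "L2a w a"] by (auto simp: L2_def L0_def l2norm_cmult norm_inverse simp flip: of_real_inverse)
   from N[THEN bspec, OF t, THEN spec, THEN spec, THEN spec, THEN mp, OF fin(3), THEN mp, OF this] show ?thesis .
  qed
  have "nrm (?F L0) <= (\<Sum>l\<in>L0. nrm (f l))" using sub fH by (intro l2norm_sum_le fin) auto
  also have "... = (\<Sum>l\<in>L2. nrm (f l))" by (rule sum.mono_neutral_right) (auto simp: fin L2_def)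
  finally have "(nrm (?F L0))^2 <= (\<Sum>l\<in>L2. nrm (f l))^2" by (intro power_mono l2norm_nonneg)
  also have "... <= (\<Sum>l\<in>L2. (nrm (f l))^2)*real (card L2)" by (rule sum_squared_le_sum_of_squares)
  also have "... <= (\<Sum>l\<in>L2. (nrm (f l))^2)*real N" using cN by (intro mult_left_mono sum_nonneg) auto
  also have "(\<Sum>l\<in>L2. (nrm (f l))^2) <= (\<Sum>l\<in>L2. Re (br (f l) (f l))/d)"
  proof (rule sum_mono)
   fix l assume l: "l : L2"
   then have lL: "l : L" "l <= R1" by (auto simp: L2_def L0_def)
   have "d*(nrm (f l))^2 <= Re (br (f l) (f l))"
    by (rule d(2)[THEN bspec, OF t, THEN spec, THEN spec, THEN spec, THEN mp, OF lR[OF lL(1)], THEN mp, OF lL(2), THEN mp, OF b[OF lL(1)]])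
   then show "(nrm (f l))^2 <= Re (br (f l) (f l))/d" using d(1) by (simp add: field_simps)
  qed
  also have "(\<Sum>l\<in>L2. Re (br (f l) (f l))/d) <= ?B L0/d"
   unfolding sum_divide_distrib[symmetric] using d(1) B0 sub fin by (intro divide_right_mono sum_mono2) (auto simp: L2_def L0_def)
  finally have lo: "(nrm (?F L0))^2 <= ?B L0/d*real N" by (simp add: mult_right_mono)
  have "?F L = (%x. ?F L0 x + ?F L1 x)" unfolding LU(1) using fin LU(2) by (simp add: sum.union_disjoint)
  then have "nrm (?F L) <= nrm (?F L0) + nrm (?F L1)" using fin sub fH by (auto intro!: l2norm_triangle L2_sum)
  then have "(nrm (?F L))^2 <= (nrm (?F L0) + nrm (?F L1))^2" by (intro power_mono l2norm_nonneg)
  also have "... <= 2*(nrm (?F L0))^2 + 2*(nrm (?F L1))^2"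
   using sum_squares_bound[of "nrm (?F L0)" "nrm (?F L1)"] by (simp add: power2_sum)
  also have "... <= 2*(?B L0/d*real N) + 2*(kp*?B L1)" using lo hi by simp
  also have "... <= M*?B L0 + M*?B L1"
  proof (rule add_mono)
   have "2*(?B L0/d*real N) = (2*real N/d)*?B L0" by simp
   also have "... <= M*?B L0" using BJ[OF sub(1)] high(1) by (intro mult_right_mono) (auto simp: M_def)
   finally show "2*(?B L0/d*real N) <= M*?B L0" .
   have "(2*kp)*?B L1 <= M*?B L1" using BJ[OF sub(2)] d(1) by (intro mult_right_mono) (auto simp: M_def)
   then show "2*(kp*?B L1) <= M*?B L1" by simp
  qed
  also have "... = M*?B L" unfolding LU(1) using fin LU(2) by (simp add: sum.union_disjoint distrib_left)
  finally show ?thesis unfolding S[OF order_refl] using M by (simp add: field_simps)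
 qed
 moreover have "0 < 1/M" using M by simp
 ultimately show ?thesis by blast
qed


abbreviation A :: "real => (real => complex) => (real => complex) => bool" where
 "A \<equiv> fiber_op w p q a"

abbreviation rh :: "real => complex set" where
 "rh t \<equiv> resolvent_set (L2a w a) (A t)"

abbreviation Res :: "real => complex => (real => complex) => real => complex" where
 "Res t \<equiv> resolvent (A t)"

section \<open>Spectral projections of the fibers\<close>

lemma fiber_op_cong:
 assumes f: "A t f g" and eq: "!!x. g' x = g x"
 shows "A t f g'"
proof -
 have "g' = g" using eq by blast
 then show ?thesis using f by simp
qed

lemma fiber_op_lin:
 assumes 1: "A t f g" and 2: "A t f' g'"
 shows "A t (%x. f x + c*f' x) (%x. g x + c*g' x)"
proof -
 obtain v v' where s: "wsol g f v" "f a = eit t*f 0" "v a = eit t * v 0"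
  "wsol g' f' v'" "f' a = eit t*f' 0" "v' a = eit t * v' 0" "g : H" "g' : H"
  using 1 2 by (auto simp: fiber_op_iff)
 have "sol {0..a} (%x. cx (w x)*(g x + c*g' x)) (%x. f x + c*f' x) (%x. v x + c * v' x)"
  using sol_add[OF s(1) sol_cmult[OF s(4), of c]] by (simp add: algebra_simps)
 moreover have "(%x. g x + c*g' x) : H" by (intro L2_add L2_cmult s)
 ultimately show ?thesis unfolding fiber_op_iff
  by (intro conjI exI[of _ "%x. v x + c * v' x"]) (simp_all add: s algebra_simps)
qed

lemma Res:
 assumes "z : rh t" "u : H"
 shows "A t (Res t z u) (%x. z*Res t z u x - u x)"
proof -
 have "(%x. - 1*u x) : H" by (rule L2_cmult[OF assms(2)])
 moreover have "\<forall>u\<in>H. \<exists>f. A t f (%x. z*f x + u x)" using assms(1) by (simp add: resolvent_set_def)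
 ultimately have "\<exists>f. A t f (%x. z*f x + - 1*u x)" by (rule bspec[rotated])
 then have "\<exists>f. A t f (%x. z*f x - u x)" by auto
 then show ?thesis unfolding resolvent_def by (rule someI_ex)
qed

lemma Res_H: "z : rh t ==> u : H ==> Res t z u : H"
 using fiber_op_H(1)[OF Res] .

text \<open>The bound at z survives a small change of the parameter with twice the constant, by
  absorbing the perturbation.\<close>

lemma resolvent_bound:
 assumes "z : rh t"
 shows "\<exists>K>0. \<forall>y f g. cmod (y - z) <= 1/K --> A t f g --> nrm f <= K*nrm (%x. g x - y*f x)"
proof -
 obtain K0 where K0: "\<forall>f g. A t f g --> nrm f <= K0*nrm (%x. g x - z*f x)" using assms by (auto simp: resolvent_set_def)
 define K where "K = \<bar>K0\<bar> + 1"
 have K: "0 < K" by (simp add: K_def)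
 have "nrm f <= 2*K*nrm (%x. g x - y*f x)" if y: "cmod (y - z) <= 1/(2*K)" and f: "A t f g" for y f g
 proof -
  note H = fiber_op_H[OF f]
  have fH: "(%x. g x - y*f x) : H" "(%x. (y - z)*f x) : H" by (intro L2_diff L2_cmult H)+
  have "nrm f <= K0*nrm (%x. g x - z*f x)" using K0 f by blast
  also have "... <= K*nrm (%x. g x - z*f x)" by (intro mult_right_mono l2norm_nonneg) (simp add: K_def)
  also have "(%x. g x - z*f x) = (%x. (g x - y*f x) + (y - z)*f x)" by (simp add: algebra_simps)
  also have "K*nrm ... <= K*(nrm (%x. g x - y*f x) + cmod (y - z)*nrm f)"
   using l2norm_triangle[OF fH] K by (intro mult_left_mono) (simp_all add: l2norm_cmult)
  also have "... <= K*nrm (%x. g x - y*f x) + nrm f/2"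
  proof -
   have "K*cmod (y - z) <= 1/2" using y K by (simp add: field_simps)
   from mult_right_mono[OF this l2norm_nonneg[of "L2a w a" f]] show ?thesis by (simp add: algebra_simps)
  qed
  finally show ?thesis by simp
 qed
 then show ?thesis using K by (intro exI[of _ "2*K"]) simp
qed

text \<open>The resolvent is picked by choice among representatives; boundedness of the inverse
  fixes it up to a function of norm 0.\<close>

lemma Res_unique:
 assumes z: "z : rh t" and f: "A t f (%x. z*f x - u x)" and u: "u : H"
 shows "nrm (%x. Res t z u x - f x) = 0"
proof -
 obtain K where K: "0 < K" "\<forall>y f g. cmod (y - z) <= 1/K --> A t f g --> nrm f <= K*nrm (%x. g x - y*f x)"
  using resolvent_bound[OF z] by blast
 have "A t (%x. Res t z u x + - 1*f x) (%x. (z*Res t z u x - u x) + - 1*(z*f x - u x))"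
  by (rule fiber_op_lin[OF Res[OF z u] f])
 from K(2)[THEN spec[of _ z], THEN spec, THEN spec, THEN mp, THEN mp, OF _ this]
 have "nrm (%x. Res t z u x - f x) <= K*nrm (%x. 0)" using K(1) by (simp add: algebra_simps)
 moreover have "nrm (%x. 0) = 0" by (simp add: l2norm_def)
 ultimately show ?thesis using l2norm_nonneg[of "L2a w a" "%x. Res t z u x - f x"] by simp
qed

lemma l2inner_bound_0:
 assumes "f : H" "h : H" "nrm f = 0"
 shows "l2inner (L2a w a) f h = 0"
 using L2_Cauchy_Schwarz[OF assms(1,2)] assms(3) by simp

text \<open>With f1 the square of the resolvent at z0 applied to u, the remainder Res(z) u - Res(z0)
  u + (z - z0) f1 lies in the domain, and A - z maps it to - (z - z0)^2 f1. The bound near z0 thus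
  makes it quadratically small, and - f1 yields the derivative.\<close>

lemma Res_holomorphic:
 assumes u: "u : H" and h: "h : H"
 shows "(%z. l2inner (L2a w a) (Res t z u) h) holomorphic_on rh t"
 unfolding holomorphic_on_def
proof
 fix z0 assume z0: "z0 : rh t"
 let ?i = "%f. l2inner (L2a w a) f h"
 obtain K where K: "0 < K" "\<forall>y f g. cmod (y - z0) <= 1/K --> A t f g --> nrm f <= K*nrm (%x. g x - y*f x)"
  using resolvent_bound[OF z0] by blast
 define f0 where "f0 = Res t z0 u"
 define f1 where "f1 = Res t z0 f0"
 have f0: "A t f0 (%x. z0*f0 x - u x)" "f0 : H" unfolding f0_def by (rule Res[OF z0 u], rule Res_H[OF z0 u])
 have f1: "A t f1 (%x. z0*f1 x - f0 x)" "f1 : H" unfolding f1_def by (rule Res[OF z0 f0(2)], rule Res_H[OF z0 f0(2)])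
 have bd: "cmod (?i (Res t z u) - ?i f0 + (z - z0)*?i f1) <= (cmod (z - z0))^2*(K*nrm f1*nrm h)"
  if z: "z : rh t" "cmod (z - z0) <= 1/K" for z
 proof -
  let ?f = "%x. (Res t z u x + - 1*f0 x) + (z - z0)*f1 x"
  have f: "A t ?f (%x. ((z*Res t z u x - u x) + - 1*(z0*f0 x - u x)) + (z - z0)*(z0*f1 x - f0 x))"
   by (intro fiber_op_lin Res z u f0 f1)
  note RH = Res_H[OF z(1) u]
  have "nrm ?f <= K*nrm (%x. (((z*Res t z u x - u x) + - 1*(z0*f0 x - u x)) + (z - z0)*(z0*f1 x - f0 x)) - z*?f x)"
   by (rule K(2)[THEN spec, THEN spec, THEN spec, THEN mp, OF z(2), THEN mp, OF f])
  also have "(%x. (((z*Res t z u x - u x) + - 1*(z0*f0 x - u x)) + (z - z0)*(z0*f1 x - f0 x)) - z*?f x) = (%x. (- (z - z0)*(z - z0))*f1 x)"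
   by (simp add: algebra_simps)
  also have "nrm ... = (cmod (z - z0))^2*nrm f1" unfolding l2norm_cmult by (simp add: norm_mult power2_eq_square norm_minus_commute)
  finally have n: "nrm ?f <= K*((cmod (z - z0))^2*nrm f1)" .
  have H1: "(%x. - 1*f0 x) : H" "(%x. (z - z0)*f1 x) : H" by (intro L2_cmult f0 f1)+
  have H2: "(%x. Res t z u x + - 1*f0 x) : H" by (intro L2_add RH H1)
  have "?i ?f = ?i (Res t z u) - ?i f0 + (z - z0)*?i f1"
   unfolding l2inner_add_left[OF H2 H1(2) h] l2inner_add_left[OF RH H1(1) h] l2inner_cmult_left by simp
  then have "cmod (?i (Res t z u) - ?i f0 + (z - z0)*?i f1) <= nrm ?f*nrm h"
   using L2_Cauchy_Schwarz[OF fiber_op_H(1)[OF f] h] by simp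
  also have "... <= K*((cmod (z - z0))^2*nrm f1)*nrm h" by (rule mult_right_mono[OF n l2norm_nonneg])
  finally show ?thesis by (simp add: mult_ac)
 qed
 have "((%z. l2inner (L2a w a) (Res t z u) h) has_field_derivative - ?i f1) (at z0 within rh t)"
  unfolding has_field_derivative_iff
 proof (rule Lim_transform_within[where d = "1/K" and f = "%z. - ?i f1 + (?i (Res t z u) - ?i f0 + (z - z0)*?i f1)/(z - z0)"])
  have "((%z. (?i (Res t z u) - ?i f0 + (z - z0)*?i f1)/(z - z0)) \<longlongrightarrow> 0) (at z0 within rh t)"
  proof (rule Lim_null_comparison)
   show "\<forall>\<^sub>F z in at z0 within rh t. cmod ((?i (Res t z u) - ?i f0 + (z - z0)*?i f1)/(z - z0)) <= cmod (z - z0)*(K*nrm f1*nrm h)"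
    unfolding eventually_at
   proof (intro exI[of _ "1/K"] conjI ballI impI)
    fix z assume z: "z : rh t" "z ~= z0 & dist z z0 < 1/K"
    have "cmod (?i (Res t z u) - ?i f0 + (z - z0)*?i f1) <= (cmod (z - z0))^2*(K*nrm f1*nrm h)"
     by (rule bd[OF z(1)]) (use z(2) in \<open>simp add: dist_norm\<close>)
    then show "cmod ((?i (Res t z u) - ?i f0 + (z - z0)*?i f1)/(z - z0)) <= cmod (z - z0)*(K*nrm f1*nrm h)"
     using z(2) by (simp add: norm_divide divide_le_eq power2_eq_square mult_ac)
   qed (use K(1) in simp)
   have "((%z. cmod (z - z0)*(K*nrm f1*nrm h)) \<longlongrightarrow> cmod (z0 - z0)*(K*nrm f1*nrm h)) (at z0 within rh t)"
    by (intro tendsto_intros)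
   then show "((%z. cmod (z - z0)*(K*nrm f1*nrm h)) \<longlongrightarrow> 0) (at z0 within rh t)" by simp
  qed
  from tendsto_add[OF tendsto_const[of "- ?i f1"] this] show "((%z. - ?i f1 + (?i (Res t z u) - ?i f0 + (z - z0)*?i f1)/(z - z0)) \<longlongrightarrow> - ?i f1) (at z0 within rh t)"
   by (simp only: add_0_right)
  fix z assume "z : rh t" "0 < dist z z0"
  then have nz: "z - z0 ~= 0" by simp
  then show "- ?i f1 + (?i (Res t z u) - ?i f0 + (z - z0)*?i f1)/(z - z0) = (?i (Res t z u) - ?i (Res t z0 u))/(z - z0)"
   unfolding f0_def[symmetric] by (simp add: add_divide_distrib)
 qed (use K(1) in simp)
 then show "(%z. l2inner (L2a w a) (Res t z u) h) field_differentiable at z0 within rh t"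
  unfolding field_differentiable_def by blast
qed

lemma bloch_combination:
 assumes "bloch t z f v" "bloch t z g u"
 shows "bloch t z (%x. f x + c*g x) (%x. v x + c*u x)"
 using sol_add[OF blochD(1)[OF assms(1)] sol_cmult[OF blochD(1)[OF assms(2)], of c]] assms
 by (simp add: bloch_def qper_def algebra_simps)

lemma bloch_data_0:
 assumes "bloch t z f v" "f 0 = 0" "v 0 = 0"
 shows "f = (%_. 0)"
 using sol_unique(1)[OF blochD(1)[OF assms(1)], of "%_. 0" "%_. 0" 0] assms sol_zero by simp

text \<open>Gram-Schmidt for the indefinite product, which cannot break down as neutral eigenvectors
  vanish. Solutions are determined by two data at 0, so the eigenspace has dimension at most 2 and
  two steps are enough.\<close>

lemma bloch_projection:
 assumes definite0: "\<forall>f v. bloch t z f v --> br f f = 0 --> nrm f = 0" and u: "u : H"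
 shows "\<exists>g k. bloch t z g k & (\<forall>f v. bloch t z f v --> br (%x. u x - g x) f = 0)"
proof -
 note definite = definite0[rule_format]
 have H: "f : H" if "bloch t z f v" for f v by (rule blochD(6)[OF that])
 have z0: "br f f = 0 ==> f = (%_. 0)" if "bloch t z f v" for f v
  using definite[OF that] bloch_trivial(1)[OF that] by blast
 have br0: "br (%_. 0) f = 0" for f by (simp add: indef_inner_def)
 have orth: "br (%x. f x + (- (br f e/br e e))*e x) e = 0" if "f : H" "e : H" "br e e ~= 0" for f e
  using br_add_left[OF that(1) L2_cmult[OF that(2)] that(2)] that(3) by (simp only: br_cmult_left) simp
 have orth': "br (%x. f x + (- (br f e/br e e))*e x) d = br f d" if "f : H" "e : H" "d : H" "br e d = 0" for f e d
  using br_add_left[OF that(1) L2_cmult[OF that(2)] that(3)] that(4) by (simp only: br_cmult_left) simp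
 show ?thesis
 proof (cases "\<exists>e1 k1. bloch t z e1 k1 & e1 ~= (%_. 0)")
  case False
  have "bloch t z (%_. 0) (%_. 0)" using sol_zero by (simp add: bloch_def qper_def)
  moreover have "br (%x. u x - 0) f = 0" if "bloch t z f v" for f v
  proof -
   have "f = (%_. 0)" using False that by blast
   then show ?thesis by (simp add: indef_inner_def)
  qed
  ultimately show ?thesis by blast
 next
  case True
  then obtain e1 k1 where e1: "bloch t z e1 k1" "e1 ~= (%_. 0)" by blast
  have n1: "br e1 e1 ~= 0" using z0[OF e1(1)] e1(2) by blast
  define u1 where "u1 = (%x. u x + (- (br u e1/br e1 e1))*e1 x)"
  have u1: "u1 : H" "br u1 e1 = 0"
   unfolding u1_def by (intro L2_add L2_cmult u H[OF e1(1)], rule orth[OF u H[OF e1(1)] n1])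
  have red: "\<exists>f1 v1 c. bloch t z f1 v1 & f = (%x. f1 x + c*e1 x) & br f1 e1 = 0" if f: "bloch t z f v" for f v
  proof (intro exI conjI)
   show "bloch t z (%x. f x + (- (br f e1/br e1 e1))*e1 x) (%x. v x + (- (br f e1/br e1 e1))*k1 x)" by (rule bloch_combination[OF f e1(1)])
   show "f = (%x. (f x + (- (br f e1/br e1 e1))*e1 x) + (br f e1/br e1 e1)*e1 x)" by simp
   show "br (%x. f x + (- (br f e1/br e1 e1))*e1 x) e1 = 0" by (rule orth[OF H[OF f] H[OF e1(1)] n1])
  qed
  have radd: "br x (%y. f y + c*e y) = br x f + cnj c*br x e" if "x : H" "f : H" "e : H" for x f e c
   using br_add_left[OF that(2) L2_cmult[OF that(3)] that(1), of c] br_commute[of x "%y. f y + c*e y"]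
   by (simp add: br_cmult_left br_commute[of x f] br_commute[of x e])
  show ?thesis
  proof (cases "\<exists>e2 k2. bloch t z e2 k2 & e2 ~= (%_. 0) & br e2 e1 = 0")
   case False
   have "br u1 f = 0" if f: "bloch t z f v" for f v
   proof -
    obtain f1 v1 c where f1: "bloch t z f1 v1" "f = (%x. f1 x + c*e1 x)" "br f1 e1 = 0" using red[OF f] by (elim exE conjE)
    then have "f1 = (%_. 0)" using False by blast
    then have "f = (%x. c*e1 x)" using f1(2) by simp
    then show ?thesis using u1(2) by (simp add: br_cmult_right)
   qed
   moreover have "u1 = (%x. u x - br u e1/br e1 e1*e1 x)" by (simp add: u1_def)
   ultimately show ?thesis using bloch_cmult[OF e1(1), of "br u e1/br e1 e1"] by auto
  next
   case True
   then obtain e2 k2 where e2: "bloch t z e2 k2" "e2 ~= (%_. 0)" "br e2 e1 = 0" by blast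
   have n2: "br e2 e2 ~= 0" using z0[OF e2(1)] e2(2) by blast
   define u2 where "u2 = (%x. u1 x + (- (br u1 e2/br e2 e2))*e2 x)"
   have u2: "u2 : H" "br u2 e2 = 0" "br u2 e1 = 0"
    unfolding u2_def orth'[OF u1(1) H[OF e2(1)] H[OF e1(1)] e2(3)]
    by (intro L2_add L2_cmult u1(1) H[OF e2(1)], rule orth[OF u1(1) H[OF e2(1)] n2], rule u1(2))
   \<comment> \<open>Three mutually orthogonal non-neutral vectors would be independent, whereas
     three data vectors in a plane are dependent.\<close>
   have triv: "f = (%_. 0)" if f: "bloch t z f v" and f12: "br f e1 = 0" "br f e2 = 0" for f v
   proof (rule ccontr)
    assume "f ~= (%_. 0)"
    have ind: "al = 0 & ga = 0 & be = 0"
     if c: "al*e1 0 + be*e2 0 + ga*f 0 = 0" "al*k1 0 + be*k2 0 + ga * v 0 = 0" for al be ga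
    proof -
     have "(%x. al*e1 x + be*e2 x + ga*f x) = (%_. 0)"
      by (rule bloch_data_0[OF bloch_combination[OF bloch_combination[OF bloch_cmult[OF e1(1)] e2(1)] f] c])
     then have br_0: "br (%x. al*e1 x + be*e2 x + ga*f x) y = 0" for y using br0 by simp
     have ex: "al*br e1 y + be*br e2 y + ga*br f y = 0" if "y : H" for y
      using br_add_left[OF L2_add[OF L2_cmult[OF H[OF e1(1)]] L2_cmult[OF H[OF e2(1)]]] L2_cmult[OF H[OF f]] that, of al be ga]
       br_add_left[OF L2_cmult[OF H[OF e1(1)]] L2_cmult[OF H[OF e2(1)]] that, of al be] br_0[of y]
      by (simp only: br_cmult_left)
     have s: "br e1 e2 = 0" "br e1 f = 0" "br e2 f = 0"
      using br_commute[of e1 e2] br_commute[of e1 f] br_commute[of e2 f] e2(3) f12 by simp_all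
     show ?thesis using ex[OF H[OF e1(1)]] ex[OF H[OF e2(1)]] ex[OF H[OF f]] e2(3) f12 s n1 n2 z0[OF f] \<open>f ~= (%_. 0)\<close> by auto
    qed
    \<comment> \<open>The 2 by 2 minors of the data are the coefficients of a linear relation among
      three vectors in the plane.\<close>
    have "e1 0*k2 0 - k1 0*e2 0 = 0"
     using ind[of "e2 0 * v 0 - k2 0*f 0" "f 0*k1 0 - v 0*e1 0" "e1 0*k2 0 - k1 0*e2 0"] by (simp add: algebra_simps)
    then have "e1 0 = 0" "k1 0 = 0"
     using ind[of "e2 0" "- e1 0" 0] ind[of "k2 0" "- k1 0" 0] by (simp_all add: algebra_simps)
    then show False using bloch_data_0[OF e1(1)] e1(2) by blast
   qed
   have "br u2 f = 0" if f: "bloch t z f v" for f v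
   proof -
    obtain f1 v1 c where f1: "bloch t z f1 v1" "f = (%x. f1 x + c*e1 x)" "br f1 e1 = 0" using red[OF f] by (elim exE conjE)
    define d where "d = br f1 e2/br e2 e2"
    have "(%x. f1 x + (- d)*e2 x) = (%_. 0)"
    proof (rule triv[OF bloch_combination[OF f1(1) e2(1)]])
     show "br (%x. f1 x + - d*e2 x) e1 = 0" unfolding d_def orth'[OF H[OF f1(1)] H[OF e2(1)] H[OF e1(1)] e2(3)] by (rule f1(3))
     show "br (%x. f1 x + - d*e2 x) e2 = 0" unfolding d_def by (rule orth[OF H[OF f1(1)] H[OF e2(1)] n2])
    qed
    then have "f1 x = d*e2 x" for x by (auto dest: fun_cong[of _ _ x])
    then have "f = (%x. d*e2 x + c*e1 x)" using f1(2) by simp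
    then show ?thesis using u2 radd[OF u2(1) L2_cmult[OF H[OF e2(1)]] H[OF e1(1)], of d c] by (simp add: br_cmult_right)
   qed
   moreover have "u2 = (%x. u x - (br u e1/br e1 e1*e1 x + br u1 e2/br e2 e2*e2 x))" by (simp add: u2_def u1_def algebra_simps)
   ultimately show ?thesis using bloch_combination[OF bloch_cmult[OF e1(1), of "br u e1/br e1 e1"] e2(1), of "br u1 e2/br e2 e2"] by auto
  qed
 qed
qed

text \<open>If the resolvents blew up, their normalisations would converge to an eigenvector F at l.
  Symmetry of A(t) makes all of them orthogonal to F, so in the limit F is neutral, against
  definiteness.\<close>

lemma bloch_kernel_subspace_resolvent_bounded:
 assumes t: "t : {-pi..pi}" and definite0: "\<forall>f v. bloch t (cx l) f v --> br f f = 0 --> nrm f = 0"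
  and u: "u : H" and orth0: "\<forall>f v. bloch t (cx l) f v --> br u f = 0"
  and r: "0 < r" "cball (cx l) r - {cx l} \<subseteq> rh t"
 shows "\<exists>B. eventually (%z. nrm (Res t z u) <= B) (at (cx l))"
proof (rule ccontr)
 assume neg: "\<not> ?thesis"
 note definite = definite0[rule_format] and orth = orth0[rule_format]
 let ?l = "cx l"
 have "\<exists>z. z ~= ?l & dist z ?l < min r (inverse (real (Suc n))) & real (Suc n) < nrm (Res t z u)" for n
 proof (rule ccontr)
  assume c: "\<not> (\<exists>z. z ~= ?l & dist z ?l < min r (inverse (real (Suc n))) & real (Suc n) < nrm (Res t z u))"
  have "eventually (%z. nrm (Res t z u) <= real (Suc n)) (at ?l)"
   unfolding eventually_at using c r(1) by (intro exI[of _ "min r (inverse (real (Suc n)))"]) (auto simp: not_less)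
  then show False using neg by blast
 qed
 then obtain z where z: "!!n. z n ~= ?l" "!!n. dist (z n) ?l < min r (inverse (real (Suc n)))" "!!n. real (Suc n) < nrm (Res t (z n) u)" by metis
 have zr: "z n : rh t" for n using r(2) z(1,2)[of n] by (auto simp: dist_commute)
 define f where "f = (%n. Res t (z n) u)"
 have fz: "A t (f n) (%x. z n*f n x - u x)" for n unfolding f_def by (rule Res[OF zr u])
 have big: "real (Suc n) < nrm (f n)" for n using z(3) by (simp add: f_def)
 have pos: "0 < nrm (f n)" for n using big[of n] by (meson of_nat_0_le_iff order_le_less_trans)
 define c where "c = (%n. cx (inverse (nrm (f n))))"
 have "\<exists>v. sol {0..a} (%x. cx (w x)*(z n*f n x - u x)) (f n) v & f n a = eit t*f n 0 & v a = eit t * v 0" for n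
  using fz[of n] by (simp add: fiber_op_iff)
 then obtain v where v: "!!n. sol {0..a} (%x. cx (w x)*(z n*f n x - u x)) (f n) (v n)"
  "!!n. f n a = eit t*f n 0" "!!n. v n a = eit t * v n 0" by metis
 have wu: "(%x. cx (w x)*u x) abs_int_on {0..a}" by (rule H_w_int[OF u])
 let ?F = "%n x. c n*f n x" and ?V = "%n x. c n * v n x" and ?ze = "%n x. - (c n*(cx (w x)*u x))"
 have s: "sol {0..a} (%x. z n*cx (w x)*?F n x + ?ze n x) (?F n) (?V n)" for n
  using sol_cmult[OF v(1)[of n], of "c n"] by (simp add: algebra_simps)
 have zlim: "z ----> ?l"
 proof (rule metric_LIMSEQ_I)
  fix e :: real assume "0 < e"
  then obtain N where N: "inverse (real (Suc N)) < e" using reals_Archimedean by blast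
  have "dist (z n) ?l < e" if "N <= n" for n
  proof -
   have "inverse (real (Suc n)) <= inverse (real (Suc N))" using that by (intro le_imp_inverse_le) auto
   moreover have "dist (z n) ?l < inverse (real (Suc n))" using z(2)[of n] by simp
   ultimately show ?thesis using N by linarith
  qed
  then show "\<exists>N. \<forall>n\<ge>N. dist (z n) ?l < e" by blast
 qed
 have zb: "cmod (z n) <= \<bar>l\<bar> + r" for n
  using z(2)[of n] norm_triangle_ineq[of ?l "z n - ?l"] by (simp add: dist_norm)
 have cn: "cmod (c n) <= inverse (real (Suc n))" for n
  unfolding c_def using big[of n] pos[of n] by (simp add: norm_inverse le_imp_inverse_le)
 have ze: "(%n. integral {0..a} (%x. cmod (?ze n x))) ----> 0"
 proof (rule Lim_null_comparison)
  let ?I = "integral {0..a} (%x. cmod (cx (w x)*u x))"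
  have "0 <= ?I" using wu by (intro integral_nonneg) (auto simp: abs_int_def)
  then show "\<forall>\<^sub>F n in sequentially. norm (integral {0..a} (%x. cmod (?ze n x))) <= inverse (real (Suc n))*?I"
   by (intro always_eventually allI) (use cn in \<open>auto simp: norm_mult abs_mult intro!: mult_right_mono\<close>)
  have "(%n. inverse (real (Suc n))*?I) ----> 0*?I" by (intro tendsto_intros LIMSEQ_inverse_real_of_nat)
  then show "(%n. inverse (real (Suc n))*?I) ----> 0" by simp
 qed
 have n1: "nrm (?F n) = 1" for n unfolding l2norm_cmult c_def using pos[of n] by (simp add: norm_inverse)
 have bc: "?F n a = eit t*?F n 0" "?V n a = eit t*?V n 0" for n using v(2,3)[of n] by simp_all
 obtain nu t' z' F V where F: "strict_mono (nu :: nat => nat)" "(%n. t) ----> t'" "(%n. z (nu n)) ----> z'" "bloch t' z' F V" "nrm F = 1"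
  "(%n. nrm (%x. ?F (nu n) x - F x)) ----> 0"
  by (rule bloch_compact[where t = "%_. t" and z = z and f = ?F and v = ?V and ze = ?ze, OF t zb s bc ze n1])
 have "t' = t" using LIMSEQ_unique[OF F(2) tendsto_const] .
 moreover have "z' = ?l" using LIMSEQ_unique[OF F(3) LIMSEQ_subseq_LIMSEQ[OF zlim F(1), unfolded o_def]] .
 ultimately have b: "bloch t ?l F V" using F(4) by simp
 have FH: "F : H" by (rule blochD(6)[OF b])
 have fH: "f n : H" for n by (rule fiber_op_H(1)[OF fz])
 \<comment> \<open>Symmetry gives (z - l) [Res(z) u, F] = [u, F], and this is 0 by the hypothesis on
   u.\<close>
 have o: "br (f n) F = 0" for n
 proof -
  have "br (%x. z n*f n x - u x) F = br (f n) (%x. ?l*F x)" by (rule fiber_op_symmetric[OF fz bloch_fiber_op[OF b]])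
  then have "z n*br (f n) F - br u F = ?l*br (f n) F"
   using br_diff_left[OF L2_cmult[OF fH] u FH] by (simp add: br_cmult_left br_cmult_right)
  then have "(z n - ?l)*br (f n) F = 0" using orth[OF b] by (simp add: algebra_simps)
  then show ?thesis using z(1)[of n] by simp
 qed
 have "cmod (br F F) <= nrm (%x. ?F (nu n) x - F x)" for n
 proof -
  have h: "?F (nu n) : H" by (rule L2_cmult[OF fH])
  have "br (%x. ?F (nu n) x - F x) F = - br F F" using br_diff_left[OF h FH FH] o by (simp add: br_cmult_left)
  then show ?thesis using br_cs[OF L2_diff[OF h FH] FH] F(5) by simp
 qed
 then have "cmod (br F F) <= 0" by (intro LIMSEQ_le_const[OF F(6)]) auto
 then show False using definite[OF b] F(5) by simp
qed

text \<open>Split u = g + u1. The resolvent of the eigenvector g is g/(z - l) and yields the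
  residue; that of u1 is bounded near l, so its singularity is removable and Cauchy's theorem
  applies. In particular l is a simple pole.\<close>

lemma circle_resolvent_integral:
 assumes t: "t : {-pi..pi}" and definite0: "\<forall>f v. bloch t (cx l) f v --> br f f = 0 --> nrm f = 0"
  and u: "u : H" and h: "h : H" and r: "0 < r" "cball (cx l) r - {cx l} \<subseteq> rh t"
  and g: "bloch t (cx l) g k" and orth0: "\<forall>f v. bloch t (cx l) f v --> br (%x. u x - g x) f = 0"
 shows "contour_integral (circlepath (cx l) r) (%z. l2inner (L2a w a) (Res t z u) h) = 2 * of_real pi*\<i>*l2inner (L2a w a) g h"
proof -
 let ?l = "cx l" and ?i = "%f. l2inner (L2a w a) f h"
 define u1 where "u1 = (%x. u x - g x)"
 have gH: "g : H" by (rule blochD(6)[OF g])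
 have u1: "u1 : H" unfolding u1_def by (rule L2_diff[OF u gH])
 have dec: "?i (Res t z u) = ?i (Res t z u1) + ?i g/(z - ?l)" if z: "z : cball ?l r - {?l}" for z
 proof -
  have zr: "z : rh t" and nz: "z - ?l ~= 0" using z r(2) by auto
  have "A t (%x. Res t z u1 x + inverse (z - ?l)*g x) (%x. (z*Res t z u1 x - u1 x) + inverse (z - ?l)*(?l*g x))"
   by (rule fiber_op_lin[OF Res[OF zr u1] bloch_fiber_op[OF g]])
  then have e: "A t (%x. Res t z u1 x + inverse (z - ?l)*g x) (%x. z*(Res t z u1 x + inverse (z - ?l)*g x) - u x)"
  proof (rule fiber_op_cong)
   fix x
   have "inverse (z - ?l)*(z - ?l) = 1" using nz by simp
   then show "z*(Res t z u1 x + inverse (z - ?l)*g x) - u x = (z*Res t z u1 x - u1 x) + inverse (z - ?l)*(?l*g x)"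
    unfolding u1_def by algebra
  qed
  note n0 = Res_unique[OF zr e u]
  note H1 = Res_H[OF zr u] and H2 = fiber_op_H(1)[OF e]
  have "?i (%x. Res t z u x - (Res t z u1 x + inverse (z - ?l)*g x)) = 0" by (rule l2inner_bound_0[OF L2_diff[OF H1 H2] h n0])
  then show ?thesis
   unfolding l2inner_diff_left[OF H1 H2 h] l2inner_add_left[OF Res_H[OF zr u1] L2_cmult[OF gH] h] l2inner_cmult_left
   by (simp add: divide_inverse mult.commute)
 qed
 obtain B where B: "eventually (%z. nrm (Res t z u1) <= B) (at ?l)"
  using bloch_kernel_subspace_resolvent_bounded[OF t definite0 u1 orth0[folded u1_def] r] by (elim exE)
 have "eventually (%z. z : cball ?l r - {?l}) (at ?l)"
  unfolding eventually_at using r(1) by (intro exI[of _ r]) (auto simp: dist_commute)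
 with B have "eventually (%z. cmod (?i (Res t z u1)) <= B*nrm h) (at ?l)"
 proof eventually_elim
  case (elim z)
  then have "z : rh t" using r(2) by blast
  then have "cmod (?i (Res t z u1)) <= nrm (Res t z u1)*nrm h" by (intro L2_Cauchy_Schwarz Res_H u1 h)
  also have "... <= B*nrm h" by (rule mult_right_mono[OF elim(1) l2norm_nonneg])
  finally show ?case .
 qed
 moreover have "(%z. ?i (Res t z u1)) holomorphic_on cball ?l r - {?l}"
  by (rule holomorphic_on_subset[OF Res_holomorphic[OF u1 h] r(2)])
 moreover have "?l : interior (cball ?l r)" using r(1) by simp
 ultimately obtain G where G: "G holomorphic_on cball ?l r" "\<forall>z\<in>cball ?l r - {?l}. G z = ?i (Res t z u1)"
  using holomorphic_on_extend_bounded[of "%z. ?i (Res t z u1)" "cball ?l r" ?l] by blast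
 have "(G has_contour_integral 0) (circlepath ?l r)"
  by (rule Cauchy_theorem_convex_simple[OF G(1)]) (use r(1) in auto)
 moreover have "((%z. ?i g/(z - ?l)) has_contour_integral (2 * of_real pi*\<i>*?i g)) (circlepath ?l r)"
  by (rule Cauchy_integral_circlepath_simple[where f = "%_. ?i g"]) (use r(1) in auto)
 ultimately have "((%z. G z + ?i g/(z - ?l)) has_contour_integral (0 + 2 * of_real pi*\<i>*?i g)) (circlepath ?l r)"
  by (rule has_contour_integral_add)
 then have "((%z. ?i (Res t z u)) has_contour_integral (0 + 2 * of_real pi*\<i>*?i g)) (circlepath ?l r)"
 proof (rule has_contour_integral_eq)
  fix z assume "z : path_image (circlepath ?l r)"
  then have "z : cball ?l r - {?l}" using r(1) by auto
  then show "G z + ?i g/(z - ?l) = ?i (Res t z u)" using dec G(2) by simp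
 qed
 then show ?thesis by (simp add: contour_integral_unique)
qed

text \<open>The projection v of u agrees in norm with the sum G of the orthogonal projections onto
  the eigenspaces. Hence [G, G] = [u, G], and c |G|^2 <= |[G, G]| <= |u| |G|. The absolute value
  lets one statement serve both half-lines.\<close>

lemma riesz_projection_bound:
 assumes t: "t : {-pi..pi}" and c: "0 < c"
  and definite: "\<forall>L f v. finite L --> (\<forall>l\<in>L. l : De & bloch t (cx l) (f l) (v l)) -->
    c*(nrm (lsum L f))^2 <= \<bar>Re (br (lsum L f) (lsum L f))\<bar>"
  and La: "La \<subseteq> cx ` De" and rp: "riesz_projection (L2a w a) (A t) La u v"
 shows "nrm v <= nrm u/c"
proof -
 have u: "u : H" and v: "v : H" and fin: "finite La" using rp by (auto simp: riesz_projection_def)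
 obtain r where r: "0 < r" "\<forall>l\<in>La. cball l r \<inter> spectrum (L2a w a) (A t) = {l}"
  "\<forall>h\<in>H. l2inner (L2a w a) v h = 1/(2 * of_real pi*\<i>)*(\<Sum>l\<in>La. contour_integral (circlepath l r) (%z. l2inner (L2a w a) (Res t z u) h))"
  using rp unfolding riesz_projection_def by (elim exE conjE)
 define L where "L = {l. cx l : La}"
 have LaL: "La = cx ` L" using La by (auto simp: L_def)
 have inj: "inj_on cx L" by (auto intro: inj_onI)
 have L: "finite L" using fin unfolding LaL by (rule finite_imageD[OF _ inj])
 have LR: "l : De" if "l : L" for l using that La by (auto simp: L_def)
 have def1: "\<forall>f v. bloch t (cx l) f v --> br f f = 0 --> nrm f = 0" if "l : De" for l
 proof (intro allI impI)
  fix f v assume f: "bloch t (cx l) f v" "br f f = 0"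
  have "\<forall>m\<in>{l}. m : De & bloch t (cx m) f v" using that f by simp
  from definite[THEN spec[of _ "{l}"], THEN spec[of _ "%_. f"], THEN spec[of _ "%_. v"], THEN mp, THEN mp, OF _ this]
  have "c*(nrm f)^2 <= 0" using f(2) by simp
  then have "(nrm f)^2 <= 0" using c by (simp add: mult_le_0_iff)
  then show "nrm f = 0" by simp
 qed
 have "\<forall>l\<in>L. \<exists>x. bloch t (cx l) (fst x) (snd x) & (\<forall>f v. bloch t (cx l) f v --> br (%y. u y - fst x y) f = 0)"
 proof
  fix l assume l: "l : L"
  obtain g k where gk: "bloch t (cx l) g k & (\<forall>f v. bloch t (cx l) f v --> br (%x. u x - g x) f = 0)"
   using bloch_projection[OF def1[OF LR[OF l]] u] by (elim exE)
  then show "\<exists>x. bloch t (cx l) (fst x) (snd x) & (\<forall>f v. bloch t (cx l) f v --> br (%y. u y - fst x y) f = 0)"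
   by (intro exI[of _ "(g, k)"]) simp
 qed
 from bchoice[OF this] obtain P where P: "\<forall>l\<in>L. bloch t (cx l) (fst (P l)) (snd (P l)) & (\<forall>f v. bloch t (cx l) f v --> br (%y. u y - fst (P l) y) f = 0)"
  by blast
 define g k where "g = (%l. fst (P l))" and "k = (%l. snd (P l))"
 have g: "bloch t (cx l) (g l) (k l)" and orth: "\<forall>f v. bloch t (cx l) f v --> br (%x. u x - g l x) f = 0" if "l : L" for l
  using P that by (auto simp: g_def k_def)
 have gH: "g l : H" if "l : L" for l by (rule blochD(6)[OF g[OF that]])
 define G where "G = (%x. \<Sum>l\<in>L. g l x)"
 have GH: "G : H" unfolding G_def by (rule L2_sum[OF L gH])
 have vG: "l2inner (L2a w a) v h = l2inner (L2a w a) G h" if h: "h : H" for h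
 proof -
  have "contour_integral (circlepath (cx l) r) (%z. l2inner (L2a w a) (Res t z u) h) = 2 * of_real pi*\<i>*l2inner (L2a w a) (g l) h"
   if l: "l : L" for l
  proof (rule circle_resolvent_integral[OF t def1[OF LR[OF l]] u h r(1) _ g[OF l] orth[OF l]])
   have "cball (cx l) r \<inter> spectrum (L2a w a) (A t) = {cx l}" using r(2) l LaL by blast
   then show "cball (cx l) r - {cx l} \<subseteq> rh t" unfolding spectrum_def by blast
  qed
  then have "(\<Sum>l\<in>La. contour_integral (circlepath l r) (%z. l2inner (L2a w a) (Res t z u) h)) = (\<Sum>l\<in>L. 2 * of_real pi*\<i>*l2inner (L2a w a) (g l) h)"
   unfolding LaL sum.reindex[OF inj] by simp
  also have "... = 2 * of_real pi*\<i>*l2inner (L2a w a) G h"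
  proof -
   have "l2inner (L2a w a) G h = (\<Sum>l\<in>L. l2inner (L2a w a) (g l) h)" unfolding G_def by (rule l2inner_sum_left[OF L gH h])
   then show ?thesis by (simp add: sum_distrib_left)
  qed
  finally show ?thesis using r(3) h by simp
 qed
 \<comment> \<open>v is known only through its products with test vectors, so v - G is tested
   against itself.\<close>
 have d: "(%x. v x - G x) : H" by (rule L2_diff[OF v GH])
 have "l2inner (L2a w a) (%x. v x - G x) (%x. v x - G x) = 0"
  unfolding l2inner_diff_left[OF v GH d] using vG[OF d] by simp
 then have "(nrm (%x. v x - G x))^2 = 0" unfolding l2inner_self by (simp only: of_real_eq_0_iff)
 then have "nrm (%x. v x - G x) = 0" by simp
 then have vn: "nrm v <= nrm G" using l2norm_triangle[OF d GH] by simp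
 have "br u (g l) = br (g l) (g l)" if l: "l : L" for l
  using orth[OF l, THEN spec, THEN spec, THEN mp, OF g[OF l]] br_diff_left[OF u gH[OF l] gH[OF l]] by simp
 moreover have "br G G = (\<Sum>l\<in>L. br (g l) (g l))"
  using br_bloch_sum[OF L g, of "%_. 1" "%_. 1"] by (simp add: G_def)
 ultimately have "br G G = br u G" unfolding G_def by (simp add: br_sum_right[OF L gH u])
 then have "\<bar>Re (br G G)\<bar> <= nrm u*nrm G" using br_cs[OF u GH] abs_Re_le_cmod[of "br u G"] by simp
 moreover have "\<forall>l\<in>L. l : De & bloch t (cx l) (g l) (k l)" using g LR by simp
 from definite[THEN spec, THEN spec, THEN spec, THEN mp, OF L, THEN mp, OF this] have "c*(nrm G)^2 <= \<bar>Re (br G G)\<bar>" by (simp add: G_def)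
 ultimately have "c*nrm G*nrm G <= nrm u*nrm G" by (simp add: power2_eq_square)
 then have "c*nrm G <= nrm u"
 proof (cases "nrm G = 0")
  case False
  then have "0 < nrm G" using l2norm_nonneg[of "L2a w a" G] by simp
  then show ?thesis using \<open>c*nrm G*nrm G <= nrm u*nrm G\<close> by simp
 qed (simp add: l2norm_nonneg)
 then have "nrm G <= nrm u/c" using c by (simp add: field_simps)
 then show ?thesis using vn by simp
qed

end

section \<open>The Gelfand transform\<close>

lemma l2inner_cnj: "l2inner M g f = cnj (l2inner M f g)"
 unfolding l2inner_def by (subst Bochner_Integration.integral_cnj[symmetric]) (simp add: mult.commute)

lemma l2norm_sum_orthogonal:
 assumes I: "finite I" and g: "!!i. i : I ==> g i : L2 M"
  and orth: "!!i j. i : I ==> j : I ==> i ~= j ==> l2inner M (g i) (g j) = 0"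
 shows "(l2norm M (%x. \<Sum>i\<in>I. g i x))^2 = (\<Sum>i\<in>I. (l2norm M (g i))^2)"
proof -
 let ?S = "%x. \<Sum>i\<in>I. g i x"
 have S: "?S : L2 M" by (rule L2_sum[OF I g])
 have 1: "l2inner M ?S (g j) = l2inner M (g j) (g j)" if j: "j : I" for j
 proof -
  have "l2inner M ?S (g j) = (\<Sum>i\<in>I. l2inner M (g i) (g j))" by (rule l2inner_sum_left[OF I g g[OF j]])
  also have "... = (\<Sum>i\<in>I. if i = j then l2inner M (g j) (g j) else 0)" by (intro sum.cong refl) (auto simp: orth[OF _ j])
  finally show ?thesis using I j by simp
 qed
 have "l2inner M ?S ?S = (\<Sum>j\<in>I. l2inner M (g j) ?S)" by (rule l2inner_sum_left[OF I g S])
 also have "... = (\<Sum>j\<in>I. l2inner M (g j) (g j))"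
 proof (intro sum.cong refl)
  fix j assume "j : I"
  from 1[OF this] show "l2inner M (g j) ?S = l2inner M (g j) (g j)" by (metis l2inner_cnj)
 qed
 finally have "cx ((l2norm M ?S)^2) = cx (\<Sum>j\<in>I. (l2norm M (g j))^2)"
  unfolding l2inner_self of_real_sum .
 then show ?thesis by (simp only: of_real_eq_iff)
qed

lemma exp_orthogonality:
 fixes n m :: int
 shows "integral\<^sup>L (lebesgue_on {-pi..pi}) (%t. exp (- \<i> * of_int n * of_real t)*cnj (exp (- \<i> * of_int m * of_real t)))
  = (if n = m then 2 * of_real pi else 0)"
proof -
 let ?k = "\<i> * of_int (m - n)"
 have e: "exp (- \<i> * of_int n * of_real t)*cnj (exp (- \<i> * of_int m * of_real t)) = exp (?k * of_real t)" for t :: real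
  by (simp add: exp_cnj algebra_simps flip: exp_add)
 have "continuous_on {-pi..pi} (%t. exp (?k * of_real t))" by (intro continuous_intros)
 then have i: "integrable (lebesgue_on {-pi..pi}) (%t. exp (?k * of_real t))"
  using absolutely_integrable_continuous_real by (simp add: absolutely_integrable_iff_integrable[symmetric])
 have "integral\<^sup>L (lebesgue_on {-pi..pi}) (%t. exp (?k * of_real t)) = integral {-pi..pi} (%t. exp (?k * of_real t))"
  by (rule lebesgue_integral_eq_integral[OF i]) simp
 also have "... = (if n = m then 2 * of_real pi else 0)"
 proof (cases "n = m")
  case True
  then show ?thesis by (simp add: scaleR_conv_of_real)
 next
  case False
  then have k: "?k ~= 0" by simp
  have "((%t. exp (?k * of_real t)) has_integral exp (?k * of_real pi)/?k - exp (?k * of_real (- pi))/?k) {-pi..pi}"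
  proof (rule fundamental_theorem_of_calculus)
   fix t :: real assume "t : {-pi..pi}"
   have "((%z. exp (?k*z)/?k) has_field_derivative exp (?k * of_real t)) (at (of_real t))"
    using k by (auto intro!: derivative_eq_intros)
   from has_vector_derivative_real_field[OF this, of "{-pi..pi}"]
   show "((%t. exp (?k * of_real t)/?k) has_vector_derivative exp (?k * of_real t)) (at t within {-pi..pi})" .
  qed simp
  moreover have "exp (?k * of_real pi) = exp (?k * of_real (- pi))"
  proof -
   have "?k * of_real pi = ?k * of_real (- pi) + cx (2*real_of_int (m - n)*pi)*\<i>" by (simp add: algebra_simps)
   then show ?thesis unfolding exp_eq by (intro exI[of _ "m - n"]) simp
  qed
  ultimately have "((%t. exp (?k * of_real t)) has_integral 0) {-pi..pi}" by simp
  then show ?thesis using False integral_unique by simp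
 qed
 finally show ?thesis unfolding e .
qed

context sturm_liouville
begin

abbreviation nu :: "real measure" where "nu \<equiv> lebesgue_on {-pi..pi}"

lemma pair_sigma_finite_L2I: "pair_sigma_finite nu (L2a w a)"
proof -
 have "integrable (L2a w a) (%_. 1 :: real)"
  using one_H by (simp add: L2_def)
 then have "finite_measure (L2a w a)" unfolding integrable_iff_bounded by (intro finite_measureI) simp
 moreover have "finite_measure nu" by (rule finite_measure_lebesgue_on) simp
 ultimately show ?thesis unfolding pair_sigma_finite_def using finite_measure.axioms(1) by blast
qed

interpretation L2I: pair_sigma_finite nu "L2a w a" by (rule pair_sigma_finite_L2I)

lemma product_L2:
 assumes g: "g : borel_measurable nu" "!!t. cmod (g t) = 1" and f: "f : H"
 shows "(%(t, x). g t*f x) : L2 (L2I w a)"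
proof -
 have fm: "f : borel_measurable (L2a w a)" and fi: "integrable (L2a w a) (%x. (cmod (f x))^2)" using f by (auto simp: L2_def)
 have m [measurable]: "(%y. g (fst y)) : borel_measurable (L2I w a)" "(%y. f (snd y)) : borel_measurable (L2I w a)"
  using measurable_compose[OF measurable_fst g(1)] measurable_compose[OF measurable_snd fm] by auto
 have "integrable (L2I w a) (%y. (cmod (g (fst y)*f (snd y)))^2)"
 proof (rule L2I.Fubini_integrable)
  show "integrable nu (%t. \<integral>x. norm ((cmod (g (fst (t, x))*f (snd (t, x))))^2) \<partial>L2a w a)"
   by (simp add: norm_mult g(2) finite_measure.integrable_const finite_measure_lebesgue_on)
  show "AE t in nu. integrable (L2a w a) (%x. (cmod (g (fst (t, x))*f (snd (t, x))))^2)" using fi by (simp add: norm_mult g(2))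
 qed measurable
 then show ?thesis by (simp add: L2_def case_prod_unfold)
qed

lemma product_l2inner:
 assumes g: "g : borel_measurable nu" "!!t. cmod (g t) = 1" and f: "f : H"
  and g': "g' : borel_measurable nu" "!!t. cmod (g' t) = 1" and f': "f' : H"
 shows "l2inner (L2I w a) (%(t, x). g t*f x) (%(t, x). g' t*f' x) = integral\<^sup>L nu (%t. g t*cnj (g' t))*l2inner (L2a w a) f f'"
proof -
 note i = L2_mult_integrable(1)[OF product_L2[OF g f] product_L2[OF g' f']]
 have "l2inner (L2I w a) (%(t, x). g t*f x) (%(t, x). g' t*f' x) = (\<integral>t. (\<integral>x. (g t*f x)*cnj (g' t*f' x) \<partial>L2a w a) \<partial>nu)"
  unfolding l2inner_def using L2I.integral_fst'[OF i] by simp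
 also have "... = (\<integral>t. (g t*cnj (g' t))*l2inner (L2a w a) f f' \<partial>nu)"
 proof (rule Bochner_Integration.integral_cong[OF refl])
  fix t
  have "(\<integral>x. (g t*f x)*cnj (g' t*f' x) \<partial>L2a w a) = (\<integral>x. (g t*cnj (g' t))*(f x*cnj (f' x)) \<partial>L2a w a)" by (simp add: mult_ac)
  then show "(\<integral>x. (g t*f x)*cnj (g' t*f' x) \<partial>L2a w a) = (g t*cnj (g' t))*l2inner (L2a w a) f f'" by (simp add: l2inner_def)
 qed
 finally show ?thesis by simp
qed

lemma w_per_int: "w (x + of_int n*a) = w x"
proof (cases "0 <= n")
 case True
 then show ?thesis using w_per_nat[of x "nat n"] by simp
next
 case False
 then show ?thesis using w_per_nat[of "x + of_int n*a" "nat (- n)"] by (simp add: algebra_simps)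
qed

lemma translate_L2:
 assumes f: "f : L2 (L2R w)"
 defines "ph \<equiv> %x. \<bar>w x\<bar>*(cmod (f x))^2"
 shows "integrable lebesgue ph" "(%x. f (x + of_int n*a)) : H"
  "(nrm (%x. f (x + of_int n*a)))^2 = integral {of_int n*a..of_int n*a + a} ph"
proof -
 have fm: "f : borel_measurable lebesgue" using f by (simp add: L2_def measurable_weighted lebesgue_on_UNIV_eq)
 show i: "integrable lebesgue ph"
  using f integrable_weighted[of "%x. (cmod (f x))^2" UNIV] fm by (simp add: L2_def ph_def lebesgue_on_UNIV_eq)
 then have "ph abs_int_on UNIV" by (simp add: absolutely_integrable_iff_integrable lebesgue_on_UNIV_eq)
 then have ai: "ph abs_int_on {c..d}" for c d by (rule set_integrable_subset) auto
 let ?b = "of_int n*a"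
 have "(%x. f (?b + x)) : borel_measurable lebesgue"
  using measurable_compose[OF lebesgue_affine_measurable[of "%_. 1" ?b] fm] by simp
 then have m: "(%x. f (x + ?b)) : borel_measurable (lebesgue_on {0<..<a})"
  by (simp add: add.commute measurable_restrict_space1)
 have sh: "ph (?b + 1*x) = \<bar>w x\<bar>*(cmod (f (x + ?b)))^2" for x
  using w_per_int[of x n] by (simp add: ph_def add.commute)
 have "(%x. ph (?b + 1*x)) abs_int_on {0..a}"
  using ai a_pos by (intro absolutely_integrable_affine) auto
 then show fH: "(%x. f (x + ?b)) : H" unfolding sh using m by (simp add: H_iff)
 have "(ph has_integral integral {?b..?b + a} ph) {?b..?b + a}"
  using ai by (intro integrable_integral) (simp add: abs_int_def)
 then have "((%x. ph (?b + 1*x)) has_integral (1/\<bar>1\<bar>) *\<^sub>R integral {?b..?b + a} ph) {0..a}"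
  using a_pos by (intro has_integral_affine) auto
 then show "(nrm (%x. f (x + ?b)))^2 = integral {?b..?b + a} ph"
  unfolding sh nrm_square[OF fH] by (simp add: integral_unique)
qed

text \<open>The exponentials are orthogonal in t with square norm 2 pi, which the prefactor removes;
  so the squared norms of the translates over one period add up.\<close>

lemma gelfand_sum_norm:
 assumes f: "f : L2 (L2R w)"
 shows "gelfand_sum a N f : L2 (L2I w a)"
  "(l2norm (L2I w a) (gelfand_sum a N f))^2 = integral {- (real N*a)..real N*a + a} (%x. \<bar>w x\<bar>*(cmod (f x))^2)"
proof -
 let ?ph = "%x. \<bar>w x\<bar>*(cmod (f x))^2"
 define g where "g = (%(n :: int) (t :: real). exp (- \<i> * of_int n * of_real t))"
 define h where "h = (%(n :: int) x. f (x + of_int n*a))"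
 define e where "e = (%n. %(t, x). g n t*h n x)"
 let ?I = "{- int N..int N}" and ?c = "1/cx (sqrt (2*pi))"
 have "continuous_on {-pi..pi} (g n)" for n unfolding g_def by (intro continuous_intros)
 then have gm: "g n : borel_measurable nu" for n by (intro continuous_imp_measurable_on_sets_lebesgue) auto
 have g1: "cmod (g n t) = 1" for n t
 proof -
  have "g n t = exp (\<i> * of_real (- (of_int n*t)))" by (simp add: g_def mult.assoc)
  then show ?thesis by (simp only: exp_i_norm)
 qed
 have hH: "h n : H" for n unfolding h_def by (rule translate_L2(2)[OF f])
 have eL: "e n : L2 (L2I w a)" for n unfolding e_def by (rule product_L2[OF gm g1 hH])
 have in_e: "l2inner (L2I w a) (e n) (e m) = (if n = m then 2 * of_real pi else 0)*l2inner (L2a w a) (h n) (h m)" for n m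
  unfolding e_def product_l2inner[OF gm g1 hH gm g1 hH] by (simp only: g_def exp_orthogonality)
 have S: "gelfand_sum a N f = (%y. ?c*(\<Sum>n\<in>?I. e n y))"
  by (simp add: gelfand_sum_def e_def g_def h_def fun_eq_iff case_prod_unfold)
 show "gelfand_sum a N f : L2 (L2I w a)" unfolding S by (intro L2_cmult L2_sum eL) simp
 have en: "(l2norm (L2I w a) (e n))^2 = 2*pi*(nrm (h n))^2" for n
 proof -
  have "cx ((l2norm (L2I w a) (e n))^2) = cx (2*pi*(nrm (h n))^2)"
   using in_e[of n n] unfolding l2inner_self by simp
  then show ?thesis by (simp only: of_real_eq_iff)
 qed
 have "(l2norm (L2I w a) (gelfand_sum a N f))^2 = (cmod ?c)^2*(\<Sum>n\<in>?I. (l2norm (L2I w a) (e n))^2)"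
  unfolding S l2norm_cmult power_mult_distrib
  by (subst l2norm_sum_orthogonal) (auto simp: eL in_e)
 also have "... = (\<Sum>n\<in>?I. (nrm (h n))^2)"
  unfolding en by (simp add: norm_divide power_divide sum_distrib_left[symmetric])
 also have "... = (\<Sum>n\<in>?I. integral {of_int n*a..of_int n*a + a} ?ph)"
  unfolding h_def translate_L2(3)[OF f] ..
 also have "... = integral {- (real N*a)..real N*a + a} ?ph"
 \<comment> \<open>The sum telescopes. Cell n is [n a, n a + a], so the cells from - N to N end at N
   a + a.\<close>
 proof -
  have "?ph abs_int_on UNIV" using translate_L2(1)[OF f] by (simp add: absolutely_integrable_iff_integrable lebesgue_on_UNIV_eq)
  then have ai: "?ph abs_int_on {c..d}" for c d by (rule set_integrable_subset) auto
  define Ph where "Ph = integral_from 0 ?ph"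
  have Ph: "integral {c..d} ?ph = Ph d - Ph c" if "c <= d" for c d
   using primitive_onD(2)[OF primitive_on_integral_from[OF ai, of 0] subset_UNIV that] by (simp add: Ph_def)
  have "(\<Sum>n\<in>{- int N..int N}. Ph (of_int n*a + a) - Ph (of_int n*a)) = Ph (real N*a + a) - Ph (- (real N*a))"
  proof (induction N)
   case (Suc N)
   have s: "{- int (Suc N)..int (Suc N)} = insert (- int (Suc N)) (insert (int (Suc N)) {- int N..int N})" by auto
   have "(\<Sum>n\<in>{- int (Suc N)..int (Suc N)}. Ph (of_int n*a + a) - Ph (of_int n*a)) =
    (Ph (of_int (- int (Suc N))*a + a) - Ph (of_int (- int (Suc N))*a)) + ((Ph (of_int (int (Suc N))*a + a) - Ph (of_int (int (Suc N))*a)) +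
     (\<Sum>n\<in>{- int N..int N}. Ph (of_int n*a + a) - Ph (of_int n*a)))"
    unfolding s by (subst sum.insert; simp)+
   moreover have "of_int (- int (Suc N))*a + a = - (real N*a)" "of_int (int (Suc N))*a = real (Suc N)*a" "of_int (- int (Suc N))*a = - (real (Suc N)*a)"
    "real (Suc N)*a = real N*a + a" by (simp_all add: algebra_simps)
   ultimately show ?case unfolding Suc by (simp only:)
  qed simp
  then show ?thesis using a_pos by (simp add: Ph)
 qed
 finally show "(l2norm (L2I w a) (gelfand_sum a N f))^2 = integral {- (real N*a)..real N*a + a} ?ph" .
qed

text \<open>The partial sums converge to F in norm, and by dominated convergence their norms exhaust
  that of f.\<close>

lemma gelfand_isometry:
 assumes g: "gelfand w a f F"
 shows "l2norm (L2I w a) F = l2norm (L2R w) f"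
proof -
 let ?ph = "%x. \<bar>w x\<bar>*(cmod (f x))^2"
 let ?S = "%N. gelfand_sum a N f"
 have f: "f : L2 (L2R w)" and F: "F : L2 (L2I w a)" and lim: "(%N. l2norm (L2I w a) (%y. F y - ?S N y)) ----> 0"
  using g by (auto simp: gelfand_def)
 note S = gelfand_sum_norm[OF f]
 have "\<bar>l2norm (L2I w a) (?S N) - l2norm (L2I w a) F\<bar> <= l2norm (L2I w a) (%y. F y - ?S N y)" for N
 proof -
  have d: "(%y. F y - ?S N y) : L2 (L2I w a)" "(%y. - 1*(F y - ?S N y)) : L2 (L2I w a)" by (intro L2_cmult L2_diff F S)+
  have "l2norm (L2I w a) F <= l2norm (L2I w a) (%y. F y - ?S N y) + l2norm (L2I w a) (?S N)"
   using l2norm_triangle[OF d(1) S(1), of N] by simp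
  moreover have "l2norm (L2I w a) (?S N) <= l2norm (L2I w a) F + l2norm (L2I w a) (%y. F y - ?S N y)"
   using l2norm_triangle[OF F d(2)] unfolding l2norm_cmult by simp
  ultimately show ?thesis by linarith
 qed
 then have "(%N. l2norm (L2I w a) (?S N) - l2norm (L2I w a) F) ----> 0"
  by (intro Lim_null_comparison[OF _ lim]) (simp add: always_eventually)
 then have "(%N. l2norm (L2I w a) (?S N)) ----> l2norm (L2I w a) F" by (simp add: LIM_zero_iff)
 then have 1: "(%N. (l2norm (L2I w a) (?S N))^2) ----> (l2norm (L2I w a) F)^2" by (intro tendsto_intros)
 have i: "integrable lebesgue ?ph" by (rule translate_L2(1)[OF f])
 then have m [measurable]: "?ph : borel_measurable lebesgue" by auto
 have "?ph abs_int_on UNIV" using i by (simp add: absolutely_integrable_iff_integrable lebesgue_on_UNIV_eq)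
 then have ai: "?ph abs_int_on {c..d}" for c d by (rule set_integrable_subset) auto
 have "(%N. integral\<^sup>L lebesgue (%x. indicator {- (real N*a)..real N*a + a} x*?ph x)) ----> integral\<^sup>L lebesgue ?ph"
 proof (rule integral_dominated_convergence[where w = ?ph])
  show "AE x in lebesgue. (%N. indicator {- (real N*a)..real N*a + a} x*?ph x) ----> ?ph x"
  proof (rule always_eventually, rule allI, rule tendsto_eventually)
   fix x
   obtain N0 where "\<bar>x\<bar>/a < real N0" using reals_Archimedean2 by blast
   then have N0: "\<bar>x\<bar> < real N0*a" using a_pos by (simp add: field_simps)
   have "x : {- (real N*a)..real N*a + a}" if "N0 <= N" for N
   proof -
    have "real N0*a <= real N*a" using that a_pos by simp
    then have "- (real N*a) <= x" "x <= real N*a + a" using N0 a_pos by linarith+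
    then show ?thesis by simp
   qed
   then show "eventually (%N. indicator {- (real N*a)..real N*a + a} x*?ph x = ?ph x) sequentially"
    unfolding eventually_sequentially by (intro exI[of _ N0] allI impI) (simp only: indicator_simps mult_1)
  qed
  show "(%x. indicator {- (real N*a)..real N*a + a} x*?ph x) : borel_measurable lebesgue" for N
   by (intro borel_measurable_times borel_measurable_indicator m) simp
 qed (use i in \<open>auto simp: indicator_def\<close>)
 moreover have "integral\<^sup>L lebesgue (%x. indicator {- (real N*a)..real N*a + a} x*?ph x) = (l2norm (L2I w a) (?S N))^2" for N
  using set_lebesgue_integral_eq_integral(2)[OF ai] unfolding S(2) set_lebesgue_integral_def by simp
 moreover have "integral\<^sup>L lebesgue ?ph = (l2norm (L2R w) f)^2"
 proof -
  have "(%x. (cmod (f x))^2) : borel_measurable (lebesgue_on UNIV)" using f by (auto simp: L2_def measurable_weighted lebesgue_on_UNIV_eq)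
  from integral_weighted[OF this] show ?thesis by (simp add: l2norm_square lebesgue_on_UNIV_eq)
 qed
 ultimately have "(%N. (l2norm (L2I w a) (?S N))^2) ----> (l2norm (L2R w) f)^2" by simp
 from LIMSEQ_unique[OF 1 this] show ?thesis using l2norm_nonneg by (metis power2_eq_iff_nonneg)
qed

lemma l2norm_fiberwise:
 assumes F: "F : L2 (L2I w a)" and G: "G : L2 (L2I w a)" and K: "0 <= K"
  and le: "AE t in nu. nrm (%x. G (t, x)) <= K*nrm (%x. F (t, x))"
 shows "l2norm (L2I w a) G <= K*l2norm (L2I w a) F"
proof -
 have i: "integrable (L2I w a) (%y. (cmod (F y))^2)" "integrable (L2I w a) (%y. (cmod (G y))^2)" using F G by (auto simp: L2_def)
 have sq: "(l2norm (L2I w a) X)^2 = (\<integral>t. (nrm (%x. X (t, x)))^2 \<partial>nu)" if "integrable (L2I w a) (%y. (cmod (X y))^2)" for X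
  unfolding l2norm_square using L2I.integral_fst'[OF that] by simp
 have int: "integrable nu (%t. (nrm (%x. X (t, x)))^2)" if "integrable (L2I w a) (%y. (cmod (X y))^2)" for X
  unfolding l2norm_square using L2I.integrable_fst'[OF that] by simp
 have "(l2norm (L2I w a) G)^2 <= (\<integral>t. K^2*(nrm (%x. F (t, x)))^2 \<partial>nu)"
  unfolding sq[OF i(2)]
 proof (rule integral_mono_AE[OF int[OF i(2)]])
  show "integrable nu (%t. K^2*(nrm (%x. F (t, x)))^2)" by (intro integrable_mult_right int i)
  show "AE t in nu. (nrm (%x. G (t, x)))^2 <= K^2*(nrm (%x. F (t, x)))^2"
   using le by eventually_elim (metis l2norm_nonneg power_mono power_mult_distrib)
 qed
 also have "... = (K*l2norm (L2I w a) F)^2" by (simp add: sq[OF i(1)] power_mult_distrib)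
 finally show ?thesis by (rule power2_le_imp_le) (intro mult_nonneg_nonneg K l2norm_nonneg)
qed

text \<open>Finitely many t are a null set, so the definiteness may fail there. The fiberwise bound
  integrates over t, and the isometry brings it back to the line.\<close>

lemma spectral_projection_bound:
 assumes c: "0 < c" and T: "finite T"
  and definite: "\<forall>t\<in>{-pi..pi} - T. \<forall>L f v. finite L --> (\<forall>l\<in>L. l : De & bloch t (cx l) (f l) (v l)) -->
    c*(nrm (lsum L f))^2 <= \<bar>Re (br (lsum L f) (lsum L f))\<bar>"
  and S: "S \<subseteq> cx ` De"
 shows "op_norm (L2R w) (spectral_E w p q a S) <= ereal (1/c)"
 unfolding op_norm_def
proof (rule SUP_least)
 fix x assume "x : {(f, g). spectral_E w p q a S f g & l2norm (L2R w) f <= 1}"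
 then obtain f g where x: "x = (f, g)" and E: "spectral_E w p q a S f g" and f1: "l2norm (L2R w) f <= 1" by blast
 obtain F G where F: "gelfand w a f F" and G: "gelfand w a g G"
  and rp: "AE t in nu. riesz_projection (L2a w a) (A t) (spectrum (L2a w a) (A t) \<inter> S) (%x. F (t, x)) (%x. G (t, x))"
  using E unfolding spectral_E_def by (elim exE conjE)
 have "negligible T" using T by (rule negligible_finite)
 then have "negligible {t : {-pi..pi}. \<not> t \<notin> T}" by (rule negligible_subset) auto
 then have "AE t in nu. t \<notin> T" by (subst AE_lebesgue_on_iff_negligible) auto
 with rp AE_space[of nu] have "AE t in nu. nrm (%x. G (t, x)) <= (1/c)*nrm (%x. F (t, x))"
 proof eventually_elim
  case (elim t)
  have t: "t : {-pi..pi} - T" using elim by (simp add: space_restrict_space)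
  have "nrm (%x. G (t, x)) <= nrm (%x. F (t, x))/c"
   by (rule riesz_projection_bound[OF _ c bspec[OF definite t] _ elim(1)]) (use t S in auto)
  then show ?case by simp
 qed
 moreover have "F : L2 (L2I w a)" "G : L2 (L2I w a)" using F G by (auto simp: gelfand_def)
 ultimately have "l2norm (L2I w a) G <= (1/c)*l2norm (L2I w a) F" using c by (intro l2norm_fiberwise) auto
 then have "l2norm (L2R w) g <= (1/c)*l2norm (L2R w) f" unfolding gelfand_isometry[OF F] gelfand_isometry[OF G] .
 also have "... <= (1/c)*1" using c f1 by (intro mult_left_mono) auto
 finally show "(case x of (f, g) => ereal (l2norm (L2R w) g)) <= ereal (1/c)" by (simp add: x)
qed

end

section \<open>Sign types of eigenvectors, reflection of the weight, and both half-lines\<close>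

lemma one_simple_uminus:
 assumes "one_simple w x0"
 shows "one_simple (%x. - w x) x0"
proof -
 obtain dl tap tam rhp rhm c where S: "0 < dl" "- 1 < tap" "- 1 < tam" "C1_on {x0..x0 + dl} rhp" "C1_on {x0 - dl..x0} rhm" "rhp x0 ~= 0" "rhm x0 ~= 0"
  "\<forall>x\<in>{0..dl}. sgn (rhp (x0 + x)) = c & - sgn (rhm (x0 - x)) = c"
  "\<forall>x. x - x0 : {0<..<dl} --> w x = rhp x*\<bar>x - x0\<bar> powr tap"
  "\<forall>x. - (x - x0) : {0<..<dl} --> w x = rhm x*\<bar>x - x0\<bar> powr tam"
  using assms unfolding one_simple_def by (elim exE conjE)
 have C: "C1_on T (%x. - f x)" if h: "C1_on T f" for T f
 proof -
  obtain f' where "\<forall>x\<in>T. (f has_real_derivative f' x) (at x within T)" "continuous_on T f'"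
   using h unfolding C1_on_def by (elim exE conjE)
  then show ?thesis unfolding C1_on_def by (intro exI[of _ "%x. - f' x"]) (auto intro!: DERIV_minus continuous_intros)
 qed
 show ?thesis unfolding one_simple_def
 proof (rule exI[of _ dl], intro conjI, rule S(1), rule exI[of _ tap], intro conjI, rule S(2), rule exI[of _ tam], intro conjI, rule S(3),
   rule exI[of _ "%x. - rhp x"], rule exI[of _ "%x. - rhm x"], intro conjI)
  show "\<exists>c. \<forall>x\<in>{0..dl}. sgn (- rhp (x0 + x)) = c & - sgn (- rhm (x0 - x)) = c"
   using S(8) by (intro exI[of _ "- c"]) (simp add: sgn_minus)
 qed (use S C in auto)
qed

context sturm_liouville
begin

lemma bloch_eigenvalue_in_fiber_spectrum:
 assumes b: "bloch t z f v" and nz: "nrm f ~= 0"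
 shows "z : spectrum (L2a w a) (A t)"
proof (rule ccontr)
 assume "z \<notin> spectrum (L2a w a) (A t)"
 then have "\<exists>K. \<forall>f g. A t f g --> nrm f <= K*nrm (%x. g x - z*f x)" by (simp add: spectrum_def resolvent_set_def)
 then obtain K where "\<forall>f g. A t f g --> nrm f <= K*nrm (%x. g x - z*f x)" ..
 with bloch_fiber_op[OF b] have "nrm f <= K*nrm (%x. z*f x - z*f x)" by blast
 moreover have "nrm (%x. z*f x - z*f x) = 0" by (simp add: l2norm_def)
 ultimately show False using nz l2norm_nonneg[of "L2a w a" f] by simp
qed

text \<open>A constant sequence transfers the sequential definition of sign type to a single
  eigenvector.\<close>

lemma constant_approx_eigenseq:
 assumes b: "bloch t z f v" and nz: "nrm f ~= 0"
 shows "approx_eigenseq (L2a w a) (A t) z (%_ x. cx (inverse (nrm f))*f x)"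
 unfolding approx_eigenseq_def
proof (intro exI[of _ "%_ x. z*(cx (inverse (nrm f))*f x)"] conjI allI)
 show "A t (%x. cx (inverse (nrm f))*f x) (%x. z*(cx (inverse (nrm f))*f x))"
  by (rule bloch_fiber_op[OF bloch_cmult[OF b]])
 show "nrm (%x. cx (inverse (nrm f))*f x) = 1"
  unfolding l2norm_cmult using nz l2norm_nonneg[of "L2a w a" f] by (simp add: norm_inverse)
qed (simp add: l2norm_def)

lemma br_normalised: "Re (br (%x. cx c*f x) (%x. cx c*f x)) = c^2*Re (br f f)"
 by (simp add: br_cmult_left br_cmult_right power2_eq_square)

lemma positive_type_eigenfunction:
 assumes "positive_type w a (A t) D" "l : D" and b: "bloch t (cx l) f v" and nz: "nrm f ~= 0"
 shows "0 < Re (br f f)"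
proof -
 have "cx l : sigma_plus w a (A t)"
  using assms(1,2) bloch_eigenvalue_in_fiber_spectrum[OF b nz] unfolding positive_type_def by blast
 then have "0 < liminf (%n::nat. ereal (Re (br (%x. cx (inverse (nrm f))*f x) (%x. cx (inverse (nrm f))*f x))))"
  using constant_approx_eigenseq[OF b nz] unfolding sigma_plus_def by blast
 then have "0 < Re (br (%x. cx (inverse (nrm f))*f x) (%x. cx (inverse (nrm f))*f x))"
  by (simp add: Liminf_const)
 then show ?thesis unfolding br_normalised using nz by (simp add: zero_less_mult_iff)
qed

lemma negative_type_eigenfunction:
 assumes "negative_type w a (A t) D" "l : D" and b: "bloch t (cx l) f v" and nz: "nrm f ~= 0"
 shows "Re (br f f) < 0"
proof -
 have "cx l : sigma_minus w a (A t)"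
  using assms(1,2) bloch_eigenvalue_in_fiber_spectrum[OF b nz] unfolding negative_type_def by blast
 then have "limsup (%n::nat. ereal (Re (br (%x. cx (inverse (nrm f))*f x) (%x. cx (inverse (nrm f))*f x)))) < 0"
  using constant_approx_eigenseq[OF b nz] unfolding sigma_minus_def by blast
 then have "Re (br (%x. cx (inverse (nrm f))*f x) (%x. cx (inverse (nrm f))*f x)) < 0"
  by (simp add: Limsup_const)
 then show ?thesis unfolding br_normalised using nz by (simp add: mult_less_0_iff)
qed

lemma reflected: "sturm_liouville a (%x. - w x) p q"
proof -
 have "(%x. - w x) abs_int_on {c..d}" for c d
  using absolutely_integrable_linear[OF w_int bounded_linear_minus[OF bounded_linear_ident]] by (simp add: o_def)
 then show ?thesis
  by unfold_locales (use a_pos w_per p_per q_per w_meas p_meas q_int ip_int w_nz p_pos in auto)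
qed

text \<open>The half-line is closed at R, whereas definiteness is known above R only. The difference
  concerns those t for which s R is an eigenvalue of A(t), and these are finitely many. The sign s
  covers both half-lines.\<close>

lemma definite_half_line:
 assumes c: "0 < c" "\<forall>t\<in>{-pi..pi}. \<forall>L f v. finite L --> (\<forall>l\<in>L. R < l & bloch t (cx (s*l)) (f l) (v l)) -->
   c*(nrm (lsum L f))^2 <= s*Re (br (lsum L f) (lsum L f))"
  and s: "s = 1 \<or> s = - 1" and S: "S \<subseteq> cx ` ((*) s ` {R..})"
 shows "op_norm (L2R w) (spectral_E w p q a S) <= ereal (1/c)"
proof -
 define T where "T = {t : {-pi..pi}. \<exists>f v. bloch t (cx (s*R)) f v & \<not> (f 0 = 0 & v 0 = 0)}"
 have T: "finite T" unfolding T_def by (rule finite_bloch_parameters)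
 show ?thesis
 proof (rule spectral_projection_bound[OF c(1) T _ S], intro ballI allI impI)
  fix t L f v assume t: "t : {-pi..pi} - T" and L: "finite L"
   and h: "\<forall>l\<in>L. l : (*) s ` {R..} & bloch t (cx l) (f l) (v l)"
  define L' where "L' = {l. R < l & s*l : L}"
  have inj: "inj_on ((*) s) X" for X using s by (auto intro: inj_onI)
  have sub: "(*) s ` L' \<subseteq> L" by (auto simp: L'_def)
  have L': "finite L'" by (rule finite_imageD[OF finite_subset[OF sub L] inj])
  \<comment> \<open>For t outside T there is no non-trivial Bloch solution at s R, so a summand at
    the end point is zero.\<close>
  have z: "f l = (%_. 0)" if l: "l : L - (*) s ` L'" for l
  proof -
   obtain m where m: "l = s*m" "R <= m" using h l by auto
   have "m = R" using l m by (auto simp: L'_def)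
   then have "l = s*R" using m by simp
   moreover have "bloch t (cx l) (f l) (v l)" using h l by blast
   ultimately have "bloch t (cx (s*R)) (f l) (v l)" by metis
   then show ?thesis using t bloch_data_0 unfolding T_def by blast
  qed
  have e: "(lsum L f) = (%x. \<Sum>l\<in>L'. f (s*l) x)"
  proof
   fix x
   have "(\<Sum>l\<in>L. f l x) = (\<Sum>l\<in>(*) s ` L'. f l x)" by (rule sum.mono_neutral_right[OF L sub]) (use z in auto)
   then show "(\<Sum>l\<in>L. f l x) = (\<Sum>l\<in>L'. f (s*l) x)" by (simp add: sum.reindex[OF inj])
  qed
  have bl: "\<forall>l\<in>L'. R < l & bloch t (cx (s*l)) (f (s*l)) (v (s*l))"
  proof
   fix l assume "l : L'"
   then have "R < l" "s*l : L" by (auto simp: L'_def)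
   with h show "R < l & bloch t (cx (s*l)) (f (s*l)) (v (s*l))" by blast
  qed
  from t have "t : {-pi..pi}" by blast
  then have "c*(nrm (%x. \<Sum>l\<in>L'. f (s*l) x))^2 <= s*Re (br (%x. \<Sum>l\<in>L'. f (s*l) x) (%x. \<Sum>l\<in>L'. f (s*l) x))"
   by (rule c(2)[THEN bspec, THEN spec[of _ L'], THEN spec[of _ "%l. f (s*l)"], THEN spec[of _ "%l. v (s*l)"], THEN mp, OF _ L', THEN mp, OF _ bl])
  also have "... <= \<bar>Re (br (%x. \<Sum>l\<in>L'. f (s*l) x) (%x. \<Sum>l\<in>L'. f (s*l) x))\<bar>" using s by auto
  finally show "c*(nrm (lsum L f))^2 <= \<bar>Re (br (lsum L f) (lsum L f))\<bar>" unfolding e .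
 qed
qed

theorem no_singularity:
 assumes R: "admissible_radius w p q a R"
  and fin: "finite {x : {0..a}. turning_point w x}"
  and os: "!!x. x : {0..a} ==> turning_point w x ==> one_simple w x"
  and pb: "!!x. x : {0..a} ==> turning_point w x ==> \<exists>dl>0. \<exists>K. AE y in lebesgue_on {x - dl<..<x + dl}. \<bar>p y\<bar> <= K & \<bar>inverse (p y)\<bar> <= K"
 shows "\<not> infinity_spectral_singularity w p q a R"
proof -
 have pt: "positive_type w a (A t) {R<..}" "negative_type w a (A t) {..<-R}" if "t : {-pi..pi}" for t
  using R that by (auto simp: admissible_radius_def)
 have cr: "\<not> critical_point w p q a (cx R)" "\<not> critical_point w p q a (cx (- R))"
  using R by (auto simp: admissible_radius_def)
 obtain R1 kp where high: "0 <= kp" "high_definite R1 kp"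
 proof -
  have "\<exists>R1 kp. 0 <= kp & high_definite R1 kp"
   by (rule high_eigenvalues_turning[OF fin]) (erule (1) os, erule (1) pb)
  then show ?thesis using that by (elim exE conjE)
 qed
 have "\<exists>c>0. definite_above R c"
 proof (rule uniform_definite[OF high])
  show "\<forall>t\<in>{-pi..pi}. \<forall>l f v. R < l --> bloch t (cx l) f v --> nrm f ~= 0 --> 0 < Re (br f f)"
   using positive_type_eigenfunction[OF pt(1)] by simp
  show "\<forall>t\<in>{-pi..pi}. \<forall>f v. bloch t (cx R) f v --> nrm f ~= 0 --> br f f ~= 0"
   using neutral_bloch_critical cr(1) by blast
 qed
 then obtain c where c: "0 < c" "definite_above R c" by (elim exE conjE)
 have up: "op_norm (L2R w) (spectral_E w p q a (cx ` {R..C})) <= ereal (1/c)" for C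
  by (rule definite_half_line[where s = 1, OF c(1)]) (use c(2) in auto)
 interpret N: sturm_liouville a "%x. - w x" p q by (rule reflected)

 \<comment> \<open>Replacing w by - w reflects the eigenvalues and the indefinite product but leaves
   the norm; so negative type below - R becomes positive type above R.\<close>
 have Nb: "N.bloch t (cx l) f v \<longleftrightarrow> bloch t (cx (- 1*l)) f v" for t l f v
  unfolding N.bloch_def bloch_def by simp
 have Nn: "N.nrm f = nrm f" for f by (simp add: l2norm_def weighted_def)
 have Nbr: "N.br f g = - br f g" for f g
  by (simp add: indef_inner_def flip: Bochner_Integration.integral_minus)
 have tp: "turning_point (%x. - w x) x \<longleftrightarrow> turning_point w x" for x
  by (auto simp: turning_point_def indefinite_on_def)
 have "\<exists>R1 kp. 0 <= kp & N.high_definite R1 kp"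
 proof (rule N.high_eigenvalues_turning)
  fix x assume x: "x : {0..a}" "turning_point (%x. - w x) x"
  then have x': "turning_point w x" by (simp add: tp)
  show "\<exists>dl>0. \<exists>K. AE y in lebesgue_on {x - dl<..<x + dl}. \<bar>p y\<bar> <= K & \<bar>inverse (p y)\<bar> <= K" by (rule pb[OF x(1) x'])
  from os[OF x(1) x'] show "one_simple (%x. - w x) x" by (rule one_simple_uminus)
 qed (use fin in \<open>simp add: tp\<close>)
 then obtain R2 kp' where high': "0 <= kp'" "N.high_definite R2 kp'"
  by (elim exE conjE)
 have "\<exists>c>0. N.definite_above R c"
 proof (rule N.uniform_definite[OF high'])
  show "\<forall>t\<in>{-pi..pi}. \<forall>l f v. R < l --> N.bloch t (cx l) f v --> N.nrm f ~= 0 --> 0 < Re (N.br f f)"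
   unfolding Nb Nn Nbr
  proof (intro ballI allI impI)
   fix t l f v assume "t : {-pi..pi}" "R < l" "bloch t (cx (- 1*l)) f v" "nrm f ~= 0"
   then show "0 < Re (- br f f)" using negative_type_eigenfunction[OF pt(2), of t "- 1*l" f v] by simp
  qed
  show "\<forall>t\<in>{-pi..pi}. \<forall>f v. N.bloch t (cx R) f v --> N.nrm f ~= 0 --> N.br f f ~= 0"
   unfolding Nb Nn Nbr
  proof (intro ballI allI impI)
   fix t f v assume "bloch t (cx (- 1*R)) f v" "nrm f ~= 0"
   then show "- br f f ~= 0" using neutral_bloch_critical[of t "- 1*R" f v] cr(2) by auto
  qed
 qed
 then obtain d where d: "0 < d" "\<forall>t\<in>{-pi..pi}. \<forall>L f v. finite L --> (\<forall>l\<in>L. R < l & bloch t (cx (- 1*l)) (f l) (v l)) -->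
   d*(nrm (lsum L f))^2 <= Re (- br (lsum L f) (lsum L f))" unfolding Nb Nn Nbr by (elim exE conjE)
 have down: "op_norm (L2R w) (spectral_E w p q a (cx ` {- C..- R})) <= ereal (1/d)" for C
 proof (rule definite_half_line[where s = "- 1", OF d(1)])
  show "cx ` {- C..- R} \<subseteq> cx ` ((*) (- 1) ` {R..})"
  proof (intro image_mono subsetI)
   fix x assume "x : {- C..- R}"
   then show "x : (*) (- 1) ` {R..}" by (intro image_eqI[of _ _ "- x"]) auto
  qed
 qed (use d(2) in auto)
 have "(SUP C \<in> {C. C > R & E_defined w p q a (cx ` {R..C})}. op_norm (L2R w) (spectral_E w p q a (cx ` {R..C}))) <= ereal (1/c)"
  by (rule SUP_least) (rule up)
 moreover have "(SUP C \<in> {C. C > R & E_defined w p q a (cx ` {-C..-R})}. op_norm (L2R w) (spectral_E w p q a (cx ` {-C..-R}))) <= ereal (1/d)"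
  by (rule SUP_least) (rule down)
 ultimately show ?thesis unfolding infinity_spectral_singularity_def by auto
qed

end

text \<open>The symmetric intervals grow by one translated period at each end, and every compact
  interval lies in one of them.\<close>

lemma periodic_absolutely_integrable:
 fixes g :: "real => real"
 assumes a: "0 < a" and per: "!!x. g (x + a) = g x" and i: "integrable (lebesgue_on {0<..<a}) g"
 shows "g abs_int_on {c..d}"
proof -
 have "g abs_int_on {0<..<a}" using i by (simp add: absolutely_integrable_iff_integrable)
 then have 0: "g abs_int_on {0..a}"
  by (subst (asm) absolutely_integrable_spike_set_eq[where T = "{0..a}"]) (auto intro: negligible_subset[of "{0, a}"])
 have pern: "g (x + real n*a) = g x" for x n
 proof (induction n)
  case (Suc n)
  have "g (x + real (Suc n)*a) = g ((x + real n*a) + a)" by (simp add: algebra_simps)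
  then show ?case using Suc by (simp only: per)
 qed simp
 have cell: "g abs_int_on {b..b + a}" if "!!x. g (x - b) = g x" for b
 proof -
  have "(%x. g (- b + 1*x)) abs_int_on {b..b + a}"
   by (rule absolutely_integrable_affine) (use 0 a in auto)
  moreover have "g (- b + 1*x) = g x" for x using that[of x] by simp
  ultimately show ?thesis by simp
 qed
 have "g abs_int_on {- (real n*a)..real n*a}" for n
 proof (induction n)
  case (Suc n)
  have r: "g abs_int_on {real n*a..real n*a + a}"
  proof (rule cell)
   show "g (x - real n*a) = g x" for x using pern[of "x - real n*a" n] by simp
  qed
  have l: "g abs_int_on {- (real (Suc n)*a)..- (real (Suc n)*a) + a}"
  proof (rule cell)
   show "g (x - - (real (Suc n)*a)) = g x" for x using pern[of x "Suc n"] by simp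
  qed
  have m: "g abs_int_on {- (real n*a)..real n*a + a}"
   by (rule absolutely_integrable_on_combine[OF Suc r]) (use a in auto)
  have e: "- (real (Suc n)*a) + a = - (real n*a)" "real n*a + a = real (Suc n)*a" by (simp_all add: algebra_simps)
  show ?case by (rule absolutely_integrable_on_combine[OF l[unfolded e(1)] m[unfolded e(2)]]) (use a in \<open>auto simp: field_simps\<close>)
 qed (use integrable_on_refl[of g 0] integrable_on_refl[of "%x. \<bar>g x\<bar>" 0] in \<open>simp add: abs_int_def\<close>)
 moreover obtain n where "max \<bar>c\<bar> \<bar>d\<bar>/a < real n" using reals_Archimedean2 by blast
 then have "max \<bar>c\<bar> \<bar>d\<bar> < real n*a" using a by (simp add: field_simps)
 then have "{c..d} \<subseteq> {- (real n*a)..real n*a}" by auto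
 ultimately show ?thesis by (rule absolutely_integrable_on_subinterval)
qed

theorem theorem5p3:
  fixes a R :: real and w p q :: "real \<Rightarrow> real"
  assumes a_pos: "a > 0"
    and measurable: "w \<in> borel_measurable lebesgue" "p \<in> borel_measurable lebesgue"
      "q \<in> borel_measurable lebesgue"
    and periodic: "\<And>x. w (x + a) = w x" "\<And>x. p (x + a) = p x" "\<And>x. q (x + a) = q x"
    and integrable: "integrable (lebesgue_on {0<..<a}) w" "integrable (lebesgue_on {0<..<a}) q"
      "integrable (lebesgue_on {0<..<a}) (\<lambda>x. inverse (p x))"
    and w_nonzero: "AE x in lebesgue. w x \<noteq> 0"
    and p_pos: "AE x in lebesgue. p x > 0"
    and R: "admissible_radius w p q a R"
    and finite_turning: "finite {x \<in> {0..a}. turning_point w x}"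
    and simple_turning: "\<And>x. x \<in> {0..a} \<Longrightarrow> turning_point w x \<Longrightarrow> one_simple w x"
    and p_bounded: "\<And>x. x \<in> {0..a} \<Longrightarrow> turning_point w x \<Longrightarrow>
      \<exists>\<delta>>0. \<exists>K. AE y in lebesgue_on {x - \<delta><..<x + \<delta>}. \<bar>p y\<bar> \<le> K \<and> \<bar>inverse (p y)\<bar> \<le> K"
  shows "\<not> infinity_spectral_singularity w p q a R"
proof -
 have "negligible {x. w x = 0}" using w_nonzero by (simp add: AE_lebesgue_iff_negligible)
 moreover have "negligible {x. p x <= 0}" using p_pos by (simp add: AE_lebesgue_iff_negligible not_less)
 ultimately interpret sturm_liouville a w p q
  by unfold_locales (use a_pos measurable periodic in \<open>auto intro!: periodic_absolutely_integrable[of a] integrable\<close>)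
 show ?thesis by (rule no_singularity[OF R finite_turning simple_turning p_bounded])
qed

end
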